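(* Let $k$ be an algebraically closed field, $R$ a finite dimensional commutative local $k$-algebra, $Q$ a finite quiver with no oriented cycles, and $\Lambda = R\otimes_k kQ$. Then the induction functor $\Lambda\otimes_{kQ}-$ induces a bijection between the set of isomorphism classes of indecomposable $\tau$-rigid $kQ$-modules and the set of isomorphism classes of indecomposable $\tau$-rigid $\Lambda$-modules.
   Context: Modules are finitely generated left modules. For a finite dimensional algebra $A$ with Auslander–Reiten translation $\tau$, an $A$-module $M$ is $\tau$-rigid if $\mathrm{Hom}_A(M,\tau M)=0$. The induction functor $\Lambda\otimes_{kQ}-:\mathrm{mod}\,kQ\to\mathrm{mod}\,\Lambda$ satisfies $\Lambda\otimes_{kQ}M\cong R\otimes_k M$. *)

theory Defs
  imports
    "HOL-Algebra.Algebraic_Closure"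
    "HOL-Algebra.Free_Abelian_Groups"
    "Graph_Theory.Arc_Walk"
begin

text \<open>
  Rings, algebras and modules are records with explicit carriers. The record
  \<^typ>\<open>('a, 'm) module\<close> of HOL-Algebra is used both for a module with underlying set in
  \<^typ>\<open>'m\<close> over a ring with underlying set in \<^typ>\<open>'a\<close> (its fields \<open>mult\<close> and \<open>one\<close> are then
  irrelevant), and for an algebra. The locale \<^locale>\<open>module\<close> requires a commutative ring of
  scalars, and \<^locale>\<open>algebra\<close> a commutative algebra, so noncommutative versions
  are needed.
\<close>

section \<open>Left modules over a ring\<close>

locale left_module = R?: ring R + M?: abelian_group M
    for R :: "('a, 'c) ring_scheme" (structure) and M :: "('a, 'm, 'd) module_scheme" (structure) +
  assumes smult_closed [simp, intro]:
      "\<lbrakk> a \<in> carrier R; x \<in> carrier M \<rbrakk> \<Longrightarrow> a \<odot>\<^bsub>M\<^esub> x \<in> carrier M"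
    and smult_l_distr:
      "\<lbrakk> a \<in> carrier R; b \<in> carrier R; x \<in> carrier M \<rbrakk> \<Longrightarrow>
      (a \<oplus> b) \<odot>\<^bsub>M\<^esub> x = a \<odot>\<^bsub>M\<^esub> x \<oplus>\<^bsub>M\<^esub> b \<odot>\<^bsub>M\<^esub> x"
    and smult_r_distr:
      "\<lbrakk> a \<in> carrier R; x \<in> carrier M; y \<in> carrier M \<rbrakk> \<Longrightarrow>
      a \<odot>\<^bsub>M\<^esub> (x \<oplus>\<^bsub>M\<^esub> y) = a \<odot>\<^bsub>M\<^esub> x \<oplus>\<^bsub>M\<^esub> a \<odot>\<^bsub>M\<^esub> y"
    and smult_assoc1:
      "\<lbrakk> a \<in> carrier R; b \<in> carrier R; x \<in> carrier M \<rbrakk> \<Longrightarrow>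
      (a \<otimes> b) \<odot>\<^bsub>M\<^esub> x = a \<odot>\<^bsub>M\<^esub> (b \<odot>\<^bsub>M\<^esub> x)"
    and smult_one [simp]:
      "x \<in> carrier M \<Longrightarrow> \<one> \<odot>\<^bsub>M\<^esub> x = x"

locale assoc_algebra = module K A + ring A
    for K :: "('k, 'c) ring_scheme" (structure) and A :: "('k, 'a, 'd) module_scheme" (structure) +
  assumes smult_assoc2:
      "\<lbrakk> c \<in> carrier K; x \<in> carrier A; y \<in> carrier A \<rbrakk> \<Longrightarrow>
      (c \<odot>\<^bsub>A\<^esub> x) \<otimes>\<^bsub>A\<^esub> y = c \<odot>\<^bsub>A\<^esub> (x \<otimes>\<^bsub>A\<^esub> y)"
    and smult_assoc3:
      "\<lbrakk> c \<in> carrier K; x \<in> carrier A; y \<in> carrier A \<rbrakk> \<Longrightarrow>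
      x \<otimes>\<^bsub>A\<^esub> (c \<odot>\<^bsub>A\<^esub> y) = c \<odot>\<^bsub>A\<^esub> (x \<otimes>\<^bsub>A\<^esub> y)"

text \<open>Over a field this says that the dimension is finite.\<close>

definition finitely_generated :: "('a, 'c) ring_scheme \<Rightarrow> ('a, 'm) module \<Rightarrow> bool" where
  "finitely_generated A M \<longleftrightarrow>
     (\<exists>S. finite S \<and> S \<subseteq> carrier M \<and>
       (\<forall>x \<in> carrier M. \<exists>c. c ` S \<subseteq> carrier A \<and> x = (\<Oplus>\<^bsub>M\<^esub>s\<in>S. c s \<odot>\<^bsub>M\<^esub> s)))"

definition local_ring :: "('a, 'c) ring_scheme \<Rightarrow> bool" where
  "local_ring R \<longleftrightarrow> (\<exists>!I. maximalideal I R)"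

text \<open>Homomorphisms are extensional functions, so that equality of functions is equality of
  homomorphisms.\<close>

definition mod_hom ::
    "('a, 'c) ring_scheme \<Rightarrow> ('a, 'm) module \<Rightarrow> ('a, 'n) module \<Rightarrow> ('m \<Rightarrow> 'n) set" where
  "mod_hom A M N = {f \<in> carrier M \<rightarrow>\<^sub>E carrier N.
     (\<forall>x \<in> carrier M. \<forall>y \<in> carrier M. f (x \<oplus>\<^bsub>M\<^esub> y) = f x \<oplus>\<^bsub>N\<^esub> f y) \<and>
     (\<forall>a \<in> carrier A. \<forall>x \<in> carrier M. f (a \<odot>\<^bsub>M\<^esub> x) = a \<odot>\<^bsub>N\<^esub> f x)}"

definition mod_iso :: "('a, 'c) ring_scheme \<Rightarrow> ('a, 'm) module \<Rightarrow> ('a, 'n) module \<Rightarrow> bool" where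
  "mod_iso A M N \<longleftrightarrow> (\<exists>f \<in> mod_hom A M N. bij_betw f (carrier M) (carrier N))"

definition mod_ker :: "('a, 'm) module \<Rightarrow> ('a, 'n) module \<Rightarrow> ('m \<Rightarrow> 'n) \<Rightarrow> 'm set" where
  "mod_ker M N f = {x \<in> carrier M. f x = \<zero>\<^bsub>N\<^esub>}"

definition indecomposable :: "('a, 'c) ring_scheme \<Rightarrow> ('a, 'm) module \<Rightarrow> bool" where
  "indecomposable A M \<longleftrightarrow> carrier M \<noteq> {\<zero>\<^bsub>M\<^esub>} \<and>
     (\<forall>U V. submodule U A M \<longrightarrow> submodule V A M \<longrightarrow>
        U \<inter> V = {\<zero>\<^bsub>M\<^esub>} \<longrightarrow> U <+>\<^bsub>M\<^esub> V = carrier M \<longrightarrow>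
        U = {\<zero>\<^bsub>M\<^esub>} \<or> V = {\<zero>\<^bsub>M\<^esub>})"

definition quotient_module :: "('a, 'm) module \<Rightarrow> 'm set \<Rightarrow> ('a, 'm set) module" where
  "quotient_module M N =
     \<lparr>carrier = a_rcosets\<^bsub>M\<^esub> N, monoid.mult = undefined, one = undefined,
      ring.zero = N, ring.add = set_add M,
      smult = (\<lambda>a C. \<Union>x\<in>C. N +>\<^bsub>M\<^esub> (a \<odot>\<^bsub>M\<^esub> x))\<rparr>"

definition free_module :: "('a, 'c) ring_scheme \<Rightarrow> nat \<Rightarrow> ('a, nat \<Rightarrow> 'a) module" where
  "free_module A n =
     \<lparr>carrier = {..<n} \<rightarrow>\<^sub>E carrier A, monoid.mult = undefined, one = undefined,
      ring.zero = (\<lambda>i\<in>{..<n}. \<zero>\<^bsub>A\<^esub>), ring.add = (\<lambda>x y. \<lambda>i\<in>{..<n}. x i \<oplus>\<^bsub>A\<^esub> y i),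
      smult = (\<lambda>a x. \<lambda>i\<in>{..<n}. a \<otimes>\<^bsub>A\<^esub> x i)\<rparr>"

definition regular_module :: "('a, 'c) ring_scheme \<Rightarrow> ('a, 'a) module" where
  "regular_module A =
     \<lparr>carrier = carrier A, monoid.mult = undefined, one = undefined,
      ring.zero = \<zero>\<^bsub>A\<^esub>, ring.add = add A, smult = monoid.mult A\<rparr>"

text \<open>Finitely generated projective modules: direct summands of \<open>A\<^sup>n\<close>.\<close>

definition fg_projective :: "('a, 'c) ring_scheme \<Rightarrow> ('a, 'm) module \<Rightarrow> bool" where
  "fg_projective A P \<longleftrightarrow> left_module A P \<and>
     (\<exists>n. \<exists>i \<in> mod_hom A P (free_module A n). \<exists>p \<in> mod_hom A (free_module A n) P.
        \<forall>x \<in> carrier P. p (i x) = x)"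

definition superfluous :: "('a, 'c) ring_scheme \<Rightarrow> ('a, 'm) module \<Rightarrow> 'm set \<Rightarrow> bool" where
  "superfluous A P N \<longleftrightarrow>
     (\<forall>U. submodule U A P \<longrightarrow> U <+>\<^bsub>P\<^esub> N = carrier P \<longrightarrow> U = carrier P)"


section \<open>The Auslander--Reiten translation\<close>

definition op_ring :: "('a, 'c) ring_scheme \<Rightarrow> ('a, 'c) ring_scheme" where
  "op_ring A = A\<lparr>monoid.mult := (\<lambda>x y. y \<otimes>\<^bsub>A\<^esub> x)\<rparr>"

text \<open>A minimal projective presentation \<open>P1 \<rightarrow> P0 \<rightarrow> M \<rightarrow> 0\<close>: both \<open>f0 : P0 \<rightarrow> M\<close> and
  \<open>f1 : P1 \<rightarrow> ker f0\<close> are projective covers. Finitely generated projective modules embed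
  into some \<open>A\<^sup>n\<close>, so there is no loss in taking \<open>P1\<close> and \<open>P0\<close> with underlying sets in
  \<^typ>\<open>nat \<Rightarrow> 'a\<close>.\<close>

definition minimal_presentation ::
    "('a, 'c) ring_scheme \<Rightarrow> ('a, 'm) module \<Rightarrow>
     ('a, nat \<Rightarrow> 'a) module \<times> ('a, nat \<Rightarrow> 'a) module \<times>
       ((nat \<Rightarrow> 'a) \<Rightarrow> (nat \<Rightarrow> 'a)) \<times> ((nat \<Rightarrow> 'a) \<Rightarrow> 'm) \<Rightarrow> bool" where
  "minimal_presentation A M = (\<lambda>(P1, P0, f1, f0).
     fg_projective A P1 \<and> fg_projective A P0 \<and>
     f1 \<in> mod_hom A P1 P0 \<and> f0 \<in> mod_hom A P0 M \<and>
     f0 ` carrier P0 = carrier M \<and> f1 ` carrier P1 = mod_ker P0 M f0 \<and>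
     superfluous A P0 (mod_ker P0 M f0) \<and> superfluous A P1 (mod_ker P1 P0 f1))"

text \<open>\<open>Hom\<^sub>A(P, A)\<close> is a right \<open>A\<close>-module by \<open>(f \<cdot> a)(x) = f(x) a\<close>, that is, a left module over
  the opposite algebra.\<close>

definition hom_to_ring :: "('a, 'c) ring_scheme \<Rightarrow> ('a, 'm) module \<Rightarrow> ('a, 'm \<Rightarrow> 'a) module" where
  "hom_to_ring A P =
     \<lparr>carrier = mod_hom A P (regular_module A), monoid.mult = undefined, one = undefined,
      ring.zero = (\<lambda>x\<in>carrier P. \<zero>\<^bsub>A\<^esub>),
      ring.add = (\<lambda>f g. \<lambda>x\<in>carrier P. f x \<oplus>\<^bsub>A\<^esub> g x),
      smult = (\<lambda>a f. \<lambda>x\<in>carrier P. f x \<otimes>\<^bsub>A\<^esub> a)\<rparr>"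

text \<open>The cokernel of \<open>Hom\<^sub>A(f1, A) : Hom\<^sub>A(P0, A) \<rightarrow> Hom\<^sub>A(P1, A)\<close>, a left module over the
  opposite algebra.\<close>

definition transpose_of ::
    "('a, 'c) ring_scheme \<Rightarrow> ('a, 'm) module \<Rightarrow> ('a, 'n) module \<Rightarrow> ('m \<Rightarrow> 'n) \<Rightarrow>
     ('a, ('m \<Rightarrow> 'a) set) module" where
  "transpose_of A P1 P0 f1 =
     quotient_module (hom_to_ring A P1)
       ((\<lambda>g. compose (carrier P1) g f1) ` carrier (hom_to_ring A P0))"

definition scalars_to_field ::
    "('k, 'a) module \<Rightarrow> ('a, 'm) module \<Rightarrow> ('k, 'm) module" where
  "scalars_to_field A M =
     \<lparr>carrier = carrier M, monoid.mult = undefined, one = undefined,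
      ring.zero = \<zero>\<^bsub>M\<^esub>, ring.add = add M,
      smult = (\<lambda>c x. (c \<odot>\<^bsub>A\<^esub> \<one>\<^bsub>A\<^esub>) \<odot>\<^bsub>M\<^esub> x)\<rparr>"

text \<open>The duality \<open>D = Hom\<^sub>K(-, K)\<close>; for a left module \<open>M\<close> over \<open>B\<close> the result is a left module
  over \<open>op_ring B\<close>.\<close>

definition dual_module ::
    "('k, 'c) ring_scheme \<Rightarrow> ('k, 'b) module \<Rightarrow> ('b, 'm) module \<Rightarrow> ('b, 'm \<Rightarrow> 'k) module" where
  "dual_module K B M =
     \<lparr>carrier = mod_hom K (scalars_to_field B M) (regular_module K),
      monoid.mult = undefined, one = undefined,
      ring.zero = (\<lambda>x\<in>carrier M. \<zero>\<^bsub>K\<^esub>),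
      ring.add = (\<lambda>f g. \<lambda>x\<in>carrier M. f x \<oplus>\<^bsub>K\<^esub> g x),
      smult = (\<lambda>b f. \<lambda>x\<in>carrier M. f (b \<odot>\<^bsub>M\<^esub> x))\<rparr>"

text \<open>\<open>\<tau>M = D Tr M\<close>. Minimal projective presentations exist over a finite dimensional algebra
  and are unique up to isomorphism, so the choice of one matters only up to isomorphism.\<close>

definition AR_translate ::
    "('k, 'c) ring_scheme \<Rightarrow> ('k, 'a) module \<Rightarrow> ('a, 'm) module \<Rightarrow>
     ('a, ((nat \<Rightarrow> 'a) \<Rightarrow> 'a) set \<Rightarrow> 'k) module" where
  "AR_translate K A M =
     (case SOME p. minimal_presentation A M p of (P1, P0, f1, f0) \<Rightarrow>
        dual_module K (op_ring A) (transpose_of A P1 P0 f1))"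

definition tau_rigid :: "('k, 'c) ring_scheme \<Rightarrow> ('k, 'a) module \<Rightarrow> ('a, 'm) module \<Rightarrow> bool" where
  "tau_rigid K A M \<longleftrightarrow>
     mod_hom A M (AR_translate K A M) = {\<lambda>x\<in>carrier M. \<zero>\<^bsub>AR_translate K A M\<^esub>}"

definition indec_tau_rigid ::
    "('k, 'c) ring_scheme \<Rightarrow> ('k, 'a) module \<Rightarrow> ('a, 'm) module \<Rightarrow> bool" where
  "indec_tau_rigid K A M \<longleftrightarrow>
     left_module A M \<and> finitely_generated A M \<and> indecomposable A M \<and> tau_rigid K A M"


section \<open>Isomorphism classes\<close>

text \<open>The isomorphism class of \<open>M\<close> consists of the modules with underlying set in \<^typ>\<open>'u\<close> that are
  isomorphic to \<open>M\<close>; \<open>M\<close> itself may have its underlying set in another type. For an algebra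
  over a field with underlying set in \<^typ>\<open>'k\<close> we use \<^typ>\<open>nat \<Rightarrow> 'k\<close> for \<^typ>\<open>'u\<close>, which is
  large enough by \<open>ex_iso_module\<close> below.\<close>

definition iso_class :: "('a, 'c) ring_scheme \<Rightarrow> ('a, 'm) module \<Rightarrow> ('a, 'u) module set" where
  "iso_class A M = {N. left_module A N \<and> mod_iso A M N}"

definition indec_tau_rigid_classes ::
    "('k, 'c) ring_scheme \<Rightarrow> ('k, 'a) module \<Rightarrow> ('a, nat \<Rightarrow> 'k) module set set" where
  "indec_tau_rigid_classes K A = iso_class A ` {M :: ('a, nat \<Rightarrow> 'k) module. indec_tau_rigid K A M}"


lemma left_module_transport:
  fixes A :: "('a, 'c) ring_scheme" and M :: "('a, 'm) module" and g :: "'m \<Rightarrow> 'u"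
  assumes "left_module A M" and inj: "inj_on g (carrier M)"
  shows "\<exists>N :: ('a, 'u) module. left_module A N \<and> mod_iso A M N"
proof -
  interpret left_module A M by fact
  define h where "h = inv_into (carrier M) g"
  have hg [simp]: "h (g x) = x" if "x \<in> carrier M" for x
    using that inj by (simp add: h_def)
  define N :: "('a, 'u) module" where "N =
     \<lparr>carrier = g ` carrier M, monoid.mult = undefined, one = undefined,
      ring.zero = g \<zero>\<^bsub>M\<^esub>, ring.add = (\<lambda>x y. g (h x \<oplus>\<^bsub>M\<^esub> h y)),
      smult = (\<lambda>a x. g (a \<odot>\<^bsub>M\<^esub> h x))\<rparr>"
  have N: "carrier N = g ` carrier M" "\<zero>\<^bsub>N\<^esub> = g \<zero>\<^bsub>M\<^esub>"
    "\<And>x y. x \<oplus>\<^bsub>N\<^esub> y = g (h x \<oplus>\<^bsub>M\<^esub> h y)" "\<And>a x. a \<odot>\<^bsub>N\<^esub> x = g (a \<odot>\<^bsub>M\<^esub> h x)"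
    by (simp_all add: N_def)
  have "abelian_group N"
  proof (rule abelian_groupI)
    fix x assume "x \<in> carrier N"
    then obtain m where "m \<in> carrier M" "x = g m" by (auto simp: N)
    then show "\<exists>y\<in>carrier N. y \<oplus>\<^bsub>N\<^esub> x = \<zero>\<^bsub>N\<^esub>"
      by (intro bexI[of _ "g (\<ominus>\<^bsub>M\<^esub> m)"]) (auto simp: N M.l_neg)
  qed (auto simp: N M.a_ac)
  then have "left_module A N"
    by (intro left_module.intro left_module_axioms.intro R.ring_axioms)
      (auto simp: N smult_l_distr smult_r_distr smult_assoc1)
  moreover have "restrict g (carrier M) \<in> mod_hom A M N"
    by (auto simp: mod_hom_def N)
  moreover have "bij_betw (restrict g (carrier M)) (carrier M) (carrier N)"
    using inj by (auto simp: bij_betw_def N inj_on_def)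
  ultimately show ?thesis unfolding mod_iso_def by blast
qed

lemma ex_iso_module:
  fixes K :: "('k, 'c) ring_scheme" and A :: "('k, 'a) module" and M :: "('a, 'm) module"
  assumes "assoc_algebra K A" "finitely_generated K A"
    and "left_module A M" "finitely_generated A M"
  shows "\<exists>N :: ('a, nat \<Rightarrow> 'k) module. left_module A N \<and> mod_iso A M N"
proof -
  interpret A: assoc_algebra K A by fact
  interpret M: left_module A M by fact
  from \<open>finitely_generated A M\<close> obtain S where S: "finite S" "S \<subseteq> carrier M"
    "\<And>x. x \<in> carrier M \<Longrightarrow> \<exists>c. c ` S \<subseteq> carrier A \<and> x = (\<Oplus>\<^bsub>M\<^esub>s\<in>S. c s \<odot>\<^bsub>M\<^esub> s)"
    unfolding finitely_generated_def by blast
  from \<open>finitely_generated K A\<close> obtain T where T: "finite T" "T \<subseteq> carrier A"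
    "\<And>a. a \<in> carrier A \<Longrightarrow> \<exists>d. d ` T \<subseteq> carrier K \<and> a = (\<Oplus>\<^bsub>A\<^esub>t\<in>T. d t \<odot>\<^bsub>A\<^esub> t)"
    unfolding finitely_generated_def by blast
  have "finite (S \<times> T)" using S T by simp
  then obtain e :: "'m \<times> 'a \<Rightarrow> nat" where e: "inj_on e (S \<times> T)"
    using finite_imp_inj_to_nat_seg by blast
  define h where "h v = (\<Oplus>\<^bsub>M\<^esub>s\<in>S. (\<Oplus>\<^bsub>A\<^esub>t\<in>T. v (e (s, t)) \<odot>\<^bsub>A\<^esub> t) \<odot>\<^bsub>M\<^esub> s)" for v
  have ex: "\<exists>v. h v = x" if "x \<in> carrier M" for x
  proof -
    obtain c where c: "c ` S \<subseteq> carrier A" "x = (\<Oplus>\<^bsub>M\<^esub>s\<in>S. c s \<odot>\<^bsub>M\<^esub> s)"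
      using S(3) \<open>x \<in> carrier M\<close> by blast
    then have "\<forall>s\<in>S. \<exists>d. d ` T \<subseteq> carrier K \<and> c s = (\<Oplus>\<^bsub>A\<^esub>t\<in>T. d t \<odot>\<^bsub>A\<^esub> t)"
      using T(3) by blast
    then obtain d where d: "\<And>s. s \<in> S \<Longrightarrow> d s ` T \<subseteq> carrier K"
      "\<And>s. s \<in> S \<Longrightarrow> c s = (\<Oplus>\<^bsub>A\<^esub>t\<in>T. d s t \<odot>\<^bsub>A\<^esub> t)"
      by metis
    define v where "v n = (case inv_into (S \<times> T) e n of (s, t) \<Rightarrow> d s t)" for n
    have v: "v (e (s, t)) = d s t" if "s \<in> S" "t \<in> T" for s t
      using that e by (simp add: v_def)
    have "(\<Oplus>\<^bsub>A\<^esub>t\<in>T. v (e (s, t)) \<odot>\<^bsub>A\<^esub> t) = c s" if "s \<in> S" for s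
      unfolding d(2)[OF that] using that T(2) d(1)[OF that] v
      by (intro A.M.finsum_cong') (auto simp: Pi_def)
    then have "h v = x"
      unfolding h_def c(2) using c(1) S(2) by (intro M.M.finsum_cong') (auto simp: Pi_def)
    then show ?thesis by blast
  qed
  have "inj_on (\<lambda>x. SOME v. h v = x) (carrier M)"
    by (rule inj_on_inverseI[of _ h]) (rule someI_ex[OF ex])
  then show ?thesis
    using left_module_transport[OF \<open>left_module A M\<close>] by blast
qed


section \<open>Tensor products and induction\<close>

text \<open>The tensor product over \<open>A\<close> of a right module \<open>U\<close> and a left module \<open>V\<close>, as a quotient of the
  free abelian group on \<open>U \<times> V\<close>. In \<open>U\<close> the term \<open>a \<odot> x\<close> denotes the product of \<open>x\<close> with \<open>a\<close>
  on the right.\<close>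

definition tensor_free :: "('a, 'm) module \<Rightarrow> ('a, 'n) module \<Rightarrow> ('m \<times> 'n \<Rightarrow>\<^sub>0 int) monoid" where
  "tensor_free U V = free_Abelian_group (carrier U \<times> carrier V)"

definition tensor_rels ::
    "('a, 'c) ring_scheme \<Rightarrow> ('a, 'm) module \<Rightarrow> ('a, 'n) module \<Rightarrow> ('m \<times> 'n \<Rightarrow>\<^sub>0 int) set" where
  "tensor_rels A U V =
     {frag_of (x \<oplus>\<^bsub>U\<^esub> x', y) - frag_of (x, y) - frag_of (x', y) | x x' y.
        x \<in> carrier U \<and> x' \<in> carrier U \<and> y \<in> carrier V} \<union>
     {frag_of (x, y \<oplus>\<^bsub>V\<^esub> y') - frag_of (x, y) - frag_of (x, y') | x y y'.
        x \<in> carrier U \<and> y \<in> carrier V \<and> y' \<in> carrier V} \<union>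
     {frag_of (a \<odot>\<^bsub>U\<^esub> x, y) - frag_of (x, a \<odot>\<^bsub>V\<^esub> y) | a x y.
        a \<in> carrier A \<and> x \<in> carrier U \<and> y \<in> carrier V}"

definition tensor_null ::
    "('a, 'c) ring_scheme \<Rightarrow> ('a, 'm) module \<Rightarrow> ('a, 'n) module \<Rightarrow> ('m \<times> 'n \<Rightarrow>\<^sub>0 int) set" where
  "tensor_null A U V = generate (tensor_free U V) (tensor_rels A U V)"

definition tensor_group ::
    "('a, 'c) ring_scheme \<Rightarrow> ('a, 'm) module \<Rightarrow> ('a, 'n) module \<Rightarrow>
     ('m \<times> 'n \<Rightarrow>\<^sub>0 int) set monoid" where
  "tensor_group A U V = tensor_free U V Mod tensor_null A U V"

definition tensor_class ::
    "('a, 'c) ring_scheme \<Rightarrow> ('a, 'm) module \<Rightarrow> ('a, 'n) module \<Rightarrow>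
     ('m \<times> 'n \<Rightarrow>\<^sub>0 int) \<Rightarrow> ('m \<times> 'n \<Rightarrow>\<^sub>0 int) set" where
  "tensor_class A U V c = tensor_null A U V #>\<^bsub>tensor_free U V\<^esub> c"

definition pure_tensor ::
    "('a, 'c) ring_scheme \<Rightarrow> ('a, 'm) module \<Rightarrow> ('a, 'n) module \<Rightarrow>
     'm \<Rightarrow> 'n \<Rightarrow> ('m \<times> 'n \<Rightarrow>\<^sub>0 int) set" where
  "pure_tensor A U V x y = tensor_class A U V (frag_of (x, y))"

text \<open>The algebra \<open>R \<otimes>\<^sub>K S\<close>, with \<open>(r \<otimes> s)(r' \<otimes> s') = rr' \<otimes> ss'\<close>. As \<open>K\<close> is commutative, \<open>R\<close>
  is a right \<open>K\<close>-module through the same scalar multiplication.\<close>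

definition tensor_algebra ::
    "('k, 'c) ring_scheme \<Rightarrow> ('k, 'r) module \<Rightarrow> ('k, 's) module \<Rightarrow>
     ('k, ('r \<times> 's \<Rightarrow>\<^sub>0 int) set) module" where
  "tensor_algebra K R S =
     \<lparr>carrier = carrier (tensor_group K R S),
      monoid.mult = (\<lambda>C D. \<Union>c\<in>C. \<Union>d\<in>D. tensor_class K R S
        (frag_extend (\<lambda>(r, s). frag_extend (\<lambda>(r', s').
           frag_of (r \<otimes>\<^bsub>R\<^esub> r', s \<otimes>\<^bsub>S\<^esub> s')) d) c)),
      one = pure_tensor K R S \<one>\<^bsub>R\<^esub> \<one>\<^bsub>S\<^esub>,
      ring.zero = \<one>\<^bsub>tensor_group K R S\<^esub>,
      ring.add = monoid.mult (tensor_group K R S),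
      smult = (\<lambda>k C. \<Union>c\<in>C. tensor_class K R S
        (frag_extend (\<lambda>(r, s). frag_of (k \<odot>\<^bsub>R\<^esub> r, s)) c))\<rparr>"

text \<open>\<open>B\<close> as a right \<open>A\<close>-module along a ring homomorphism \<open>h : A \<rightarrow> B\<close>, and the left \<open>B\<close>-module
  \<open>B \<otimes>\<^sub>A M\<close>.\<close>

definition right_module_along ::
    "('b, 'c) ring_scheme \<Rightarrow> ('a \<Rightarrow> 'b) \<Rightarrow> ('a, 'b) module" where
  "right_module_along B h =
     \<lparr>carrier = carrier B, monoid.mult = undefined, one = undefined,
      ring.zero = \<zero>\<^bsub>B\<^esub>, ring.add = add B, smult = (\<lambda>a b. b \<otimes>\<^bsub>B\<^esub> h a)\<rparr>"

definition extend_scalars ::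
    "('a, 'c) ring_scheme \<Rightarrow> ('b, 'd) ring_scheme \<Rightarrow> ('a \<Rightarrow> 'b) \<Rightarrow> ('a, 'm) module \<Rightarrow>
     ('b, ('b \<times> 'm \<Rightarrow>\<^sub>0 int) set) module" where
  "extend_scalars A B h M = (let U = right_module_along B h in
     \<lparr>carrier = carrier (tensor_group A U M), monoid.mult = undefined, one = undefined,
      ring.zero = \<one>\<^bsub>tensor_group A U M\<^esub>,
      ring.add = monoid.mult (tensor_group A U M),
      smult = (\<lambda>b C. \<Union>c\<in>C. tensor_class A U M
        (frag_extend (\<lambda>(x, m). frag_of (b \<otimes>\<^bsub>B\<^esub> x, m)) c))\<rparr>)"


section \<open>Path algebras\<close>

text \<open>A quiver is a directed multigraph. A path is given by its starting vertex and the list of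
  its arrows, in the order in which they are traversed; trivial paths have an empty list.\<close>

definition no_oriented_cycles :: "('v, 'e) pre_digraph \<Rightarrow> bool" where
  "no_oriented_cycles Q \<longleftrightarrow> \<not> (\<exists>u p. pre_digraph.awalk Q u p u \<and> p \<noteq> [])"

definition paths :: "('v, 'e) pre_digraph \<Rightarrow> ('v \<times> 'e list) set" where
  "paths Q = {(u, p). \<exists>v. pre_digraph.awalk Q u p v}"

definition path_end :: "('v, 'e) pre_digraph \<Rightarrow> 'v \<times> 'e list \<Rightarrow> 'v" where
  "path_end Q = (\<lambda>(u, p). last (pre_digraph.awalk_verts Q u p))"

text \<open>The product \<open>qp\<close> of paths is \<open>p\<close> followed by \<open>q\<close>, so that left modules are covariant
  representations of the quiver.\<close>

definition path_factorizations ::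
    "('v, 'e) pre_digraph \<Rightarrow> 'v \<times> 'e list \<Rightarrow> (('v \<times> 'e list) \<times> ('v \<times> 'e list)) set" where
  "path_factorizations Q r =
     {(q, p). q \<in> paths Q \<and> p \<in> paths Q \<and> fst q = path_end Q p \<and> r = (fst p, snd p @ snd q)}"

definition path_algebra ::
    "('k, 'c) ring_scheme \<Rightarrow> ('v, 'e) pre_digraph \<Rightarrow> ('k, 'v \<times> 'e list \<Rightarrow> 'k) module" where
  "path_algebra K Q =
     \<lparr>carrier = {f. f ` paths Q \<subseteq> carrier K \<and> (\<forall>r. r \<notin> paths Q \<longrightarrow> f r = \<zero>\<^bsub>K\<^esub>) \<and>
                    finite {r. f r \<noteq> \<zero>\<^bsub>K\<^esub>}},
      monoid.mult = (\<lambda>f g r. \<Oplus>\<^bsub>K\<^esub>z\<in>path_factorizations Q r. f (fst z) \<otimes>\<^bsub>K\<^esub> g (snd z)),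
      one = (\<lambda>(u, p). if u \<in> verts Q \<and> p = [] then \<one>\<^bsub>K\<^esub> else \<zero>\<^bsub>K\<^esub>),
      ring.zero = (\<lambda>_. \<zero>\<^bsub>K\<^esub>),
      ring.add = (\<lambda>f g r. f r \<oplus>\<^bsub>K\<^esub> g r),
      smult = (\<lambda>c f r. c \<otimes>\<^bsub>K\<^esub> f r)\<rparr>"


section \<open>The algebra \<open>\<Lambda> = R \<otimes>\<^sub>K KQ\<close> and the induction functor\<close>

definition Lambda_algebra ::
    "('k, 'c) ring_scheme \<Rightarrow> ('k, 'r) module \<Rightarrow> ('v, 'e) pre_digraph \<Rightarrow>
     ('k, ('r \<times> ('v \<times> 'e list \<Rightarrow> 'k) \<Rightarrow>\<^sub>0 int) set) module" where
  "Lambda_algebra K R Q = tensor_algebra K R (path_algebra K Q)"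

text \<open>The functor \<open>\<Lambda> \<otimes>\<^bsub>KQ\<^esub> -\<close> on objects, along \<open>KQ \<rightarrow> \<Lambda>, a \<mapsto> 1 \<otimes> a\<close>.\<close>

definition induction ::
    "('k, 'c) ring_scheme \<Rightarrow> ('k, 'r) module \<Rightarrow> ('v, 'e) pre_digraph \<Rightarrow>
     ('v \<times> 'e list \<Rightarrow> 'k, 'm) module \<Rightarrow>
     (('r \<times> ('v \<times> 'e list \<Rightarrow> 'k) \<Rightarrow>\<^sub>0 int) set,
      ((('r \<times> ('v \<times> 'e list \<Rightarrow> 'k) \<Rightarrow>\<^sub>0 int) set \<times> 'm) \<Rightarrow>\<^sub>0 int) set) module" where
  "induction K R Q =
     extend_scalars (path_algebra K Q) (Lambda_algebra K R Q)
       (pure_tensor K R (path_algebra K Q) \<one>\<^bsub>R\<^esub>)"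

end

theory Submission
  imports Defs
begin

text \<open>
  For a module over a finite dimensional algebra, presented as the cokernel of \<open>F : P\<^sub>1 \<rightarrow> P\<^sub>0\<close> with
  \<open>P\<^sub>1\<close> and \<open>P\<^sub>0\<close> finitely generated projective, the Auslander--Reiten formula identifies
  \<open>Hom(M, \<tau>M)\<close> with the dual of the cokernel of \<open>Hom(F, M)\<close> if \<open>F\<close> is part of a minimal presentation.
  So \<open>M\<close> is \<open>\<tau>\<close>-rigid iff it has a presentation for which every map \<open>P\<^sub>1 \<rightarrow> M\<close> factors through \<open>F\<close>.
  Writing \<open>F\<close> as a matrix, this condition passes from \<open>A = KQ\<close> to \<open>\<Lambda> = R \<otimes> A\<close> and back: matrices are
  extended along \<open>A \<rightarrow> \<Lambda>\<close> and reduced along \<open>\<pi> : \<Lambda> \<rightarrow> A\<close>, which comes from \<open>R \<rightarrow> R/m = K\<close>. Since \<open>m\<close> is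
  nilpotent, the factorization property for \<open>M\<close> lifts through the filtration of a module \<open>N\<close> with
  \<open>N/mN \<cong> M\<close>. So two rigid \<open>\<Lambda>\<close>-modules with isomorphic reductions modulo \<open>m\<close> are isomorphic; in
  particular a rigid \<open>N\<close> is isomorphic to \<open>\<Lambda> \<otimes>\<^sub>A (N/mN)\<close>, and \<open>N \<mapsto> N/mN\<close> is inverse to induction.
  A decomposition of \<open>M\<close> induces one of \<open>\<Lambda> \<otimes>\<^sub>A M\<close>, and by Nakayama's lemma a proper decomposition of \<open>N\<close>
  induces one of \<open>N/mN\<close>. Of \<open>A\<close> only finite dimensionality is used.
\<close>

section \<open>Finite linear combinations and matrices\<close>

text \<open>The factorization property depends on the presentation: a summand of P1 that maps to
  zero in P0 violates it as soon as it has a nonzero map to M. Therefore it is asked of some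
  presentation only, and a comparison of presentations shows that a minimal one then has it too;
  extended or reduced matrices never have to be shown minimal. The idempotents \<open>e\<close> and
  \<open>d\<close> are carried along because the P1 of a minimal presentation need not be free, and
  a complement that maps to zero would be just such a summand. Algebraic closedness enters through
  one fact, that the residue field of R is K; this gives \<pi> with the section \<iota>. Radicals,
  idempotent lifting and Krull-Schmidt are avoided. Projective covers come from minimal submodules,
  by chain conditions over K. Nakayama-type statements come from the finite filtration by m^i N: an
  endomorphism that is the identity modulo m differs from the identity by a map that raises the
  filtration. That induction is well defined on isomorphism classes also follows from uniqueness of
  rigid lifts, in place of functoriality of the tensor product.\<close>

primrec ssum :: "('a, 'b) ring_scheme \<Rightarrow> nat \<Rightarrow> (nat \<Rightarrow> 'a) \<Rightarrow> 'a" where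
  "ssum G 0 f = \<zero>\<^bsub>G\<^esub>"
| "ssum G (Suc n) f = ssum G n f \<oplus>\<^bsub>G\<^esub> f n"

definition lcomb :: "('a, 'm, 'd) module_scheme \<Rightarrow> nat \<Rightarrow> (nat \<Rightarrow> 'a) \<Rightarrow> (nat \<Rightarrow> 'm) \<Rightarrow> 'm" where
  "lcomb M n v y = ssum M n (\<lambda>i. v i \<odot>\<^bsub>M\<^esub> y i)"

text \<open>Vectors and matrices are indexed by all natural numbers, so that identities between matrices
  are equations between functions; only the contracted index of a product is bounded.\<close>

definition Vec :: "('a, 'b) partial_object_scheme \<Rightarrow> (nat \<Rightarrow> 'a) set" where
  "Vec G = {f. \<forall>i. f i \<in> carrier G}"

definition Mat :: "('a, 'b) partial_object_scheme \<Rightarrow> (nat \<Rightarrow> nat \<Rightarrow> 'a) set" where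
  "Mat G = {B. \<forall>i. B i \<in> Vec G}"

definition mmul :: "('a, 'b) ring_scheme \<Rightarrow> nat \<Rightarrow> (nat \<Rightarrow> nat \<Rightarrow> 'a) \<Rightarrow> (nat \<Rightarrow> nat \<Rightarrow> 'a) \<Rightarrow>
    nat \<Rightarrow> nat \<Rightarrow> 'a" where
  "mmul R n B Y = (\<lambda>i j. ssum R n (\<lambda>k. B i k \<otimes>\<^bsub>R\<^esub> Y k j))"

definition mvec :: "('a, 'm, 'd) module_scheme \<Rightarrow> nat \<Rightarrow> (nat \<Rightarrow> nat \<Rightarrow> 'a) \<Rightarrow> (nat \<Rightarrow> 'm) \<Rightarrow>
    nat \<Rightarrow> 'm" where
  "mvec M n B y = (\<lambda>i. lcomb M n (B i) y)"

definition vsub :: "('a, 'b) ring_scheme \<Rightarrow> (nat \<Rightarrow> 'a) \<Rightarrow> (nat \<Rightarrow> 'a) \<Rightarrow> nat \<Rightarrow> 'a" where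
  "vsub G x y = (\<lambda>i. x i \<ominus>\<^bsub>G\<^esub> y i)"

definition vadd :: "('a, 'b) ring_scheme \<Rightarrow> (nat \<Rightarrow> 'a) \<Rightarrow> (nat \<Rightarrow> 'a) \<Rightarrow> nat \<Rightarrow> 'a" where
  "vadd G x y = (\<lambda>i. x i \<oplus>\<^bsub>G\<^esub> y i)"

definition msub :: "('a, 'b) ring_scheme \<Rightarrow> (nat \<Rightarrow> nat \<Rightarrow> 'a) \<Rightarrow> (nat \<Rightarrow> nat \<Rightarrow> 'a) \<Rightarrow>
    nat \<Rightarrow> nat \<Rightarrow> 'a" where
  "msub G B Y = (\<lambda>i. vsub G (B i) (Y i))"

lemma VecI [intro?]: "(\<And>i. f i \<in> carrier G) \<Longrightarrow> f \<in> Vec G"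
  by (simp add: Vec_def)

lemma VecD: "f \<in> Vec G \<Longrightarrow> f i \<in> carrier G"
  by (simp add: Vec_def)

lemma MatI [intro?]: "(\<And>i j. B i j \<in> carrier G) \<Longrightarrow> B \<in> Mat G"
  by (simp add: Mat_def Vec_def)

lemma MatD: "B \<in> Mat G \<Longrightarrow> B i \<in> Vec G"
  by (simp add: Mat_def)

lemma MatDD: "B \<in> Mat G \<Longrightarrow> B i j \<in> carrier G"
  by (simp add: Mat_def Vec_def)

lemma Mat_const: "v \<in> Vec G \<Longrightarrow> (\<lambda>_. v) \<in> Mat G"
  by (simp add: Mat_def)

text \<open>No membership in a carrier is asked for, in contrast to \<open>finsum_cong'\<close>;
  this is the gain from defining sums by recursion.\<close>

lemma ssum_cong: "(\<And>i. i < n \<Longrightarrow> f i = g i) \<Longrightarrow> ssum G n f = ssum G n g"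
  by (induction n) auto

lemma lcomb_cong:
  "(\<And>i. i < n \<Longrightarrow> v i = w i) \<Longrightarrow> (\<And>i. i < n \<Longrightarrow> x i = y i) \<Longrightarrow> lcomb M n v x = lcomb M n w y"
  unfolding lcomb_def by (rule ssum_cong) simp

lemma lcomb_0 [simp]: "lcomb M 0 v y = \<zero>\<^bsub>M\<^esub>"
  and lcomb_Suc [simp]: "lcomb M (Suc n) v y = lcomb M n v y \<oplus>\<^bsub>M\<^esub> v n \<odot>\<^bsub>M\<^esub> y n"
  by (simp_all add: lcomb_def)

context abelian_group
begin

lemma ssum_closed: "(\<And>i. i < n \<Longrightarrow> f i \<in> carrier G) \<Longrightarrow> ssum G n f \<in> carrier G"
  by (induction n) auto

lemma ssum_closed' [simp]: "f \<in> Vec G \<Longrightarrow> ssum G n f \<in> carrier G"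
  by (simp add: Vec_def Mat_def ssum_closed)

lemma ssum_zero [simp]: "ssum G n (\<lambda>_. \<zero>) = \<zero>"
  by (induction n) auto

lemma ssum_zero': "(\<And>i. i < n \<Longrightarrow> f i = \<zero>) \<Longrightarrow> ssum G n f = \<zero>"
  by (induction n) auto

lemma ssum_add:
  "(\<And>i. i < n \<Longrightarrow> f i \<in> carrier G) \<Longrightarrow> (\<And>i. i < n \<Longrightarrow> g i \<in> carrier G) \<Longrightarrow>
    ssum G n (\<lambda>i. f i \<oplus> g i) = ssum G n f \<oplus> ssum G n g"
  by (induction n) (simp_all add: ssum_closed a_ac)

lemma ssum_neg:
  "(\<And>i. i < n \<Longrightarrow> f i \<in> carrier G) \<Longrightarrow> ssum G n (\<lambda>i. \<ominus> f i) = \<ominus> ssum G n f"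
  by (induction n) (simp_all add: ssum_closed minus_add a_comm minus_equality[of \<zero> \<zero>])

lemma ssum_diff:
  "(\<And>i. i < n \<Longrightarrow> f i \<in> carrier G) \<Longrightarrow> (\<And>i. i < n \<Longrightarrow> g i \<in> carrier G) \<Longrightarrow>
    ssum G n (\<lambda>i. f i \<ominus> g i) = ssum G n f \<ominus> ssum G n g"
  by (simp add: a_minus_def ssum_add ssum_neg)

lemma ssum_swap:
  "(\<And>i j. i < m \<Longrightarrow> j < n \<Longrightarrow> f i j \<in> carrier G) \<Longrightarrow>
    ssum G m (\<lambda>i. ssum G n (f i)) = ssum G n (\<lambda>j. ssum G m (\<lambda>i. f i j))"
  by (induction m) (simp_all add: ssum_add ssum_closed)

lemma ssum_single:
  "k < n \<Longrightarrow> x \<in> carrier G \<Longrightarrow> ssum G n (\<lambda>i. if i = k then x else \<zero>) = x"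
proof (induction n)
  case (Suc n)
  then show ?case
    by (cases "k = n") (auto simp: ssum_zero')
qed simp

lemma finsum_eq_ssum:
  "(\<And>i. i < n \<Longrightarrow> f i \<in> carrier G) \<Longrightarrow> finsum G f {..<n} = ssum G n f"
  by (induction n) (simp_all add: lessThan_Suc finsum_insert Pi_def a_comm ssum_closed)

lemma vsub_Vec [simp]: "x \<in> Vec G \<Longrightarrow> y \<in> Vec G \<Longrightarrow> vsub G x y \<in> Vec G"
  by (auto simp: Vec_def Mat_def vsub_def Vec_def)

lemma vadd_Vec [simp]: "x \<in> Vec G \<Longrightarrow> y \<in> Vec G \<Longrightarrow> vadd G x y \<in> Vec G"
  by (auto simp: Vec_def Mat_def vadd_def Vec_def)

lemma msub_Mat [simp]: "B \<in> Mat G \<Longrightarrow> Y \<in> Mat G \<Longrightarrow> msub G B Y \<in> Mat G"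
  by (simp add: Vec_def Mat_def msub_def vsub_def)

lemma minus_zero_iff: "x \<in> carrier G \<Longrightarrow> y \<in> carrier G \<Longrightarrow> x \<ominus> y = \<zero> \<longleftrightarrow> x = y"
  by (simp add: a_minus_def add.inv_solve_right')

lemma vsub_zero_iff: "x \<in> Vec G \<Longrightarrow> y \<in> Vec G \<Longrightarrow> vsub G x y = (\<lambda>_. \<zero>) \<longleftrightarrow> x = y"
  by (auto simp: Vec_def Mat_def vsub_def fun_eq_iff minus_zero_iff)

lemma add_minus_cancel: "x \<in> carrier G \<Longrightarrow> y \<in> carrier G \<Longrightarrow> x \<oplus> (y \<ominus> x) = y"
  by (metis a_lcomm a_minus_def add.inv_closed r_neg r_zero)

end

lemma ssum_hom:
  assumes "abelian_group G" "abelian_group H"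
    and "\<And>x y. x \<in> carrier G \<Longrightarrow> y \<in> carrier G \<Longrightarrow> h (x \<oplus>\<^bsub>G\<^esub> y) = h x \<oplus>\<^bsub>H\<^esub> h y"
    and "h \<zero>\<^bsub>G\<^esub> = \<zero>\<^bsub>H\<^esub>" and "\<And>i. i < n \<Longrightarrow> f i \<in> carrier G"
  shows "h (ssum G n f) = ssum H n (\<lambda>i. h (f i))"
  using assms(5) by (induction n) (simp_all add: assms abelian_group.ssum_closed[OF assms(1)])

lemma additive_zero:
  assumes "abelian_group G" "abelian_group H"
    and "\<And>x. x \<in> carrier G \<Longrightarrow> h x \<in> carrier H"
    and "\<And>x y. x \<in> carrier G \<Longrightarrow> y \<in> carrier G \<Longrightarrow> h (x \<oplus>\<^bsub>G\<^esub> y) = h x \<oplus>\<^bsub>H\<^esub> h y"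
  shows "h \<zero>\<^bsub>G\<^esub> = \<zero>\<^bsub>H\<^esub>"
proof -
  interpret G: abelian_group G by fact
  interpret H: abelian_group H by fact
  have "h \<zero>\<^bsub>G\<^esub> \<oplus>\<^bsub>H\<^esub> h \<zero>\<^bsub>G\<^esub> = h \<zero>\<^bsub>G\<^esub>"
    using assms(4)[of "\<zero>\<^bsub>G\<^esub>" "\<zero>\<^bsub>G\<^esub>"] by simp
  then show ?thesis
    using assms(3)[of "\<zero>\<^bsub>G\<^esub>"] by (metis G.zero_closed H.add.r_cancel_one')
qed

lemma additive_minus:
  assumes "abelian_group G" "abelian_group H"
    and "\<And>x. x \<in> carrier G \<Longrightarrow> h x \<in> carrier H"
    and "\<And>x y. x \<in> carrier G \<Longrightarrow> y \<in> carrier G \<Longrightarrow> h (x \<oplus>\<^bsub>G\<^esub> y) = h x \<oplus>\<^bsub>H\<^esub> h y"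
    and "x \<in> carrier G"
  shows "h (\<ominus>\<^bsub>G\<^esub> x) = \<ominus>\<^bsub>H\<^esub> h x"
proof -
  interpret G: abelian_group G by fact
  interpret H: abelian_group H by fact
  have "h (\<ominus>\<^bsub>G\<^esub> x) \<oplus>\<^bsub>H\<^esub> h x = \<zero>\<^bsub>H\<^esub>"
    using assms(4)[of "\<ominus>\<^bsub>G\<^esub> x" x] assms additive_zero[OF assms(1-4)] by (simp add: G.l_neg)
  then show ?thesis
    using assms by (simp add: H.minus_equality)
qed

lemma additive_diff:
  assumes "abelian_group G" "abelian_group H"
    and "\<And>x. x \<in> carrier G \<Longrightarrow> h x \<in> carrier H"
    and "\<And>x y. x \<in> carrier G \<Longrightarrow> y \<in> carrier G \<Longrightarrow> h (x \<oplus>\<^bsub>G\<^esub> y) = h x \<oplus>\<^bsub>H\<^esub> h y"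
    and "x \<in> carrier G" "y \<in> carrier G"
  shows "h (x \<ominus>\<^bsub>G\<^esub> y) = h x \<ominus>\<^bsub>H\<^esub> h y"
proof -
  interpret G: abelian_group G by fact
  interpret H: abelian_group H by fact
  show ?thesis
    using additive_minus[OF assms(1-4)] assms by (simp add: a_minus_def)
qed

context left_module
begin

lemma left_module: "left_module R M" ..

lemma smult_l_null [simp]:
  assumes "x \<in> carrier M" shows "\<zero> \<odot>\<^bsub>M\<^esub> x = \<zero>\<^bsub>M\<^esub>"
  by (rule additive_zero[where h = "\<lambda>a. a \<odot>\<^bsub>M\<^esub> x" and G = R and H = M])
    (use assms in \<open>auto simp: smult_l_distr R.is_abelian_group M.abelian_group_axioms\<close>)

lemma smult_r_null [simp]:
  assumes "a \<in> carrier R" shows "a \<odot>\<^bsub>M\<^esub> \<zero>\<^bsub>M\<^esub> = \<zero>\<^bsub>M\<^esub>"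
  by (rule additive_zero[where h = "\<lambda>x. a \<odot>\<^bsub>M\<^esub> x" and G = M and H = M])
    (use assms in \<open>auto simp: smult_r_distr M.abelian_group_axioms\<close>)

lemma smult_l_minus:
  "\<lbrakk> a \<in> carrier R; x \<in> carrier M \<rbrakk> \<Longrightarrow> (\<ominus>a) \<odot>\<^bsub>M\<^esub> x = \<ominus>\<^bsub>M\<^esub> (a \<odot>\<^bsub>M\<^esub> x)"
  by (rule additive_minus[where h = "\<lambda>a. a \<odot>\<^bsub>M\<^esub> x" and G = R and H = M])
    (auto simp: smult_l_distr R.is_abelian_group M.abelian_group_axioms)

lemma smult_r_minus:
  "\<lbrakk> a \<in> carrier R; x \<in> carrier M \<rbrakk> \<Longrightarrow> a \<odot>\<^bsub>M\<^esub> (\<ominus>\<^bsub>M\<^esub> x) = \<ominus>\<^bsub>M\<^esub> (a \<odot>\<^bsub>M\<^esub> x)"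
  by (rule additive_minus[where h = "\<lambda>x. a \<odot>\<^bsub>M\<^esub> x" and G = M and H = M])
    (auto simp: smult_r_distr M.abelian_group_axioms)

lemma smult_l_diff:
  "\<lbrakk> a \<in> carrier R; b \<in> carrier R; x \<in> carrier M \<rbrakk> \<Longrightarrow>
    (a \<ominus> b) \<odot>\<^bsub>M\<^esub> x = a \<odot>\<^bsub>M\<^esub> x \<ominus>\<^bsub>M\<^esub> b \<odot>\<^bsub>M\<^esub> x"
  by (simp add: a_minus_def smult_l_distr smult_l_minus)

lemma smult_r_diff:
  "\<lbrakk> a \<in> carrier R; x \<in> carrier M; y \<in> carrier M \<rbrakk> \<Longrightarrow>
    a \<odot>\<^bsub>M\<^esub> (x \<ominus>\<^bsub>M\<^esub> y) = a \<odot>\<^bsub>M\<^esub> x \<ominus>\<^bsub>M\<^esub> a \<odot>\<^bsub>M\<^esub> y"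
  by (simp add: a_minus_def smult_r_distr smult_r_minus)

lemma smult_ssum:
  "a \<in> carrier R \<Longrightarrow> (\<And>i. i < n \<Longrightarrow> f i \<in> carrier M) \<Longrightarrow>
    a \<odot>\<^bsub>M\<^esub> ssum M n f = ssum M n (\<lambda>i. a \<odot>\<^bsub>M\<^esub> f i)"
  by (induction n) (simp_all add: smult_r_distr M.ssum_closed)

lemma ssum_smult:
  "x \<in> carrier M \<Longrightarrow> (\<And>i. i < n \<Longrightarrow> f i \<in> carrier R) \<Longrightarrow>
    ssum R n f \<odot>\<^bsub>M\<^esub> x = ssum M n (\<lambda>i. f i \<odot>\<^bsub>M\<^esub> x)"
  by (induction n) (simp_all add: smult_l_distr R.ssum_closed)

lemma lcomb_closed [simp]: "v \<in> Vec R \<Longrightarrow> y \<in> Vec M \<Longrightarrow> lcomb M n v y \<in> carrier M"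
  by (simp add: Vec_def Mat_def lcomb_def M.ssum_closed)

lemma lcomb_add_l:
  "v \<in> Vec R \<Longrightarrow> w \<in> Vec R \<Longrightarrow> y \<in> Vec M \<Longrightarrow>
    lcomb M n (\<lambda>i. v i \<oplus> w i) y = lcomb M n v y \<oplus>\<^bsub>M\<^esub> lcomb M n w y"
  by (simp add: Vec_def Mat_def lcomb_def smult_l_distr M.ssum_add)

lemma lcomb_add_r:
  "v \<in> Vec R \<Longrightarrow> x \<in> Vec M \<Longrightarrow> y \<in> Vec M \<Longrightarrow>
    lcomb M n v (\<lambda>i. x i \<oplus>\<^bsub>M\<^esub> y i) = lcomb M n v x \<oplus>\<^bsub>M\<^esub> lcomb M n v y"
  by (simp add: Vec_def Mat_def lcomb_def smult_r_distr M.ssum_add)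

lemma lcomb_diff_l:
  "v \<in> Vec R \<Longrightarrow> w \<in> Vec R \<Longrightarrow> y \<in> Vec M \<Longrightarrow>
    lcomb M n (\<lambda>i. v i \<ominus> w i) y = lcomb M n v y \<ominus>\<^bsub>M\<^esub> lcomb M n w y"
  by (simp add: Vec_def Mat_def lcomb_def smult_l_diff M.ssum_diff)

lemma lcomb_diff_r:
  "v \<in> Vec R \<Longrightarrow> x \<in> Vec M \<Longrightarrow> y \<in> Vec M \<Longrightarrow>
    lcomb M n v (\<lambda>i. x i \<ominus>\<^bsub>M\<^esub> y i) = lcomb M n v x \<ominus>\<^bsub>M\<^esub> lcomb M n v y"
  by (simp add: Vec_def Mat_def lcomb_def smult_r_diff M.ssum_diff)

lemma lcomb_smult_l:
  "c \<in> carrier R \<Longrightarrow> v \<in> Vec R \<Longrightarrow> y \<in> Vec M \<Longrightarrow>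
    lcomb M n (\<lambda>i. c \<otimes> v i) y = c \<odot>\<^bsub>M\<^esub> lcomb M n v y"
  by (simp add: Vec_def Mat_def lcomb_def smult_ssum smult_assoc1)

text \<open>Over a noncommutative ring a scalar passes through the coefficients only if it commutes
  with them. The rule is used when the coefficients are central generators, and when the scalar
  comes from the field.\<close>

lemma lcomb_smult_r:
  "c \<in> carrier R \<Longrightarrow> v \<in> Vec R \<Longrightarrow> y \<in> Vec M \<Longrightarrow> (\<And>i. c \<otimes> v i = v i \<otimes> c) \<Longrightarrow>
    lcomb M n v (\<lambda>i. c \<odot>\<^bsub>M\<^esub> y i) = c \<odot>\<^bsub>M\<^esub> lcomb M n v y"
  by (simp add: Vec_def Mat_def lcomb_def smult_ssum flip: smult_assoc1)

lemma lcomb_zero_l [simp]: "y \<in> Vec M \<Longrightarrow> lcomb M n (\<lambda>_. \<zero>) y = \<zero>\<^bsub>M\<^esub>"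
  by (simp add: Vec_def Mat_def lcomb_def)

lemma lcomb_zero_r [simp]: "v \<in> Vec R \<Longrightarrow> lcomb M n v (\<lambda>_. \<zero>\<^bsub>M\<^esub>) = \<zero>\<^bsub>M\<^esub>"
  by (simp add: Vec_def Mat_def lcomb_def)

lemma lcomb_unit:
  assumes "k < n" "y \<in> Vec M"
  shows "lcomb M n (\<lambda>i. if i = k then \<one> else \<zero>) y = y k"
proof -
  have "lcomb M n (\<lambda>i. if i = k then \<one> else \<zero>) y = ssum M n (\<lambda>i. if i = k then y k else \<zero>\<^bsub>M\<^esub>)"
    unfolding lcomb_def using assms by (intro ssum_cong) (auto simp: Vec_def Mat_def)
  then show ?thesis using assms by (simp add: Vec_def Mat_def M.ssum_single)
qed

text \<open>Exchange of the two summations. This is the associativity behind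
  \<open>mvec_mmul\<close> and, for the regular module, behind \<open>mmul_assoc\<close>.\<close>

lemma lcomb_lcomb:
  assumes "u \<in> Vec R" "Y \<in> Mat R" "y \<in> Vec M"
  shows "lcomb M n (\<lambda>j. ssum R m (\<lambda>k. u k \<otimes> Y k j)) y = lcomb M m u (\<lambda>k. lcomb M n (Y k) y)"
proof -
  have "lcomb M m u (\<lambda>k. lcomb M n (Y k) y) = ssum M m (\<lambda>k. ssum M n (\<lambda>j. (u k \<otimes> Y k j) \<odot>\<^bsub>M\<^esub> y j))"
    using assms by (simp add: Vec_def Mat_def lcomb_def smult_ssum smult_assoc1)
  also have "\<dots> = ssum M n (\<lambda>j. ssum M m (\<lambda>k. (u k \<otimes> Y k j) \<odot>\<^bsub>M\<^esub> y j))"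
    using assms by (intro M.ssum_swap) (auto simp: Vec_def Mat_def)
  also have "\<dots> = lcomb M n (\<lambda>j. ssum R m (\<lambda>k. u k \<otimes> Y k j)) y"
    using assms by (simp add: Vec_def Mat_def lcomb_def ssum_smult)
  finally show ?thesis ..
qed

lemma mvec_Vec [simp]: "B \<in> Mat R \<Longrightarrow> y \<in> Vec M \<Longrightarrow> mvec M n B y \<in> Vec M"
  by (simp add: Vec_def Mat_def mvec_def Vec_def[of M])

lemma mvec_mmul:
  "B \<in> Mat R \<Longrightarrow> Y \<in> Mat R \<Longrightarrow> y \<in> Vec M \<Longrightarrow> mvec M n (mmul R m B Y) y = mvec M m B (mvec M n Y y)"
  by (simp add: Vec_def Mat_def mvec_def mmul_def lcomb_lcomb)

lemma mvec_msub:
  "B \<in> Mat R \<Longrightarrow> Y \<in> Mat R \<Longrightarrow> y \<in> Vec M \<Longrightarrow>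
    mvec M n (msub R B Y) y = vsub M (mvec M n B y) (mvec M n Y y)"
  by (simp add: Vec_def Mat_def mvec_def msub_def vsub_def lcomb_diff_l)

lemma mvec_vsub:
  "B \<in> Mat R \<Longrightarrow> x \<in> Vec M \<Longrightarrow> y \<in> Vec M \<Longrightarrow>
    mvec M n B (vsub M x y) = vsub M (mvec M n B x) (mvec M n B y)"
  by (simp add: Vec_def Mat_def mvec_def vsub_def lcomb_diff_r)

lemma mvec_vadd:
  "B \<in> Mat R \<Longrightarrow> x \<in> Vec M \<Longrightarrow> y \<in> Vec M \<Longrightarrow>
    mvec M n B (vadd M x y) = vadd M (mvec M n B x) (mvec M n B y)"
  by (simp add: Vec_def Mat_def mvec_def vadd_def lcomb_add_r)

lemma mvec_zero [simp]: "B \<in> Mat R \<Longrightarrow> mvec M n B (\<lambda>_. \<zero>\<^bsub>M\<^esub>) = (\<lambda>_. \<zero>\<^bsub>M\<^esub>)"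
  by (simp add: Vec_def Mat_def mvec_def)

end

section \<open>Matrix products by way of the regular module\<close>

lemma regular_module_simps [simp]:
  "carrier (regular_module A) = carrier A" "\<zero>\<^bsub>regular_module A\<^esub> = \<zero>\<^bsub>A\<^esub>"
  "x \<oplus>\<^bsub>regular_module A\<^esub> y = x \<oplus>\<^bsub>A\<^esub> y" "a \<odot>\<^bsub>regular_module A\<^esub> x = a \<otimes>\<^bsub>A\<^esub> x"
  by (simp_all add: regular_module_def)

lemma Vec_regular [simp]: "Vec (regular_module A) = Vec A"
  by (simp add: Vec_def)

lemma abelian_group_cong:
  assumes "abelian_group G" "carrier H = carrier G" "\<zero>\<^bsub>H\<^esub> = \<zero>\<^bsub>G\<^esub>" "add H = add G"
  shows "abelian_group H"
proof -
  interpret G: abelian_group G by fact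
  show ?thesis
  proof (rule abelian_groupI)
    fix x assume "x \<in> carrier H"
    then show "\<exists>y\<in>carrier H. y \<oplus>\<^bsub>H\<^esub> x = \<zero>\<^bsub>H\<^esub>"
      by (intro bexI[of _ "\<ominus>\<^bsub>G\<^esub> x"]) (auto simp: assms G.l_neg)
  qed (auto simp: assms G.a_ac)
qed

lemma (in ring) left_module_regular: "left_module R (regular_module R)"
proof -
  have "abelian_group (regular_module R)"
    by (rule abelian_group_cong[OF is_abelian_group]) (simp_all add: regular_module_def)
  then show ?thesis
    by (intro left_module.intro left_module_axioms.intro ring_axioms)
      (auto simp: l_distr r_distr m_assoc)
qed

lemma ssum_regular [simp]: "ssum (regular_module A) n f = ssum A n f"
  by (induction n) simp_all

text \<open>Column by column, a matrix product is a matrix acting on a vector of the regular module,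
  so identities for \<open>mmul\<close> can be read off from those for \<open>mvec\<close>.\<close>

lemma mmul_eq_mvec: "mmul R n B Y i j = mvec (regular_module R) n B (\<lambda>k. Y k j) i"
  by (simp add: mmul_def mvec_def lcomb_def)

context ring
begin

lemma mmul_Mat [simp]: "B \<in> Mat R \<Longrightarrow> Y \<in> Mat R \<Longrightarrow> mmul R n B Y \<in> Mat R"
  by (rule MatI) (simp add: Vec_def Mat_def mmul_def ssum_closed)

lemma mmul_assoc:
  assumes "B \<in> Mat R" "Y \<in> Mat R" "Z \<in> Mat R"
  shows "mmul R n (mmul R m B Y) Z = mmul R m B (mmul R n Y Z)"
proof (intro ext)
  interpret L: left_module R "regular_module R" by (rule left_module_regular)
  fix i j
  have "mvec (regular_module R) n (mmul R m B Y) (\<lambda>k. Z k j) =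
        mvec (regular_module R) m B (mvec (regular_module R) n Y (\<lambda>k. Z k j))"
    using assms by (intro L.mvec_mmul) (auto simp: Vec_def Mat_def)
  then show "mmul R n (mmul R m B Y) Z i j = mmul R m B (mmul R n Y Z) i j"
    by (simp add: Vec_def Mat_def mmul_eq_mvec[abs_def])
qed

lemma minus_mult_l: "x \<in> carrier R \<Longrightarrow> y \<in> carrier R \<Longrightarrow> z \<in> carrier R \<Longrightarrow> (x \<ominus> y) \<otimes> z = x \<otimes> z \<ominus> y \<otimes> z"
  by (simp add: a_minus_def l_distr l_minus)

lemma minus_mult_r: "x \<in> carrier R \<Longrightarrow> y \<in> carrier R \<Longrightarrow> z \<in> carrier R \<Longrightarrow> x \<otimes> (y \<ominus> z) = x \<otimes> y \<ominus> x \<otimes> z"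
  by (simp add: a_minus_def r_distr r_minus)

lemma mmul_msub_l:
  "B \<in> Mat R \<Longrightarrow> Y \<in> Mat R \<Longrightarrow> Z \<in> Mat R \<Longrightarrow>
    mmul R n (msub R B Y) Z = msub R (mmul R n B Z) (mmul R n Y Z)"
  by (simp add: Vec_def Mat_def mmul_def msub_def vsub_def minus_mult_l ssum_diff)

lemma mmul_msub_r:
  "B \<in> Mat R \<Longrightarrow> Y \<in> Mat R \<Longrightarrow> Z \<in> Mat R \<Longrightarrow>
    mmul R n B (msub R Y Z) = msub R (mmul R n B Y) (mmul R n B Z)"
  by (simp add: Vec_def Mat_def mmul_def msub_def vsub_def minus_mult_r ssum_diff)

end

section \<open>Submodules and homomorphisms\<close>

lemma submodule_subset: "submodule H A M \<Longrightarrow> H \<subseteq> carrier M"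
  using submodule.axioms(1) subgroup.subset by fastforce

lemma submodule_zero: "submodule H A M \<Longrightarrow> \<zero>\<^bsub>M\<^esub> \<in> H"
  using submodule.axioms(1) subgroup.one_closed by fastforce

lemma submodule_add: "submodule H A M \<Longrightarrow> x \<in> H \<Longrightarrow> y \<in> H \<Longrightarrow> x \<oplus>\<^bsub>M\<^esub> y \<in> H"
  using submodule.axioms(1) subgroup.m_closed by fastforce

lemma submodule_minus: "submodule H A M \<Longrightarrow> x \<in> H \<Longrightarrow> \<ominus>\<^bsub>M\<^esub> x \<in> H"
  unfolding a_inv_def by (rule subgroup.m_inv_closed[OF submodule.axioms(1)])

lemma submodule_diff: "submodule H A M \<Longrightarrow> x \<in> H \<Longrightarrow> y \<in> H \<Longrightarrow> x \<ominus>\<^bsub>M\<^esub> y \<in> H"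
  by (simp add: a_minus_def submodule_add submodule_minus)

lemma submodule_smult: "submodule H A M \<Longrightarrow> a \<in> carrier A \<Longrightarrow> x \<in> H \<Longrightarrow> a \<odot>\<^bsub>M\<^esub> x \<in> H"
  by (rule submodule.smult_closed)

lemma submodule_ssum: "submodule H A M \<Longrightarrow> (\<And>i. i < n \<Longrightarrow> f i \<in> H) \<Longrightarrow> ssum M n f \<in> H"
  by (induction n) (simp_all add: submodule_zero submodule_add)

lemma submodule_lcomb:
  "submodule H A M \<Longrightarrow> v \<in> Vec A \<Longrightarrow> (\<And>i. i < n \<Longrightarrow> y i \<in> H) \<Longrightarrow> lcomb M n v y \<in> H"
  unfolding lcomb_def by (rule submodule_ssum) (simp_all add: submodule_smult VecD)

context left_module
begin

lemma submoduleI: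
  assumes "H \<subseteq> carrier M" "\<zero>\<^bsub>M\<^esub> \<in> H" "\<And>x y. x \<in> H \<Longrightarrow> y \<in> H \<Longrightarrow> x \<oplus>\<^bsub>M\<^esub> y \<in> H"
    and "\<And>a x. a \<in> carrier R \<Longrightarrow> x \<in> H \<Longrightarrow> a \<odot>\<^bsub>M\<^esub> x \<in> H"
  shows "submodule H R M"
proof -
  \<comment> \<open>Closure under negatives need not be assumed, since -x is (-1) x.\<close>
  have inv: "\<ominus>\<^bsub>M\<^esub> x \<in> H" if "x \<in> H" for x
    using that assms(1) assms(4)[of "\<ominus> \<one>" x] by (auto simp: smult_l_minus subset_iff)
  show ?thesis
    by (intro submodule.intro subgroup.intro submodule_axioms.intro)
      (use assms inv in \<open>auto simp: a_inv_def\<close>)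
qed

lemma submodule_carrier: "submodule (carrier M) R M"
  by (rule submoduleI) auto

lemma submodule_zero_set: "submodule {\<zero>\<^bsub>M\<^esub>} R M"
  by (rule submoduleI) auto

lemma submodule_left_module:
  assumes "submodule H R M"
  shows "left_module R (M\<lparr>carrier := H\<rparr>)"
proof -
  note H = submodule_subset[OF assms] submodule_zero[OF assms] submodule_add[OF assms]
    submodule_smult[OF assms]
  have "abelian_group (M\<lparr>carrier := H\<rparr>)"
  proof (rule abelian_groupI)
    fix x assume "x \<in> carrier (M\<lparr>carrier := H\<rparr>)"
    then show "\<exists>y\<in>carrier (M\<lparr>carrier := H\<rparr>). y \<oplus>\<^bsub>M\<lparr>carrier := H\<rparr>\<^esub> x = \<zero>\<^bsub>M\<lparr>carrier := H\<rparr>\<^esub>"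
      using H(1) by (intro bexI[of _ "\<ominus>\<^bsub>M\<^esub> x"]) (auto simp: submodule_minus[OF assms] M.l_neg)
  qed (use H in \<open>auto simp: subset_iff M.a_ac\<close>)
  then show ?thesis
    using H by (intro left_module.intro left_module_axioms.intro R.ring_axioms)
      (auto simp: subset_iff smult_l_distr smult_r_distr smult_assoc1)
qed

lemma submodule_of_submodule:
  assumes "submodule H R M"
  shows "submodule U R (M\<lparr>carrier := H\<rparr>) \<longleftrightarrow> submodule U R M \<and> U \<subseteq> H"
proof -
  interpret H: left_module R "M\<lparr>carrier := H\<rparr>" by (rule submodule_left_module[OF assms])
  show ?thesis
  proof
    assume U: "submodule U R (M\<lparr>carrier := H\<rparr>)"
    have "U \<subseteq> H" using submodule_subset[OF U] by simp
    moreover have "submodule U R M"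
      by (rule submoduleI)
        (use submodule_zero[OF U] submodule_add[OF U] submodule_smult[OF U] \<open>U \<subseteq> H\<close>
          submodule_subset[OF assms] in auto)
    ultimately show "submodule U R M \<and> U \<subseteq> H" by simp
  next
    assume U: "submodule U R M \<and> U \<subseteq> H"
    then show "submodule U R (M\<lparr>carrier := H\<rparr>)"
      using submodule_zero[of U R M] submodule_add[of U R M] submodule_smult[of U R M]
      by (intro H.submoduleI) auto
  qed
qed

lemma set_add_iff: "x \<in> U <+>\<^bsub>M\<^esub> V \<longleftrightarrow> (\<exists>u\<in>U. \<exists>v\<in>V. x = u \<oplus>\<^bsub>M\<^esub> v)"
  by (auto simp: set_add_def set_mult_def)

lemma submodule_set_add:
  assumes "submodule U R M" "submodule V R M"
  shows "submodule (U <+>\<^bsub>M\<^esub> V) R M"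
proof (rule submoduleI)
  note U = submodule_subset[OF assms(1)] and V = submodule_subset[OF assms(2)]
  show "U <+>\<^bsub>M\<^esub> V \<subseteq> carrier M" using U V by (auto simp: set_add_iff subset_iff)
  show "\<zero>\<^bsub>M\<^esub> \<in> U <+>\<^bsub>M\<^esub> V"
    unfolding set_add_iff using assms by (intro bexI[of _ "\<zero>\<^bsub>M\<^esub>"]) (auto simp: submodule_zero)
  show "x \<oplus>\<^bsub>M\<^esub> y \<in> U <+>\<^bsub>M\<^esub> V" if "x \<in> U <+>\<^bsub>M\<^esub> V" "y \<in> U <+>\<^bsub>M\<^esub> V" for x y
  proof -
    obtain u v u' v' where *: "u \<in> U" "v \<in> V" "u' \<in> U" "v' \<in> V" "x = u \<oplus>\<^bsub>M\<^esub> v" "y = u' \<oplus>\<^bsub>M\<^esub> v'"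
      using \<open>x \<in> _\<close> \<open>y \<in> _\<close> unfolding set_add_iff by blast
    then have "u \<in> carrier M" "v \<in> carrier M" "u' \<in> carrier M" "v' \<in> carrier M"
      using U V by auto
    then have "x \<oplus>\<^bsub>M\<^esub> y = (u \<oplus>\<^bsub>M\<^esub> u') \<oplus>\<^bsub>M\<^esub> (v \<oplus>\<^bsub>M\<^esub> v')"
      by (simp add: * M.a_ac)
    then show ?thesis
      unfolding set_add_iff using assms * by (blast intro: submodule_add)
  qed
  show "a \<odot>\<^bsub>M\<^esub> x \<in> U <+>\<^bsub>M\<^esub> V" if "a \<in> carrier R" "x \<in> U <+>\<^bsub>M\<^esub> V" for a x
  proof -
    obtain u v where *: "u \<in> U" "v \<in> V" "x = u \<oplus>\<^bsub>M\<^esub> v"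
      using \<open>x \<in> _\<close> unfolding set_add_iff by blast
    then have "a \<odot>\<^bsub>M\<^esub> x = a \<odot>\<^bsub>M\<^esub> u \<oplus>\<^bsub>M\<^esub> a \<odot>\<^bsub>M\<^esub> v"
      using U V that(1) by (simp add: smult_r_distr subset_iff)
    then show ?thesis
      unfolding set_add_iff using assms * that by (blast intro: submodule_smult)
  qed
qed

lemma set_add_upper:
  assumes "submodule U R M" "submodule V R M"
  shows "U \<subseteq> U <+>\<^bsub>M\<^esub> V" "V \<subseteq> U <+>\<^bsub>M\<^esub> V"
  using assms submodule_zero[of U R M] submodule_zero[of V R M]
    submodule_subset[of U R M] submodule_subset[of V R M]
  by (auto simp: set_add_iff subset_iff) (metis M.r_zero, metis M.l_zero)

lemma submodule_cyclic:
  assumes "x \<in> carrier M"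
  shows "submodule ((\<lambda>a. a \<odot>\<^bsub>M\<^esub> x) ` carrier R) R M"
proof (rule submoduleI)
  show "\<zero>\<^bsub>M\<^esub> \<in> (\<lambda>a. a \<odot>\<^bsub>M\<^esub> x) ` carrier R"
    using assms by (intro image_eqI[of _ _ \<zero>]) auto
qed (use assms in \<open>auto simp: smult_assoc1[symmetric] smult_l_distr[symmetric]\<close>)

lemma submodule_lcombs:
  assumes "y \<in> Vec M"
  shows "submodule {lcomb M n v y | v. v \<in> Vec R} R M"
proof (rule submoduleI)
  show "\<zero>\<^bsub>M\<^esub> \<in> {lcomb M n v y | v. v \<in> Vec R}"
    using assms by (auto intro!: exI[of _ "\<lambda>_. \<zero>"] simp: Vec_def)
next
  fix x x' assume "x \<in> {lcomb M n v y | v. v \<in> Vec R}" "x' \<in> {lcomb M n v y | v. v \<in> Vec R}"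
  then obtain v w where *: "v \<in> Vec R" "w \<in> Vec R" "x = lcomb M n v y" "x' = lcomb M n w y"
    by blast
  have "(\<lambda>i. v i \<oplus> w i) \<in> Vec R" using * by (simp add: Vec_def)
  then show "x \<oplus>\<^bsub>M\<^esub> x' \<in> {lcomb M n v y | v. v \<in> Vec R}"
    using * assms lcomb_add_l[of v w y n] by force
next
  fix a x assume "a \<in> carrier R" "x \<in> {lcomb M n v y | v. v \<in> Vec R}"
  then obtain v where *: "a \<in> carrier R" "v \<in> Vec R" "x = lcomb M n v y" by blast
  have "(\<lambda>i. a \<otimes> v i) \<in> Vec R" using * by (simp add: Vec_def)
  then show "a \<odot>\<^bsub>M\<^esub> x \<in> {lcomb M n v y | v. v \<in> Vec R}"
    using * assms lcomb_smult_l[of a v y n] by force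
qed (use assms in auto)

end

section \<open>Homomorphisms and isomorphisms of modules\<close>

lemma mod_homI:
  assumes "\<And>x. x \<in> carrier M \<Longrightarrow> f x \<in> carrier N" "\<And>x. x \<notin> carrier M \<Longrightarrow> f x = undefined"
    "\<And>x y. x \<in> carrier M \<Longrightarrow> y \<in> carrier M \<Longrightarrow> f (x \<oplus>\<^bsub>M\<^esub> y) = f x \<oplus>\<^bsub>N\<^esub> f y"
    "\<And>a x. a \<in> carrier A \<Longrightarrow> x \<in> carrier M \<Longrightarrow> f (a \<odot>\<^bsub>M\<^esub> x) = a \<odot>\<^bsub>N\<^esub> f x"
  shows "f \<in> mod_hom A M N"
  using assms by (auto simp: mod_hom_def extensional_def PiE_def)

lemma restrict_mod_hom:
  assumes "left_module A M" "\<And>x. x \<in> carrier M \<Longrightarrow> f x \<in> carrier N"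
    "\<And>x y. x \<in> carrier M \<Longrightarrow> y \<in> carrier M \<Longrightarrow> f (x \<oplus>\<^bsub>M\<^esub> y) = f x \<oplus>\<^bsub>N\<^esub> f y"
    "\<And>a x. a \<in> carrier A \<Longrightarrow> x \<in> carrier M \<Longrightarrow> f (a \<odot>\<^bsub>M\<^esub> x) = a \<odot>\<^bsub>N\<^esub> f x"
  shows "restrict f (carrier M) \<in> mod_hom A M N"
proof -
  interpret left_module A M by fact
  show ?thesis using assms(2-) by (intro mod_homI) auto
qed

lemma mod_hom_closed: "f \<in> mod_hom A M N \<Longrightarrow> x \<in> carrier M \<Longrightarrow> f x \<in> carrier N"
  by (auto simp: mod_hom_def)

lemma mod_hom_add:
  "f \<in> mod_hom A M N \<Longrightarrow> x \<in> carrier M \<Longrightarrow> y \<in> carrier M \<Longrightarrow> f (x \<oplus>\<^bsub>M\<^esub> y) = f x \<oplus>\<^bsub>N\<^esub> f y"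
  by (auto simp: mod_hom_def)

lemma mod_hom_smult:
  "f \<in> mod_hom A M N \<Longrightarrow> a \<in> carrier A \<Longrightarrow> x \<in> carrier M \<Longrightarrow> f (a \<odot>\<^bsub>M\<^esub> x) = a \<odot>\<^bsub>N\<^esub> f x"
  by (auto simp: mod_hom_def)

lemma mod_hom_ext:
  "f \<in> mod_hom A M N \<Longrightarrow> g \<in> mod_hom A M N \<Longrightarrow> (\<And>x. x \<in> carrier M \<Longrightarrow> f x = g x) \<Longrightarrow> f = g"
  unfolding mod_hom_def by (auto intro: PiE_ext)

locale mod_hom_loc = M: left_module A M + N: left_module A N
  for A (structure) and M :: "('a, 'm) module" and N :: "('a, 'n) module" +
  fixes f assumes f: "f \<in> mod_hom A M N"
begin

lemma closed: "x \<in> carrier M \<Longrightarrow> f x \<in> carrier N"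
  by (rule mod_hom_closed[OF f])

lemma add: "x \<in> carrier M \<Longrightarrow> y \<in> carrier M \<Longrightarrow> f (x \<oplus>\<^bsub>M\<^esub> y) = f x \<oplus>\<^bsub>N\<^esub> f y"
  by (rule mod_hom_add[OF f])

lemma smult: "a \<in> carrier A \<Longrightarrow> x \<in> carrier M \<Longrightarrow> f (a \<odot>\<^bsub>M\<^esub> x) = a \<odot>\<^bsub>N\<^esub> f x"
  by (rule mod_hom_smult[OF f])

lemma zero: "f \<zero>\<^bsub>M\<^esub> = \<zero>\<^bsub>N\<^esub>"
  by (rule additive_zero[OF M.M.abelian_group_axioms N.M.abelian_group_axioms]) (simp_all add: closed add)

lemma diff: "x \<in> carrier M \<Longrightarrow> y \<in> carrier M \<Longrightarrow> f (x \<ominus>\<^bsub>M\<^esub> y) = f x \<ominus>\<^bsub>N\<^esub> f y"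
  by (rule additive_diff[OF M.M.abelian_group_axioms N.M.abelian_group_axioms]) (simp_all add: closed add)

lemma ssum: "(\<And>i. i < n \<Longrightarrow> x i \<in> carrier M) \<Longrightarrow> f (ssum M n x) = ssum N n (\<lambda>i. f (x i))"
  by (rule ssum_hom[OF M.M.abelian_group_axioms N.M.abelian_group_axioms]) (simp_all add: add zero)

lemma lcomb: "v \<in> Vec A \<Longrightarrow> y \<in> Vec M \<Longrightarrow> f (lcomb M n v y) = lcomb N n v (\<lambda>i. f (y i))"
  by (simp add: lcomb_def ssum Vec_def smult)

lemma Vec: "y \<in> Vec M \<Longrightarrow> (\<lambda>i. f (y i)) \<in> Vec N"
  by (simp add: Vec_def closed)

lemma submodule_image:
  assumes "submodule U A M" shows "submodule (f ` U) A N"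
proof -
  note U = submodule_subset[OF assms]
  show ?thesis
  proof (rule N.submoduleI)
    show "\<zero>\<^bsub>N\<^esub> \<in> f ` U" using submodule_zero[OF assms] zero by force
  next
    fix x y assume "x \<in> f ` U" "y \<in> f ` U"
    then obtain u v where "u \<in> U" "v \<in> U" "x = f u" "y = f v" by blast
    then show "x \<oplus>\<^bsub>N\<^esub> y \<in> f ` U"
      using U submodule_add[OF assms] by (intro image_eqI[of _ _ "u \<oplus>\<^bsub>M\<^esub> v"]) (auto simp: add subset_iff)
  next
    fix a x assume "a \<in> carrier A" "x \<in> f ` U"
    then obtain u where "u \<in> U" "x = f u" by blast
    then show "a \<odot>\<^bsub>N\<^esub> x \<in> f ` U"
      using U submodule_smult[OF assms] \<open>a \<in> carrier A\<close>
      by (intro image_eqI[of _ _ "a \<odot>\<^bsub>M\<^esub> u"]) (auto simp: smult subset_iff)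
  qed (use U closed in auto)
qed

lemma submodule_ker: "submodule (mod_ker M N f) A M"
  by (rule M.submoduleI) (auto simp: mod_ker_def zero add smult)

end

lemma mod_hom_locI: "left_module A M \<Longrightarrow> left_module A N \<Longrightarrow> f \<in> mod_hom A M N \<Longrightarrow> mod_hom_loc A M N f"
  by (intro mod_hom_loc.intro mod_hom_loc_axioms.intro)

lemma mod_hom_compose:
  assumes "left_module A M" "f \<in> mod_hom A M N" "g \<in> mod_hom A N P"
  shows "compose (carrier M) g f \<in> mod_hom A M P"
proof -
  interpret M: left_module A M by fact
  show ?thesis
    using assms(2,3)
    by (intro mod_homI) (auto simp: compose_def mod_hom_closed mod_hom_add mod_hom_smult)
qed

lemma mod_iso_refl: assumes "left_module A M" shows "mod_iso A M M"
  unfolding mod_iso_def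
  by (rule bexI[of _ "restrict (\<lambda>x. x) (carrier M)"])
    (auto simp: bij_betw_def inj_on_def intro: restrict_mod_hom[OF assms])

lemma mod_iso_inverse:
  assumes "left_module A M" "left_module A N" "f \<in> mod_hom A M N" "bij_betw f (carrier M) (carrier N)"
  shows "restrict (inv_into (carrier M) f) (carrier N) \<in> mod_hom A N M"
proof -
  interpret M: left_module A M by fact
  let ?g = "inv_into (carrier M) f"
  have g: "?g x \<in> carrier M" "f (?g x) = x" if "x \<in> carrier N" for x
    using assms(4) that by (auto simp: bij_betw_def f_inv_into_f inv_into_into)
  have uniq: "?g x = y" if "y \<in> carrier M" "f y = x" for x y
    using assms(4) that by (auto simp: bij_betw_def)
  show ?thesis
    by (rule restrict_mod_hom[OF assms(2)])
      (auto simp: g intro!: uniq simp: mod_hom_add[OF assms(3)] mod_hom_smult[OF assms(3)])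
qed

lemma mod_iso_sym:
  assumes "left_module A M" "left_module A N" "mod_iso A M N"
  shows "mod_iso A N M"
proof -
  obtain f where f: "f \<in> mod_hom A M N" "bij_betw f (carrier M) (carrier N)"
    using assms(3) by (auto simp: mod_iso_def)
  have "bij_betw (inv_into (carrier M) f) (carrier N) (carrier M)"
    using f(2) by (rule bij_betw_inv_into)
  then have "bij_betw (restrict (inv_into (carrier M) f) (carrier N)) (carrier N) (carrier M)"
    by (rule bij_betw_cong[THEN iffD1, rotated]) simp
  with mod_iso_inverse[OF assms(1,2) f] show ?thesis
    unfolding mod_iso_def by blast
qed

lemma mod_iso_trans:
  assumes "left_module A M" "mod_iso A M N" "mod_iso A N P"
  shows "mod_iso A M P"
proof -
  obtain f g where *: "f \<in> mod_hom A M N" "bij_betw f (carrier M) (carrier N)"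
    "g \<in> mod_hom A N P" "bij_betw g (carrier N) (carrier P)"
    using assms by (auto simp: mod_iso_def)
  have "bij_betw (compose (carrier M) g f) (carrier M) (carrier P)"
    using bij_betw_trans[OF *(2,4)] by (rule bij_betw_cong[THEN iffD1, rotated]) (simp add: compose_def)
  with mod_hom_compose[OF assms(1) *(1,3)] show ?thesis
    by (auto simp: mod_iso_def)
qed

section \<open>Finite generation and modules of bounded length\<close>

text \<open>Generation is phrased by submodules, so that it can be verified by closure arguments
  without handling finite sums; \<open>gens_lcomb\<close> and \<open>lcomb_gens\<close> translate to
  explicit combinations.\<close>

definition gens :: "('a, 'c) ring_scheme \<Rightarrow> ('a, 'm) module \<Rightarrow> 'm set \<Rightarrow> bool" where
  "gens A M S \<longleftrightarrow> S \<subseteq> carrier M \<and> (\<forall>W. submodule W A M \<longrightarrow> S \<subseteq> W \<longrightarrow> W = carrier M)"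

lemma gens_lcomb:
  assumes "left_module A M" "finite S" "gens A M S"
  shows "\<exists>n y. y \<in> Vec M \<and> bij_betw y {..<n} S \<and> (\<forall>x\<in>carrier M. \<exists>v\<in>Vec A. x = lcomb M n v y)"
proof -
  interpret left_module A M by fact
  obtain n h where h: "bij_betw h {..<n::nat} S"
    using ex_bij_betw_nat_finite[OF \<open>finite S\<close>] by (auto simp: atLeast0LessThan)
  \<comment> \<open>The value zero beyond \<open>n\<close> makes the enumeration a total vector in
    \<open>Vec M\<close>.\<close>
  define y where "y i = (if i < n then h i else \<zero>\<^bsub>M\<^esub>)" for i
  have S: "S \<subseteq> carrier M" using assms(3) by (simp add: gens_def)
  have h': "h i \<in> carrier M" if "i < n" for i
    using h S that by (auto simp: bij_betw_def)
  have y: "y \<in> Vec M"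
    by (auto simp: y_def h' intro: VecI)
  have bij: "bij_betw y {..<n} S"
    using h by (rule bij_betw_cong[THEN iffD1, rotated]) (simp add: y_def)
  have "S \<subseteq> {lcomb M n v y | v. v \<in> Vec A}"
  proof
    fix s assume "s \<in> S"
    then obtain k where "k < n" "s = y k" using bij by (auto simp: bij_betw_def)
    then show "s \<in> {lcomb M n v y | v. v \<in> Vec A}"
      using y by (intro CollectI exI[of _ "\<lambda>i. if i = k then \<one>\<^bsub>A\<^esub> else \<zero>\<^bsub>A\<^esub>"]) (simp add: lcomb_unit Vec_def)
  qed
  then have "{lcomb M n v y | v. v \<in> Vec A} = carrier M"
    using assms(3) submodule_lcombs[OF y] by (auto simp: gens_def)
  then show ?thesis using y bij by blast
qed

lemma lcomb_gens:
  assumes "left_module A M" "y \<in> Vec M" "\<And>x. x \<in> carrier M \<Longrightarrow> \<exists>v\<in>Vec A. x = lcomb M n v y"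
  shows "gens A M (y ` {..<n})"
proof -
  interpret left_module A M by fact
  have "W = carrier M" if "submodule W A M" "y ` {..<n} \<subseteq> W" for W
    using assms(3) submodule_lcomb[OF that(1), of _ n y] that(2) submodule_subset[OF that(1)]
    by (auto simp: image_subset_iff)
  then show ?thesis using assms(2) by (auto simp: gens_def Vec_def)
qed

lemma finitely_generated_iff:
  assumes "left_module A M"
  shows "finitely_generated A M \<longleftrightarrow> (\<exists>S. finite S \<and> gens A M S)"
proof
  interpret left_module A M by fact
  assume "finitely_generated A M"
  then obtain S where S: "finite S" "S \<subseteq> carrier M"
    "\<And>x. x \<in> carrier M \<Longrightarrow> \<exists>c. c ` S \<subseteq> carrier A \<and> x = (\<Oplus>\<^bsub>M\<^esub>s\<in>S. c s \<odot>\<^bsub>M\<^esub> s)"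
    unfolding finitely_generated_def by blast
  have "W = carrier M" if W: "submodule W A M" "S \<subseteq> W" for W
  proof
    show "W \<subseteq> carrier M" by (rule submodule_subset[OF W(1)])
    show "carrier M \<subseteq> W"
    proof
      fix x assume "x \<in> carrier M"
      then obtain c where c: "c ` S \<subseteq> carrier A" "x = (\<Oplus>\<^bsub>M\<^esub>s\<in>S. c s \<odot>\<^bsub>M\<^esub> s)" using S(3) by blast
      have "T \<subseteq> S \<Longrightarrow> (\<Oplus>\<^bsub>M\<^esub>s\<in>T. c s \<odot>\<^bsub>M\<^esub> s) \<in> W" if "finite T" for T
        using that
      proof (induction T)
        case empty then show ?case by (simp add: submodule_zero[OF W(1)])
      next
        case (insert s T)
        then have "(\<Oplus>\<^bsub>M\<^esub>s\<in>insert s T. c s \<odot>\<^bsub>M\<^esub> s) = c s \<odot>\<^bsub>M\<^esub> s \<oplus>\<^bsub>M\<^esub> (\<Oplus>\<^bsub>M\<^esub>s\<in>T. c s \<odot>\<^bsub>M\<^esub> s)"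
          using c(1) S(2) by (intro M.finsum_insert) (auto simp: Pi_def subset_iff)
        moreover have "c s \<odot>\<^bsub>M\<^esub> s \<in> W"
          using insert c(1) W(2) by (intro submodule_smult[OF W(1)]) auto
        ultimately show ?case
          using insert by (simp add: submodule_add[OF W(1)])
      qed
      then show "x \<in> W" using c(2) S(1) by simp
    qed
  qed
  then show "\<exists>S. finite S \<and> gens A M S" using S(1,2) by (auto simp: gens_def)
next
  interpret left_module A M by fact
  assume "\<exists>S. finite S \<and> gens A M S"
  then obtain S where S: "finite S" "gens A M S" by blast
  obtain n y where y: "y \<in> Vec M" "bij_betw y {..<n} S"
    and span: "\<And>x. x \<in> carrier M \<Longrightarrow> \<exists>v\<in>Vec A. x = lcomb M n v y"
    using gens_lcomb[OF assms S] by blast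
  have "\<exists>c. c ` S \<subseteq> carrier A \<and> x = (\<Oplus>\<^bsub>M\<^esub>s\<in>S. c s \<odot>\<^bsub>M\<^esub> s)" if x: "x \<in> carrier M" for x
  proof -
    obtain v where v: "v \<in> Vec A" "x = lcomb M n v y" using span x by blast
    let ?c = "\<lambda>s. v (inv_into {..<n} y s)"
    have inj: "inj_on y {..<n}" and im: "S = y ` {..<n}" using y(2) by (auto simp: bij_betw_def)
    have "(\<Oplus>\<^bsub>M\<^esub>s\<in>S. ?c s \<odot>\<^bsub>M\<^esub> s) = (\<Oplus>\<^bsub>M\<^esub>i\<in>{..<n}. ?c (y i) \<odot>\<^bsub>M\<^esub> y i)"
      unfolding im using v y by (intro M.finsum_reindex[OF _ inj]) (auto simp: Vec_def)
    also have "\<dots> = (\<Oplus>\<^bsub>M\<^esub>i\<in>{..<n}. v i \<odot>\<^bsub>M\<^esub> y i)"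
      using v y inj by (intro M.finsum_cong') (auto simp: Vec_def)
    also have "\<dots> = x"
      unfolding v(2) lcomb_def using v y by (intro M.finsum_eq_ssum) (auto simp: Vec_def)
    finally show ?thesis
      using v(1) by (intro exI[of _ ?c]) (auto simp: Vec_def)
  qed
  then show "finitely_generated A M"
    using S unfolding finitely_generated_def gens_def by blast
qed

lemma finitely_generated_lcomb:
  assumes "left_module A M"
  shows "finitely_generated A M \<longleftrightarrow>
    (\<exists>n y. y \<in> Vec M \<and> (\<forall>x\<in>carrier M. \<exists>v\<in>Vec A. x = lcomb M n v y))"
  unfolding finitely_generated_iff[OF assms]
  using gens_lcomb[OF assms] lcomb_gens[OF assms] by (metis finite_imageI finite_lessThan)

text \<open>A bounded, strictly monotone rank function replaces finite length. It yields both chain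
  conditions without composition series or dimension theory.\<close>

definition bounded_length :: "('a, 'c) ring_scheme \<Rightarrow> ('a, 'm) module \<Rightarrow> bool" where
  "bounded_length A M \<longleftrightarrow> (\<exists>\<mu> :: 'm set \<Rightarrow> nat. \<exists>n. \<forall>U V. submodule U A M \<longrightarrow> submodule V A M \<longrightarrow>
     U \<subset> V \<longrightarrow> \<mu> U < \<mu> V \<and> \<mu> V \<le> n)"

text \<open>The measure of a subspace is the number of its pivots with respect to a generating sequence.\<close>

lemma bounded_length_vector_space:
  assumes "field K" "left_module K V" "finitely_generated K V"
  shows "bounded_length K V"
proof -
  interpret K: field K by fact
  interpret left_module K V by fact
  obtain n y where y: "y \<in> Vec V" and span: "\<And>x. x \<in> carrier V \<Longrightarrow> \<exists>v\<in>Vec K. x = lcomb V n v y"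
    using assms(3) unfolding finitely_generated_lcomb[OF assms(2)] by blast
  \<comment> \<open>An index is a pivot of W if some combination in W has its last coefficient
    there, normalized to one. The generators \<open>y\<close> may be dependent.\<close>
  define piv where "piv W = {i. i < n \<and> (\<exists>v\<in>Vec K. v i = \<one>\<^bsub>K\<^esub> \<and> lcomb V (Suc i) v y \<in> W)}" for W
  have fin: "finite (piv W)" for W by (simp add: piv_def)
  \<comment> \<open>Gaussian elimination from the last coefficient downwards: if every pivot of V'
    is one of U, each element of V' is reduced by elements of U until nothing is left.\<close>
  have eq: "V' \<subseteq> U" if UV: "submodule U K V" "submodule V' K V" "U \<subseteq> V'" "piv V' \<subseteq> piv U" for U V'
  proof -
    have "i \<le> n \<Longrightarrow> lcomb V i v y \<in> V' \<Longrightarrow> v \<in> Vec K \<Longrightarrow> lcomb V i v y \<in> U" for i v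
    proof (induction i arbitrary: v)
      case 0 then show ?case by (simp add: submodule_zero[OF UV(1)])
    next
      case (Suc i)
      show ?case
      proof (cases "v i = \<zero>\<^bsub>K\<^esub>")
        case True
        have "lcomb V (Suc i) v y = lcomb V i v y" using True y Suc.prems by (simp add: VecD)
        then show ?thesis using Suc by simp
      next
        case False
        have vi: "v i \<in> Units K" using False Suc.prems by (simp add: K.field_Units VecD)
        then have inv: "inv\<^bsub>K\<^esub> v i \<in> carrier K" by simp
        have "(\<lambda>k. inv\<^bsub>K\<^esub> (v i) \<otimes>\<^bsub>K\<^esub> v k) \<in> Vec K" using Suc.prems inv by (simp add: Vec_def)
        moreover have "inv\<^bsub>K\<^esub> (v i) \<otimes>\<^bsub>K\<^esub> v i = \<one>\<^bsub>K\<^esub>" using vi by simp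
        moreover have "lcomb V (Suc i) (\<lambda>k. inv\<^bsub>K\<^esub> (v i) \<otimes>\<^bsub>K\<^esub> v k) y \<in> V'"
          using lcomb_smult_l[OF inv Suc.prems(3) y, of "Suc i"] submodule_smult[OF UV(2) inv Suc.prems(2)]
          by simp
        ultimately have "i \<in> piv V'" using Suc.prems by (auto simp: piv_def)
        then obtain w where w: "w \<in> Vec K" "w i = \<one>\<^bsub>K\<^esub>" "lcomb V (Suc i) w y \<in> U"
          using UV(4) by (auto simp: piv_def)
        \<comment> \<open>Subtracting the multiple \<open>v i\<close> of the normalized
          \<open>w\<close> clears coefficient \<open>i\<close>, so the induction hypothesis applies
          to a shorter combination.\<close>
        define u where "u k = v k \<ominus>\<^bsub>K\<^esub> v i \<otimes>\<^bsub>K\<^esub> w k" for k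
        have vw: "(\<lambda>k. v i \<otimes>\<^bsub>K\<^esub> w k) \<in> Vec K" using w Suc.prems by (simp add: Vec_def)
        have u: "u \<in> Vec K" using vw Suc.prems by (simp add: Vec_def u_def)
        have "u i = \<zero>\<^bsub>K\<^esub>" using w Suc.prems by (simp add: u_def VecD K.r_neg a_minus_def)
        then have "lcomb V i u y = lcomb V (Suc i) u y" using u y by (simp add: VecD)
        also have "\<dots> = lcomb V (Suc i) v y \<ominus>\<^bsub>V\<^esub> v i \<odot>\<^bsub>V\<^esub> lcomb V (Suc i) w y"
          unfolding u_def using lcomb_diff_l[OF Suc.prems(3) vw y] lcomb_smult_l[OF VecD[OF Suc.prems(3)] w(1) y]
          by (metis (no_types))
        finally have eq: "lcomb V i u y = lcomb V (Suc i) v y \<ominus>\<^bsub>V\<^esub> v i \<odot>\<^bsub>V\<^esub> lcomb V (Suc i) w y" .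
        have vwU: "v i \<odot>\<^bsub>V\<^esub> lcomb V (Suc i) w y \<in> U"
          by (rule submodule_smult[OF UV(1) VecD[OF Suc.prems(3)] w(3)])
        then have "lcomb V i u y \<in> V'"
          unfolding eq using UV(3) by (intro submodule_diff[OF UV(2) Suc.prems(2)]) auto
        then have "lcomb V i u y \<in> U" using Suc.IH[of u] u Suc.prems by simp
        then have "v i \<odot>\<^bsub>V\<^esub> lcomb V (Suc i) w y \<oplus>\<^bsub>V\<^esub> lcomb V i u y \<in> U"
          by (rule submodule_add[OF UV(1) vwU])
        moreover have "v i \<odot>\<^bsub>V\<^esub> lcomb V (Suc i) w y \<oplus>\<^bsub>V\<^esub> lcomb V i u y = lcomb V (Suc i) v y"
          unfolding eq using Suc.prems(3) w(1) y VecD[OF Suc.prems(3)]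
          by (intro M.add_minus_cancel smult_closed lcomb_closed)
        ultimately show ?thesis by simp
      qed
    qed
    then show ?thesis
      using span submodule_subset[OF UV(2)] by (metis le_refl subset_iff)
  qed
  have mono: "piv U \<subseteq> piv V'" if "U \<subseteq> V'" for U V' using that by (auto simp: piv_def)
  have "card (piv U) < card (piv V') \<and> card (piv V') \<le> n"
    if "submodule U K V" "submodule V' K V" "U \<subset> V'" for U V'
  proof
    have "piv U \<subset> piv V'" using eq[of U V'] mono[of U V'] that by auto
    then show "card (piv U) < card (piv V')" by (rule psubset_card_mono[OF fin])
    have "piv V' \<subseteq> {..<n}" by (auto simp: piv_def)
    then show "card (piv V') \<le> n" by (metis card_lessThan card_mono finite_lessThan)
  qed
  then show ?thesis unfolding bounded_length_def by (intro exI[of _ "\<lambda>U. card (piv U)"]) blast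
qed

text \<open>The scalars of the two modules may differ. Submodules over an algebra are in particular
  subspaces over the field, so a bound for subspaces suffices.\<close>

lemma bounded_length_mono:
  assumes "bounded_length K M'" "\<And>U. submodule U A M \<Longrightarrow> submodule U K M'"
  shows "bounded_length A M"
  using assms unfolding bounded_length_def by meson

lemma min_submodule:
  assumes "bounded_length A M" "submodule U A M" "P U"
  shows "\<exists>V. submodule V A M \<and> P V \<and> (\<forall>W. submodule W A M \<longrightarrow> P W \<longrightarrow> W \<subseteq> V \<longrightarrow> W = V)"
proof -
  obtain \<mu> :: "_ \<Rightarrow> nat" where \<mu>: "\<And>U V. submodule U A M \<Longrightarrow> submodule V A M \<Longrightarrow> U \<subset> V \<Longrightarrow> \<mu> U < \<mu> V"
    using assms(1) unfolding bounded_length_def by blast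
  obtain V where V: "submodule V A M \<and> P V" "\<And>W. submodule W A M \<and> P W \<Longrightarrow> \<mu> V \<le> \<mu> W"
    using ex_has_least_nat[of "\<lambda>V. submodule V A M \<and> P V" U \<mu>] assms by blast
  show ?thesis
    by (rule exI[of _ V]) (use V \<mu> in \<open>auto simp: not_less[symmetric]\<close>)
qed

lemma max_submodule:
  assumes "bounded_length A M" "submodule U A M" "P U"
  shows "\<exists>V. submodule V A M \<and> P V \<and> (\<forall>W. submodule W A M \<longrightarrow> P W \<longrightarrow> V \<subseteq> W \<longrightarrow> W = V)"
proof -
  obtain \<mu> :: "_ \<Rightarrow> nat" and n where \<mu>: "\<And>U V. submodule U A M \<Longrightarrow> submodule V A M \<Longrightarrow> U \<subset> V \<Longrightarrow> \<mu> U < \<mu> V \<and> \<mu> V \<le> n"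
    using assms(1) unfolding bounded_length_def by blast
  \<comment> \<open>The difference is truncated; the bound by \<open>n\<close> on the larger of two
    nested submodules makes it strictly decreasing, so its least value marks a maximal
    submodule.\<close>
  obtain V where V: "submodule V A M \<and> P V"
    "\<And>W. submodule W A M \<and> P W \<Longrightarrow> n - \<mu> V \<le> n - \<mu> W"
    using ex_has_least_nat[of "\<lambda>V. submodule V A M \<and> P V" U "\<lambda>V. n - \<mu> V"] assms by blast
  show ?thesis
  proof (intro exI[of _ V] conjI allI impI)
    fix W assume W: "submodule W A M" "P W" "V \<subseteq> W"
    show "W = V"
    proof (rule ccontr)
      assume "W \<noteq> V"
      then have "\<mu> V < \<mu> W \<and> \<mu> W \<le> n" using \<mu>[of V W] V W by auto
      then show False using V(2)[of W] W by auto
    qed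
  qed (use V in auto)
qed

text \<open>The record type is fixed to \<open>module\<close>, because \<open>mod_hom\<close> and
  \<open>finitely_generated\<close> are declared for it alone while \<open>left_module\<close>
  admits record extensions.\<close>

locale pure_left_module = left_module R M
  for R :: "('a, 'c) ring_scheme" (structure) and M :: "('a, 'm) module" (structure)
begin

text \<open>The Noetherian argument: among the submodules generated by a finite subset of
  \<open>U\<close> choose a maximal one. Adjoining any further element of \<open>U\<close> would
  enlarge it. The predicate \<open>P\<close> describes the generated submodule as the smallest one
  containing \<open>S\<close>.\<close>

lemma submodule_finitely_generated:
  assumes "bounded_length R M" "submodule U R M"
  shows "finitely_generated R (M\<lparr>carrier := U\<rparr>)"
proof -
  define P where "P V \<longleftrightarrow> (\<exists>S. finite S \<and> S \<subseteq> U \<and> S \<subseteq> V \<and>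
    (\<forall>W. submodule W R M \<longrightarrow> S \<subseteq> W \<longrightarrow> V \<subseteq> W))" for V
  have "P {\<zero>\<^bsub>M\<^esub>}" unfolding P_def by (rule exI[of _ "{}"]) (auto simp: submodule_zero)
  from max_submodule[of R M _ P, OF assms(1) submodule_zero_set this]
  obtain V where V: "submodule V R M" "P V" "\<And>W. submodule W R M \<Longrightarrow> P W \<Longrightarrow> V \<subseteq> W \<Longrightarrow> W = V"
    by blast
  from V(2) obtain S where S: "finite S" "S \<subseteq> U" "S \<subseteq> V" "\<And>W. submodule W R M \<Longrightarrow> S \<subseteq> W \<Longrightarrow> V \<subseteq> W"
    unfolding P_def by blast
  have "U \<subseteq> V"
  proof
    fix x assume x: "x \<in> U"
    then have xM: "x \<in> carrier M" using submodule_subset[OF assms(2)] by auto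
    let ?C = "(\<lambda>a. a \<odot>\<^bsub>M\<^esub> x) ` carrier R"
    have C: "submodule ?C R M" by (rule submodule_cyclic[OF xM])
    have xC: "x \<in> ?C" by (rule image_eqI[of _ _ \<one>]) (simp_all add: xM)
    note sub = set_add_upper[OF V(1) C]
    have "P (V <+>\<^bsub>M\<^esub> ?C)"
      unfolding P_def
    proof (intro exI[of _ "insert x S"] conjI allI impI)
      fix W assume W: "submodule W R M" "insert x S \<subseteq> W"
      have "V \<subseteq> W" using S(4)[OF W(1)] W(2) by auto
      then show "V <+>\<^bsub>M\<^esub> ?C \<subseteq> W"
        using W by (auto simp: set_add_iff intro!: submodule_add[OF W(1)] submodule_smult[OF W(1)])
    qed (use S x xC sub in auto)
    then have "V <+>\<^bsub>M\<^esub> ?C = V" using V(3)[OF submodule_set_add[OF V(1) C]] sub by blast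
    then show "x \<in> V" using sub xC by blast
  qed
  then have "gens R (M\<lparr>carrier := U\<rparr>) S"
    using S(2,4) unfolding gens_def submodule_of_submodule[OF assms(2)] by force
  then show ?thesis
    using S(1) finitely_generated_iff[OF submodule_left_module[OF assms(2)]] by blast
qed

lemma bounded_length_submodule:
  assumes "bounded_length R M" "submodule U R M"
  shows "bounded_length R (M\<lparr>carrier := U\<rparr>)"
  by (rule bounded_length_mono[OF assms(1)]) (simp add: submodule_of_submodule[OF assms(2)])

text \<open>The kernels of the powers of \<open>f\<close> stabilise, say at n. If f x = 0, write x =
  f^n z by surjectivity; then z lies in the kernel of f^(n+1), hence in that of f^n, so x =
  0.\<close>

lemma surjective_endomorphism_inj:
  assumes "bounded_length R M" "f \<in> mod_hom R M M" "f ` carrier M = carrier M"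
  shows "inj_on f (carrier M)"
proof -
  interpret f: mod_hom_loc R M M f
    by (rule mod_hom_locI) (use assms left_module in auto)
  define Kn where "Kn n = {x \<in> carrier M. (f ^^ n) x = \<zero>\<^bsub>M\<^esub>}" for n
  have fn: "(f ^^ n) x \<in> carrier M" if "x \<in> carrier M" for n x
    using that by (induction n) (auto simp: f.closed)
  have add: "(f ^^ n) (x \<oplus>\<^bsub>M\<^esub> y) = (f ^^ n) x \<oplus>\<^bsub>M\<^esub> (f ^^ n) y" if "x \<in> carrier M" "y \<in> carrier M" for n x y
    using that by (induction n) (auto simp: f.add fn)
  have smult: "(f ^^ n) (a \<odot>\<^bsub>M\<^esub> x) = a \<odot>\<^bsub>M\<^esub> (f ^^ n) x" if "a \<in> carrier R" "x \<in> carrier M" for n a x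
    using that by (induction n) (auto simp: f.smult fn)
  have zero: "(f ^^ n) \<zero>\<^bsub>M\<^esub> = \<zero>\<^bsub>M\<^esub>" for n
    by (induction n) (auto simp: f.zero)
  have sub: "submodule (Kn n) R M" for n
    unfolding Kn_def by (rule submoduleI) (auto simp: add smult zero)
  from max_submodule[of R M "Kn 0" "\<lambda>V. V \<in> range Kn", OF assms(1) sub]
  obtain n where "\<forall>W. submodule W R M \<longrightarrow> W \<in> range Kn \<longrightarrow> Kn n \<subseteq> W \<longrightarrow> W = Kn n" by auto
  moreover have "Kn n \<subseteq> Kn (Suc n)" by (auto simp: Kn_def f.zero)
  ultimately have eq: "Kn (Suc n) = Kn n" using sub by blast
  have surj: "\<exists>x\<in>carrier M. y = (f ^^ k) x" if "y \<in> carrier M" for y k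
    using that
  proof (induction k arbitrary: y)
    case (Suc k)
    obtain z where "z \<in> carrier M" "y = f z" using Suc.prems assms(3) by blast
    with Suc.IH[of z] show ?case by auto
  qed auto
  have ker: "x = \<zero>\<^bsub>M\<^esub>" if x: "x \<in> carrier M" "f x = \<zero>\<^bsub>M\<^esub>" for x
  proof -
    obtain z where z: "z \<in> carrier M" "x = (f ^^ n) z" using surj[OF x(1)] by blast
    then have "z \<in> Kn (Suc n)" using x by (simp add: Kn_def)
    then show ?thesis using eq z by (auto simp: Kn_def)
  qed
  show ?thesis
  proof (rule inj_onI)
    fix x y assume xy: "x \<in> carrier M" "y \<in> carrier M" "f x = f y"
    then have "f (x \<ominus>\<^bsub>M\<^esub> y) = \<zero>\<^bsub>M\<^esub>" by (simp add: f.diff M.minus_zero_iff f.closed)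
    then show "x = y" using ker[of "x \<ominus>\<^bsub>M\<^esub> y"] xy by (simp add: M.minus_zero_iff)
  qed
qed

end

text \<open>By Zorn's lemma there is a largest subspace U that contains W and misses z. Then V is
  the direct sum of U and the line of z, and the functional is the coefficient of z. Zorn is called
  for because the later application is to a space of infinite sequences.\<close>

lemma exists_functional:
  assumes "field K" "left_module K V" "submodule W K V" "z \<in> carrier V" "z \<notin> W"
  shows "\<exists>f \<in> mod_hom K V (regular_module K). (\<forall>w\<in>W. f w = \<zero>\<^bsub>K\<^esub>) \<and> f z \<noteq> \<zero>\<^bsub>K\<^esub>"
proof -
  interpret K: field K by fact
  interpret left_module K V by fact
  let ?A = "{U. submodule U K V \<and> W \<subseteq> U \<and> z \<notin> U}"
  have "\<exists>U\<in>?A. \<forall>U'\<in>?A. U \<subseteq> U' \<longrightarrow> U' = U"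
  proof (rule subset_Zorn_nonempty)
    show "?A \<noteq> {}" using assms by blast
    fix C assume C: "C \<noteq> {}" "subset.chain ?A C"
    then have sub: "\<And>U. U \<in> C \<Longrightarrow> submodule U K V \<and> W \<subseteq> U \<and> z \<notin> U"
      by (auto simp: subset_chain_def)
    have "submodule (\<Union>C) K V"
    proof (rule submoduleI)
      fix x y assume "x \<in> \<Union>C" "y \<in> \<Union>C"
      then obtain U where "U \<in> C" "x \<in> U" "y \<in> U"
        using C(2) unfolding subset_chain_def by blast
      then show "x \<oplus>\<^bsub>V\<^esub> y \<in> \<Union>C" using sub[of U] submodule_add[of U K V x y] by blast
    next
      show "\<Union>C \<subseteq> carrier V" using sub submodule_subset[of _ K V] by blast
      show "\<zero>\<^bsub>V\<^esub> \<in> \<Union>C" using sub C(1) submodule_zero[of _ K V] by blast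
      show "a \<odot>\<^bsub>V\<^esub> x \<in> \<Union>C" if "a \<in> carrier K" "x \<in> \<Union>C" for a x
        using sub that submodule_smult[of _ K V a x] by blast
    qed
    then show "\<Union>C \<in> ?A" using sub C(1) by blast
  qed
  then obtain U where "U \<in> ?A" and max': "\<forall>U'\<in>?A. U \<subseteq> U' \<longrightarrow> U' = U" ..
  then have U: "submodule U K V" "W \<subseteq> U" "z \<notin> U" by auto
  have max: "U' = U" if "submodule U' K V" "W \<subseteq> U'" "z \<notin> U'" "U \<subseteq> U'" for U'
    using max' that by simp
  note UV = submodule_subset[OF U(1)]
  have ex: "\<exists>c\<in>carrier K. x \<ominus>\<^bsub>V\<^esub> c \<odot>\<^bsub>V\<^esub> z \<in> U" if x: "x \<in> carrier V" for x
  proof (cases "x \<in> U")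
    case True
    then show ?thesis using x assms(4) by (intro bexI[of _ "\<zero>\<^bsub>K\<^esub>"]) (auto simp: a_minus_def M.minus_equality[of "\<zero>\<^bsub>V\<^esub>" "\<zero>\<^bsub>V\<^esub>"])
  next
    case False
    let ?C = "(\<lambda>a. a \<odot>\<^bsub>V\<^esub> x) ` carrier K"
    have C: "submodule ?C K V" by (rule submodule_cyclic[OF x])
    have xC: "x \<in> ?C" by (rule image_eqI[of _ _ "\<one>\<^bsub>K\<^esub>"]) (simp_all add: x)
    note sub = set_add_upper[OF U(1) C]
    \<comment> \<open>Maximality: a subspace that is strictly larger than \<open>U\<close> has to
      contain \<open>z\<close>.\<close>
    have "z \<in> U <+>\<^bsub>V\<^esub> ?C"
    proof (rule ccontr)
      assume "z \<notin> U <+>\<^bsub>V\<^esub> ?C"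
      then have "U <+>\<^bsub>V\<^esub> ?C = U"
        using max[OF submodule_set_add[OF U(1) C]] sub U(2) by auto
      then show False using sub xC False by blast
    qed
    then obtain u a where ua: "u \<in> U" "a \<in> carrier K" "z = u \<oplus>\<^bsub>V\<^esub> a \<odot>\<^bsub>V\<^esub> x"
      by (auto simp: set_add_iff)
    have uV: "u \<in> carrier V" using ua UV by auto
    have "a \<noteq> \<zero>\<^bsub>K\<^esub>" using ua U(3) x uV by auto
    then have a: "a \<in> Units K" using ua by (simp add: K.field_Units)
    define b where "b = inv\<^bsub>K\<^esub> a"
    have b: "b \<in> carrier K" "b \<otimes>\<^bsub>K\<^esub> a = \<one>\<^bsub>K\<^esub>" using a by (simp_all add: b_def)
    have "b \<odot>\<^bsub>V\<^esub> z = b \<odot>\<^bsub>V\<^esub> u \<oplus>\<^bsub>V\<^esub> x"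
      using ua b x uV by (simp add: smult_r_distr smult_assoc1[symmetric])
    then have "x \<ominus>\<^bsub>V\<^esub> b \<odot>\<^bsub>V\<^esub> z = \<ominus>\<^bsub>V\<^esub> (b \<odot>\<^bsub>V\<^esub> u)"
      using b uV x by (simp add: a_minus_def M.minus_add) (simp add: M.a_ac M.r_neg M.r_neg1 M.r_neg2 M.a_comm)
    then have "x \<ominus>\<^bsub>V\<^esub> b \<odot>\<^bsub>V\<^esub> z \<in> U"
      using submodule_minus[OF U(1) submodule_smult[OF U(1) b(1) ua(1)]] by simp
    then show ?thesis using b by blast
  qed
  have uniq: "c = d" if c: "c \<in> carrier K" "d \<in> carrier K" "x \<in> carrier V"
    "x \<ominus>\<^bsub>V\<^esub> c \<odot>\<^bsub>V\<^esub> z \<in> U" "x \<ominus>\<^bsub>V\<^esub> d \<odot>\<^bsub>V\<^esub> z \<in> U" for c d x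
  proof (rule ccontr)
    assume "c \<noteq> d"
    then have "c \<ominus>\<^bsub>K\<^esub> d \<noteq> \<zero>\<^bsub>K\<^esub>" using c by (simp add: K.minus_zero_iff)
    then have u: "c \<ominus>\<^bsub>K\<^esub> d \<in> Units K" using c by (simp add: K.field_Units)
    have "(x \<ominus>\<^bsub>V\<^esub> d \<odot>\<^bsub>V\<^esub> z) \<ominus>\<^bsub>V\<^esub> (x \<ominus>\<^bsub>V\<^esub> c \<odot>\<^bsub>V\<^esub> z) = (c \<ominus>\<^bsub>K\<^esub> d) \<odot>\<^bsub>V\<^esub> z"
      using c assms(4) by (simp add: smult_l_distr smult_l_minus a_minus_def M.minus_add M.a_ac M.r_neg1 M.r_neg2)
    then have cz: "(c \<ominus>\<^bsub>K\<^esub> d) \<odot>\<^bsub>V\<^esub> z \<in> U" using submodule_diff[OF U(1) c(5,4)] by simp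
    have "inv\<^bsub>K\<^esub> (c \<ominus>\<^bsub>K\<^esub> d) \<odot>\<^bsub>V\<^esub> ((c \<ominus>\<^bsub>K\<^esub> d) \<odot>\<^bsub>V\<^esub> z) \<in> U"
      by (rule submodule_smult[OF U(1) K.Units_inv_closed[OF u] cz])
    moreover have "inv\<^bsub>K\<^esub> (c \<ominus>\<^bsub>K\<^esub> d) \<odot>\<^bsub>V\<^esub> ((c \<ominus>\<^bsub>K\<^esub> d) \<odot>\<^bsub>V\<^esub> z) = z"
      using u assms(4) K.Units_closed[OF u] smult_assoc1[of "inv\<^bsub>K\<^esub> (c \<ominus>\<^bsub>K\<^esub> d)" "c \<ominus>\<^bsub>K\<^esub> d" z] by simp
    ultimately show False using U(3) by simp
  qed
  define f where "f = (\<lambda>x\<in>carrier V. SOME c. c \<in> carrier K \<and> x \<ominus>\<^bsub>V\<^esub> c \<odot>\<^bsub>V\<^esub> z \<in> U)"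
  have f: "f x \<in> carrier K" "x \<ominus>\<^bsub>V\<^esub> f x \<odot>\<^bsub>V\<^esub> z \<in> U" if "x \<in> carrier V" for x
    using someI_ex[OF ex[OF that, unfolded Bex_def]] that by (auto simp: f_def)
  have fI: "f x = c" if "x \<in> carrier V" "c \<in> carrier K" "x \<ominus>\<^bsub>V\<^esub> c \<odot>\<^bsub>V\<^esub> z \<in> U" for x c
    using uniq[OF f(1)[OF that(1)] that(2,1) f(2)[OF that(1)] that(3)] .
  have "f \<in> mod_hom K V (regular_module K)"
  proof (rule mod_homI, simp_all)
    show "x \<notin> carrier V \<Longrightarrow> f x = undefined" for x by (simp add: f_def)
    show "x \<in> carrier V \<Longrightarrow> f x \<in> carrier K" for x by (rule f)
  next
    fix x y assume xy: "x \<in> carrier V" "y \<in> carrier V"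
    have "(x \<oplus>\<^bsub>V\<^esub> y) \<ominus>\<^bsub>V\<^esub> (f x \<oplus>\<^bsub>K\<^esub> f y) \<odot>\<^bsub>V\<^esub> z = (x \<ominus>\<^bsub>V\<^esub> f x \<odot>\<^bsub>V\<^esub> z) \<oplus>\<^bsub>V\<^esub> (y \<ominus>\<^bsub>V\<^esub> f y \<odot>\<^bsub>V\<^esub> z)"
      using xy f assms(4) by (simp add: smult_l_distr a_minus_def M.minus_add M.a_ac)
    then show "f (x \<oplus>\<^bsub>V\<^esub> y) = f x \<oplus>\<^bsub>K\<^esub> f y"
      using xy f submodule_add[OF U(1) f(2)[OF xy(1)] f(2)[OF xy(2)]] by (intro fI) auto
  next
    fix a x assume x: "a \<in> carrier K" "x \<in> carrier V"
    have "a \<odot>\<^bsub>V\<^esub> x \<ominus>\<^bsub>V\<^esub> (a \<otimes>\<^bsub>K\<^esub> f x) \<odot>\<^bsub>V\<^esub> z = a \<odot>\<^bsub>V\<^esub> (x \<ominus>\<^bsub>V\<^esub> f x \<odot>\<^bsub>V\<^esub> z)"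
      using x f assms(4) by (simp add: smult_r_diff smult_assoc1)
    then show "f (a \<odot>\<^bsub>V\<^esub> x) = a \<otimes>\<^bsub>K\<^esub> f x"
      using x f submodule_smult[OF U(1) x(1) f(2)[OF x(2)]] by (intro fI) auto
  qed
  moreover have "f w = \<zero>\<^bsub>K\<^esub>" if "w \<in> W" for w
    using that U(2) UV assms(4) by (intro fI) (auto simp: a_minus_def M.minus_equality[of "\<zero>\<^bsub>V\<^esub>" "\<zero>\<^bsub>V\<^esub>"] subset_iff)
  moreover have "f z = \<one>\<^bsub>K\<^esub>"
    using assms(4) submodule_zero[OF U(1)] by (intro fI) (auto simp: M.minus_zero_iff M.r_neg a_minus_def)
  ultimately show ?thesis using K.one_not_zero by (intro bexI[of _ f]) auto
qed

section \<open>Presentations by matrices\<close>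

text \<open>A presentation \<open>P\<^sub>1 \<rightarrow> P\<^sub>0 \<rightarrow> M \<rightarrow> 0\<close> by finitely generated projective modules
  \<open>P\<^sub>1 = A\<^sup>a e\<close> and \<open>P\<^sub>0 = A\<^sup>b d\<close> (row vectors), with \<open>e\<close> and \<open>d\<close> idempotent, the first map given by the
  matrix \<open>F = e F d\<close>, and \<open>y\<close> the images in \<open>M\<close> of the rows of \<open>d\<close>.\<close>

definition pres :: "('a, 'c) ring_scheme \<Rightarrow> ('a, 'm) module \<Rightarrow> nat \<Rightarrow> nat \<Rightarrow> (nat \<Rightarrow> nat \<Rightarrow> 'a) \<Rightarrow>
    (nat \<Rightarrow> nat \<Rightarrow> 'a) \<Rightarrow> (nat \<Rightarrow> nat \<Rightarrow> 'a) \<Rightarrow> (nat \<Rightarrow> 'm) \<Rightarrow> bool" where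
  "pres A M a b e d F y \<longleftrightarrow>
     e \<in> Mat A \<and> d \<in> Mat A \<and> F \<in> Mat A \<and> y \<in> Vec M \<and>
     mmul A a e e = e \<and> mmul A a e F = F \<and> mmul A b F d = F \<and>
     mvec M b d y = y \<and> mvec M b F y = (\<lambda>_. \<zero>\<^bsub>M\<^esub>) \<and>
     (\<forall>x\<in>Vec M. \<exists>V\<in>Mat A. x = mvec M b V y) \<and>
     (\<forall>V\<in>Mat A. mvec M b V y = (\<lambda>_. \<zero>\<^bsub>M\<^esub>) \<longrightarrow> (\<exists>U\<in>Mat A. mmul A b V d = mmul A a U F))"

text \<open>Homomorphisms \<open>P\<^sub>1 \<rightarrow> M\<close> are the column vectors \<open>z\<close> with \<open>e z = z\<close>; each of them factors through
  \<open>P\<^sub>1 \<rightarrow> P\<^sub>0\<close>.\<close>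

definition factors :: "('a, 'm) module \<Rightarrow> nat \<Rightarrow> nat \<Rightarrow> (nat \<Rightarrow> nat \<Rightarrow> 'a) \<Rightarrow> (nat \<Rightarrow> nat \<Rightarrow> 'a) \<Rightarrow> bool" where
  "factors M a b e F \<longleftrightarrow> (\<forall>z\<in>Vec M. mvec M a e z = z \<longrightarrow> (\<exists>w\<in>Vec M. mvec M b F w = z))"

text \<open>Minimality of the presentation is left out on purpose: this is what lets the property
  pass along ring homomorphisms by applying them to the matrices. \<open>tau_rigid_iff\<close> shows
  that nothing is lost.\<close>

definition rigid :: "('a, 'c) ring_scheme \<Rightarrow> ('a, 'm) module \<Rightarrow> bool" where
  "rigid A M \<longleftrightarrow> (\<exists>a b e d F y. pres A M a b e d F y \<and> factors M a b e F)"

text \<open>The kernel of \<open>P\<^sub>1 \<rightarrow> P\<^sub>0\<close> is superfluous: endomorphisms of \<open>P\<^sub>1\<close> over \<open>P\<^sub>0\<close> are split surjective.\<close>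

definition right_minimal :: "('a, 'c) ring_scheme \<Rightarrow> nat \<Rightarrow> (nat \<Rightarrow> nat \<Rightarrow> 'a) \<Rightarrow> (nat \<Rightarrow> nat \<Rightarrow> 'a) \<Rightarrow> bool" where
  "right_minimal A a e F \<longleftrightarrow> (\<forall>G\<in>Mat A. mmul A a e G = G \<longrightarrow> mmul A a G e = G \<longrightarrow> mmul A a G F = F \<longrightarrow>
     (\<exists>S\<in>Mat A. mmul A a e S = S \<and> mmul A a S e = S \<and> mmul A a S G = e))"

text \<open>Right minimality gives a left inverse S of G. As S is again an endomorphism over P0, it
  has a left inverse T as well, and T = T S G = G; hence S is also a right inverse.\<close>

lemma right_minimal_inverse:
  assumes "ring A" "e \<in> Mat A" "F \<in> Mat A" "mmul A a e e = e" "mmul A a e F = F" "right_minimal A a e F"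
    and G: "G \<in> Mat A" "mmul A a e G = G" "mmul A a G e = G" "mmul A a G F = F"
  obtains S where "S \<in> Mat A" "mmul A a e S = S" "mmul A a S e = S" "mmul A a G S = e"
proof -
  interpret ring A by fact
  obtain S where S: "S \<in> Mat A" "mmul A a e S = S" "mmul A a S e = S" "mmul A a S G = e"
    using assms(6) G unfolding right_minimal_def by blast
  have "mmul A a S F = mmul A a S (mmul A a G F)" by (simp add: G)
  also have "\<dots> = mmul A a (mmul A a S G) F" using S(1) G(1) assms(3) by (simp add: mmul_assoc)
  also have "\<dots> = F" by (simp add: S assms(5))
  finally obtain T where T: "T \<in> Mat A" "mmul A a T e = T" "mmul A a T S = e"
    using assms(6) S unfolding right_minimal_def by blast
  have "T = mmul A a T (mmul A a S G)" by (simp add: S T)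
  also have "\<dots> = mmul A a (mmul A a T S) G" using S(1) T(1) G(1) by (simp add: mmul_assoc)
  also have "\<dots> = G" by (simp add: T(3) G)
  finally show thesis using that S(1-3) T(3) by simp
qed

lemma (in ring) msub_msub_cancel:
  "B \<in> Mat R \<Longrightarrow> C \<in> Mat R \<Longrightarrow> msub R B (msub R B C) = C"
proof -
  have "x \<ominus> (x \<ominus> c) = c" if "x \<in> carrier R" "c \<in> carrier R" for x c
    using that add_minus_cancel[of x c] by (simp add: a_minus_def minus_add a_ac)
  then show "B \<in> Mat R \<Longrightarrow> C \<in> Mat R \<Longrightarrow> msub R B (msub R B C) = C"
    by (simp add: msub_def vsub_def MatDD)
qed

text \<open>Comparison of presentations. Lifts of the identity of M in both directions compose,
  after correction by a homotopy, to an endomorphism G of P1' over P0', which right minimality makes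
  invertible. So a map P1' -> M is G followed by some x, and this splits into a part that passes
  through P1, where the factorization is known, and a part that already passes through F'.\<close>

lemma factors_transfer:
  assumes "left_module A M"
    and D: "pres A M a b e d F y" "factors M a b e F"
    and D': "pres A M a' b' e' d' F' y'" "right_minimal A a' e' F'"
  shows "factors M a' b' e' F'"
proof -
  interpret left_module A M by fact
  note [simp] = R.mmul_Mat R.mmul_assoc mvec_Vec
  from D(1) have M[simp]: "e \<in> Mat A" "d \<in> Mat A" "F \<in> Mat A" "y \<in> Vec M"
    and p: "mmul A a e F = F" "mmul A b F d = F" "mvec M b d y = y" "mvec M b F y = (\<lambda>_. \<zero>\<^bsub>M\<^esub>)"
    and span: "\<And>x. x \<in> Vec M \<Longrightarrow> \<exists>V\<in>Mat A. x = mvec M b V y"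
    and ker: "\<And>V. V \<in> Mat A \<Longrightarrow> mvec M b V y = (\<lambda>_. \<zero>\<^bsub>M\<^esub>) \<Longrightarrow> \<exists>U\<in>Mat A. mmul A b V d = mmul A a U F"
    unfolding pres_def by blast+
  from D'(1) have M'[simp]: "e' \<in> Mat A" "d' \<in> Mat A" "F' \<in> Mat A" "y' \<in> Vec M"
    and p': "mmul A a' e' e' = e'" "mmul A a' e' F' = F'" "mmul A b' F' d' = F'" "mvec M b' d' y' = y'"
      "mvec M b' F' y' = (\<lambda>_. \<zero>\<^bsub>M\<^esub>)"
    and span': "\<And>x. x \<in> Vec M \<Longrightarrow> \<exists>V\<in>Mat A. x = mvec M b' V y'"
    and ker': "\<And>V. V \<in> Mat A \<Longrightarrow> mvec M b' V y' = (\<lambda>_. \<zero>\<^bsub>M\<^esub>) \<Longrightarrow> \<exists>U\<in>Mat A. mmul A b' V d' = mmul A a' U F'"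
    unfolding pres_def by blast+
  \<comment> \<open>\<open>V\<close> and \<open>U\<close> lift the identity of M to maps P0' -> P0
    and P0 -> P0'; exactness then lifts them to \<open>V1\<close> : P1' -> P1 and \<open>U1\<close>
    : P1 -> P1'.\<close>
  obtain V where V[simp]: "V \<in> Mat A" and yV: "y' = mvec M b V y" using span[of y'] by auto
  obtain U where U[simp]: "U \<in> Mat A" and yU: "y = mvec M b' U y'" using span'[of y] by auto
  have "mvec M b (mmul A b' F' V) y = (\<lambda>_. \<zero>\<^bsub>M\<^esub>)"
    using p'(5) by (simp add: mvec_mmul flip: yV)
  with ker[of "mmul A b' F' V"] obtain V1 where V1[simp]: "V1 \<in> Mat A"
    and eqV1: "mmul A b' F' (mmul A b V d) = mmul A a V1 F" by auto
  have "mvec M b' (mmul A b F U) y' = (\<lambda>_. \<zero>\<^bsub>M\<^esub>)"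
    using p(4) by (simp add: mvec_mmul flip: yU)
  with ker'[of "mmul A b F U"] obtain U1 where U1[simp]: "U1 \<in> Mat A"
    and eqU1: "mmul A b F (mmul A b' U d') = mmul A a' U1 F'" by auto
  \<comment> \<open>The factor \<open>e\<close> makes \<open>U2\<close> a map defined on P1, so that
    every vector \<open>U2 x\<close> is fixed by \<open>e\<close> and \<open>factors\<close> applies
    to it.\<close>
  define U2 where "U2 = mmul A a e U1"
  have U2[simp]: "U2 \<in> Mat A" by (simp add: U2_def)
  have "mmul A a' U2 F' = mmul A a e (mmul A b F (mmul A b' U d'))" by (simp add: U2_def eqU1)
  also have "\<dots> = mmul A b (mmul A a e F) (mmul A b' U d')" by simp
  finally have eqU2: "mmul A a' U2 F' = mmul A b F (mmul A b' U d')" by (simp add: p)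
  have eU2: "mmul A a e U2 = U2"
    using D(1) by (simp add: U2_def pres_def flip: R.mmul_assoc)
  \<comment> \<open>The composite P0' -> P0 -> P0', again a lift of the identity of M. Its
    difference from \<open>d'\<close> lands in the image of F', which gives the homotopy
    \<open>T\<close>.\<close>
  define W where "W = mmul A b V (mmul A b d U)"
  have W[simp]: "W \<in> Mat A" by (simp add: W_def)
  have "mvec M b' W y' = y'"
    by (simp add: W_def mvec_mmul flip: yU) (simp add: p flip: yV)
  then have "mvec M b' (msub A W d') y' = (\<lambda>_. \<zero>\<^bsub>M\<^esub>)"
    by (simp add: mvec_msub p' M.vsub_zero_iff)
  with ker'[of "msub A W d'"] obtain T where T[simp]: "T \<in> Mat A"
    and eqT: "mmul A b' (msub A W d') d' = mmul A a' T F'" by auto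
  let ?Z = "mmul A a V1 (mmul A a' U2 F')"
  have "mmul A b' F' (mmul A b' W d') = mmul A b (mmul A b' F' (mmul A b V d)) (mmul A b' U d')"
    by (simp add: W_def)
  also have "\<dots> = ?Z" by (subst eqV1) (simp add: eqU2)
  finally have FWd: "mmul A b' F' (mmul A b' W d') = ?Z" .
  have "mmul A b' F' (mmul A a' T F') = mmul A b' F' (msub A (mmul A b' W d') (mmul A b' d' d'))"
    using eqT by (simp add: R.mmul_msub_l)
  also have "\<dots> = msub A ?Z F'"
    by (simp add: R.mmul_msub_r FWd p'(3) del: R.mmul_assoc flip: R.mmul_assoc)
  finally have FTF: "mmul A b' F' (mmul A a' T F') = msub A ?Z F'" .
  \<comment> \<open>With Z = V1 U2 F' one has F' T F' = Z - F', so subtracting the homotopy term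
    leaves exactly G0 F' = F'.\<close>
  define G0 where "G0 = msub A (mmul A a V1 U2) (mmul A b' F' T)"
  have G0[simp]: "G0 \<in> Mat A" by (simp add: G0_def)
  have G0F: "mmul A a' G0 F' = F'"
    by (simp add: G0_def R.mmul_msub_l FTF R.msub_msub_cancel)
  \<comment> \<open>Both sides are cut down by \<open>e'\<close>, since right minimality speaks of
    endomorphisms of P1' and not of the free module around it.\<close>
  define G where "G = mmul A a' e' (mmul A a' G0 e')"
  have e'e': "mmul A a' e' (mmul A a' e' B) = mmul A a' e' B" if "B \<in> Mat A" for B
    using that p'(1) by (simp flip: R.mmul_assoc)
  have G[simp]: "G \<in> Mat A" "mmul A a' e' G = G" "mmul A a' G e' = G" "mmul A a' G F' = F'"
    by (simp_all add: G_def p' e'e' G0F)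
  obtain S where S: "S \<in> Mat A" "mmul A a' e' S = S" "mmul A a' G S = e'"
    by (rule right_minimal_inverse[OF R.ring_axioms _ _ p'(1,2) D'(2) G]) auto
  show ?thesis
    unfolding factors_def
  proof (intro ballI impI)
    fix z assume z[simp]: "z \<in> Vec M" and ez: "mvec M a' e' z = z"
    define x where "x = mvec M a' S z"
    have x[simp]: "x \<in> Vec M" using S by (simp add: x_def)
    have ex: "mvec M a' e' x = x" using S by (simp add: x_def flip: mvec_mmul)
    have Gx: "mvec M a' G x = z" using S ez by (simp add: x_def flip: mvec_mmul)
    have "mvec M a e (mvec M a' U2 x) = mvec M a' U2 x" by (simp add: eU2 flip: mvec_mmul)
    then obtain w where w[simp]: "w \<in> Vec M" and Fw: "mvec M b F w = mvec M a' U2 x"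
      using D(2) unfolding factors_def by (metis U2 mvec_Vec x)
    \<comment> \<open>Both terms of \<open>G0\<close> end in the image of F': the first because V1 F
      = F' V d, the second by its shape.\<close>
    have "mvec M a' G0 x = vsub M (mvec M a V1 (mvec M b F w)) (mvec M b' F' (mvec M a' T x))"
      by (simp add: G0_def mvec_msub mvec_mmul Fw)
    also have "mvec M a V1 (mvec M b F w) = mvec M b (mmul A b' F' (mmul A b V d)) w"
      by (simp only: eqV1 mvec_mmul[OF V1 M(3) w])
    also have "\<dots> = mvec M b' F' (mvec M b (mmul A b V d) w)" by (simp add: mvec_mmul)
    also have "vsub M \<dots> (mvec M b' F' (mvec M a' T x)) =
        mvec M b' F' (vsub M (mvec M b (mmul A b V d) w) (mvec M a' T x))"
      by (simp add: mvec_vsub)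
    finally have G0x: "mvec M a' G0 x = mvec M b' F' (vsub M (mvec M b (mmul A b V d) w) (mvec M a' T x))" .
    have "z = mvec M a' e' (mvec M a' G0 x)"
      using Gx by (simp add: G_def mvec_mmul ex)
    also have "\<dots> = mvec M b' (mmul A a' e' F') (vsub M (mvec M b (mmul A b V d) w) (mvec M a' T x))"
      unfolding G0x by (simp add: mvec_mmul)
    finally show "\<exists>w\<in>Vec M. mvec M b' F' w = z"
      by (intro bexI[of _ "vsub M (mvec M b (mmul A b V d) w) (mvec M a' T x)"]) (simp_all add: p')
  qed
qed

section \<open>Free modules and dual bases\<close>

lemma free_module_simps [simp]:
  "carrier (free_module A n) = {..<n} \<rightarrow>\<^sub>E carrier A"
  "\<zero>\<^bsub>free_module A n\<^esub> = (\<lambda>i\<in>{..<n}. \<zero>\<^bsub>A\<^esub>)"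
  "x \<oplus>\<^bsub>free_module A n\<^esub> y = (\<lambda>i\<in>{..<n}. x i \<oplus>\<^bsub>A\<^esub> y i)"
  "a \<odot>\<^bsub>free_module A n\<^esub> x = (\<lambda>i\<in>{..<n}. a \<otimes>\<^bsub>A\<^esub> x i)"
  by (simp_all add: free_module_def)

lemma (in ring) left_module_free: "left_module R (free_module R n)"
proof -
  have "abelian_group (free_module R n)"
  proof (rule abelian_groupI)
    fix x assume "x \<in> carrier (free_module R n)"
    then show "\<exists>y\<in>carrier (free_module R n). y \<oplus>\<^bsub>free_module R n\<^esub> x = \<zero>\<^bsub>free_module R n\<^esub>"
      by (intro bexI[of _ "\<lambda>i\<in>{..<n}. \<ominus> x i"]) (auto simp: PiE_iff l_neg fun_eq_iff)
  qed (auto simp: PiE_iff a_ac fun_eq_iff extensional_def)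
  then show ?thesis
    by (intro left_module.intro left_module_axioms.intro ring_axioms)
      (auto simp: PiE_iff fun_eq_iff extensional_def l_distr r_distr m_assoc)
qed

definition free_basis :: "('a, 'c) ring_scheme \<Rightarrow> nat \<Rightarrow> nat \<Rightarrow> nat \<Rightarrow> 'a" where
  "free_basis A n i = (\<lambda>j\<in>{..<n}. if j = i then \<one>\<^bsub>A\<^esub> else \<zero>\<^bsub>A\<^esub>)"

text \<open>Elements of \<open>free_module A n\<close> are \<open>undefined\<close> from
  \<open>n\<close> on; this turns them into total coefficient vectors.\<close>

definition pad :: "('a, 'c) ring_scheme \<Rightarrow> nat \<Rightarrow> (nat \<Rightarrow> 'a) \<Rightarrow> nat \<Rightarrow> 'a" where
  "pad A n v = (\<lambda>i. if i < n then v i else \<zero>\<^bsub>A\<^esub>)"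

context ring
begin

lemma free_basis_Vec: "free_basis R n \<in> Vec (free_module R n)"
  by (rule VecI) (simp add: free_basis_def PiE_iff extensional_def)

lemma pad_Vec: "v \<in> carrier (free_module R n) \<Longrightarrow> pad R n v \<in> Vec R"
  by (rule VecI) (auto simp: pad_def)

lemma ssum_free: "ssum (free_module R n) m f = (\<lambda>j\<in>{..<n}. ssum R m (\<lambda>k. f k j))"
  by (induction m) (auto simp: fun_eq_iff)

lemma free_expand:
  assumes "v \<in> carrier (free_module R n)"
  shows "v = lcomb (free_module R n) n (pad R n v) (free_basis R n)"
proof -
  have "ssum R n (\<lambda>k. v k \<otimes> (if j = k then \<one> else \<zero>)) = v j" if "j < n" for j
  proof -
    have "ssum R n (\<lambda>k. v k \<otimes> (if j = k then \<one> else \<zero>)) = ssum R n (\<lambda>k. if k = j then v j else \<zero>)"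
      using assms by (intro ssum_cong) (auto simp: PiE_iff)
    then show ?thesis using assms that by (auto simp: ssum_single PiE_iff)
  qed
  then show ?thesis
    using assms unfolding lcomb_def ssum_free
    by (auto simp: fun_eq_iff pad_def free_basis_def extensional_def PiE_iff cong: ssum_cong)
qed

end

text \<open>The pair of \<open>xs\<close> and \<open>c\<close> is a dual basis of \<open>P\<close>; \<open>c\<close> takes an element to its coordinates.\<close>

definition dual_basis :: "('a, 'c) ring_scheme \<Rightarrow> ('a, 'm) module \<Rightarrow> nat \<Rightarrow> (nat \<Rightarrow> 'm) \<Rightarrow>
    ('m \<Rightarrow> nat \<Rightarrow> 'a) \<Rightarrow> bool" where
  "dual_basis A P n xs c \<longleftrightarrow> xs \<in> Vec P \<and>
     (\<forall>x\<in>carrier P. c x \<in> Vec A \<and> x = lcomb P n (c x) xs) \<and>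
     (\<forall>x\<in>carrier P. \<forall>x'\<in>carrier P. \<forall>j. c (x \<oplus>\<^bsub>P\<^esub> x') j = c x j \<oplus>\<^bsub>A\<^esub> c x' j) \<and>
     (\<forall>a\<in>carrier A. \<forall>x\<in>carrier P. \<forall>j. c (a \<odot>\<^bsub>P\<^esub> x) j = a \<otimes>\<^bsub>A\<^esub> c x j)"

text \<open>The splitting of A^n -> P supplies both halves: the images of the standard basis
  vectors, and the coordinates of the embedded element.\<close>

lemma fg_projective_dual_basis:
  assumes "fg_projective A P"
  obtains n xs c where "dual_basis A P n xs c"
proof -
  obtain n i p where P: "left_module A P" and i: "i \<in> mod_hom A P (free_module A n)"
    and p: "p \<in> mod_hom A (free_module A n) P" and pi: "\<And>x. x \<in> carrier P \<Longrightarrow> p (i x) = x"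
    using assms unfolding fg_projective_def by blast
  interpret P: left_module A P by fact
  interpret p: mod_hom_loc A "free_module A n" P p
    by (rule mod_hom_locI[OF P.R.left_module_free P p])
  have ic: "i x \<in> carrier (free_module A n)" if "x \<in> carrier P" for x
    by (rule mod_hom_closed[OF i that])
  have "x = lcomb P n (pad A n (i x)) (\<lambda>j. p (free_basis A n j))" if "x \<in> carrier P" for x
  proof -
    have "x = p (i x)" by (simp add: pi that)
    also have "i x = lcomb (free_module A n) n (pad A n (i x)) (free_basis A n)"
      by (rule P.R.free_expand[OF ic[OF that]])
    also have "p \<dots> = lcomb P n (pad A n (i x)) (\<lambda>j. p (free_basis A n j))"
      by (rule p.lcomb[OF P.R.pad_Vec[OF ic[OF that]] P.R.free_basis_Vec])
    finally show ?thesis .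
  qed
  then have "dual_basis A P n (\<lambda>j. p (free_basis A n j)) (\<lambda>x. pad A n (i x))"
    using P.R.pad_Vec[OF ic] p.Vec[OF P.R.free_basis_Vec] mod_hom_add[OF i] mod_hom_smult[OF i]
    by (auto simp: dual_basis_def pad_def)
  then show thesis by (rule that)
qed

lemma dual_basis_coord_lcomb:
  assumes "left_module A P" "dual_basis A P n xs c" "u \<in> Vec A" "z \<in> Vec P"
  shows "c (lcomb P m u z) = (\<lambda>j. ssum A m (\<lambda>k. u k \<otimes>\<^bsub>A\<^esub> c (z k) j))"
proof
  interpret P: left_module A P by fact
  fix j
  have c: "x \<in> carrier P \<Longrightarrow> c x \<in> Vec A" for x using assms(2) by (simp add: dual_basis_def)
  have add: "x \<in> carrier P \<Longrightarrow> x' \<in> carrier P \<Longrightarrow> c (x \<oplus>\<^bsub>P\<^esub> x') j = c x j \<oplus>\<^bsub>A\<^esub> c x' j" for x x'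
    using assms(2) by (simp add: dual_basis_def)
  have zero: "c \<zero>\<^bsub>P\<^esub> j = \<zero>\<^bsub>A\<^esub>"
    by (rule additive_zero[OF P.M.abelian_group_axioms P.R.is_abelian_group, of "\<lambda>x. c x j"])
      (simp_all add: c VecD add)
  have "c (ssum P m (\<lambda>k. u k \<odot>\<^bsub>P\<^esub> z k)) j = ssum A m (\<lambda>k. c (u k \<odot>\<^bsub>P\<^esub> z k) j)"
    by (rule ssum_hom[OF P.M.abelian_group_axioms P.R.is_abelian_group, of "\<lambda>x. c x j"])
      (use assms(3,4) in \<open>simp_all add: add zero VecD\<close>)
  also have "\<dots> = ssum A m (\<lambda>k. u k \<otimes>\<^bsub>A\<^esub> c (z k) j)"
    using assms(2-4) by (intro ssum_cong) (simp add: dual_basis_def VecD)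
  finally show "c (lcomb P m u z) j = ssum A m (\<lambda>k. u k \<otimes>\<^bsub>A\<^esub> c (z k) j)"
    by (simp add: lcomb_def)
qed

section \<open>Matrices of a projective presentation\<close>

locale presentation = P1: left_module A P1 + P0: left_module A P0 + M: left_module A M
  for A :: "('a, 'c) ring_scheme" and P1 :: "('a, 'p) module" and P0 :: "('a, 'q) module"
    and M :: "('a, 'm) module" +
  fixes f1 f0 a b xs1 c1 xs0 c0
  assumes f1: "f1 \<in> mod_hom A P1 P0" and f0: "f0 \<in> mod_hom A P0 M"
    and surj: "f0 ` carrier P0 = carrier M" and exact: "f1 ` carrier P1 = mod_ker P0 M f0"
    and b1: "dual_basis A P1 a xs1 c1" and b0: "dual_basis A P0 b xs0 c0"
begin

sublocale f1: mod_hom_loc A P1 P0 f1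
  by (rule mod_hom_locI[OF P1.left_module P0.left_module f1])

sublocale f0: mod_hom_loc A P0 M f0
  by (rule mod_hom_locI[OF P0.left_module M.left_module f0])

text \<open>\<open>e\<close> and \<open>d\<close> are the idempotent matrices of the composites A^a
  -> P1 -> A^a and A^b -> P0 -> A^b; \<open>F\<close> is the matrix of \<open>f1\<close> in these
  coordinates.\<close>

definition "e i = c1 (xs1 i)"
definition "d i = c0 (xs0 i)"
definition "F i = c0 (f1 (xs1 i))"
definition "y i = f0 (xs0 i)"

lemma xs1: "xs1 \<in> Vec P1" and xs0: "xs0 \<in> Vec P0"
  using b1 b0 by (simp_all add: dual_basis_def)

lemma c1: "x \<in> carrier P1 \<Longrightarrow> c1 x \<in> Vec A" and c0: "x' \<in> carrier P0 \<Longrightarrow> c0 x' \<in> Vec A"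
  using b1 b0 by (simp_all add: dual_basis_def)

lemma expand1: "x \<in> carrier P1 \<Longrightarrow> lcomb P1 a (c1 x) xs1 = x"
  and expand0: "x' \<in> carrier P0 \<Longrightarrow> lcomb P0 b (c0 x') xs0 = x'"
  using b1 b0 by (simp_all add: dual_basis_def)

lemmas coord1 = dual_basis_coord_lcomb[OF P1.left_module b1]
lemmas coord0 = dual_basis_coord_lcomb[OF P0.left_module b0]

lemma e_Mat: "e \<in> Mat A" and d_Mat: "d \<in> Mat A" and F_Mat: "F \<in> Mat A" and y_Vec: "y \<in> Vec M"
  using xs1 xs0 by (auto simp: e_def[abs_def] d_def[abs_def] F_def[abs_def] y_def[abs_def] Mat_def c1 c0 VecD f1.closed
      intro!: f0.Vec)

lemma coord_f1:
  assumes "x \<in> carrier P1" shows "c0 (f1 x) j = ssum A a (\<lambda>k. c1 x k \<otimes>\<^bsub>A\<^esub> F k j)"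
proof -
  have "f1 x = lcomb P0 a (c1 x) (\<lambda>k. f1 (xs1 k))"
    using f1.lcomb[OF c1[OF assms] xs1, of a] by (simp add: expand1 assms)
  then show ?thesis
    using coord0[OF c1[OF assms] f1.Vec[OF xs1], of a] by (simp add: F_def)
qed

text \<open>The matrix identities all arise by expanding an element in the dual basis and then
  applying a coordinate map or \<open>f0\<close>. The last two conditions are surjectivity of
  \<open>f0\<close> and exactness at P0, row by row.\<close>

lemma pres: "pres A M a b e d F y"
  unfolding pres_def
proof (intro conjI ballI impI e_Mat d_Mat F_Mat y_Vec)
  show "mmul A a e e = e"
  proof (intro ext)
    fix i j
    have x: "xs1 i \<in> carrier P1" by (rule VecD[OF xs1])
    show "mmul A a e e i j = e i j"
      unfolding mmul_def e_def
      by (rule fun_cong[OF coord1[OF c1[OF x] xs1, of a, unfolded expand1[OF x]], symmetric])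
  qed
  show "mmul A a e F = F"
  proof (intro ext)
    fix i j
    show "mmul A a e F i j = F i j"
      using coord_f1[OF VecD[OF xs1], of i j] by (simp add: mmul_def e_def F_def)
  qed
  show "mmul A b F d = F"
  proof (intro ext)
    fix i j
    have x: "f1 (xs1 i) \<in> carrier P0" by (rule f1.closed[OF VecD[OF xs1]])
    show "mmul A b F d i j = F i j"
      unfolding mmul_def F_def d_def
      by (rule fun_cong[OF coord0[OF c0[OF x] xs0, of b, unfolded expand0[OF x]], symmetric])
  qed
  show "mvec M b d y = y"
  proof
    fix i
    have x: "xs0 i \<in> carrier P0" by (rule VecD[OF xs0])
    show "mvec M b d y i = y i"
      using f0.lcomb[OF c0[OF x] xs0, of b] by (simp add: mvec_def d_def y_def[abs_def] expand0[OF x])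
  qed
  have f01: "f0 (f1 x) = \<zero>\<^bsub>M\<^esub>" if "x \<in> carrier P1" for x
    using exact that by (auto simp: mod_ker_def)
  show "mvec M b F y = (\<lambda>_. \<zero>\<^bsub>M\<^esub>)"
  proof
    fix i
    have x: "xs1 i \<in> carrier P1" by (rule VecD[OF xs1])
    show "mvec M b F y i = \<zero>\<^bsub>M\<^esub>"
      using f0.lcomb[OF c0[OF f1.closed[OF x]] xs0, of b] f01[OF x]
      by (simp add: mvec_def F_def y_def[abs_def] expand0[OF f1.closed[OF x]])
  qed
next
  fix x assume x: "x \<in> Vec M"
  have "\<exists>v\<in>Vec A. x i = lcomb M b v y" for i
  proof -
    obtain p where p: "p \<in> carrier P0" "x i = f0 p" using surj VecD[OF x, of i] by (metis imageE)
    then show ?thesis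
      using f0.lcomb[OF c0[OF p(1)] xs0, of b] by (intro bexI[of _ "c0 p"]) (simp_all add: expand0 c0 y_def[abs_def])
  qed
  then obtain V where "\<And>i. V i \<in> Vec A" "\<And>i. x i = lcomb M b (V i) y" by metis
  then show "\<exists>V\<in>Mat A. x = mvec M b V y"
    by (intro bexI[of _ V]) (auto simp: mvec_def Mat_def)
next
  fix V assume V: "V \<in> Mat A" "mvec M b V y = (\<lambda>_. \<zero>\<^bsub>M\<^esub>)"
  \<comment> \<open>Row \<open>i\<close> of \<open>V\<close> names an element of P0 in the kernel of
    \<open>f0\<close>; exactness lifts it to P1, and the coordinates of the lift form the row of
    \<open>U\<close>.\<close>
  have "\<exists>x\<in>carrier P1. f1 x = lcomb P0 b (V i) xs0" for i
  proof -
    have "f0 (lcomb P0 b (V i) xs0) = \<zero>\<^bsub>M\<^esub>"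
      using f0.lcomb[OF MatD[OF V(1)] xs0, of b i] V(2) by (simp add: y_def[abs_def] mvec_def fun_eq_iff)
    then have "lcomb P0 b (V i) xs0 \<in> f1 ` carrier P1"
      unfolding exact mod_ker_def using MatD[OF V(1)] xs0 by simp
    then show ?thesis by force
  qed
  then obtain x where x: "\<And>i. x i \<in> carrier P1" "\<And>i. f1 (x i) = lcomb P0 b (V i) xs0" by metis
  have "mmul A b V d = mmul A a (\<lambda>i. c1 (x i)) F"
  proof (intro ext)
    fix i j
    have "mmul A b V d i j = c0 (f1 (x i)) j"
      using coord0[OF MatD[OF V(1)] xs0, of b i] by (simp add: x mmul_def d_def)
    then show "mmul A b V d i j = mmul A a (\<lambda>i. c1 (x i)) F i j"
      by (simp add: coord_f1[OF x(1)] mmul_def)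
  qed
  then show "\<exists>U\<in>Mat A. mmul A b V d = mmul A a U F"
    using x by (intro bexI[of _ "\<lambda>i. c1 (x i)"]) (simp_all add: Mat_def c1)
qed

text \<open>An endomorphism of P1 over P0 moves elements only by elements of the kernel of
  \<open>f1\<close>, so its image together with this kernel is all of P1. Superfluity then makes it
  surjective, and preimages of the dual basis give the left inverse.\<close>

lemma right_minimal:
  assumes "superfluous A P1 (mod_ker P1 P0 f1)"
  shows "right_minimal A a e F"
  unfolding right_minimal_def
proof (intro ballI impI)
  fix G assume G: "G \<in> Mat A" "mmul A a e G = G" "mmul A a G e = G" "mmul A a G F = F"
  \<comment> \<open>The image of \<open>xs1 i\<close> under the endomorphism with matrix
    \<open>G\<close>.\<close>
  define g where "g i = lcomb P1 a (G i) xs1" for i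
  have g: "g \<in> Vec P1" using G xs1 by (auto intro!: VecI simp: g_def MatD)
  have cg: "c1 (g i) = G i" for i
    unfolding g_def using coord1[OF MatD[OF G(1)] xs1, of a i] fun_cong[OF G(3), of i]
    by (simp add: mmul_def e_def)
  have f1g: "f1 (g i) = f1 (xs1 i)" for i
  proof -
    have "c0 (f1 (g i)) = c0 (f1 (xs1 i))"
      using coord_f1[OF VecD[OF g], of i] coord_f1[OF VecD[OF xs1], of i] fun_cong[OF G(4), of i]
      by (simp add: cg fun_eq_iff mmul_def F_def)
    then show ?thesis
      using expand0[OF f1.closed[OF VecD[OF g]], of i] expand0[OF f1.closed[OF VecD[OF xs1]], of i] by metis
  qed
  let ?U = "{lcomb P1 a v g | v. v \<in> Vec A}"
  have U: "submodule ?U A P1" by (rule P1.submodule_lcombs[OF g])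
  have "?U <+>\<^bsub>P1\<^esub> mod_ker P1 P0 f1 = carrier P1"
  proof
    show "?U <+>\<^bsub>P1\<^esub> mod_ker P1 P0 f1 \<subseteq> carrier P1"
      using submodule_subset[OF P1.submodule_set_add[OF U f1.submodule_ker]] .
    show "carrier P1 \<subseteq> ?U <+>\<^bsub>P1\<^esub> mod_ker P1 P0 f1"
    proof
      fix x assume x: "x \<in> carrier P1"
      let ?u = "lcomb P1 a (c1 x) g"
      have u: "?u \<in> carrier P1" using c1[OF x] g by simp
      have "f1 ?u = f1 x"
        using f1.lcomb[OF c1[OF x] g, of a] f1.lcomb[OF c1[OF x] xs1, of a] by (simp add: f1g expand1 x)
      then have "x \<ominus>\<^bsub>P1\<^esub> ?u \<in> mod_ker P1 P0 f1"
        using u x by (simp add: mod_ker_def f1.diff P0.M.minus_zero_iff f1.closed)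
      moreover have "x = ?u \<oplus>\<^bsub>P1\<^esub> (x \<ominus>\<^bsub>P1\<^esub> ?u)" using u x by (simp add: P1.M.add_minus_cancel)
      ultimately show "x \<in> ?U <+>\<^bsub>P1\<^esub> mod_ker P1 P0 f1"
        unfolding P1.set_add_iff using c1[OF x] by blast
    qed
  qed
  then have "?U = carrier P1" using assms U unfolding superfluous_def by blast
  then have "\<exists>v\<in>Vec A. xs1 i = lcomb P1 a v g" for i using VecD[OF xs1, of i] by blast
  then obtain S where S: "\<And>i. S i \<in> Vec A" "\<And>i. xs1 i = lcomb P1 a (S i) g" by metis
  have SM: "S \<in> Mat A" using S by (simp add: Mat_def)
  have SG: "mmul A a S G = e"
  proof (intro ext)
    fix i j
    show "mmul A a S G i j = e i j"
      unfolding e_def S(2)[of i] using coord1[OF S(1) g, of a i] by (simp add: mmul_def cg)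
  qed
  note [simp] = e_Mat G(1) SM P1.R.mmul_assoc
  have ee: "mmul A a e e = e" using pres by (simp add: pres_def)
  then have ee': "mmul A a e (mmul A a e B) = mmul A a e B" if "B \<in> Mat A" for B
    using that by (simp flip: P1.R.mmul_assoc)
  \<comment> \<open>The coefficients \<open>S\<close> need not respect the idempotent; multiplying
    by \<open>e\<close> on both sides repairs this without changing the product with
    \<open>G\<close>.\<close>
  show "\<exists>S\<in>Mat A. mmul A a e S = S \<and> mmul A a S e = S \<and> mmul A a S G = e"
    by (rule bexI[of _ "mmul A a e (mmul A a S e)"]) (simp_all add: ee ee' G(2) SG)
qed

end

section \<open>Quotient modules\<close>

locale quotient_mod = pure_left_module R M for R (structure) and M :: "('a, 'm) module" (structure) +
  fixes N assumes N: "submodule N R M"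
begin

definition "coset x = N +>\<^bsub>M\<^esub> x"

lemma coset_iff: "y \<in> coset x \<longleftrightarrow> (\<exists>h\<in>N. y = h \<oplus>\<^bsub>M\<^esub> x)"
  by (auto simp: coset_def a_r_coset_def')

lemma N_closed [simp]: "h \<in> N \<Longrightarrow> h \<in> carrier M"
  using submodule_subset[OF N] by auto

lemma coset_self: "x \<in> carrier M \<Longrightarrow> x \<in> coset x"
  unfolding coset_iff by (rule bexI[OF _ submodule_zero[OF N]]) simp

lemma coset_subset: "x \<in> carrier M \<Longrightarrow> y \<in> coset x \<Longrightarrow> y \<in> carrier M"
  by (auto simp: coset_iff)

lemma coset_mem_iff: "x \<in> carrier M \<Longrightarrow> y \<in> carrier M \<Longrightarrow> y \<in> coset x \<longleftrightarrow> y \<ominus>\<^bsub>M\<^esub> x \<in> N"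
proof
  assume x: "x \<in> carrier M" "y \<in> carrier M"
  show "y \<ominus>\<^bsub>M\<^esub> x \<in> N" if yx: "y \<in> coset x"
  proof -
    obtain h where h: "h \<in> N" "y = h \<oplus>\<^bsub>M\<^esub> x" using yx by (auto simp: coset_iff)
    have "y \<ominus>\<^bsub>M\<^esub> x = h" using h x by (simp add: a_minus_def M.a_assoc M.r_neg)
    then show ?thesis using h by simp
  qed
  show "y \<in> coset x" if "y \<ominus>\<^bsub>M\<^esub> x \<in> N"
    unfolding coset_iff using that x M.add_minus_cancel[of x y]
    by (intro bexI[of _ "y \<ominus>\<^bsub>M\<^esub> x"]) (simp_all add: M.a_comm)
qed

lemma coset_eq_iff:
  assumes x: "x \<in> carrier M" "y \<in> carrier M"
  shows "coset y = coset x \<longleftrightarrow> y \<ominus>\<^bsub>M\<^esub> x \<in> N"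
proof
  assume "coset y = coset x"
  then show "y \<ominus>\<^bsub>M\<^esub> x \<in> N" using coset_self[OF x(2)] coset_mem_iff[OF x] by simp
next
  assume yx: "y \<ominus>\<^bsub>M\<^esub> x \<in> N"
  have "z \<in> coset y \<longleftrightarrow> z \<in> coset x" if z: "z \<in> carrier M" for z
  proof -
    have trans: "p \<ominus>\<^bsub>M\<^esub> r \<in> N" if "p \<ominus>\<^bsub>M\<^esub> q \<in> N" "q \<ominus>\<^bsub>M\<^esub> r \<in> N"
      "p \<in> carrier M" "q \<in> carrier M" "r \<in> carrier M" for p q r
    proof -
      have "p \<ominus>\<^bsub>M\<^esub> r = (p \<ominus>\<^bsub>M\<^esub> q) \<oplus>\<^bsub>M\<^esub> (q \<ominus>\<^bsub>M\<^esub> r)"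
        using that(3-5) by (simp add: a_minus_def M.a_assoc M.r_neg1)
      then show ?thesis using submodule_add[OF N that(1,2)] by simp
    qed
    have "\<ominus>\<^bsub>M\<^esub> (y \<ominus>\<^bsub>M\<^esub> x) = x \<ominus>\<^bsub>M\<^esub> y"
      using x by (simp add: a_minus_def M.minus_add M.a_comm)
    then have xy: "x \<ominus>\<^bsub>M\<^esub> y \<in> N" using submodule_minus[OF N yx] by simp
    show ?thesis
      using coset_mem_iff[OF x(1) z] coset_mem_iff[OF x(2) z] trans[of z y x] trans[of z x y] yx xy x z by blast
  qed
  then show "coset y = coset x" using coset_subset x by blast
qed

lemma coset_of_mem: "x \<in> carrier M \<Longrightarrow> y \<in> coset x \<Longrightarrow> coset y = coset x"
  using coset_eq_iff coset_mem_iff coset_subset by blast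

abbreviation "Q \<equiv> quotient_module M N"

lemma Q_carrier: "carrier Q = coset ` carrier M"
  by (auto simp: quotient_module_def A_RCOSETS_def' coset_def)

lemma Q_carrierE: assumes "C \<in> carrier Q" obtains x where "x \<in> carrier M" "C = coset x"
  using assms by (auto simp: Q_carrier)

lemma coset_zero_iff: assumes "x \<in> carrier M" shows "coset x = N \<longleftrightarrow> x \<in> N"
proof
  show "coset x = N \<Longrightarrow> x \<in> N" using coset_self[OF assms] by simp
  assume x: "x \<in> N"
  have "x \<ominus>\<^bsub>M\<^esub> \<zero>\<^bsub>M\<^esub> = x" using assms by (simp add: a_minus_def M.minus_equality[of "\<zero>\<^bsub>M\<^esub>" "\<zero>\<^bsub>M\<^esub>"])
  then have "coset x = coset \<zero>\<^bsub>M\<^esub>" using coset_eq_iff[of "\<zero>\<^bsub>M\<^esub>" x] x by simp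
  also have "\<dots> = N" by (auto simp: coset_iff)
  finally show "coset x = N" .
qed

lemma Q_zero: "\<zero>\<^bsub>Q\<^esub> = N"
  by (simp add: quotient_module_def)

lemma Q_add:
  assumes "x \<in> carrier M" "y \<in> carrier M"
  shows "coset x \<oplus>\<^bsub>Q\<^esub> coset y = coset (x \<oplus>\<^bsub>M\<^esub> y)"
proof -
  have "z \<in> coset x <+>\<^bsub>M\<^esub> coset y \<longleftrightarrow> z \<in> coset (x \<oplus>\<^bsub>M\<^esub> y)" for z
  proof
    assume "z \<in> coset x <+>\<^bsub>M\<^esub> coset y"
    then obtain h k where hk: "h \<in> N" "k \<in> N" "z = (h \<oplus>\<^bsub>M\<^esub> x) \<oplus>\<^bsub>M\<^esub> (k \<oplus>\<^bsub>M\<^esub> y)"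
      by (auto simp: set_add_iff coset_iff)
    then have "z = (h \<oplus>\<^bsub>M\<^esub> k) \<oplus>\<^bsub>M\<^esub> (x \<oplus>\<^bsub>M\<^esub> y)" using assms by (simp add: M.a_ac)
    then show "z \<in> coset (x \<oplus>\<^bsub>M\<^esub> y)"
      unfolding coset_iff using submodule_add[OF N hk(1,2)] by blast
  next
    assume "z \<in> coset (x \<oplus>\<^bsub>M\<^esub> y)"
    then obtain h where h: "h \<in> N" "z = h \<oplus>\<^bsub>M\<^esub> (x \<oplus>\<^bsub>M\<^esub> y)" by (auto simp: coset_iff)
    then have "z = (h \<oplus>\<^bsub>M\<^esub> x) \<oplus>\<^bsub>M\<^esub> y" using assms by (simp add: M.a_ac)
    moreover have "h \<oplus>\<^bsub>M\<^esub> x \<in> coset x" using h by (auto simp: coset_iff)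
    ultimately show "z \<in> coset x <+>\<^bsub>M\<^esub> coset y"
      unfolding set_add_iff using coset_self[OF assms(2)] by blast
  qed
  then show ?thesis by (auto simp: quotient_module_def)
qed

lemma Q_smult:
  assumes "a \<in> carrier R" "x \<in> carrier M"
  shows "a \<odot>\<^bsub>Q\<^esub> coset x = coset (a \<odot>\<^bsub>M\<^esub> x)"
proof -
  have "coset (a \<odot>\<^bsub>M\<^esub> z) = coset (a \<odot>\<^bsub>M\<^esub> x)" if z: "z \<in> coset x" for z
  proof -
    have zM: "z \<in> carrier M" by (rule coset_subset[OF assms(2) z])
    have "a \<odot>\<^bsub>M\<^esub> (z \<ominus>\<^bsub>M\<^esub> x) \<in> N"
      using z assms zM coset_mem_iff by (intro submodule_smult[OF N]) auto
    then show ?thesis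
      using coset_eq_iff[of "a \<odot>\<^bsub>M\<^esub> x" "a \<odot>\<^bsub>M\<^esub> z"] assms zM by (simp add: smult_r_diff)
  qed
  then have "(\<Union>z\<in>coset x. coset (a \<odot>\<^bsub>M\<^esub> z)) = coset (a \<odot>\<^bsub>M\<^esub> x)"
    using coset_self[OF assms(2)] by blast
  then show ?thesis by (simp add: quotient_module_def coset_def)
qed

lemma Q_left_module: "left_module R Q"
proof -
  have zero: "\<zero>\<^bsub>Q\<^esub> = coset \<zero>\<^bsub>M\<^esub>" using coset_zero_iff[of "\<zero>\<^bsub>M\<^esub>"] submodule_zero[OF N] by (simp add: Q_zero)
  have "abelian_group Q"
  proof (rule abelian_groupI)
    fix C assume "C \<in> carrier Q"
    then obtain x where x: "x \<in> carrier M" "C = coset x" by (rule Q_carrierE)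
    then show "\<exists>y\<in>carrier Q. y \<oplus>\<^bsub>Q\<^esub> C = \<zero>\<^bsub>Q\<^esub>"
      by (intro bexI[of _ "coset (\<ominus>\<^bsub>M\<^esub> x)"]) (simp_all add: Q_add M.l_neg zero Q_carrier)
  qed (auto simp: Q_carrier Q_add zero M.a_ac)
  then show ?thesis
    by (intro left_module.intro left_module_axioms.intro R.ring_axioms)
      (auto simp: Q_carrier Q_add Q_smult smult_l_distr smult_r_distr smult_assoc1)
qed

lemma coset_closed: "x \<in> carrier M \<Longrightarrow> coset x \<in> carrier Q"
  by (simp add: Q_carrier)

end

section \<open>Finite dimensional algebras\<close>

lemma mod_hom_restrict:
  assumes "f \<in> mod_hom A M N" "submodule U A M"
  shows "restrict f U \<in> mod_hom A (M\<lparr>carrier := U\<rparr>) N"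
  using assms submodule_subset[OF assms(2)] submodule_add[OF assms(2)] submodule_smult[OF assms(2)]
  by (intro mod_homI) (auto simp: mod_hom_closed mod_hom_add mod_hom_smult subset_iff)

locale fd_algebra = assoc_algebra K A + K: field K
  for K :: "('k, 'c) ring_scheme" and A :: "('k, 'a) module" +
  assumes fin: "finitely_generated K A"
begin

lemma ring_A: "ring A" ..

lemmas A_left_module_free = ring.left_module_free[OF ring_A]
lemmas A_free_expand = ring.free_expand[OF ring_A]
lemmas A_pad_Vec = ring.pad_Vec[OF ring_A]
lemmas A_free_basis_Vec = ring.free_basis_Vec[OF ring_A]

lemma left_module_A: "left_module K A"
  by (intro left_module.intro left_module_axioms.intro)
    (auto simp: smult_l_distr smult_r_distr smult_assoc1 R.ring_axioms M.abelian_group_axioms)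

definition "sc c = c \<odot>\<^bsub>A\<^esub> \<one>\<^bsub>A\<^esub>"

lemma sc_closed [simp]: "c \<in> carrier K \<Longrightarrow> sc c \<in> carrier A"
  by (simp add: sc_def)

lemma sc_mult: "c \<in> carrier K \<Longrightarrow> x \<in> carrier A \<Longrightarrow> sc c \<otimes>\<^bsub>A\<^esub> x = c \<odot>\<^bsub>A\<^esub> x"
  by (simp add: sc_def smult_assoc2)

lemma mult_sc: "c \<in> carrier K \<Longrightarrow> x \<in> carrier A \<Longrightarrow> x \<otimes>\<^bsub>A\<^esub> sc c = c \<odot>\<^bsub>A\<^esub> x"
  by (simp add: sc_def smult_assoc3)

lemma sc_add: "c \<in> carrier K \<Longrightarrow> c' \<in> carrier K \<Longrightarrow> sc (c \<oplus>\<^bsub>K\<^esub> c') = sc c \<oplus>\<^bsub>A\<^esub> sc c'"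
  by (simp add: sc_def smult_l_distr)

lemma sc_mult_sc: "c \<in> carrier K \<Longrightarrow> c' \<in> carrier K \<Longrightarrow> sc (c \<otimes>\<^bsub>K\<^esub> c') = sc c \<otimes>\<^bsub>A\<^esub> sc c'"
  by (simp add: sc_mult) (simp add: sc_def smult_assoc1)

lemma sc_one: "sc \<one>\<^bsub>K\<^esub> = \<one>\<^bsub>A\<^esub>"
  by (simp add: sc_def)

lemma stf_simps [simp]:
  "carrier (scalars_to_field A N) = carrier N" "\<zero>\<^bsub>scalars_to_field A N\<^esub> = \<zero>\<^bsub>N\<^esub>"
  "x \<oplus>\<^bsub>scalars_to_field A N\<^esub> y = x \<oplus>\<^bsub>N\<^esub> y" "c \<odot>\<^bsub>scalars_to_field A N\<^esub> x = sc c \<odot>\<^bsub>N\<^esub> x"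
  by (simp_all add: scalars_to_field_def sc_def)

lemma stf_left_module:
  assumes "left_module A N" shows "left_module K (scalars_to_field A N)"
proof -
  interpret N: left_module A N by fact
  have "abelian_group (scalars_to_field A N)"
    by (rule abelian_group_cong[OF N.M.abelian_group_axioms]) (simp_all add: scalars_to_field_def)
  then show ?thesis
    by (intro left_module.intro left_module_axioms.intro R.ring_axioms)
      (auto simp: sc_add sc_mult_sc sc_one N.smult_l_distr N.smult_r_distr N.smult_assoc1)
qed

lemma stf_submodule:
  assumes "left_module A N" "submodule U A N" shows "submodule U K (scalars_to_field A N)"
proof -
  interpret N: left_module K "scalars_to_field A N" by (rule stf_left_module[OF assms(1)])
  show ?thesis
    by (rule N.submoduleI)
      (use submodule_subset[OF assms(2)] in
        \<open>auto simp: submodule_zero[OF assms(2)] submodule_add[OF assms(2)] submodule_smult[OF assms(2)]\<close>)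
qed

text \<open>The products of algebra generators with module generators generate over the field. The
  proof first varies the algebra factor, then the module factor.\<close>

lemma stf_finitely_generated:
  assumes "left_module A N" "finitely_generated A N"
  shows "finitely_generated K (scalars_to_field A N)"
proof -
  interpret N: left_module A N by fact
  interpret NK: left_module K "scalars_to_field A N" by (rule stf_left_module[OF assms(1)])
  interpret AK: left_module K A by (rule left_module_A)
  obtain S where S: "finite S" "gens A N S"
    using assms finitely_generated_iff by blast
  obtain T where T: "finite T" "gens K A T"
    using fin finitely_generated_iff[OF left_module_A] by blast
  let ?ST = "(\<lambda>(s, t). t \<odot>\<^bsub>N\<^esub> s) ` (S \<times> T)"
  have cl: "s \<in> carrier N" "t \<in> carrier A" if "s \<in> S" "t \<in> T" for s t
    using that S T by (auto simp: gens_def)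
  have "W = carrier N" if W: "submodule W K (scalars_to_field A N)" "?ST \<subseteq> W" for W
  proof -
    have WN: "W \<subseteq> carrier N" using submodule_subset[OF W(1)] by simp
    note W' = submodule_zero[OF W(1), simplified] submodule_add[OF W(1), simplified]
      submodule_smult[OF W(1), simplified]
    have 1: "l \<odot>\<^bsub>N\<^esub> s \<in> W" if s: "s \<in> S" and l: "l \<in> carrier A" for s l
    proof -
      have sN: "s \<in> carrier N" using s S by (auto simp: gens_def)
      let ?L = "{l \<in> carrier A. l \<odot>\<^bsub>N\<^esub> s \<in> W}"
      have "submodule ?L K A"
      proof (rule AK.submoduleI)
        fix c x assume c: "c \<in> carrier K" "x \<in> ?L"
        then have "(c \<odot>\<^bsub>A\<^esub> x) \<odot>\<^bsub>N\<^esub> s = sc c \<odot>\<^bsub>N\<^esub> (x \<odot>\<^bsub>N\<^esub> s)"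
          using sN by (simp flip: sc_mult N.smult_assoc1)
        then show "c \<odot>\<^bsub>A\<^esub> x \<in> ?L" using c W'(3) by simp
      qed (use sN W' in \<open>auto simp: N.smult_l_distr\<close>)
      moreover have "T \<subseteq> ?L" using W(2) s cl by auto
      ultimately have "?L = carrier A" using T unfolding gens_def by blast
      then show ?thesis using l by auto
    qed
    \<comment> \<open>\<open>W\<close> is a subspace only. This is the largest A-submodule inside
      it, and it contains the generators \<open>S\<close>.\<close>
    let ?M = "{x \<in> carrier N. \<forall>l\<in>carrier A. l \<odot>\<^bsub>N\<^esub> x \<in> W}"
    have "submodule ?M A N"
      by (rule N.submoduleI) (use W' in \<open>auto simp: N.smult_r_distr N.smult_assoc1[symmetric]\<close>)
    moreover have "S \<subseteq> ?M" using 1 cl S by (auto simp: gens_def)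
    ultimately have M: "?M = carrier N" using S(2) unfolding gens_def by blast
    have "x \<in> W" if "x \<in> carrier N" for x
    proof -
      have "\<one>\<^bsub>A\<^esub> \<odot>\<^bsub>N\<^esub> x \<in> W" using that M by blast
      then show ?thesis using that by simp
    qed
    then show "W = carrier N" using WN by blast
  qed
  moreover have "?ST \<subseteq> carrier N" using cl by auto
  ultimately have "gens K (scalars_to_field A N) ?ST" by (simp add: gens_def)
  moreover have "finite ?ST" using S T by simp
  ultimately show ?thesis
    using finitely_generated_iff[OF stf_left_module[OF assms(1)]] by blast
qed

lemma bounded_length:
  assumes "left_module A N" "finitely_generated A N"
  shows "bounded_length A N"
  by (rule bounded_length_mono[OF bounded_length_vector_space[OF K.field_axioms
        stf_left_module stf_finitely_generated] stf_submodule]) (use assms in auto)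

section \<open>Projective covers and minimal presentations\<close>

lemma free_finitely_generated: "finitely_generated A (free_module A n)"
  unfolding finitely_generated_lcomb[OF A_left_module_free]
  by (intro exI[of _ n] exI[of _ "free_basis A n"] conjI ballI bexI[of _ "pad A n _"])
    (auto intro!: A_free_expand A_pad_Vec A_free_basis_Vec simp del: free_module_simps)

lemma projective_cover:
  assumes "left_module A M" "finitely_generated A M"
  shows "\<exists>U n f. submodule U A (free_module A n) \<and>
    fg_projective A ((free_module A n)\<lparr>carrier := U\<rparr>) \<and>
    f \<in> mod_hom A ((free_module A n)\<lparr>carrier := U\<rparr>) M \<and> f ` U = carrier M \<and>
    superfluous A ((free_module A n)\<lparr>carrier := U\<rparr>) (mod_ker ((free_module A n)\<lparr>carrier := U\<rparr>) M f)"
proof -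
  interpret M: left_module A M by fact
  obtain n y where y: "y \<in> Vec M" and span: "\<And>x. x \<in> carrier M \<Longrightarrow> \<exists>v\<in>Vec A. x = lcomb M n v y"
    using assms unfolding finitely_generated_lcomb[OF assms(1)] by blast
  let ?F = "free_module A n"
  interpret F: pure_left_module A ?F by (intro pure_left_module.intro A_left_module_free)
  \<comment> \<open>Stated for an arbitrary target because it serves twice, for \<open>f\<close>
    into M and for \<open>l\<close> into the free module.\<close>
  have add: "lcomb N n (pad A n (v \<oplus>\<^bsub>?F\<^esub> w)) z = lcomb N n (pad A n v) z \<oplus>\<^bsub>N\<^esub> lcomb N n (pad A n w) z"
    if "left_module A N" "v \<in> carrier ?F" "w \<in> carrier ?F" "z \<in> Vec N" for v w z and N :: "('a, 'n) module"
  proof -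
    interpret N: left_module A N by fact
    have "pad A n (v \<oplus>\<^bsub>?F\<^esub> w) = (\<lambda>i. pad A n v i \<oplus>\<^bsub>A\<^esub> pad A n w i)" by (simp add: pad_def fun_eq_iff)
    then show ?thesis using N.lcomb_add_l[OF A_pad_Vec[OF that(2)] A_pad_Vec[OF that(3)] that(4)] by simp
  qed
  have smult: "lcomb N n (pad A n (c \<odot>\<^bsub>?F\<^esub> v)) z = c \<odot>\<^bsub>N\<^esub> lcomb N n (pad A n v) z"
    if "left_module A N" "v \<in> carrier ?F" "c \<in> carrier A" "z \<in> Vec N" for v c z and N :: "('a, 'n) module"
  proof -
    interpret N: left_module A N by fact
    have "c \<otimes>\<^bsub>A\<^esub> \<zero>\<^bsub>A\<^esub> = \<zero>\<^bsub>A\<^esub>" 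
      using that(3) by (simp add: ring.ring_simprules(25)[OF ring_A])
    then have "pad A n (c \<odot>\<^bsub>?F\<^esub> v) = (\<lambda>i. c \<otimes>\<^bsub>A\<^esub> pad A n v i)" by (simp add: pad_def fun_eq_iff)
    then show ?thesis using N.lcomb_smult_l[OF that(3) A_pad_Vec[OF that(2)] that(4)] by simp
  qed
  define f where "f = (\<lambda>v\<in>carrier ?F. lcomb M n (pad A n v) y)"
  have fh: "f \<in> mod_hom A ?F M"
    unfolding f_def
  proof (rule restrict_mod_hom[OF A_left_module_free])
    show "lcomb M n (pad A n v) y \<in> carrier M" if "v \<in> carrier ?F" for v
      using A_pad_Vec[OF that] y by simp
  qed (rule add[OF assms(1) _ _ y] smult[OF assms(1) _ _ y]; assumption)+
  interpret f: mod_hom_loc A ?F M f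
    by (rule mod_hom_locI[OF A_left_module_free assms(1) fh])
  have f_restrict: "f (restrict v {..<n}) = lcomb M n v y" if "v \<in> Vec A" for v
    using that unfolding f_def by (auto simp: VecD intro!: lcomb_cong simp: pad_def)
  have f_surj: "f ` carrier ?F = carrier M"
  proof
    show "f ` carrier ?F \<subseteq> carrier M" using f.closed by blast
    show "carrier M \<subseteq> f ` carrier ?F"
    proof
      fix x assume "x \<in> carrier M"
      then obtain v where v: "v \<in> Vec A" "x = lcomb M n v y" using span by blast
      then show "x \<in> f ` carrier ?F"
        by (intro image_eqI[of _ _ "restrict v {..<n}"]) (simp_all add: f_restrict VecD)
    qed
  qed
  have bl: "bounded_length A ?F" by (rule bounded_length[OF A_left_module_free free_finitely_generated])
  \<comment> \<open>The submodule chosen here carries the whole construction: its minimality is used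
    for surjectivity of \<open>k\<close> and for superfluity of the kernel.\<close>
  from min_submodule[of A ?F "carrier ?F" "\<lambda>U. f ` U = carrier M", OF bl F.submodule_carrier f_surj]
  obtain U where U: "submodule U A ?F" "f ` U = carrier M"
    and min: "\<And>W. submodule W A ?F \<Longrightarrow> f ` W = carrier M \<Longrightarrow> W \<subseteq> U \<Longrightarrow> W = U" by blast
  note UF = submodule_subset[OF U(1)]
  let ?P = "?F\<lparr>carrier := U\<rparr>"
  have P: "left_module A ?P" by (rule F.submodule_left_module[OF U(1)])
  interpret P: pure_left_module A ?P by (intro pure_left_module.intro P)
  have "\<exists>u\<in>U. f u = y i" for i using U(2) VecD[OF y, of i] by (metis imageE)
  then obtain u where u: "\<And>i. u i \<in> U" "\<And>i. f (u i) = y i" by metis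
  have uV: "u \<in> Vec ?F" by (rule VecI, rule subsetD[OF UF u(1)])
  \<comment> \<open>The i-th basis vector goes to \<open>u i\<close>, an element of \<open>U\<close>
    over \<open>y i\<close>; therefore \<open>f\<close> is unchanged by \<open>l\<close>.\<close>
  define l where "l = (\<lambda>v\<in>carrier ?F. lcomb ?F n (pad A n v) u)"
  have lU: "l v \<in> U" if "v \<in> carrier ?F" for v
    unfolding l_def using that u(1) by (simp add: submodule_lcomb[OF U(1) A_pad_Vec] del: free_module_simps)
  have lh: "l \<in> mod_hom A ?F ?P"
    unfolding l_def
  proof (rule restrict_mod_hom[OF A_left_module_free])
    show "lcomb ?F n (pad A n v) u \<in> carrier ?P" if "v \<in> carrier ?F" for v
      using lU[OF that] that by (simp add: l_def del: free_module_simps)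
  next
    fix v w assume "v \<in> carrier ?F" "w \<in> carrier ?F"
    from add[OF A_left_module_free this uV]
    show "lcomb ?F n (pad A n (v \<oplus>\<^bsub>?F\<^esub> w)) u =
      lcomb ?F n (pad A n v) u \<oplus>\<^bsub>?P\<^esub> lcomb ?F n (pad A n w) u" by simp
  next
    fix c v assume "c \<in> carrier A" "v \<in> carrier ?F"
    from smult[OF A_left_module_free this(2,1) uV]
    show "lcomb ?F n (pad A n (c \<odot>\<^bsub>?F\<^esub> v)) u = c \<odot>\<^bsub>?P\<^esub> lcomb ?F n (pad A n v) u" by simp
  qed
  have fl: "f (l v) = f v" if v: "v \<in> carrier ?F" for v
  proof -
    have "f (l v) = lcomb M n (pad A n v) (\<lambda>i. f (u i))"
      using v f.lcomb[OF A_pad_Vec[OF v] uV] by (simp add: l_def del: free_module_simps)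
    also have "\<dots> = lcomb M n (pad A n v) y" by (simp only: u)
    also have "\<dots> = f v" using v by (simp add: f_def del: free_module_simps)
    finally show ?thesis .
  qed
  define k where "k = restrict l U"
  have kh: "k \<in> mod_hom A ?P ?P"
    unfolding k_def by (rule mod_hom_restrict[OF lh U(1)])
  interpret k: mod_hom_loc A ?P ?P k by (rule mod_hom_locI[OF P P kh])
  have fk: "f (k v) = f v" if "v \<in> U" for v
    using that fl UF by (auto simp: k_def)
  have kU: "k ` U = U"
  proof (rule min)
    have "submodule (k ` U) A ?P" using k.submodule_image[OF P.submodule_carrier] by simp
    then show "submodule (k ` U) A ?F" "k ` U \<subseteq> U"
      using F.submodule_of_submodule[OF U(1)] by auto
    show "f ` k ` U = carrier M" unfolding image_image using fk U(2) by (simp cong: image_cong)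
  qed
  have inj: "inj_on k U"
    using P.surjective_endomorphism_inj[OF F.bounded_length_submodule[OF bl U(1)] kh] kU by simp
  have bij: "bij_betw k (carrier ?P) (carrier ?P)" using inj kU by (simp add: bij_betw_def)
  let ?ki = "restrict (inv_into U k) U"
  have ki: "?ki \<in> mod_hom A ?P ?P" using mod_iso_inverse[OF P P kh bij] by simp
  have proj: "fg_projective A ?P"
    unfolding fg_projective_def
  proof (intro conjI P exI[of _ n] bexI ballI)
    show "restrict (\<lambda>x. x) U \<in> mod_hom A ?P ?F"
      using restrict_mod_hom[OF P, of "\<lambda>x. x" ?F] UF by (auto simp del: free_module_simps simp add: subset_iff)
    \<comment> \<open>On \<open>U\<close> the map \<open>l\<close> is \<open>k\<close>, so following
      it by the inverse of \<open>k\<close> gives a retraction onto \<open>U\<close>.\<close>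
    show "compose (carrier ?F) ?ki l \<in> mod_hom A ?F ?P"
      by (rule mod_hom_compose[OF A_left_module_free lh ki])
    fix x assume "x \<in> carrier ?P"
    then have x: "x \<in> U" "x \<in> carrier ?F" using UF by auto
    have "inv_into U k (l x) = x"
      using x inv_into_f_f[OF inj, of x] by (simp add: k_def)
    then show "compose (carrier ?F) ?ki l (restrict (\<lambda>x. x) U x) = x"
      using x lU[OF x(2)] by (simp add: compose_def del: free_module_simps)
  qed
  define f0 where "f0 = restrict f U"
  have f0h: "f0 \<in> mod_hom A ?P M"
    unfolding f0_def by (rule mod_hom_restrict[OF fh U(1)])
  interpret f0: mod_hom_loc A ?P M f0 by (rule mod_hom_locI[OF P assms(1) f0h])
  have "superfluous A ?P (mod_ker ?P M f0)"
    unfolding superfluous_def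
  proof (intro allI impI)
    fix W assume W: "submodule W A ?P" "W <+>\<^bsub>?P\<^esub> mod_ker ?P M f0 = carrier ?P"
    have W': "submodule W A ?F" "W \<subseteq> U" using W(1) F.submodule_of_submodule[OF U(1)] by auto
    have "f ` W = carrier M"
    proof
      show "f ` W \<subseteq> carrier M" using W' UF f.closed by blast
      show "carrier M \<subseteq> f ` W"
      proof
        fix m assume "m \<in> carrier M"
        then obtain x where x: "x \<in> U" "m = f x" using U(2) by blast
        then have "x \<in> W <+>\<^bsub>?P\<^esub> mod_ker ?P M f0" unfolding W(2) by simp
        then obtain w k where wk: "w \<in> W" "k \<in> mod_ker ?P M f0" "x = w \<oplus>\<^bsub>?P\<^esub> k"
          unfolding P.set_add_iff by blast
        have kk: "k \<in> U" "f k = \<zero>\<^bsub>M\<^esub>" using wk(2) by (auto simp: mod_ker_def f0_def)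
        have "f x = f w"
          using wk(1,3) kk W'(2) UF f.add[of w k] f.closed[of w] by (simp add: subset_iff del: free_module_simps)
        then show "m \<in> f ` W" using x wk by simp
      qed
    qed
    then show "W = carrier ?P" using min[OF W'(1) _ W'(2)] by simp
  qed
  moreover have "f0 ` U = carrier M" using U(2) by (simp add: f0_def)
  ultimately show ?thesis using U(1) proj f0h by blast
qed

text \<open>A projective cover of M, followed by one of its kernel. The kernel is finitely generated
  by the chain condition.\<close>

lemma ex_minimal_presentation:
  assumes "left_module A M" "finitely_generated A M"
  shows "\<exists>p. minimal_presentation A M p"
proof -
  obtain U n f where U: "submodule U A (free_module A n)"
    and P: "fg_projective A ((free_module A n)\<lparr>carrier := U\<rparr>)"
    and f: "f \<in> mod_hom A ((free_module A n)\<lparr>carrier := U\<rparr>) M" "f ` U = carrier M"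
      "superfluous A ((free_module A n)\<lparr>carrier := U\<rparr>) (mod_ker ((free_module A n)\<lparr>carrier := U\<rparr>) M f)"
    using projective_cover[OF assms] by blast
  let ?F = "free_module A n"
  interpret F: pure_left_module A ?F by (intro pure_left_module.intro A_left_module_free)
  let ?P = "?F\<lparr>carrier := U\<rparr>"
  have Pm: "left_module A ?P" by (rule F.submodule_left_module[OF U])
  interpret P: pure_left_module A ?P by (intro pure_left_module.intro Pm)
  interpret f: mod_hom_loc A ?P M f by (rule mod_hom_locI[OF Pm assms(1) f(1)])
  have bl: "bounded_length A ?F" by (rule bounded_length[OF A_left_module_free free_finitely_generated])
  define N where "N = mod_ker ?P M f"
  have N: "submodule N A ?P" unfolding N_def by (rule f.submodule_ker)
  have NU: "N \<subseteq> U" using submodule_subset[OF N] by simp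
  let ?N = "?P\<lparr>carrier := N\<rparr>"
  have Nm: "left_module A ?N" by (rule P.submodule_left_module[OF N])
  have "finitely_generated A ?N"
    by (rule P.submodule_finitely_generated[OF F.bounded_length_submodule[OF bl U] N])
  from projective_cover[OF Nm this] obtain U1 n1 f1 where U1: "submodule U1 A (free_module A n1)"
    and P1: "fg_projective A ((free_module A n1)\<lparr>carrier := U1\<rparr>)"
    and f1: "f1 \<in> mod_hom A ((free_module A n1)\<lparr>carrier := U1\<rparr>) ?N" "f1 ` U1 = carrier ?N"
      "superfluous A ((free_module A n1)\<lparr>carrier := U1\<rparr>) (mod_ker ((free_module A n1)\<lparr>carrier := U1\<rparr>) ?N f1)"
    by blast
  have "f1 \<in> mod_hom A ((free_module A n1)\<lparr>carrier := U1\<rparr>) ?P"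
    using f1(1) NU by (auto simp: mod_hom_def)
  then have "minimal_presentation A M ((free_module A n1)\<lparr>carrier := U1\<rparr>, ?P, f1, f)"
    using P P1 f f1(2,3) by (simp add: minimal_presentation_def N_def mod_ker_def)
  then show ?thesis by blast
qed

end

section \<open>The functional characterisation of tau-rigidity\<close>

lemma op_ring_simps [simp]:
  "carrier (op_ring A) = carrier A" "\<zero>\<^bsub>op_ring A\<^esub> = \<zero>\<^bsub>A\<^esub>" "\<one>\<^bsub>op_ring A\<^esub> = \<one>\<^bsub>A\<^esub>"
  "x \<oplus>\<^bsub>op_ring A\<^esub> y = x \<oplus>\<^bsub>A\<^esub> y" "x \<otimes>\<^bsub>op_ring A\<^esub> y = y \<otimes>\<^bsub>A\<^esub> x"
  by (simp_all add: op_ring_def)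

lemma op_ring_smult [simp]: "smult (op_ring A) = smult A"
  by (simp add: op_ring_def)

lemma ring_op_ring: assumes "ring A" shows "ring (op_ring A)"
proof -
  interpret ring A by fact
  have "abelian_group (op_ring A)"
    by (rule abelian_group_cong[OF is_abelian_group]) (simp_all add: op_ring_def)
  then show ?thesis
    by (intro ringI monoidI) (auto simp: m_assoc l_distr r_distr)
qed

lemma hom_to_ring_simps [simp]:
  "carrier (hom_to_ring A P) = mod_hom A P (regular_module A)"
  "\<zero>\<^bsub>hom_to_ring A P\<^esub> = (\<lambda>x\<in>carrier P. \<zero>\<^bsub>A\<^esub>)"
  "f \<oplus>\<^bsub>hom_to_ring A P\<^esub> g = (\<lambda>x\<in>carrier P. f x \<oplus>\<^bsub>A\<^esub> g x)"
  "a \<odot>\<^bsub>hom_to_ring A P\<^esub> f = (\<lambda>x\<in>carrier P. f x \<otimes>\<^bsub>A\<^esub> a)"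
  by (simp_all add: hom_to_ring_def)

lemma left_module_hom_to_ring:
  assumes "left_module A P" shows "left_module (op_ring A) (hom_to_ring A P)"
proof -
  interpret left_module A P by fact
  note hom = mod_hom_closed[of _ A P "regular_module A", simplified]
    mod_hom_add[of _ A P "regular_module A", simplified] mod_hom_smult[of _ A P "regular_module A", simplified]
  have ext: "f x = undefined" if "f \<in> mod_hom A P (regular_module A)" "x \<notin> carrier P" for f x
    using that by (auto simp: mod_hom_def PiE_iff extensional_def)
  have zero: "(\<lambda>x\<in>carrier P. \<zero>\<^bsub>A\<^esub>) \<in> mod_hom A P (regular_module A)"
    by (rule restrict_mod_hom[OF left_module]) simp_all
  have add: "(\<lambda>x\<in>carrier P. f x \<oplus>\<^bsub>A\<^esub> g x) \<in> mod_hom A P (regular_module A)"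
    if "f \<in> mod_hom A P (regular_module A)" "g \<in> mod_hom A P (regular_module A)" for f g
    using that by (intro restrict_mod_hom[OF left_module]) (simp_all add: hom R.a_ac R.r_distr)
  have smult: "(\<lambda>x\<in>carrier P. f x \<otimes>\<^bsub>A\<^esub> a) \<in> mod_hom A P (regular_module A)"
    if "f \<in> mod_hom A P (regular_module A)" "a \<in> carrier A" for f a
    using that by (intro restrict_mod_hom[OF left_module]) (simp_all add: hom R.m_assoc R.l_distr)
  have "abelian_group (hom_to_ring A P)"
  proof (rule abelian_groupI)
    fix f assume f: "f \<in> carrier (hom_to_ring A P)"
    then have "(\<lambda>x\<in>carrier P. \<ominus>\<^bsub>A\<^esub> f x) \<in> mod_hom A P (regular_module A)"
      by (intro restrict_mod_hom[OF left_module]) (simp_all add: hom R.minus_add R.a_comm R.r_minus)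
    then show "\<exists>g\<in>carrier (hom_to_ring A P). g \<oplus>\<^bsub>hom_to_ring A P\<^esub> f = \<zero>\<^bsub>hom_to_ring A P\<^esub>"
      using f by (intro bexI[of _ "\<lambda>x\<in>carrier P. \<ominus>\<^bsub>A\<^esub> f x"]) (auto simp: hom R.l_neg fun_eq_iff)
  qed (auto simp: zero add hom ext R.a_ac fun_eq_iff)
  then show ?thesis
    by (intro left_module.intro left_module_axioms.intro ring_op_ring R.ring_axioms)
      (auto simp: smult hom ext fun_eq_iff R.r_distr R.l_distr R.m_assoc)
qed

text \<open>The space of all sequences in a module, in which a functional is chosen in
  \<open>zero_imp_factors\<close>.\<close>

lemma left_module_Vec:
  assumes "left_module K N"
  defines "V \<equiv> \<lparr>carrier = Vec N, monoid.mult = undefined, one = undefined,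
     ring.zero = (\<lambda>_. \<zero>\<^bsub>N\<^esub>), ring.add = (\<lambda>x y i. x i \<oplus>\<^bsub>N\<^esub> y i), smult = (\<lambda>c x i. c \<odot>\<^bsub>N\<^esub> x i)\<rparr>"
  shows "left_module K V"
proof -
  interpret left_module K N by fact
  have "abelian_group V"
  proof (rule abelian_groupI)
    fix f assume f: "f \<in> carrier V"
    then show "\<exists>g\<in>carrier V. g \<oplus>\<^bsub>V\<^esub> f = \<zero>\<^bsub>V\<^esub>"
      by (intro bexI[of _ "\<lambda>i. \<ominus>\<^bsub>N\<^esub> f i"]) (auto simp: V_def Vec_def M.l_neg)
  qed (auto simp: V_def Vec_def M.a_ac)
  then show ?thesis
    by (intro left_module.intro left_module_axioms.intro R.ring_axioms)
      (auto simp: V_def Vec_def smult_l_distr smult_r_distr smult_assoc1)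
qed

section \<open>Maps into D Tr M as balanced pairings\<close>

locale tau_presentation = fd_algebra K A + presentation A P1 P0 M f1 f0 a b xs1 c1 xs0 c0
  for K :: "('k, 'c) ring_scheme" and A :: "('k, 'a) module" and P1 :: "('a, 'p) module"
    and P0 :: "('a, 'q) module" and M :: "('a, 'm) module" and f1 f0 a b xs1 c1 xs0 c0
begin

text \<open>For a minimal presentation the quotient \<open>T\<close> of \<open>H\<close> by the
  image \<open>I\<close> of Hom(f1, A) is Tr M, and \<open>D\<close> below is the Auslander-Reiten
  translate.\<close>

definition "H = hom_to_ring A P1"
definition "I = (\<lambda>g. compose (carrier P1) g f1) ` mod_hom A P0 (regular_module A)"

lemma H_carrier: "carrier H = mod_hom A P1 (regular_module A)"
  by (simp add: H_def)

lemma H_simps [simp]: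
  "\<zero>\<^bsub>H\<^esub> = (\<lambda>x\<in>carrier P1. \<zero>\<^bsub>A\<^esub>)"
  "f \<oplus>\<^bsub>H\<^esub> g = (\<lambda>x\<in>carrier P1. f x \<oplus>\<^bsub>A\<^esub> g x)"
  "l \<odot>\<^bsub>H\<^esub> f = (\<lambda>x\<in>carrier P1. f x \<otimes>\<^bsub>A\<^esub> l)"
  by (simp_all add: H_def)

sublocale H: left_module "op_ring A" H
  unfolding H_def by (rule left_module_hom_to_ring[OF P1.left_module])

lemma submodule_I: "submodule I (op_ring A) H"
proof (rule H.submoduleI)
  interpret H0: left_module "op_ring A" "hom_to_ring A P0"
    by (rule left_module_hom_to_ring[OF P0.left_module])
  show "I \<subseteq> carrier H" using mod_hom_compose[OF P1.left_module f1] by (auto simp: I_def H_carrier)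
  show "\<zero>\<^bsub>H\<^esub> \<in> I"
    unfolding I_def using H0.M.zero_closed
    by (intro image_eqI[of _ _ "\<zero>\<^bsub>hom_to_ring A P0\<^esub>"]) (auto simp: compose_def fun_eq_iff f1.closed)
  fix f g assume "f \<in> I" "g \<in> I"
  then obtain f' g' where *: "f' \<in> mod_hom A P0 (regular_module A)" "f = compose (carrier P1) f' f1"
    "g' \<in> mod_hom A P0 (regular_module A)" "g = compose (carrier P1) g' f1" unfolding I_def by blast
  show "f \<oplus>\<^bsub>H\<^esub> g \<in> I"
    unfolding I_def using * H0.M.a_closed[of f' g']
    by (intro image_eqI[of _ _ "f' \<oplus>\<^bsub>hom_to_ring A P0\<^esub> g'"])
      (auto simp: compose_def fun_eq_iff f1.closed)
next
  interpret H0: left_module "op_ring A" "hom_to_ring A P0"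
    by (rule left_module_hom_to_ring[OF P0.left_module])
  fix c f assume "c \<in> carrier (op_ring A)" "f \<in> I"
  then obtain f' where *: "c \<in> carrier (op_ring A)" "f' \<in> mod_hom A P0 (regular_module A)"
    "f = compose (carrier P1) f' f1" unfolding I_def by blast
  show "c \<odot>\<^bsub>H\<^esub> f \<in> I"
    unfolding I_def using * H0.smult_closed[of c f']
    by (intro image_eqI[of _ _ "c \<odot>\<^bsub>hom_to_ring A P0\<^esub> f'"])
      (auto simp: compose_def fun_eq_iff f1.closed)
qed

sublocale T: quotient_mod "op_ring A" H I
  by (intro quotient_mod.intro pure_left_module.intro quotient_mod_axioms.intro submodule_I H.left_module)

abbreviation "T \<equiv> quotient_module H I"
definition "D = dual_module K (op_ring A) T"

lemma D_simps:
  "carrier D = mod_hom K (scalars_to_field (op_ring A) T) (regular_module K)"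
  "\<zero>\<^bsub>D\<^esub> = (\<lambda>x\<in>carrier T. \<zero>\<^bsub>K\<^esub>)"
  "f \<oplus>\<^bsub>D\<^esub> g = (\<lambda>x\<in>carrier T. f x \<oplus>\<^bsub>K\<^esub> g x)"
  "l \<odot>\<^bsub>D\<^esub> f = (\<lambda>x\<in>carrier T. f (l \<odot>\<^bsub>T\<^esub> x))"
  by (simp_all add: D_def dual_module_def)

lemma stf_T_simps:
  "carrier (scalars_to_field (op_ring A) T) = carrier T" "\<zero>\<^bsub>scalars_to_field (op_ring A) T\<^esub> = \<zero>\<^bsub>T\<^esub>"
  "x \<oplus>\<^bsub>scalars_to_field (op_ring A) T\<^esub> x' = x \<oplus>\<^bsub>T\<^esub> x'"
  "c \<odot>\<^bsub>scalars_to_field (op_ring A) T\<^esub> x = sc c \<odot>\<^bsub>T\<^esub> x"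
  by (simp_all add: scalars_to_field_def sc_def)

lemma D_memD:
  assumes "\<phi> \<in> carrier D"
  shows "C \<in> carrier T \<Longrightarrow> \<phi> C \<in> carrier K"
    and "C \<in> carrier T \<Longrightarrow> C' \<in> carrier T \<Longrightarrow> \<phi> (C \<oplus>\<^bsub>T\<^esub> C') = \<phi> C \<oplus>\<^bsub>K\<^esub> \<phi> C'"
    and "C \<notin> carrier T \<Longrightarrow> \<phi> C = undefined"
  using assms mod_hom_closed[of \<phi> K "scalars_to_field (op_ring A) T" "regular_module K" C]
    mod_hom_add[of \<phi> K "scalars_to_field (op_ring A) T" "regular_module K" C C']
  by (auto simp: D_simps stf_T_simps mod_hom_def PiE_iff extensional_def)

lemma D_zero_closed: "\<zero>\<^bsub>D\<^esub> \<in> carrier D"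
  unfolding D_simps
proof (rule mod_homI)
  interpret Tm: left_module "op_ring A" T by (rule T.Q_left_module)
  show "x \<in> carrier (scalars_to_field (op_ring A) T) \<Longrightarrow> (\<lambda>x\<in>carrier T. \<zero>\<^bsub>K\<^esub>) x \<in> carrier (regular_module K)" for x
    by (simp add: stf_T_simps)
qed (use left_module.smult_closed[OF T.Q_left_module] abelian_group.axioms left_module.axioms(2)[OF T.Q_left_module]
   abelian_monoid.a_closed[OF abelian_group.axioms(1)[OF left_module.axioms(2)[OF T.Q_left_module]]]
    in \<open>auto simp: stf_T_simps\<close>)

lemma zero_hom: "(\<lambda>x\<in>carrier M. \<zero>\<^bsub>D\<^esub>) \<in> mod_hom A M D"
proof (rule restrict_mod_hom[OF M.left_module])
  interpret Tm: left_module "op_ring A" T by (rule T.Q_left_module)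
  show "\<zero>\<^bsub>D\<^esub> \<in> carrier D" by (rule D_zero_closed)
  show "\<zero>\<^bsub>D\<^esub> = \<zero>\<^bsub>D\<^esub> \<oplus>\<^bsub>D\<^esub> \<zero>\<^bsub>D\<^esub>" by (auto simp: D_simps)
  show "\<zero>\<^bsub>D\<^esub> = l \<odot>\<^bsub>D\<^esub> \<zero>\<^bsub>D\<^esub>" if "l \<in> carrier A" for l
    using that Tm.smult_closed[of l] by (auto simp: D_simps fun_eq_iff)
qed

definition "coord i = (\<lambda>x\<in>carrier P1. c1 x i)"

lemma coord_H: "coord i \<in> carrier H"
  unfolding coord_def H_carrier
  using b1 by (intro restrict_mod_hom[OF P1.left_module]) (simp_all add: dual_basis_def VecD)

lemma H_apply: "g \<in> carrier H \<Longrightarrow> x \<in> carrier P1 \<Longrightarrow> g x = ssum A a (\<lambda>k. c1 x k \<otimes>\<^bsub>A\<^esub> g (xs1 k))"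
proof -
  assume g: "g \<in> carrier H" and x: "x \<in> carrier P1"
  interpret g: mod_hom_loc A P1 "regular_module A" g
    using g by (intro mod_hom_locI P1.left_module ring.left_module_regular ring_A) (simp add: H_carrier)
  show ?thesis
    using g.lcomb[OF c1[OF x] xs1, of a] expand1[OF x] by (simp add: lcomb_def)
qed

lemma H_closed: "g \<in> carrier H \<Longrightarrow> x \<in> carrier P1 \<Longrightarrow> g x \<in> carrier A"
  using mod_hom_closed[of g A P1 "regular_module A"] by (simp add: H_carrier)

lemma H_Vec: "g \<in> carrier H \<Longrightarrow> (\<lambda>i. g (xs1 i)) \<in> Vec A"
  using H_closed VecD[OF xs1] by (auto intro: VecI)

lemma ssum_H: "(\<And>k. f k \<in> carrier H) \<Longrightarrow> x \<in> carrier P1 \<Longrightarrow> ssum H n f x = ssum A n (\<lambda>k. f k x)"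
  by (induction n) simp_all

text \<open>The vector represents the homomorphism P1 -> M that takes x to g(x) m; being fixed by
  \<open>e\<close> means that it is given by the values on the dual basis.\<close>

lemma fixed_by_e:
  assumes "g \<in> carrier H" "m \<in> carrier M"
  shows "mvec M a e (\<lambda>i. g (xs1 i) \<odot>\<^bsub>M\<^esub> m) = (\<lambda>i. g (xs1 i) \<odot>\<^bsub>M\<^esub> m)"
proof
  fix i
  have "mvec M a e (\<lambda>i. g (xs1 i) \<odot>\<^bsub>M\<^esub> m) i = ssum M a (\<lambda>k. (e i k \<otimes>\<^bsub>A\<^esub> g (xs1 k)) \<odot>\<^bsub>M\<^esub> m)"
    using assms H_Vec[OF assms(1)] MatDD[OF e_Mat] by (simp add: mvec_def lcomb_def M.smult_assoc1 Vec_def)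
  also have "\<dots> = ssum A a (\<lambda>k. e i k \<otimes>\<^bsub>A\<^esub> g (xs1 k)) \<odot>\<^bsub>M\<^esub> m"
    using assms H_Vec[OF assms(1)] MatDD[OF e_Mat] by (intro M.ssum_smult[symmetric]) (simp_all add: Vec_def)
  also have "ssum A a (\<lambda>k. e i k \<otimes>\<^bsub>A\<^esub> g (xs1 k)) = g (xs1 i)"
    using H_apply[OF assms(1) VecD[OF xs1, of i]] by (simp add: e_def)
  finally show "mvec M a e (\<lambda>i. g (xs1 i) \<odot>\<^bsub>M\<^esub> m) i = g (xs1 i) \<odot>\<^bsub>M\<^esub> m" .
qed

text \<open>A homomorphism \<open>M \<rightarrow> \<tau>M\<close> is a pairing \<open>\<beta>\<close> of \<open>Hom(P\<^sub>1, A)\<close> with \<open>M\<close>, balanced over \<open>A\<close> and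
  vanishing on the maps that factor through \<open>P\<^sub>0\<close>. Expanding \<open>g\<close> in the dual basis, one needs only the
  values \<open>\<beta> (coord i, g (xs1 i) m)\<close>, and \<open>i \<mapsto> g (xs1 i) m\<close> factors as \<open>F w\<close>.\<close>

lemma factors_imp_zero:
  assumes "factors M a b e F" and Phi: "\<Phi> \<in> mod_hom A M D"
  shows "\<Phi> = (\<lambda>x\<in>carrier M. \<zero>\<^bsub>D\<^esub>)"
proof -
  interpret Tm: left_module "op_ring A" T by (rule T.Q_left_module)
  define \<beta> where "\<beta> g m = \<Phi> m (T.coset g)" for g m
  have PhiD: "\<Phi> m \<in> carrier D" if "m \<in> carrier M" for m by (rule mod_hom_closed[OF Phi that])
  have \<beta>_closed: "\<beta> g m \<in> carrier K" if "g \<in> carrier H" "m \<in> carrier M" for g m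
    unfolding \<beta>_def by (rule D_memD(1)[OF PhiD[OF that(2)] T.coset_closed[OF that(1)]])
  have add1: "\<beta> (g \<oplus>\<^bsub>H\<^esub> g') m = \<beta> g m \<oplus>\<^bsub>K\<^esub> \<beta> g' m"
    if "g \<in> carrier H" "g' \<in> carrier H" "m \<in> carrier M" for g g' m
    using D_memD(2)[OF PhiD[OF that(3)] T.coset_closed[OF that(1)] T.coset_closed[OF that(2)]]
      T.Q_add[OF that(1,2)] by (simp add: \<beta>_def)
  have add2: "\<beta> g (m \<oplus>\<^bsub>M\<^esub> m') = \<beta> g m \<oplus>\<^bsub>K\<^esub> \<beta> g m'"
    if "g \<in> carrier H" "m \<in> carrier M" "m' \<in> carrier M" for g m m'
    using mod_hom_add[OF Phi that(2,3)] T.coset_closed[OF that(1)] by (simp add: \<beta>_def D_simps)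
  have bal: "\<beta> g (l \<odot>\<^bsub>M\<^esub> m) = \<beta> (l \<odot>\<^bsub>H\<^esub> g) m" if "g \<in> carrier H" "m \<in> carrier M" "l \<in> carrier A" for g m l
    using mod_hom_smult[OF Phi that(3,2)] T.coset_closed[OF that(1)] T.Q_smult[of l g] that
    by (simp add: \<beta>_def D_simps)
  have vanish: "\<beta> g m = \<zero>\<^bsub>K\<^esub>" if "g \<in> I" "m \<in> carrier M" for g m
  proof -
    have gH: "g \<in> carrier H" using submodule_subset[OF submodule_I] that(1) by blast
    have "g \<oplus>\<^bsub>H\<^esub> \<zero>\<^bsub>H\<^esub> = g" by (rule H.M.r_zero[OF gH])
    have "T.coset g = T.coset \<zero>\<^bsub>H\<^esub>"
      using T.coset_zero_iff[OF gH] T.coset_zero_iff[OF H.M.zero_closed] that(1) submodule_zero[OF submodule_I] by simp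
    then have "\<beta> g m = \<beta> \<zero>\<^bsub>H\<^esub> m" by (simp add: \<beta>_def)
    also have "\<dots> = \<zero>\<^bsub>K\<^esub>"
      by (rule additive_zero[OF H.M.abelian_group_axioms R.is_abelian_group, of "\<lambda>g. \<beta> g m"])
        (use that(2) \<beta>_closed add1 in \<open>blast+\<close>)
    finally show ?thesis .
  qed
  have sum1: "\<beta> (ssum H n f) m = ssum K n (\<lambda>k. \<beta> (f k) m)" if "\<And>k. f k \<in> carrier H" "m \<in> carrier M" for f m n
    by (rule ssum_hom[OF H.M.abelian_group_axioms R.is_abelian_group, of "\<lambda>g. \<beta> g m"])
      (use that add1 vanish[OF submodule_zero[OF submodule_I]] in \<open>blast+\<close>)
  have sum2: "\<beta> g (ssum M n f) = ssum K n (\<lambda>k. \<beta> g (f k))" if "g \<in> carrier H" "\<And>k. f k \<in> carrier M" for f g n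
  proof (rule ssum_hom[OF M.M.abelian_group_axioms R.is_abelian_group, of "\<beta> g"])
    show "\<beta> g \<zero>\<^bsub>M\<^esub> = \<zero>\<^bsub>K\<^esub>"
      by (rule additive_zero[OF M.M.abelian_group_axioms R.is_abelian_group, of "\<beta> g"])
        (use that(1) \<beta>_closed add2 in \<open>blast+\<close>)
  qed (use that add2 in \<open>blast+\<close>)
  have zero: "\<beta> g m = \<zero>\<^bsub>K\<^esub>" if g: "g \<in> carrier H" and m: "m \<in> carrier M" for g m
  proof -
    let ?z = "\<lambda>i. g (xs1 i) \<odot>\<^bsub>M\<^esub> m"
    have z: "?z \<in> Vec M" using H_Vec[OF g] m by (simp add: Vec_def)
    obtain w where w: "w \<in> Vec M" "mvec M b F w = ?z"
      using assms(1) z fixed_by_e[OF g m] unfolding factors_def by blast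
    have gx: "g (xs1 i) \<in> carrier A" for i using H_Vec[OF g] by (simp add: Vec_def)
    have t: "g (xs1 k) \<odot>\<^bsub>H\<^esub> coord k \<in> carrier H" for k
      using H.smult_closed[of "g (xs1 k)" "coord k"] gx coord_H by simp
    \<comment> \<open>Dual basis expansion of \<open>g\<close> in Hom(P1, A). Balancedness will then
      carry the coefficients g(xs1 k) over to \<open>m\<close>.\<close>
    have "g = ssum H a (\<lambda>k. g (xs1 k) \<odot>\<^bsub>H\<^esub> coord k)"
    proof (rule mod_hom_ext[of _ A P1 "regular_module A"])
      show "g \<in> mod_hom A P1 (regular_module A)" using g by (simp add: H_carrier)
      show "ssum H a (\<lambda>k. g (xs1 k) \<odot>\<^bsub>H\<^esub> coord k) \<in> mod_hom A P1 (regular_module A)"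
        using H.M.ssum_closed[of a "\<lambda>k. g (xs1 k) \<odot>\<^bsub>H\<^esub> coord k"] t by (simp add: H_carrier)
      fix x assume x: "x \<in> carrier P1"
      show "g x = ssum H a (\<lambda>k. g (xs1 k) \<odot>\<^bsub>H\<^esub> coord k) x"
        unfolding ssum_H[OF t x] using x H_apply[OF g x] by (simp add: coord_def)
    qed
    then have "\<beta> g m = \<beta> (ssum H a (\<lambda>k. g (xs1 k) \<odot>\<^bsub>H\<^esub> coord k)) m" by (rule arg_cong)
    also have "\<dots> = ssum K a (\<lambda>i. \<beta> (g (xs1 i) \<odot>\<^bsub>H\<^esub> coord i) m)"
      by (rule sum1[OF t m])
    also have "\<dots> = ssum K a (\<lambda>i. \<beta> (coord i) (?z i))"
      using bal coord_H m gx by (intro ssum_cong) simp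
    also have "\<dots> = ssum K a (\<lambda>i. \<beta> (coord i) (ssum M b (\<lambda>j. F i j \<odot>\<^bsub>M\<^esub> w j)))"
      using w(2) by (simp add: mvec_def lcomb_def fun_eq_iff)
    also have "\<dots> = ssum K a (\<lambda>i. ssum K b (\<lambda>j. \<beta> (coord i) (F i j \<odot>\<^bsub>M\<^esub> w j)))"
      using w(1) MatDD[OF F_Mat] by (intro ssum_cong sum2 coord_H) (simp add: VecD)
    also have "\<dots> = ssum K a (\<lambda>i. ssum K b (\<lambda>j. \<beta> (F i j \<odot>\<^bsub>H\<^esub> coord i) (w j)))"
      using w(1) MatDD[OF F_Mat] by (intro ssum_cong bal coord_H) (simp_all add: VecD)
    also have "\<dots> = ssum K b (\<lambda>j. ssum K a (\<lambda>i. \<beta> (F i j \<odot>\<^bsub>H\<^esub> coord i) (w j)))"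
    proof (intro R.ssum_swap \<beta>_closed)
      show "F i j \<odot>\<^bsub>H\<^esub> coord i \<in> carrier H" for i j
        by (rule H.smult_closed[OF _ coord_H]) (simp add: MatDD[OF F_Mat])
      show "w j \<in> carrier M" for j using w(1) by (rule VecD)
    qed
    also have "\<dots> = ssum K b (\<lambda>j. \<zero>\<^bsub>K\<^esub>)"
    proof (rule ssum_cong)
      fix j
      have t': "F i j \<odot>\<^bsub>H\<^esub> coord i \<in> carrier H" for i
        by (rule H.smult_closed[OF _ coord_H]) (simp add: MatDD[OF F_Mat])
      have wj: "w j \<in> carrier M" by (rule VecD[OF w(1)])
      let ?p = "\<lambda>x\<in>carrier P0. c0 x j"
      have p: "?p \<in> mod_hom A P0 (regular_module A)"
        using b0 by (intro restrict_mod_hom[OF P0.left_module]) (simp_all add: dual_basis_def VecD)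
      \<comment> \<open>The j-th column of \<open>F\<close> combines the coordinate functions of P1
        into the j-th coordinate function of P0 composed with \<open>f1\<close>, which lies in
        \<open>I\<close>.\<close>
      have "ssum H a (\<lambda>i. F i j \<odot>\<^bsub>H\<^esub> coord i) = compose (carrier P1) ?p f1"
      proof (rule mod_hom_ext[of _ A P1 "regular_module A"])
        show "ssum H a (\<lambda>i. F i j \<odot>\<^bsub>H\<^esub> coord i) \<in> mod_hom A P1 (regular_module A)"
          using H.M.ssum_closed[of a "\<lambda>i. F i j \<odot>\<^bsub>H\<^esub> coord i"] t' by (simp add: H_carrier)
        show "compose (carrier P1) ?p f1 \<in> mod_hom A P1 (regular_module A)"
          by (rule mod_hom_compose[OF P1.left_module f1 p])
        fix x assume x: "x \<in> carrier P1"
        show "ssum H a (\<lambda>i. F i j \<odot>\<^bsub>H\<^esub> coord i) x = compose (carrier P1) ?p f1 x"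
          unfolding ssum_H[OF t' x] using x coord_f1[OF x] by (simp add: coord_def compose_def f1.closed)
      qed
      then have "ssum H a (\<lambda>i. F i j \<odot>\<^bsub>H\<^esub> coord i) \<in> I" using p unfolding I_def by blast
      with vanish[OF this wj] sum1[of "\<lambda>i. F i j \<odot>\<^bsub>H\<^esub> coord i", OF t' wj, of a]
      show "ssum K a (\<lambda>i. \<beta> (F i j \<odot>\<^bsub>H\<^esub> coord i) (w j)) = \<zero>\<^bsub>K\<^esub>" by simp
    qed
    also have "\<dots> = \<zero>\<^bsub>K\<^esub>" by simp
    finally show ?thesis .
  qed
  show ?thesis
  proof (rule mod_hom_ext[OF Phi zero_hom])
    fix m assume m: "m \<in> carrier M"
    have "\<Phi> m C = \<zero>\<^bsub>D\<^esub> C" for C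
    proof (cases "C \<in> carrier T")
      case True
      then obtain g where "g \<in> carrier H" "C = T.coset g" by (rule T.Q_carrierE)
      then show ?thesis using zero[of g m] m True by (simp add: \<beta>_def D_simps)
    next
      case False
      then show ?thesis using D_memD(3)[OF PhiD[OF m] False] by (simp add: D_simps)
    qed
    then show "\<Phi> m = (\<lambda>x\<in>carrier M. \<zero>\<^bsub>D\<^esub>) m" using m by auto
  qed
qed

text \<open>By contradiction. If z is fixed by \<open>e\<close> but not of the form F w, a
  functional \<phi> separates it from such vectors. The pairing of g with m obtained by applying
  \<phi> to the vector g(xs1 i) m then vanishes on \<open>I\<close>, so it defines a map M -> D.
  That map is zero by assumption, but \<phi> z is a sum of values of the pairing.\<close>

lemma zero_imp_factors:
  assumes zero: "\<And>\<Phi>. \<Phi> \<in> mod_hom A M D \<Longrightarrow> \<Phi> = (\<lambda>x\<in>carrier M. \<zero>\<^bsub>D\<^esub>)"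
  shows "factors M a b e F"
  unfolding factors_def
proof (intro ballI impI)
  interpret Tm: left_module "op_ring A" T by (rule T.Q_left_module)
  fix z assume z: "z \<in> Vec M" and ez: "mvec M a e z = z"
  have eF: "mmul A a e F = F" using pres by (simp add: pres_def)
  define V :: "('k, nat \<Rightarrow> 'm) module" where "V = \<lparr>carrier = Vec (scalars_to_field A M), monoid.mult = undefined, one = undefined,
     ring.zero = (\<lambda>_. \<zero>\<^bsub>scalars_to_field A M\<^esub>), ring.add = (\<lambda>x y i. x i \<oplus>\<^bsub>scalars_to_field A M\<^esub> y i),
     smult = (\<lambda>c x i. c \<odot>\<^bsub>scalars_to_field A M\<^esub> x i)\<rparr>"
  interpret V: left_module K V
    unfolding V_def by (rule left_module_Vec[OF stf_left_module[OF M.left_module]])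
  have V[simp]: "carrier V = Vec M" "\<zero>\<^bsub>V\<^esub> = (\<lambda>_. \<zero>\<^bsub>M\<^esub>)" "x \<oplus>\<^bsub>V\<^esub> y = (\<lambda>i. x i \<oplus>\<^bsub>M\<^esub> y i)"
    "c \<odot>\<^bsub>V\<^esub> x = (\<lambda>i. sc c \<odot>\<^bsub>M\<^esub> x i)" for x y c
    by (simp_all add: V_def Vec_def)
  \<comment> \<open>A vector fixed by \<open>e\<close> lies in \<open>W\<close> only if it has the
    form F w, so the offending z is outside.\<close>
  define W where "W = {v \<in> Vec M. \<exists>w\<in>Vec M. mvec M a e v = mvec M b F w}"
  have scr: "mvec M n B (\<lambda>i. sc c \<odot>\<^bsub>M\<^esub> v i) = (\<lambda>i. sc c \<odot>\<^bsub>M\<^esub> mvec M n B v i)"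
    if "B \<in> Mat A" "c \<in> carrier K" "v \<in> Vec M" for n B c v
    using that M.lcomb_smult_r[OF sc_closed MatD[OF that(1)] that(3)]
    by (simp add: mvec_def sc_mult mult_sc MatDD)
  have W: "submodule W K V"
  proof (rule V.submoduleI)
    show "\<zero>\<^bsub>V\<^esub> \<in> W"
      using e_Mat F_Mat by (auto simp: W_def Vec_def intro!: bexI[of _ "\<lambda>_. \<zero>\<^bsub>M\<^esub>"])
    show "x \<oplus>\<^bsub>V\<^esub> y \<in> W" if xy: "x \<in> W" "y \<in> W" for x y
    proof -
      obtain u v where uv: "u \<in> Vec M" "v \<in> Vec M" "mvec M a e x = mvec M b F u" "mvec M a e y = mvec M b F v"
        using xy unfolding W_def by blast
      have "mvec M a e (vadd M x y) = mvec M b F (vadd M u v)"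
        using that uv e_Mat F_Mat by (simp add: W_def M.mvec_vadd)
      moreover have "vadd M x y \<in> Vec M" "vadd M u v \<in> Vec M" using that uv by (auto simp: W_def)
      ultimately show ?thesis by (auto simp: W_def vadd_def)
    qed
    show "c \<odot>\<^bsub>V\<^esub> x \<in> W" if cx: "c \<in> carrier K" "x \<in> W" for c x
    proof -
      obtain u where u: "u \<in> Vec M" "mvec M a e x = mvec M b F u"
        using cx unfolding W_def by blast
      have x: "x \<in> Vec M" using that by (simp add: W_def)
      have "mvec M a e (\<lambda>i. sc c \<odot>\<^bsub>M\<^esub> x i) = mvec M b F (\<lambda>i. sc c \<odot>\<^bsub>M\<^esub> u i)"
        using that(1) x u e_Mat F_Mat by (simp add: scr)
      moreover have "(\<lambda>i. sc c \<odot>\<^bsub>M\<^esub> x i) \<in> Vec M" "(\<lambda>i. sc c \<odot>\<^bsub>M\<^esub> u i) \<in> Vec M"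
        using that(1) x u by (auto simp: Vec_def)
      ultimately show ?thesis by (auto simp: W_def)
    qed
  qed (auto simp: W_def)
  show "\<exists>w\<in>Vec M. mvec M b F w = z"
  proof (rule ccontr)
    assume "\<not> (\<exists>w\<in>Vec M. mvec M b F w = z)"
    then have "z \<notin> W" using ez by (auto simp: W_def)
    then obtain \<phi> where \<phi>: "\<phi> \<in> mod_hom K V (regular_module K)"
      and \<phi>W: "\<And>w. w \<in> W \<Longrightarrow> \<phi> w = \<zero>\<^bsub>K\<^esub>" and \<phi>z: "\<phi> z \<noteq> \<zero>\<^bsub>K\<^esub>"
      using exists_functional[OF K.field_axioms V.left_module W, of z] z by auto
    interpret \<phi>: mod_hom_loc K V "regular_module K" \<phi>
      by (rule mod_hom_locI[OF V.left_module R.left_module_regular \<phi>])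
    \<comment> \<open>\<open>fixed_by_e\<close> explains the argument of \<phi>: it is the
      homomorphism P1 -> M given by g and m.\<close>
    define \<beta> where "\<beta> g m = \<phi> (\<lambda>i. g (xs1 i) \<odot>\<^bsub>M\<^esub> m)" for g m
    have vec: "(\<lambda>i. g (xs1 i) \<odot>\<^bsub>M\<^esub> m) \<in> Vec M" if "g \<in> carrier H" "m \<in> carrier M" for g m
      using H_Vec[OF that(1)] that(2) by (simp add: Vec_def)
    have \<beta>_closed: "\<beta> g m \<in> carrier K" if "g \<in> carrier H" "m \<in> carrier M" for g m
      unfolding \<beta>_def using \<phi>.closed[of "\<lambda>i. g (xs1 i) \<odot>\<^bsub>M\<^esub> m"] vec[OF that] by simp
    have gx: "g (xs1 i) \<in> carrier A" if "g \<in> carrier H" for g i using H_Vec[OF that] by (simp add: Vec_def)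
    have xsc: "xs1 i \<in> carrier P1" for i by (rule VecD[OF xs1])
    have add1: "\<beta> (g \<oplus>\<^bsub>H\<^esub> g') m = \<beta> g m \<oplus>\<^bsub>K\<^esub> \<beta> g' m"
      if "g \<in> carrier H" "g' \<in> carrier H" "m \<in> carrier M" for g g' m
      unfolding \<beta>_def using \<phi>.add[of "\<lambda>i. g (xs1 i) \<odot>\<^bsub>M\<^esub> m" "\<lambda>i. g' (xs1 i) \<odot>\<^bsub>M\<^esub> m"] vec[OF that(1,3)] vec[OF that(2,3)]
      by (simp add: xsc M.smult_l_distr[OF gx[OF that(1)] gx[OF that(2)] that(3)])
    have add2: "\<beta> g (m \<oplus>\<^bsub>M\<^esub> m') = \<beta> g m \<oplus>\<^bsub>K\<^esub> \<beta> g m'"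
      if "g \<in> carrier H" "m \<in> carrier M" "m' \<in> carrier M" for g m m'
      unfolding \<beta>_def using \<phi>.add[of "\<lambda>i. g (xs1 i) \<odot>\<^bsub>M\<^esub> m" "\<lambda>i. g (xs1 i) \<odot>\<^bsub>M\<^esub> m'"] vec[OF that(1,2)] vec[OF that(1,3)]
      by (simp add: M.smult_r_distr[OF gx[OF that(1)] that(2,3)])
    have bal: "\<beta> g (l \<odot>\<^bsub>M\<^esub> m) = \<beta> (l \<odot>\<^bsub>H\<^esub> g) m" if "g \<in> carrier H" "m \<in> carrier M" "l \<in> carrier A" for g m l
      unfolding \<beta>_def by (simp add: xsc M.smult_assoc1[OF gx[OF that(1)] that(3,2)])
    have vanish: "\<beta> g m = \<zero>\<^bsub>K\<^esub>" if gm: "g \<in> I" "m \<in> carrier M" for g m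
    proof -
      have gH: "g \<in> carrier H" using submodule_subset[OF submodule_I] gm(1) by blast
      obtain h where h: "h \<in> mod_hom A P0 (regular_module A)" "g = compose (carrier P1) h f1"
        using gm(1) by (auto simp: I_def)
      interpret h: mod_hom_loc A P0 "regular_module A" h
        by (rule mod_hom_locI[OF P0.left_module ring.left_module_regular[OF ring_A] h(1)])
      let ?w = "\<lambda>j. h (xs0 j) \<odot>\<^bsub>M\<^esub> m"
      have hx: "h (xs0 j) \<in> carrier A" for j using h.closed[OF VecD[OF xs0]] by simp
      have w: "?w \<in> Vec M" using hx that(2) by (simp add: Vec_def)
      have "(\<lambda>i. g (xs1 i) \<odot>\<^bsub>M\<^esub> m) = mvec M b F ?w"
      proof
        fix i
        have fx: "f1 (xs1 i) \<in> carrier P0" by (rule f1.closed[OF xsc])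
        have "g (xs1 i) = h (f1 (xs1 i))" by (simp add: h(2) compose_def xsc)
        also have "\<dots> = ssum A b (\<lambda>j. F i j \<otimes>\<^bsub>A\<^esub> h (xs0 j))"
          using h.lcomb[OF c0[OF fx] xs0, of b] expand0[OF fx] by (simp add: lcomb_def F_def)
        finally show "g (xs1 i) \<odot>\<^bsub>M\<^esub> m = mvec M b F ?w i"
          using M.ssum_smult[OF that(2), of b "\<lambda>j. F i j \<otimes>\<^bsub>A\<^esub> h (xs0 j)"] MatDD[OF F_Mat] hx that(2)
          by (simp add: mvec_def lcomb_def M.smult_assoc1)
      qed
      moreover have "mvec M b F ?w \<in> W"
        unfolding W_def using w e_Mat F_Mat eF by (auto simp flip: M.mvec_mmul intro!: bexI[OF _ w])
      ultimately show ?thesis unfolding \<beta>_def by (simp add: \<phi>W)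
    qed
    have \<beta>_cong: "\<beta> g m = \<beta> g' m" if "g \<in> carrier H" "g' \<in> carrier H" "m \<in> carrier M" "T.coset g = T.coset g'" for g g' m
    proof -
      have "\<beta> (g \<ominus>\<^bsub>H\<^esub> g') m = \<beta> g m \<ominus>\<^bsub>K\<^esub> \<beta> g' m"
        by (rule additive_diff[OF H.M.abelian_group_axioms R.is_abelian_group, of "\<lambda>g. \<beta> g m"])
          (use that add1 \<beta>_closed in \<open>blast+\<close>)
      moreover have "\<beta> (g \<ominus>\<^bsub>H\<^esub> g') m = \<zero>\<^bsub>K\<^esub>"
        using T.coset_eq_iff[OF that(2,1)] that by (intro vanish) simp_all
      ultimately show ?thesis using R.minus_zero_iff[OF \<beta>_closed \<beta>_closed, of g m g' m] that by simp
    qed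
    \<comment> \<open>A representative is chosen in each coset; \<open>\<beta>_cong\<close> shows
      that the choice does not matter.\<close>
    define \<Phi> where "\<Phi> = (\<lambda>m\<in>carrier M. \<lambda>C\<in>carrier T. \<beta> (SOME g. g \<in> C) m)"
    have \<Phi>: "\<Phi> m (T.coset g) = \<beta> g m" if "m \<in> carrier M" "g \<in> carrier H" for m g
    proof -
      have s: "(SOME h. h \<in> T.coset g) \<in> T.coset g" by (rule someI[of "\<lambda>h. h \<in> T.coset g", OF T.coset_self[OF that(2)]])
      have sH: "(SOME h. h \<in> T.coset g) \<in> carrier H" by (rule T.coset_subset[OF that(2) s])
      show ?thesis
        using \<beta>_cong[OF sH that(2,1) T.coset_of_mem[OF that(2) s]] that T.coset_closed[OF that(2)]
        by (simp add: \<Phi>_def)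
    qed
    have scH: "\<beta> (sc c \<odot>\<^bsub>H\<^esub> g) m = c \<otimes>\<^bsub>K\<^esub> \<beta> g m" if "c \<in> carrier K" "g \<in> carrier H" "m \<in> carrier M" for c g m
    proof -
      have "(\<lambda>i. (sc c \<odot>\<^bsub>H\<^esub> g) (xs1 i) \<odot>\<^bsub>M\<^esub> m) = c \<odot>\<^bsub>V\<^esub> (\<lambda>i. g (xs1 i) \<odot>\<^bsub>M\<^esub> m)"
        using that gx[OF that(2)] by (simp add: xsc fun_eq_iff mult_sc flip: sc_mult M.smult_assoc1)
      then show ?thesis
        unfolding \<beta>_def using \<phi>.smult[OF that(1), of "\<lambda>i. g (xs1 i) \<odot>\<^bsub>M\<^esub> m"] vec[OF that(2,3)] by simp
    qed
    have \<Phi>_out: "\<Phi> m C = undefined" if "m \<in> carrier M" "C \<notin> carrier T" for m C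
      using that by (simp add: \<Phi>_def)
    have \<Phi>D: "\<Phi> m \<in> carrier D" if m: "m \<in> carrier M" for m
      unfolding D_simps
    proof (rule mod_homI; unfold stf_T_simps regular_module_simps)
      show "\<Phi> m C \<in> carrier K" if "C \<in> carrier T" for C
        using that by (auto elim!: T.Q_carrierE simp: \<Phi> m \<beta>_closed)
      show "\<Phi> m (C \<oplus>\<^bsub>T\<^esub> C') = \<Phi> m C \<oplus>\<^bsub>K\<^esub> \<Phi> m C'" if CC: "C \<in> carrier T" "C' \<in> carrier T" for C C'
      proof -
        obtain g g' where g: "g \<in> carrier H" "C = T.coset g" "g' \<in> carrier H" "C' = T.coset g'"
          using CC T.Q_carrierE by metis
        show ?thesis
          using \<Phi>[OF m H.M.a_closed[OF g(1,3)]] \<Phi>[OF m g(1)] \<Phi>[OF m g(3)] T.Q_add[OF g(1,3)] add1[OF g(1,3) m]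
          by (simp add: g(2,4))
      qed
      show "\<Phi> m (sc c \<odot>\<^bsub>T\<^esub> C) = c \<otimes>\<^bsub>K\<^esub> \<Phi> m C" if cC: "c \<in> carrier K" "C \<in> carrier T" for c C
      proof -
        obtain g where g: "g \<in> carrier H" "C = T.coset g" using cC(2) by (rule T.Q_carrierE)
        have c: "sc c \<in> carrier (op_ring A)" using that(1) by simp
        show ?thesis
          using \<Phi>[OF m H.smult_closed[OF c g(1)]] \<Phi>[OF m g(1)] T.Q_smult[OF c g(1)] scH[OF that(1) g(1) m]
          by (simp add: g(2))
      qed
    qed (rule \<Phi>_out[OF m])
    have "\<Phi> \<in> mod_hom A M D"
    proof (rule mod_homI)
      fix m m' assume m: "m \<in> carrier M" "m' \<in> carrier M"
      have "\<Phi> (m \<oplus>\<^bsub>M\<^esub> m') C = (\<Phi> m \<oplus>\<^bsub>D\<^esub> \<Phi> m') C" for C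
      proof (cases "C \<in> carrier T")
        case True
        then obtain g where "g \<in> carrier H" "C = T.coset g" by (rule T.Q_carrierE)
        then show ?thesis using True m by (simp add: D_simps \<Phi> add2)
      qed (use m in \<open>simp add: D_simps \<Phi>_out\<close>)
      then show "\<Phi> (m \<oplus>\<^bsub>M\<^esub> m') = \<Phi> m \<oplus>\<^bsub>D\<^esub> \<Phi> m'" ..
    next
      fix l m assume m: "l \<in> carrier A" "m \<in> carrier M"
      have "\<Phi> (l \<odot>\<^bsub>M\<^esub> m) C = (l \<odot>\<^bsub>D\<^esub> \<Phi> m) C" for C
      proof (cases "C \<in> carrier T")
        case True
        then obtain g where g: "g \<in> carrier H" "C = T.coset g" by (rule T.Q_carrierE)
        have l: "l \<in> carrier (op_ring A)" using m(1) by simp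
        show ?thesis
          using True g(1) m \<Phi>[OF m(2) H.smult_closed[OF l g(1)]] T.Q_smult[OF l g(1)] bal[OF g(1) m(2,1)]
            \<Phi>[OF M.smult_closed[OF m] g(1)]
          by (simp add: D_simps g(2))
      qed (use m in \<open>simp add: D_simps \<Phi>_out\<close>)
      then show "\<Phi> (l \<odot>\<^bsub>M\<^esub> m) = l \<odot>\<^bsub>D\<^esub> \<Phi> m" ..
    qed (use \<Phi>D in \<open>simp_all add: \<Phi>_def\<close>)
    from zero[OF this] have all0: "\<beta> g m = \<zero>\<^bsub>K\<^esub>" if "g \<in> carrier H" "m \<in> carrier M" for g m
      using \<Phi>[OF that(2,1)] that T.coset_closed[OF that(1)] by (simp add: D_simps)
    have ssumV: "ssum V n f = (\<lambda>i. ssum M n (\<lambda>k. f k i))" for n f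
      by (induction n) simp_all
    \<comment> \<open>Since e z = z, the vector z is the sum of the vectors with entries e i k z k.
      Each is the argument of the pairing for the k-th coordinate function and z k.\<close>
    have "z = ssum V a (\<lambda>k i. e i k \<odot>\<^bsub>M\<^esub> z k)"
      unfolding ssumV using ez by (simp add: mvec_def lcomb_def fun_eq_iff)
    then have "\<phi> z = \<phi> (ssum V a (\<lambda>k i. e i k \<odot>\<^bsub>M\<^esub> z k))" by simp
    also have "\<dots> = ssum (regular_module K) a (\<lambda>k. \<phi> (\<lambda>i. e i k \<odot>\<^bsub>M\<^esub> z k))"
      using MatDD[OF e_Mat] z by (intro \<phi>.ssum) (simp add: Vec_def)
    also have "\<dots> = ssum K a (\<lambda>k. \<beta> (coord k) (z k))"
      by (simp add: \<beta>_def coord_def xsc e_def)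
    also have "\<dots> = \<zero>\<^bsub>K\<^esub>"
      using z coord_H by (simp add: all0 VecD)
    finally show False using \<phi>z by simp
  qed
qed

end

text \<open>\<open>tau_rigid\<close> refers to the one minimal presentation picked by choice,
  \<open>rigid\<close> to an unspecified one; \<open>factors_transfer\<close> bridges the gap from
  right to left.\<close>

lemma (in fd_algebra) tau_rigid_iff:
  assumes "left_module A M" "finitely_generated A M"
  shows "tau_rigid K A M \<longleftrightarrow> rigid A M"
proof -
  define p where "p = (SOME p. minimal_presentation A M p)"
  have p: "minimal_presentation A M p"
    unfolding p_def using someI_ex[OF ex_minimal_presentation[OF assms]] .
  obtain P1 P0 f1 f0 where peq: "p = (P1, P0, f1, f0)" by (cases p)
  have mp: "fg_projective A P1" "fg_projective A P0" "f1 \<in> mod_hom A P1 P0" "f0 \<in> mod_hom A P0 M"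
    "f0 ` carrier P0 = carrier M" "f1 ` carrier P1 = mod_ker P0 M f0"
    "superfluous A P1 (mod_ker P1 P0 f1)"
    using p by (simp_all add: peq minimal_presentation_def)
  obtain a xs1 c1 where b1: "dual_basis A P1 a xs1 c1" by (rule fg_projective_dual_basis[OF mp(1)])
  obtain b xs0 c0 where b0: "dual_basis A P0 b xs0 c0" by (rule fg_projective_dual_basis[OF mp(2)])
  have lm: "left_module A P1" "left_module A P0" using mp by (simp_all add: fg_projective_def)
  interpret P: presentation A P1 P0 M f1 f0 a b xs1 c1 xs0 c0
    by (intro presentation.intro presentation_axioms.intro lm assms(1) mp b1 b0)
  interpret T: tau_presentation K A P1 P0 M f1 f0 a b xs1 c1 xs0 c0
    by (intro tau_presentation.intro fd_algebra_axioms P.presentation_axioms)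
  have D: "AR_translate K A M = T.D"
    unfolding AR_translate_def p_def[symmetric] peq by (simp add: transpose_of_def T.D_def T.H_def T.I_def)
  show ?thesis
  proof
    assume "tau_rigid K A M"
    then have "factors M a b P.e P.F"
      unfolding tau_rigid_def D by (intro T.zero_imp_factors) auto
    then show "rigid A M" using P.pres unfolding rigid_def by blast
  next
    assume "rigid A M"
    then obtain a' b' e' d' F' y' where "pres A M a' b' e' d' F' y'" "factors M a' b' e' F'"
      unfolding rigid_def by blast
    from factors_transfer[OF assms(1) this P.pres P.right_minimal[OF mp(7)]]
    have "factors M a b P.e P.F" .
    then show "tau_rigid K A M"
      unfolding tau_rigid_def D using T.factors_imp_zero T.zero_hom by blast
  qed
qed

lemma (in abelian_group) add_minus_right_cancel:
  "x \<in> carrier G \<Longrightarrow> y \<in> carrier G \<Longrightarrow> (x \<oplus> y) \<ominus> y = x"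
  by (simp add: a_minus_def a_assoc r_neg)

section \<open>Semilinear maps\<close>

text \<open>Needed in both directions: along \<iota> for the map m to 1 \<otimes> m into the induced
  module, and along \<pi> for reduction modulo m.\<close>

locale semilinear = N: left_module L N + M: left_module A M
  for L :: "('l, 'c) ring_scheme" and A :: "('a, 'd) ring_scheme" and N :: "('l, 'n) module"
    and M :: "('a, 'm) module" +
  fixes h :: "'l \<Rightarrow> 'a" and q :: "'n \<Rightarrow> 'm"
  assumes h: "h \<in> ring_hom L A"
    and q_closed: "x \<in> carrier N \<Longrightarrow> q x \<in> carrier M"
    and q_add: "x \<in> carrier N \<Longrightarrow> x' \<in> carrier N \<Longrightarrow> q (x \<oplus>\<^bsub>N\<^esub> x') = q x \<oplus>\<^bsub>M\<^esub> q x'"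
    and q_smult: "l \<in> carrier L \<Longrightarrow> x \<in> carrier N \<Longrightarrow> q (l \<odot>\<^bsub>N\<^esub> x) = h l \<odot>\<^bsub>M\<^esub> q x"
begin

lemma h_closed: "l \<in> carrier L \<Longrightarrow> h l \<in> carrier A"
  by (rule ring_hom_closed[OF h])

lemma h_add: "l \<in> carrier L \<Longrightarrow> l' \<in> carrier L \<Longrightarrow> h (l \<oplus>\<^bsub>L\<^esub> l') = h l \<oplus>\<^bsub>A\<^esub> h l'"
  by (rule ring_hom_add[OF h])

lemma h_mult: "l \<in> carrier L \<Longrightarrow> l' \<in> carrier L \<Longrightarrow> h (l \<otimes>\<^bsub>L\<^esub> l') = h l \<otimes>\<^bsub>A\<^esub> h l'"
  by (rule ring_hom_mult[OF h])

lemma h_zero: "h \<zero>\<^bsub>L\<^esub> = \<zero>\<^bsub>A\<^esub>"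
  by (rule additive_zero[OF N.R.is_abelian_group M.R.is_abelian_group h_closed h_add])

lemma q_zero: "q \<zero>\<^bsub>N\<^esub> = \<zero>\<^bsub>M\<^esub>"
  by (rule additive_zero[OF N.M.abelian_group_axioms M.M.abelian_group_axioms q_closed q_add])

lemma h_diff: "l \<in> carrier L \<Longrightarrow> l' \<in> carrier L \<Longrightarrow> h (l \<ominus>\<^bsub>L\<^esub> l') = h l \<ominus>\<^bsub>A\<^esub> h l'"
  by (rule additive_diff[OF N.R.is_abelian_group M.R.is_abelian_group h_closed h_add])

lemma q_diff: "x \<in> carrier N \<Longrightarrow> x' \<in> carrier N \<Longrightarrow> q (x \<ominus>\<^bsub>N\<^esub> x') = q x \<ominus>\<^bsub>M\<^esub> q x'"
  by (rule additive_diff[OF N.M.abelian_group_axioms M.M.abelian_group_axioms q_closed q_add])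

lemma h_ssum: "(\<And>i. i < n \<Longrightarrow> f i \<in> carrier L) \<Longrightarrow> h (ssum L n f) = ssum A n (\<lambda>i. h (f i))"
  by (rule ssum_hom[OF N.R.is_abelian_group M.R.is_abelian_group h_add h_zero])

lemma q_ssum: "(\<And>i. i < n \<Longrightarrow> f i \<in> carrier N) \<Longrightarrow> q (ssum N n f) = ssum M n (\<lambda>i. q (f i))"
  by (rule ssum_hom[OF N.M.abelian_group_axioms M.M.abelian_group_axioms q_add q_zero])

lemma q_lcomb: "v \<in> Vec L \<Longrightarrow> x \<in> Vec N \<Longrightarrow> q (lcomb N n v x) = lcomb M n (\<lambda>i. h (v i)) (\<lambda>i. q (x i))"
  by (simp add: lcomb_def q_ssum q_smult Vec_def)

lemma h_Mat: "B \<in> Mat L \<Longrightarrow> (\<lambda>i j. h (B i j)) \<in> Mat A"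
  by (simp add: Mat_def Vec_def h_closed)

lemma h_Vec: "v \<in> Vec L \<Longrightarrow> (\<lambda>i. h (v i)) \<in> Vec A"
  by (simp add: Vec_def h_closed)

lemma q_Vec: "x \<in> Vec N \<Longrightarrow> (\<lambda>i. q (x i)) \<in> Vec M"
  by (simp add: Vec_def q_closed)

lemma q_mvec: "B \<in> Mat L \<Longrightarrow> x \<in> Vec N \<Longrightarrow>
    (\<lambda>i. q (mvec N n B x i)) = mvec M n (\<lambda>i j. h (B i j)) (\<lambda>i. q (x i))"
  by (simp add: mvec_def q_lcomb MatD)

lemma h_mmul: "B \<in> Mat L \<Longrightarrow> C \<in> Mat L \<Longrightarrow>
    (\<lambda>i j. h (mmul L n B C i j)) = mmul A n (\<lambda>i j. h (B i j)) (\<lambda>i j. h (C i j))"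
  by (simp add: mmul_def h_ssum h_mult MatDD)

end

text \<open>The outer and inner coefficients are interchanged, so they have to commute. It is
  applied to \<open>t\<close> against the image of A, and to the central generators \<open>c\<close>
  against any coefficients.\<close>

lemma (in left_module) lcomb_swap:
  assumes "u \<in> Vec R" "t \<in> Vec R" "\<And>k. x k \<in> Vec M" "\<And>i k. u i \<otimes> t k = t k \<otimes> u i"
  shows "lcomb M n u (\<lambda>i. lcomb M m t (\<lambda>k. x k i)) = lcomb M m t (\<lambda>k. lcomb M n u (x k))"
proof -
  have "lcomb M n u (\<lambda>i. lcomb M m t (\<lambda>k. x k i)) = ssum M n (\<lambda>i. ssum M m (\<lambda>k. (u i \<otimes> t k) \<odot>\<^bsub>M\<^esub> x k i))"
    using assms(1-3) by (simp add: lcomb_def smult_ssum smult_assoc1 Vec_def)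
  also have "\<dots> = ssum M m (\<lambda>k. ssum M n (\<lambda>i. (u i \<otimes> t k) \<odot>\<^bsub>M\<^esub> x k i))"
    using assms(1-3) by (intro M.ssum_swap) (simp add: Vec_def)
  also have "\<dots> = ssum M m (\<lambda>k. ssum M n (\<lambda>i. (t k \<otimes> u i) \<odot>\<^bsub>M\<^esub> x k i))"
    by (simp add: assms(4))
  also have "\<dots> = lcomb M m t (\<lambda>k. lcomb M n u (x k))"
    using assms(1-3) by (simp add: lcomb_def smult_ssum smult_assoc1 Vec_def)
  finally show ?thesis .
qed

lemma presD:
  assumes "pres A M a b e d F y"
  shows "e \<in> Mat A" "d \<in> Mat A" "F \<in> Mat A" "y \<in> Vec M"
    "mmul A a e e = e" "mmul A a e F = F" "mmul A b F d = F" "mvec M b d y = y"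
    "mvec M b F y = (\<lambda>_. \<zero>\<^bsub>M\<^esub>)"
    and "x \<in> Vec M \<Longrightarrow> \<exists>V\<in>Mat A. x = mvec M b V y"
    and "V \<in> Mat A \<Longrightarrow> mvec M b V y = (\<lambda>_. \<zero>\<^bsub>M\<^esub>) \<Longrightarrow> \<exists>U\<in>Mat A. mmul A b V d = mmul A a U F"
  using assms unfolding pres_def by blast+

lemma rigid_imp_finitely_generated:
  assumes "left_module A M" "rigid A M" shows "finitely_generated A M"
proof -
  obtain a b e d F y where p: "pres A M a b e d F y" using assms(2) unfolding rigid_def by blast
  have "\<exists>v\<in>Vec A. x = lcomb M b v y" if x: "x \<in> carrier M" for x
  proof -
    obtain V where "V \<in> Mat A" "(\<lambda>_. x) = mvec M b V y" using presD(10)[OF p, of "\<lambda>_. x"] x by (auto simp: Vec_def)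
    then show ?thesis by (intro bexI[of _ "V 0"]) (auto simp: mvec_def fun_eq_iff MatD)
  qed
  then show ?thesis
    unfolding finitely_generated_lcomb[OF assms(1)] using presD(4)[OF p] by blast
qed

section \<open>Coordinates of matrices and vectors over the extension\<close>

section \<open>Base change to a free extension\<close>

text \<open>Here \<open>L\<close> is spanned over the image of \<open>A\<close> by elements \<open>t k\<close> commuting with it, and \<open>E\<close> is
  \<open>L \<otimes>\<^sub>A M\<close>, with \<open>s m = 1 \<otimes> m\<close>.\<close>

locale free_extension = semilinear A L M E \<iota> s
  for A :: "('a, 'd) ring_scheme" and L :: "('l, 'c) ring_scheme" and M :: "('a, 'm) module"
    and E :: "('l, 'n) module" and \<iota> s +
  fixes n :: nat and t :: "nat \<Rightarrow> 'l"
  assumes t: "t \<in> Vec L"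
    and commute: "a \<in> carrier A \<Longrightarrow> \<iota> a \<otimes>\<^bsub>L\<^esub> t k = t k \<otimes>\<^bsub>L\<^esub> \<iota> a"
    and span: "l \<in> carrier L \<Longrightarrow> \<exists>u\<in>Vec A. l = ssum L n (\<lambda>k. t k \<otimes>\<^bsub>L\<^esub> \<iota> (u k))"
    and span_E: "x \<in> carrier E \<Longrightarrow> \<exists>m\<in>Vec M. x = lcomb E n t (\<lambda>k. s (m k))"
    and unique: "m \<in> Vec M \<Longrightarrow> lcomb E n t (\<lambda>k. s (m k)) = \<zero>\<^bsub>E\<^esub> \<Longrightarrow> k < n \<Longrightarrow> m k = \<zero>\<^bsub>M\<^esub>"
begin

text \<open>The family \<open>V\<close> lists the coordinate matrices over A with respect to
  \<open>t\<close>, and \<open>ex_Mexp\<close> says that every matrix over L arises so;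
  \<open>Vexp\<close> is the analogue for vectors of E.\<close>

definition "Mexp V = (\<lambda>i j. ssum L n (\<lambda>k. t k \<otimes>\<^bsub>L\<^esub> \<iota> (V k i j)))"

definition "Vexp x = (\<lambda>i. lcomb E n t (\<lambda>k. s (x k i)))"

lemma Mexp_Mat: "(\<And>k. V k \<in> Mat A) \<Longrightarrow> Mexp V \<in> Mat L"
  using t by (auto intro!: MatI M.R.ssum_closed simp: Mexp_def h_closed MatDD VecD)

lemma Vexp_Vec: "(\<And>k. x k \<in> Vec M) \<Longrightarrow> Vexp x \<in> Vec E"
  using t by (auto intro!: VecI M.lcomb_closed simp: Vexp_def q_closed VecD)

lemma ex_Mexp:
  assumes "V \<in> Mat L" shows "\<exists>W. (\<forall>k. W k \<in> Mat A) \<and> V = Mexp W"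
proof -
  have "\<forall>i j. \<exists>u\<in>Vec A. V i j = ssum L n (\<lambda>k. t k \<otimes>\<^bsub>L\<^esub> \<iota> (u k))"
    using span MatDD[OF assms] by blast
  then obtain u where u: "\<And>i j. u i j \<in> Vec A" "\<And>i j. V i j = ssum L n (\<lambda>k. t k \<otimes>\<^bsub>L\<^esub> \<iota> (u i j k))" by metis
  show ?thesis
    by (rule exI[of _ "\<lambda>k i j. u i j k"]) (use u in \<open>auto simp: Mexp_def Mat_def Vec_def fun_eq_iff\<close>)
qed

lemma ex_Vexp:
  assumes "x \<in> Vec E" shows "\<exists>m. (\<forall>k. m k \<in> Vec M) \<and> x = Vexp m"
proof -
  have "\<forall>i. \<exists>u\<in>Vec M. x i = lcomb E n t (\<lambda>k. s (u k))"
    using span_E VecD[OF assms] by blast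
  then obtain u where u: "\<And>i. u i \<in> Vec M" "\<And>i. x i = lcomb E n t (\<lambda>k. s (u i k))" by metis
  show ?thesis
    by (rule exI[of _ "\<lambda>k i. u i k"]) (use u in \<open>auto simp: Vexp_def Vec_def fun_eq_iff\<close>)
qed

text \<open>The \<open>t k\<close> stand on the left, so applying the matrix to a vector coming from
  M happens coordinate by coordinate.\<close>

lemma mvec_Mexp:
  assumes "\<And>k. V k \<in> Mat A" "y \<in> Vec M"
  shows "mvec E m (Mexp V) (\<lambda>i. s (y i)) = Vexp (\<lambda>k. mvec M m (V k) y)"
proof
  fix i
  have Y: "(\<lambda>k j. \<iota> (V k i j)) \<in> Mat L" using assms by (auto intro!: MatI simp: h_closed MatDD)
  have "mvec E m (Mexp V) (\<lambda>i. s (y i)) i = lcomb E n t (\<lambda>k. lcomb E m (\<lambda>j. \<iota> (V k i j)) (\<lambda>i. s (y i)))"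
    unfolding mvec_def Mexp_def by (rule M.lcomb_lcomb[OF t Y q_Vec[OF assms(2)]])
  also have "\<dots> = Vexp (\<lambda>k. mvec M m (V k) y) i"
    using q_lcomb[OF MatD[OF assms(1)] assms(2)] by (simp add: Vexp_def mvec_def)
  finally show "mvec E m (Mexp V) (\<lambda>i. s (y i)) i = Vexp (\<lambda>k. mvec M m (V k) y) i" .
qed

lemma mmul_Mexp:
  assumes "\<And>k. V k \<in> Mat A" "B \<in> Mat A"
  shows "mmul L m (Mexp V) (\<lambda>i j. \<iota> (B i j)) = Mexp (\<lambda>k. mmul A m (V k) B)"
proof (intro ext)
  fix i j
  interpret reg: left_module L "regular_module L" by (rule M.R.left_module_regular)
  have Y: "(\<lambda>k j. \<iota> (V k i j)) \<in> Mat L" using assms by (auto intro!: MatI simp: h_closed MatDD)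
  have B: "(\<lambda>k. \<iota> (B k j)) \<in> Vec (regular_module L)" using assms by (auto intro!: VecI simp: h_closed MatDD)
  have "mmul L m (Mexp V) (\<lambda>i j. \<iota> (B i j)) i j =
      lcomb (regular_module L) m (\<lambda>j. ssum L n (\<lambda>k. t k \<otimes>\<^bsub>L\<^esub> \<iota> (V k i j))) (\<lambda>k. \<iota> (B k j))"
    by (simp add: mmul_def lcomb_def Mexp_def)
  also have "\<dots> = lcomb (regular_module L) n t (\<lambda>k. lcomb (regular_module L) m (\<lambda>j. \<iota> (V k i j)) (\<lambda>k. \<iota> (B k j)))"
    by (rule reg.lcomb_lcomb[OF t Y B])
  also have "\<dots> = Mexp (\<lambda>k. mmul A m (V k) B) i j"
    using assms by (simp add: Mexp_def lcomb_def mmul_def h_ssum h_mult MatDD)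
  finally show "mmul L m (Mexp V) (\<lambda>i j. \<iota> (B i j)) i j = Mexp (\<lambda>k. mmul A m (V k) B) i j" .
qed

text \<open>Here the matrix has entries in A and has to move past the \<open>t k\<close>; this is
  what \<open>commute\<close> provides.\<close>

lemma mvec_Vexp:
  assumes "\<And>k. x k \<in> Vec M" "B \<in> Mat A"
  shows "mvec E m (\<lambda>i j. \<iota> (B i j)) (Vexp x) = Vexp (\<lambda>k. mvec M m B (x k))"
proof
  fix i
  have "mvec E m (\<lambda>i j. \<iota> (B i j)) (Vexp x) i = lcomb E n t (\<lambda>k. lcomb E m (\<lambda>j. \<iota> (B i j)) (\<lambda>j. s (x k j)))"
    unfolding mvec_def Vexp_def
    by (rule M.lcomb_swap) (use assms t in \<open>auto simp: commute MatDD q_Vec h_Vec MatD\<close>)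
  also have "\<dots> = Vexp (\<lambda>k. mvec M m B (x k)) i"
    using q_lcomb[OF MatD[OF assms(2)] assms(1)] by (simp add: Vexp_def mvec_def)
  finally show "mvec E m (\<lambda>i j. \<iota> (B i j)) (Vexp x) i = Vexp (\<lambda>k. mvec M m B (x k)) i" .
qed

lemma Mexp_cong: "(\<And>k. k < n \<Longrightarrow> V k = W k) \<Longrightarrow> Mexp V = Mexp W"
  unfolding Mexp_def by (auto intro!: ext ssum_cong)

text \<open>The matrices are kept and \<iota> is applied to their entries. In coordinates with
  respect to \<open>t\<close>, spanning, exactness and factorization over L become \<open>n\<close>
  copies of the statements over A; exactness needs that coordinates in E are unique.\<close>

lemma rigid_extension:
  assumes "rigid A M" shows "rigid L E"
proof -
  obtain a b e d F y where p: "pres A M a b e d F y" and fac: "factors M a b e F"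
    using assms unfolding rigid_def by blast
  note pM = presD(1-4)[OF p]
  let ?e = "\<lambda>i j. \<iota> (e i j)" and ?d = "\<lambda>i j. \<iota> (d i j)" and ?F = "\<lambda>i j. \<iota> (F i j)" and ?y = "\<lambda>i. s (y i)"
  have "pres L E a b ?e ?d ?F ?y"
    unfolding pres_def
  proof (intro conjI ballI impI h_Mat q_Vec pM)
    show "mmul L a ?e ?e = ?e" using h_mmul[OF pM(1,1), of a] presD(5)[OF p] by simp
    show "mmul L a ?e ?F = ?F" using h_mmul[OF pM(1,3), of a] presD(6)[OF p] by simp
    show "mmul L b ?F ?d = ?F" using h_mmul[OF pM(3,2), of b] presD(7)[OF p] by simp
    show "mvec E b ?d ?y = ?y" using q_mvec[OF pM(2,4), of b] presD(8)[OF p] by simp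
    show "mvec E b ?F ?y = (\<lambda>_. \<zero>\<^bsub>E\<^esub>)" using q_mvec[OF pM(3,4), of b] presD(9)[OF p] by (simp add: q_zero)
  next
    fix x assume "x \<in> Vec E"
    then obtain m where m: "\<And>k. m k \<in> Vec M" "x = Vexp m" using ex_Vexp by blast
    have "\<forall>k. \<exists>V\<in>Mat A. m k = mvec M b V y" using presD(10)[OF p] m(1) by blast
    then obtain V where V: "\<And>k. V k \<in> Mat A" "\<And>k. m k = mvec M b (V k) y" by metis
    have "x = mvec E b (Mexp V) ?y"
      using mvec_Mexp[of V, OF V(1) pM(4), of b] by (simp add: m(2) V(2)[symmetric])
    then show "\<exists>V\<in>Mat L. x = mvec E b V ?y" using Mexp_Mat[of V, OF V(1)] by blast
  next
    fix V assume V: "V \<in> Mat L" "mvec E b V ?y = (\<lambda>_. \<zero>\<^bsub>E\<^esub>)"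
    obtain W where W: "\<And>k. W k \<in> Mat A" "V = Mexp W" using ex_Mexp[OF V(1)] by blast
    have 0: "Vexp (\<lambda>k. mvec M b (W k) y) = (\<lambda>_. \<zero>\<^bsub>E\<^esub>)"
      using V(2) mvec_Mexp[of W, OF W(1) pM(4), of b] by (simp add: W(2))
    have "mvec M b (W k) y = (\<lambda>_. \<zero>\<^bsub>M\<^esub>)" if "k < n" for k
    proof
      fix i
      show "mvec M b (W k) y i = \<zero>\<^bsub>M\<^esub>"
        using fun_cong[OF 0, of i] that N.mvec_Vec[OF W(1) pM(4)]
        by (intro unique[of "\<lambda>k. mvec M b (W k) y i"]) (simp_all add: Vexp_def Vec_def)
    qed
    \<comment> \<open>The conclusion is made conditional because uniqueness speaks of indices below
      \<open>n\<close> only, while \<open>Mexp\<close> wants a matrix for every index.\<close>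
    then have "\<exists>U\<in>Mat A. k < n \<longrightarrow> mmul A b (W k) d = mmul A a U F" for k
      using presD(11)[OF p W(1), of k] pM(1) by blast
    then obtain U where U: "\<And>k. U k \<in> Mat A" "\<And>k. k < n \<Longrightarrow> mmul A b (W k) d = mmul A a (U k) F"
      by metis
    have "mmul L b V ?d = mmul L a (Mexp U) ?F"
      using mmul_Mexp[of W, OF W(1) pM(2), of b] mmul_Mexp[of U, OF U(1) pM(3), of a] Mexp_cong[OF U(2)] by (simp add: W(2))
    then show "\<exists>U\<in>Mat L. mmul L b V ?d = mmul L a U ?F" using Mexp_Mat[of U, OF U(1)] by blast
  qed
  moreover have "factors E a b ?e ?F"
    unfolding factors_def
  proof (intro ballI impI)
    fix z assume z: "z \<in> Vec E" "mvec E a ?e z = z"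
    obtain x where x: "\<And>k. x k \<in> Vec M" "z = Vexp x" using ex_Vexp[OF z(1)] by blast
    have "mvec M a e (mvec M a e (x k)) = mvec M a e (x k)" for k
      using presD(5)[OF p] pM x by (simp flip: N.mvec_mmul)
    then have "\<forall>k. \<exists>w\<in>Vec M. mvec M b F w = mvec M a e (x k)"
      using fac x pM N.mvec_Vec unfolding factors_def by blast
    then obtain w where w: "\<And>k. w k \<in> Vec M" "\<And>k. mvec M b F (w k) = mvec M a e (x k)" by metis
    have "mvec E b ?F (Vexp w) = mvec E a ?e (Vexp x)"
      using mvec_Vexp[of w, OF w(1) pM(3), of b] mvec_Vexp[of x, OF x(1) pM(1), of a] by (simp add: w(2))
    then show "\<exists>w\<in>Vec E. mvec E b ?F w = z" using Vexp_Vec[of w, OF w(1)] z(2) x(2) by (intro bexI[of _ "Vexp w"]) simp_all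
  qed
  ultimately show ?thesis unfolding rigid_def by blast
qed

text \<open>A decomposition of M extends to one of E, by letting all coordinates range over a
  summand.\<close>

lemma indecomposable_restriction:
  assumes "indecomposable L E" shows "indecomposable A M"
proof -
  have E0: "carrier E \<noteq> {\<zero>\<^bsub>E\<^esub>}"
    and ind: "\<And>U V. submodule U L E \<Longrightarrow> submodule V L E \<Longrightarrow> U \<inter> V = {\<zero>\<^bsub>E\<^esub>} \<Longrightarrow>
      U <+>\<^bsub>E\<^esub> V = carrier E \<Longrightarrow> U = {\<zero>\<^bsub>E\<^esub>} \<or> V = {\<zero>\<^bsub>E\<^esub>}"
    using assms by (auto simp: indecomposable_def)
  obtain x where x: "x \<in> carrier E" "x \<noteq> \<zero>\<^bsub>E\<^esub>" using E0 M.M.zero_closed by blast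
  then obtain m where m: "m \<in> Vec M" "x = lcomb E n t (\<lambda>k. s (m k))" using span_E by blast
  have M0: "carrier M \<noteq> {\<zero>\<^bsub>M\<^esub>}"
  proof
    assume "carrier M = {\<zero>\<^bsub>M\<^esub>}"
    then have "m = (\<lambda>_. \<zero>\<^bsub>M\<^esub>)" using m(1) by (auto simp: Vec_def fun_eq_iff)
    then show False using x(2) m(2) t by (simp add: q_zero)
  qed
  \<comment> \<open>At least one coordinate is needed to see that a nonzero submodule of M has a
    nonzero extension.\<close>
  have "n \<noteq> 0" using x(2) m(2) by (cases n) auto
  then have n: "0 < n" by simp
  define ext where "ext U = {lcomb E n t (\<lambda>k. s (m k)) | m. \<forall>k. m k \<in> U}" for U
  have extI: "lcomb E n t (\<lambda>k. s (m k)) \<in> ext U" if "\<And>k. m k \<in> U" for m U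
    using that by (auto simp: ext_def)
  have ext: "submodule (ext U) L E" if U: "submodule U A M" for U
  proof (rule M.submoduleI)
    note UM = submodule_subset[OF U]
    have mV: "m \<in> Vec M" if "\<And>k. m k \<in> U" for m using that UM by (auto intro: VecI)
    show "ext U \<subseteq> carrier E" using mV t by (auto simp: ext_def intro!: M.lcomb_closed q_Vec)
    have "lcomb E n t (\<lambda>k. s \<zero>\<^bsub>M\<^esub>) \<in> ext U" by (rule extI) (rule submodule_zero[OF U])
    then show z: "\<zero>\<^bsub>E\<^esub> \<in> ext U" using t by (simp add: q_zero)
    show add: "x \<oplus>\<^bsub>E\<^esub> x' \<in> ext U" if xx: "x \<in> ext U" "x' \<in> ext U" for x x'
    proof -
      obtain m where m: "\<forall>k. m k \<in> U" "x = lcomb E n t (\<lambda>k. s (m k))" using xx by (auto simp: ext_def)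
      obtain m' where m': "\<forall>k. m' k \<in> U" "x' = lcomb E n t (\<lambda>k. s (m' k))" using xx by (auto simp: ext_def)
      have mm: "\<And>k. m k \<in> U" "\<And>k. m' k \<in> U" "x = lcomb E n t (\<lambda>k. s (m k))"
        "x' = lcomb E n t (\<lambda>k. s (m' k))" using m m' by auto
      have "lcomb E n t (\<lambda>k. s (m k \<oplus>\<^bsub>M\<^esub> m' k)) \<in> ext U"
        by (rule extI) (rule submodule_add[OF U mm(1,2)])
      then show ?thesis
        using M.lcomb_add_r[OF t q_Vec[OF mV[OF mm(1)]] q_Vec[OF mV[OF mm(2)]], of n] mm UM
        by (simp add: q_add subset_iff)
    qed
    show "l \<odot>\<^bsub>E\<^esub> x \<in> ext U" if lx: "l \<in> carrier L" "x \<in> ext U" for l x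
    proof -
      \<comment> \<open>Single generators come first: expanding the scalar in terms of
        \<open>t\<close> moves its coefficients into \<open>U\<close>. General elements are then
        sums of such terms.\<close>
      have gen: "l' \<odot>\<^bsub>E\<^esub> s m \<in> ext U" if l': "l' \<in> carrier L" and m: "m \<in> U" for l' m
      proof -
        obtain u where u: "u \<in> Vec A" "l' = ssum L n (\<lambda>k. t k \<otimes>\<^bsub>L\<^esub> \<iota> (u k))" using span[OF l'] by blast
        have mM: "m \<in> carrier M" using m UM by auto
        have "l' \<odot>\<^bsub>E\<^esub> s m = lcomb E n t (\<lambda>k. s (u k \<odot>\<^bsub>M\<^esub> m))"
          unfolding u(2) using t mM u(1)
          by (simp add: M.ssum_smult q_closed h_closed VecD lcomb_def M.smult_assoc1 q_smult)
        then show ?thesis using extI[of "\<lambda>k. u k \<odot>\<^bsub>M\<^esub> m"] submodule_smult[OF U VecD[OF u(1)] m] by simp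
      qed
      obtain m where m: "\<And>k. m k \<in> U" "x = lcomb E n t (\<lambda>k. s (m k))" using lx(2) by (auto simp: ext_def)
      have mM: "m k \<in> carrier M" for k using m(1) UM by auto
      have eq: "l \<odot>\<^bsub>E\<^esub> x = ssum E n (\<lambda>k. (l \<otimes>\<^bsub>L\<^esub> t k) \<odot>\<^bsub>E\<^esub> s (m k))"
        unfolding m(2) lcomb_def using t mM lx(1)
        by (simp add: M.smult_ssum q_closed VecD M.smult_assoc1)
      have "ssum E k' (\<lambda>k. (l \<otimes>\<^bsub>L\<^esub> t k) \<odot>\<^bsub>E\<^esub> s (m k)) \<in> ext U" for k'
        by (induction k') (use z add gen m(1) lx(1) t in \<open>simp_all add: VecD\<close>)
      then show ?thesis unfolding eq .
    qed
  qed
  have "U = {\<zero>\<^bsub>M\<^esub>} \<or> V = {\<zero>\<^bsub>M\<^esub>}"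
    if UV: "submodule U A M" "submodule V A M" "U \<inter> V = {\<zero>\<^bsub>M\<^esub>}" "U <+>\<^bsub>M\<^esub> V = carrier M" for U V
  proof -
    note sub = submodule_subset[OF UV(1)] submodule_subset[OF UV(2)]
    have "ext U \<inter> ext V = {\<zero>\<^bsub>E\<^esub>}"
    proof
      show "{\<zero>\<^bsub>E\<^esub>} \<subseteq> ext U \<inter> ext V" using submodule_zero[OF ext] UV by simp
      show "ext U \<inter> ext V \<subseteq> {\<zero>\<^bsub>E\<^esub>}"
      proof
        fix x assume x: "x \<in> ext U \<inter> ext V"
        obtain m where m: "\<forall>k. m k \<in> U" "x = lcomb E n t (\<lambda>k. s (m k))" using x by (auto simp: ext_def)
        obtain m' where m': "\<forall>k. m' k \<in> V" "x = lcomb E n t (\<lambda>k. s (m' k))" using x by (auto simp: ext_def)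
        have mm: "\<And>k. m k \<in> U" "\<And>k. m' k \<in> V" "x = lcomb E n t (\<lambda>k. s (m k))"
          "x = lcomb E n t (\<lambda>k. s (m' k))" using m m' by auto
        have v: "m \<in> Vec M" "m' \<in> Vec M" using m(1) m'(1) sub by (auto simp: Vec_def)
        have "lcomb E n t (\<lambda>k. s (m k \<ominus>\<^bsub>M\<^esub> m' k)) = x \<ominus>\<^bsub>E\<^esub> x"
          using M.lcomb_diff_r[OF t q_Vec[OF v(1)] q_Vec[OF v(2)], of n] v mm by (simp add: q_diff VecD)
        moreover have "x \<in> carrier E" unfolding mm(3) using t q_Vec[OF v(1)] by (rule M.lcomb_closed)
        ultimately have 0: "lcomb E n t (\<lambda>k. s (m k \<ominus>\<^bsub>M\<^esub> m' k)) = \<zero>\<^bsub>E\<^esub>" by (simp add: M.M.minus_zero_iff)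
        have "m k = \<zero>\<^bsub>M\<^esub>" if "k < n" for k
        proof -
          have "m k \<ominus>\<^bsub>M\<^esub> m' k = \<zero>\<^bsub>M\<^esub>"
            using v by (intro unique[OF _ 0 that]) (simp add: Vec_def)
          then have "m k = m' k" using N.M.minus_zero_iff[OF VecD[OF v(1)] VecD[OF v(2)]] by simp
          then show ?thesis using mm(1)[of k] mm(2)[of k] UV(3) by auto
        qed
        then have "x = lcomb E n t (\<lambda>k. \<zero>\<^bsub>E\<^esub>)" unfolding mm(3) by (intro lcomb_cong) (simp_all add: q_zero)
        then show "x \<in> {\<zero>\<^bsub>E\<^esub>}" using t by simp
      qed
    qed
    moreover have "ext U <+>\<^bsub>E\<^esub> ext V = carrier E"
    proof
      show "ext U <+>\<^bsub>E\<^esub> ext V \<subseteq> carrier E"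
        by (rule submodule_subset[OF M.submodule_set_add[OF ext[OF UV(1)] ext[OF UV(2)]]])
      show "carrier E \<subseteq> ext U <+>\<^bsub>E\<^esub> ext V"
      proof
        fix x assume "x \<in> carrier E"
        then obtain m where m: "m \<in> Vec M" "x = lcomb E n t (\<lambda>k. s (m k))" using span_E by blast
        have "\<forall>k. \<exists>u v. u \<in> U \<and> v \<in> V \<and> m k = u \<oplus>\<^bsub>M\<^esub> v"
          using UV(4) VecD[OF m(1)] N.set_add_iff by blast
        then obtain u v where uv: "\<And>k. u k \<in> U" "\<And>k. v k \<in> V" "\<And>k. m k = u k \<oplus>\<^bsub>M\<^esub> v k" by metis
        have vv: "u \<in> Vec M" "v \<in> Vec M" using uv(1,2) sub by (auto simp: Vec_def)
        have "x = lcomb E n t (\<lambda>k. s (u k)) \<oplus>\<^bsub>E\<^esub> lcomb E n t (\<lambda>k. s (v k))"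
          using M.lcomb_add_r[OF t q_Vec[OF vv(1)] q_Vec[OF vv(2)], of n] vv m(2) by (simp add: uv(3) q_add VecD)
        then show "x \<in> ext U <+>\<^bsub>E\<^esub> ext V"
          unfolding M.set_add_iff using extI[of u, OF uv(1)] extI[of v, OF uv(2)] by blast
      qed
    qed
    ultimately have "ext U = {\<zero>\<^bsub>E\<^esub>} \<or> ext V = {\<zero>\<^bsub>E\<^esub>}"
      using ind ext UV by blast
    moreover have "W = {\<zero>\<^bsub>M\<^esub>}" if W: "submodule W A M" "ext W = {\<zero>\<^bsub>E\<^esub>}" for W
    proof -
      have "m = \<zero>\<^bsub>M\<^esub>" if m: "m \<in> W" for m
      proof -
        have mM: "m \<in> carrier M" using submodule_subset[OF W(1)] m by auto
        have "lcomb E n t (\<lambda>k. s m) = \<zero>\<^bsub>E\<^esub>" using extI[of "\<lambda>_. m" W] m W(2) by simp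
        then show ?thesis using unique[of "\<lambda>_. m", OF _ _ n] mM by (simp add: Vec_def)
      qed
      then show ?thesis using submodule_zero[OF W(1)] by blast
    qed
    ultimately show ?thesis using UV by blast
  qed
  then show ?thesis using M0 unfolding indecomposable_def by blast
qed

end

section \<open>Reduction modulo a nilpotent ideal\<close>

text \<open>The kernel of \<open>\<pi> : L \<rightarrow> A\<close> is generated by central elements \<open>c 0, \<dots>, c (s - 1)\<close>, all long products
  of which vanish.\<close>

locale nil_extension = L: ring L + A: ring A for L :: "('l, 'c) ring_scheme" and A :: "('a, 'd) ring_scheme" +
  fixes \<pi> :: "'l \<Rightarrow> 'a" and \<iota> :: "'a \<Rightarrow> 'l" and c :: "nat \<Rightarrow> 'l" and s nil :: nat
  assumes \<pi>: "\<pi> \<in> ring_hom L A" and \<iota>: "\<iota> \<in> ring_hom A L"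
    and \<pi>_\<iota>: "a \<in> carrier A \<Longrightarrow> \<pi> (\<iota> a) = a"
    and c: "c \<in> Vec L" and \<pi>_c: "\<pi> (c j) = \<zero>\<^bsub>A\<^esub>"
    and central: "l \<in> carrier L \<Longrightarrow> l \<otimes>\<^bsub>L\<^esub> c j = c j \<otimes>\<^bsub>L\<^esub> l"
    and nil: "length w = nil \<Longrightarrow> set w \<subseteq> {..<s} \<Longrightarrow> foldl (\<lambda>p j. p \<otimes>\<^bsub>L\<^esub> c j) \<one>\<^bsub>L\<^esub> w = \<zero>\<^bsub>L\<^esub>"

text \<open>\<open>q\<close> identifies M with N/mN, where m is generated by the \<open>c j\<close>.
  A surjection with prescribed kernel is more flexible than the literal quotient: it covers
  \<Lambda>-modules induced from M as well as isomorphic copies of M.\<close>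

locale reduction = nil_extension L A \<pi> \<iota> c s nil + semilinear L A N M \<pi> q
  for L :: "('l, 'c) ring_scheme" and A :: "('a, 'd) ring_scheme" and N :: "('l, 'n) module"
    and M :: "('a, 'm) module" and \<pi> \<iota> c s nil q +
  assumes q_surj: "x \<in> carrier M \<Longrightarrow> \<exists>n\<in>carrier N. q n = x"
    and q_ker: "n \<in> carrier N \<Longrightarrow> q n = \<zero>\<^bsub>M\<^esub> \<Longrightarrow> \<exists>v\<in>Vec N. n = lcomb N s c v"
begin

lemma q_lcomb_c: "v \<in> Vec N \<Longrightarrow> q (lcomb N s c v) = \<zero>\<^bsub>M\<^esub>"
  using q_lcomb[OF c, of v s] q_Vec[of v] by (simp add: \<pi>_c)

lemma q_Vec_surj: assumes "x \<in> Vec M" obtains v where "v \<in> Vec N" "\<And>i. q (v i) = x i"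
proof -
  have "\<forall>i. \<exists>n\<in>carrier N. q n = x i" using q_surj VecD[OF assms] by blast
  then obtain v where "\<And>i. v i \<in> carrier N" "\<And>i. q (v i) = x i" by metis
  then show thesis by (intro that[of v]) (auto intro: VecI)
qed

lemma \<iota>_closed: "a \<in> carrier A \<Longrightarrow> \<iota> a \<in> carrier L"
  by (rule ring_hom_closed[OF \<iota>])

lemma \<iota>_Mat: "B \<in> Mat A \<Longrightarrow> (\<lambda>i j. \<iota> (B i j)) \<in> Mat L"
  by (simp add: Mat_def Vec_def \<iota>_closed)

text \<open>\<pi> is applied to all entries. The point is exactness: a relation over A, lifted along
  \<iota>, holds in N only up to mN, so it has to be corrected by a matrix in the kernel of \<pi>
  before exactness over L can be used.\<close>

lemma pres_factors_reduction:
  assumes p: "pres L N a b e d F y" and fac: "factors N a b e F"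
  shows "pres A M a b (\<lambda>i j. \<pi> (e i j)) (\<lambda>i j. \<pi> (d i j)) (\<lambda>i j. \<pi> (F i j)) (\<lambda>i. q (y i))" (is "pres A M a b ?e ?d ?F ?y")
    and "factors M a b (\<lambda>i j. \<pi> (e i j)) (\<lambda>i j. \<pi> (F i j))"
proof -
  note pM = presD(1-4)[OF p]
  show "pres A M a b ?e ?d ?F ?y"
    unfolding pres_def
  proof (intro conjI ballI impI h_Mat q_Vec pM)
    show "mmul A a ?e ?e = ?e" using h_mmul[OF pM(1,1), of a] presD(5)[OF p] by simp
    show "mmul A a ?e ?F = ?F" using h_mmul[OF pM(1,3), of a] presD(6)[OF p] by simp
    show "mmul A b ?F ?d = ?F" using h_mmul[OF pM(3,2), of b] presD(7)[OF p] by simp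
    show "mvec M b ?d ?y = ?y" using q_mvec[OF pM(2,4), of b] presD(8)[OF p] by simp
    show "mvec M b ?F ?y = (\<lambda>_. \<zero>\<^bsub>M\<^esub>)" using q_mvec[OF pM(3,4), of b] presD(9)[OF p] by (simp add: q_zero)
  next
    fix x assume "x \<in> Vec M"
    then obtain v where v: "v \<in> Vec N" "\<And>i. q (v i) = x i" by (rule q_Vec_surj) blast
    then obtain V where V: "V \<in> Mat L" "v = mvec N b V y" using presD(10)[OF p] by blast
    have "x = mvec M b (\<lambda>i j. \<pi> (V i j)) ?y"
      using q_mvec[OF V(1) pM(4), of b] v(2) by (simp add: V(2)[symmetric])
    then show "\<exists>V\<in>Mat A. x = mvec M b V ?y" using h_Mat[OF V(1)] by blast
  next
    fix V assume V: "V \<in> Mat A" "mvec M b V ?y = (\<lambda>_. \<zero>\<^bsub>M\<^esub>)"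
    have V': "(\<lambda>i j. \<pi> (\<iota> (V i j))) = V" using V(1) by (simp add: \<pi>_\<iota> MatDD)
    have "q (mvec N b (\<lambda>i j. \<iota> (V i j)) y i) = \<zero>\<^bsub>M\<^esub>" for i
      using fun_cong[OF q_mvec[OF \<iota>_Mat[OF V(1)] pM(4), of b], of i] V(2) by (simp add: V')
    then have "\<forall>i. \<exists>v\<in>Vec N. mvec N b (\<lambda>i j. \<iota> (V i j)) y i = lcomb N s c v"
      using q_ker VecD[OF N.mvec_Vec[OF \<iota>_Mat[OF V(1)] pM(4)]] by blast
    then obtain v where v: "\<And>i. v i \<in> Vec N" "\<And>i. mvec N b (\<lambda>i j. \<iota> (V i j)) y i = lcomb N s c (v i)" by metis
    have "\<forall>k. \<exists>C\<in>Mat L. (\<lambda>i. v i k) = mvec N b C y"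
      using presD(10)[OF p] v(1) by (simp add: Vec_def)
    then obtain C where C: "\<And>k. C k \<in> Mat L" "\<And>k. (\<lambda>i. v i k) = mvec N b (C k) y" by metis
    \<comment> \<open>The error of the lifted relation is a combination of the \<open>c k\<close>
      with coefficients in N; writing these in terms of \<open>y\<close> yields the correcting
      matrix, which \<pi> kills.\<close>
    define Z where "Z = (\<lambda>i j. ssum L s (\<lambda>k. c k \<otimes>\<^bsub>L\<^esub> C k i j))"
    have Z: "Z \<in> Mat L" using c C(1) by (auto intro!: MatI L.ssum_closed simp: Z_def VecD MatDD)
    have "mvec N b Z y = mvec N b (\<lambda>i j. \<iota> (V i j)) y"
    proof
      fix i
      have Y: "(\<lambda>k j. C k i j) \<in> Mat L" using C(1) by (auto intro!: MatI simp: MatDD)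
      have "mvec N b Z y i = lcomb N s c (\<lambda>k. lcomb N b (C k i) y)"
        using N.lcomb_lcomb[OF c Y pM(4), of b s] by (simp add: mvec_def Z_def)
      also have "\<dots> = lcomb N s c (v i)"
        using C(2) by (intro lcomb_cong) (auto simp: mvec_def fun_eq_iff)
      finally show "mvec N b Z y i = mvec N b (\<lambda>i j. \<iota> (V i j)) y i" by (simp add: v(2))
    qed
    then have "mvec N b (msub L (\<lambda>i j. \<iota> (V i j)) Z) y = (\<lambda>_. \<zero>\<^bsub>N\<^esub>)"
      using Z \<iota>_Mat[OF V(1)] pM(4) by (simp add: N.mvec_msub N.M.vsub_zero_iff)
    then obtain U where U: "U \<in> Mat L" "mmul L b (msub L (\<lambda>i j. \<iota> (V i j)) Z) d = mmul L a U F"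
      using presD(11)[OF p, of "msub L (\<lambda>i j. \<iota> (V i j)) Z"] Z \<iota>_Mat[OF V(1)] by auto
    have "\<pi> (msub L (\<lambda>i j. \<iota> (V i j)) Z i j) = V i j" for i j
    proof -
      have "\<pi> (Z i j) = \<zero>\<^bsub>A\<^esub>"
        unfolding Z_def using c C(1) by (simp add: h_ssum h_mult VecD MatDD \<pi>_c h_closed)
      moreover have "x \<ominus>\<^bsub>A\<^esub> \<zero>\<^bsub>A\<^esub> = x" if "x \<in> carrier A" for x
        using that by (simp add: a_minus_def A.minus_equality[of "\<zero>\<^bsub>A\<^esub>" "\<zero>\<^bsub>A\<^esub>"])
      ultimately show ?thesis
        using MatDD[OF Z, of i j] \<iota>_closed[OF MatDD[OF V(1)], of i j] MatDD[OF V(1), of i j]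
        by (simp add: msub_def vsub_def h_diff \<pi>_\<iota>)
    qed
    then have "mmul A b V ?d = mmul A a (\<lambda>i j. \<pi> (U i j)) ?F"
      using h_mmul[OF _ pM(2), of "msub L (\<lambda>i j. \<iota> (V i j)) Z" b] h_mmul[OF U(1) pM(3), of a] U(2) Z \<iota>_Mat[OF V(1)]
      by simp
    then show "\<exists>U\<in>Mat A. mmul A b V ?d = mmul A a U ?F" using h_Mat[OF U(1)] by blast
  qed
  show "factors M a b ?e ?F"
    unfolding factors_def
  proof (intro ballI impI)
    fix z assume z: "z \<in> Vec M" "mvec M a ?e z = z"
    then obtain v where v: "v \<in> Vec N" "\<And>i. q (v i) = z i" by (rule_tac q_Vec_surj) blast+
    \<comment> \<open>The lift \<open>v\<close> of z need not be fixed by \<open>e\<close>, so e v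
      is factored instead; it also reduces to z.\<close>
    have "mvec N a e (mvec N a e v) = mvec N a e v"
      using presD(5)[OF p] pM v by (simp flip: N.mvec_mmul)
    then obtain w where w: "w \<in> Vec N" "mvec N b F w = mvec N a e v"
      using fac pM v N.mvec_Vec unfolding factors_def by blast
    have "mvec M b ?F (\<lambda>i. q (w i)) = mvec M a ?e (\<lambda>i. q (v i))"
      using q_mvec[OF pM(3) w(1), of b] q_mvec[OF pM(1) v(1), of a] by (simp add: w(2))
    then show "\<exists>w\<in>Vec M. mvec M b ?F w = z"
      using q_Vec[OF w(1)] by (intro bexI[of _ "\<lambda>i. q (w i)"]) (simp_all add: v(2) z(2))
  qed
qed

lemma rigid_reduction: "rigid L N \<Longrightarrow> rigid A M"
  unfolding rigid_def using pres_factors_reduction by blast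

text \<open>The filtration by m^i N.\<close>

primrec mpow :: "nat \<Rightarrow> 'n set" where
  "mpow 0 = carrier N"
| "mpow (Suc i) = {lcomb N s c v | v. \<forall>k. v k \<in> mpow i}"

lemma mpow_submodule: "submodule (mpow i) L N"
proof (induction i)
  case 0 then show ?case by (simp add: N.submodule_carrier)
next
  case (Suc i)
  have V: "v \<in> Vec N" if "\<forall>k. v k \<in> mpow i" for v
    using that submodule_subset[OF Suc] by (auto intro: VecI)
  show ?case
  proof (rule N.submoduleI)
    show "mpow (Suc i) \<subseteq> carrier N" using V c by auto
    show "\<zero>\<^bsub>N\<^esub> \<in> mpow (Suc i)"
      using c submodule_zero[OF Suc] by (auto intro!: exI[of _ "\<lambda>_. \<zero>\<^bsub>N\<^esub>"])
  next
    fix x y assume "x \<in> mpow (Suc i)" "y \<in> mpow (Suc i)"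
    then obtain v w where vw: "\<forall>k. v k \<in> mpow i" "x = lcomb N s c v" "\<forall>k. w k \<in> mpow i" "y = lcomb N s c w" by auto
    have "x \<oplus>\<^bsub>N\<^esub> y = lcomb N s c (\<lambda>k. v k \<oplus>\<^bsub>N\<^esub> w k)" using vw V c by (simp add: N.lcomb_add_r)
    then show "x \<oplus>\<^bsub>N\<^esub> y \<in> mpow (Suc i)" using vw submodule_add[OF Suc] by auto
  next
    fix l x assume "l \<in> carrier L" "x \<in> mpow (Suc i)"
    then obtain v where v: "l \<in> carrier L" "\<forall>k. v k \<in> mpow i" "x = lcomb N s c v" by auto
    have "l \<odot>\<^bsub>N\<^esub> x = lcomb N s c (\<lambda>k. l \<odot>\<^bsub>N\<^esub> v k)" using v V c central by (simp add: N.lcomb_smult_r)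
    then show "l \<odot>\<^bsub>N\<^esub> x \<in> mpow (Suc i)" using v submodule_smult[OF Suc] by auto
  qed
qed

lemma mpow_carrier: "x \<in> mpow i \<Longrightarrow> x \<in> carrier N"
  using submodule_subset[OF mpow_submodule] by blast

lemma mpow_Vec: "(\<And>k. v k \<in> mpow i) \<Longrightarrow> v \<in> Vec N"
  by (rule VecI) (rule mpow_carrier)

lemma mpow_decreasing: "mpow (Suc i) \<subseteq> mpow i"
  using submodule_lcomb[OF mpow_submodule c] by auto

lemma mpow_Suc_mem: "(\<And>k. v k \<in> mpow i) \<Longrightarrow> lcomb N s c v \<in> mpow (Suc i)"
  by auto

lemma mpow_1_iff: "x \<in> carrier N \<Longrightarrow> x \<in> mpow (Suc 0) \<longleftrightarrow> q x = \<zero>\<^bsub>M\<^esub>"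
  using q_lcomb_c q_ker by (auto simp: Vec_def)

text \<open>More generally a product of nil - i generators annihilates m^i N; the claim is the case
  of the empty product.\<close>

lemma mpow_nil: "mpow nil = {\<zero>\<^bsub>N\<^esub>}"
proof -
  let ?w = "foldl (\<lambda>p j. p \<otimes>\<^bsub>L\<^esub> c j) \<one>\<^bsub>L\<^esub>"
  have wc: "?w w \<in> carrier L" for w
    by (induction w rule: rev_induct) (use c in \<open>auto simp: VecD\<close>)
  have "i \<le> nil \<Longrightarrow> length w = nil - i \<Longrightarrow> set w \<subseteq> {..<s} \<Longrightarrow> x \<in> mpow i \<Longrightarrow> ?w w \<odot>\<^bsub>N\<^esub> x = \<zero>\<^bsub>N\<^esub>" for i w x
  proof (induction i arbitrary: w x)
    case 0
    then show ?case using nil[of w] by simp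
  next
    case (Suc i)
    then obtain v where v: "\<And>k. v k \<in> mpow i" "x = lcomb N s c v" by auto
    have vN: "v k \<in> carrier N" for k by (rule mpow_carrier[OF v(1)])
    have "?w w \<odot>\<^bsub>N\<^esub> x = ssum N s (\<lambda>k. ?w (w @ [k]) \<odot>\<^bsub>N\<^esub> v k)"
      unfolding v(2) lcomb_def using wc vN VecD[OF c] by (simp add: N.smult_ssum N.smult_assoc1)
    also have "\<dots> = \<zero>\<^bsub>N\<^esub>"
      using Suc.prems v(1) by (intro N.M.ssum_zero' Suc.IH) auto
    finally show ?case .
  qed
  from this[of nil "[]"] have one: "\<one>\<^bsub>L\<^esub> \<odot>\<^bsub>N\<^esub> x = \<zero>\<^bsub>N\<^esub>" if "x \<in> mpow nil" for x
    using that by simp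
  have "x = \<zero>\<^bsub>N\<^esub>" if "x \<in> mpow nil" for x
    using one[OF that] N.smult_one[OF mpow_carrier[OF that]] by metis
  then show ?thesis using submodule_zero[OF mpow_submodule] by blast
qed

text \<open>The map x - f x raises the filtration by one step. Hence a kernel element lies in every
  step, and preimages are found by successive approximation; both end because the filtration
  does.\<close>

lemma endomorphism_over_reduction_bij:
  assumes f: "f \<in> mod_hom L N N" and qf: "\<And>x. x \<in> carrier N \<Longrightarrow> q (f x) = q x"
  shows "bij_betw f (carrier N) (carrier N)"
proof -
  interpret f: mod_hom_loc L N N f by (rule mod_hom_locI[OF N.left_module N.left_module f])
  have \<theta>: "x \<ominus>\<^bsub>N\<^esub> f x \<in> mpow (Suc i)" if "x \<in> mpow i" for x i
    using that
  proof (induction i arbitrary: x)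
    case 0
    then have "q (x \<ominus>\<^bsub>N\<^esub> f x) = \<zero>\<^bsub>M\<^esub>" by (simp add: q_diff f.closed qf M.M.minus_zero_iff q_closed)
    then show ?case using 0 mpow_1_iff[of "x \<ominus>\<^bsub>N\<^esub> f x"] f.closed by simp
  next
    case (Suc i)
    then obtain v where v: "\<And>k. v k \<in> mpow i" "x = lcomb N s c v" by auto
    have vV: "v \<in> Vec N" by (rule mpow_Vec[OF v(1)])
    have "x \<ominus>\<^bsub>N\<^esub> f x = lcomb N s c (\<lambda>k. v k \<ominus>\<^bsub>N\<^esub> f (v k))"
      unfolding v(2) using f.lcomb[OF c vV] N.lcomb_diff_r[OF c vV f.Vec[OF vV]] by simp
    then show ?case using mpow_Suc_mem[of "\<lambda>k. v k \<ominus>\<^bsub>N\<^esub> f (v k)" "Suc i"] Suc.IH[OF v(1)] by simp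
  qed
  have inj: "inj_on f (carrier N)"
  proof (rule inj_onI)
    fix x x' assume x: "x \<in> carrier N" "x' \<in> carrier N" "f x = f x'"
    have "x \<ominus>\<^bsub>N\<^esub> x' \<in> mpow i" for i
    proof (induction i)
      case 0 then show ?case using x by simp
    next
      case (Suc i)
      have "f (x \<ominus>\<^bsub>N\<^esub> x') = \<zero>\<^bsub>N\<^esub>" using x by (simp add: f.diff N.M.minus_zero_iff f.closed)
      then have "(x \<ominus>\<^bsub>N\<^esub> x') \<ominus>\<^bsub>N\<^esub> f (x \<ominus>\<^bsub>N\<^esub> x') = x \<ominus>\<^bsub>N\<^esub> x'"
        using x by (simp add: a_minus_def N.M.minus_equality[of "\<zero>\<^bsub>N\<^esub>" "\<zero>\<^bsub>N\<^esub>"])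
      then show ?case using \<theta>[OF Suc] by simp
    qed
    from this[of nil] show "x = x'" using x by (simp add: mpow_nil N.M.minus_zero_iff)
  qed
  \<comment> \<open>Newton-like iteration: adding the current error to z replaces the error r by r -
    f r, one step deeper in the filtration.\<close>
  have "\<exists>z\<in>carrier N. x \<ominus>\<^bsub>N\<^esub> f z \<in> mpow i" if x: "x \<in> carrier N" for x i
  proof (induction i)
    case 0 then show ?case using x f.closed by (auto intro!: bexI[of _ x])
  next
    case (Suc i)
    then obtain z where z: "z \<in> carrier N" "x \<ominus>\<^bsub>N\<^esub> f z \<in> mpow i" by blast
    let ?r = "x \<ominus>\<^bsub>N\<^esub> f z"
    have r: "?r \<in> carrier N" using x z f.closed by simp
    have "x \<ominus>\<^bsub>N\<^esub> f (z \<oplus>\<^bsub>N\<^esub> ?r) = ?r \<ominus>\<^bsub>N\<^esub> f ?r"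
      using x z r f.closed by (simp add: f.add a_minus_def N.M.minus_add N.M.a_assoc)
    then show ?case using \<theta>[OF z(2)] z r by (intro bexI[of _ "z \<oplus>\<^bsub>N\<^esub> ?r"]) simp_all
  qed
  then have "\<exists>z\<in>carrier N. x \<ominus>\<^bsub>N\<^esub> f z = \<zero>\<^bsub>N\<^esub>" if "x \<in> carrier N" for x
    using that mpow_nil by blast
  then have "\<exists>z\<in>carrier N. x = f z" if "x \<in> carrier N" for x
    using that N.M.minus_zero_iff[OF that f.closed] by blast
  then have "carrier N \<subseteq> f ` carrier N" by blast
  then show ?thesis using inj f.closed by (auto simp: bij_betw_def)
qed

text \<open>Both the independence of the images q(U), q(V) and the fact that q(U) = 0 forces U = 0
  follow from one comparison of components, \<open>split\<close>.\<close>

lemma indecomposable_extension: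
  assumes "indecomposable A M" shows "indecomposable L N"
proof -
  have M0: "carrier M \<noteq> {\<zero>\<^bsub>M\<^esub>}"
    and ind: "\<And>U V. submodule U A M \<Longrightarrow> submodule V A M \<Longrightarrow> U \<inter> V = {\<zero>\<^bsub>M\<^esub>} \<Longrightarrow>
      U <+>\<^bsub>M\<^esub> V = carrier M \<Longrightarrow> U = {\<zero>\<^bsub>M\<^esub>} \<or> V = {\<zero>\<^bsub>M\<^esub>}"
    using assms by (auto simp: indecomposable_def)
  have N0: "carrier N \<noteq> {\<zero>\<^bsub>N\<^esub>}"
  proof
    assume N: "carrier N = {\<zero>\<^bsub>N\<^esub>}"
    have "x = \<zero>\<^bsub>M\<^esub>" if "x \<in> carrier M" for x using q_surj[OF that] N q_zero by auto
    then show False using M0 M.M.zero_closed by blast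
  qed
  have im: "submodule (q ` U) A M" if U: "submodule U L N" for U
  proof (rule M.submoduleI)
    note UN = submodule_subset[OF U]
    show "q ` U \<subseteq> carrier M" using UN q_closed by auto
    show "\<zero>\<^bsub>M\<^esub> \<in> q ` U" using submodule_zero[OF U] q_zero by force
    fix x y assume "x \<in> q ` U" "y \<in> q ` U"
    then obtain u v where "u \<in> U" "v \<in> U" "x = q u" "y = q v" by blast
    then show "x \<oplus>\<^bsub>M\<^esub> y \<in> q ` U"
      using UN submodule_add[OF U] by (intro image_eqI[of _ _ "u \<oplus>\<^bsub>N\<^esub> v"]) (auto simp: q_add subset_iff)
  next
    note UN = submodule_subset[OF U]
    fix a x assume "a \<in> carrier A" "x \<in> q ` U"
    then obtain u where "u \<in> U" "x = q u" by blast
    then show "a \<odot>\<^bsub>M\<^esub> x \<in> q ` U"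
      using UN submodule_smult[OF U \<iota>_closed] \<open>a \<in> carrier A\<close>
      by (intro image_eqI[of _ _ "\<iota> a \<odot>\<^bsub>N\<^esub> u"]) (auto simp: q_smult \<iota>_closed \<pi>_\<iota> subset_iff)
  qed
  \<comment> \<open>If q u = q v, then u - v lies in mN = mU + mV. Comparing the components in U
    shows that u lies in mU.\<close>
  have split: "\<exists>z. (\<forall>k. z k \<in> U) \<and> u = lcomb N s c z"
    if UV: "submodule U L N" "submodule V L N" "U \<inter> V = {\<zero>\<^bsub>N\<^esub>}" "U <+>\<^bsub>N\<^esub> V = carrier N"
      and uv: "u \<in> U" "v \<in> V" "q u = q v" for U V u v
  proof -
    note sub = submodule_subset[OF UV(1)] submodule_subset[OF UV(2)]
    have uvN: "u \<in> carrier N" "v \<in> carrier N" using uv sub by auto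
    have "q (u \<ominus>\<^bsub>N\<^esub> v) = \<zero>\<^bsub>M\<^esub>" using uvN uv(3) by (simp add: q_diff M.M.minus_zero_iff q_closed)
    then obtain x where x: "x \<in> Vec N" "u \<ominus>\<^bsub>N\<^esub> v = lcomb N s c x" using q_ker uvN by blast
    have "\<forall>k. \<exists>z z'. z \<in> U \<and> z' \<in> V \<and> x k = z \<oplus>\<^bsub>N\<^esub> z'"
      using UV(4) VecD[OF x(1)] N.set_add_iff by blast
    then obtain z z' where z: "\<And>k. z k \<in> U" "\<And>k. z' k \<in> V" "\<And>k. x k = z k \<oplus>\<^bsub>N\<^esub> z' k" by metis
    have zV: "z \<in> Vec N" "z' \<in> Vec N" using z(1,2) sub by (auto simp: Vec_def)
    let ?l = "lcomb N s c z" and ?l' = "lcomb N s c z'"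
    have l: "?l \<in> U" "?l' \<in> V" "?l \<in> carrier N" "?l' \<in> carrier N"
      by (rule submodule_lcomb[OF UV(1) c z(1)], rule submodule_lcomb[OF UV(2) c z(2)])
        (rule N.lcomb_closed[OF c zV(1)], rule N.lcomb_closed[OF c zV(2)])
    have "x = (\<lambda>k. z k \<oplus>\<^bsub>N\<^esub> z' k)" by (rule ext) (rule z(3))
    then have "u \<ominus>\<^bsub>N\<^esub> v = ?l \<oplus>\<^bsub>N\<^esub> ?l'"
      using x(2) N.lcomb_add_r[OF c zV, of s] by simp
    then have "u = v \<oplus>\<^bsub>N\<^esub> (?l \<oplus>\<^bsub>N\<^esub> ?l')"
      using N.M.add_minus_cancel[OF uvN(2,1)] by simp
    also have "\<dots> = (v \<oplus>\<^bsub>N\<^esub> ?l') \<oplus>\<^bsub>N\<^esub> ?l"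
      by (simp only: N.M.a_ac uvN l N.M.a_closed)
    finally have "u \<ominus>\<^bsub>N\<^esub> ?l = v \<oplus>\<^bsub>N\<^esub> ?l'"
      using N.M.add_minus_right_cancel[OF N.M.a_closed[OF uvN(2) l(4)] l(3)] by simp
    moreover have "u \<ominus>\<^bsub>N\<^esub> ?l \<in> U" using submodule_diff[OF UV(1) uv(1) l(1)] .
    moreover have "v \<oplus>\<^bsub>N\<^esub> ?l' \<in> V" using submodule_add[OF UV(2) uv(2) l(2)] .
    ultimately have "u \<ominus>\<^bsub>N\<^esub> ?l = \<zero>\<^bsub>N\<^esub>" using UV(3) by auto
    then have "u = ?l" using N.M.minus_zero_iff[OF uvN(1) l(3)] by simp
    then show ?thesis using z by blast
  qed
  \<comment> \<open>Nakayama for a summand: here \<open>split\<close> with v = 0 gives U = mU, hence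
    U lies in every step of the filtration.\<close>
  have zero: "U = {\<zero>\<^bsub>N\<^esub>}"
    if UV: "submodule U L N" "submodule V L N" "U \<inter> V = {\<zero>\<^bsub>N\<^esub>}" "U <+>\<^bsub>N\<^esub> V = carrier N"
      and qU: "q ` U = {\<zero>\<^bsub>M\<^esub>}" for U V
  proof -
    have "U \<subseteq> mpow i" for i
    proof (induction i)
      case 0 then show ?case using submodule_subset[OF UV(1)] by simp
    next
      case (Suc i)
      show ?case
      proof
        fix u assume u: "u \<in> U"
        have "q u = q \<zero>\<^bsub>N\<^esub>" using qU u q_zero by auto
        then obtain z where z: "\<forall>k. z k \<in> U" "u = lcomb N s c z"
          using split[OF UV u submodule_zero[OF UV(2)]] by blast
        then show "u \<in> mpow (Suc i)" using Suc by auto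
      qed
    qed
    then show ?thesis using mpow_nil submodule_zero[OF UV(1)] by blast
  qed
  have "U = {\<zero>\<^bsub>N\<^esub>} \<or> V = {\<zero>\<^bsub>N\<^esub>}"
    if UV: "submodule U L N" "submodule V L N" "U \<inter> V = {\<zero>\<^bsub>N\<^esub>}" "U <+>\<^bsub>N\<^esub> V = carrier N" for U V
  proof -
    note sub = submodule_subset[OF UV(1)] submodule_subset[OF UV(2)]
    have VU: "V \<inter> U = {\<zero>\<^bsub>N\<^esub>}" "V <+>\<^bsub>N\<^esub> U = carrier N"
    proof -
      show "V \<inter> U = {\<zero>\<^bsub>N\<^esub>}" using UV(3) by blast
      have "V <+>\<^bsub>N\<^esub> U = U <+>\<^bsub>N\<^esub> V"
        unfolding set_eq_iff N.set_add_iff using sub N.M.a_comm by (metis subsetD)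
      then show "V <+>\<^bsub>N\<^esub> U = carrier N" using UV(4) by simp
    qed
    have "q ` U \<inter> q ` V = {\<zero>\<^bsub>M\<^esub>}"
    proof -
      have "x = \<zero>\<^bsub>M\<^esub>" if x: "x \<in> q ` U" "x \<in> q ` V" for x
      proof -
        obtain u v where uv: "u \<in> U" "v \<in> V" "x = q u" "x = q v" using x by blast
        obtain z where z: "\<forall>k. z k \<in> U" "u = lcomb N s c z" using split[OF UV uv(1,2)] uv by metis
        then have "z \<in> Vec N" using sub by (auto intro: VecI)
        then show ?thesis using uv z q_lcomb_c by simp
      qed
      then show ?thesis using submodule_zero[OF im] UV by blast
    qed
    moreover have "q ` U <+>\<^bsub>M\<^esub> q ` V = carrier M"
    proof
      show "q ` U <+>\<^bsub>M\<^esub> q ` V \<subseteq> carrier M"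
        by (rule submodule_subset[OF M.submodule_set_add[OF im[OF UV(1)] im[OF UV(2)]]])
      show "carrier M \<subseteq> q ` U <+>\<^bsub>M\<^esub> q ` V"
      proof
        fix x assume "x \<in> carrier M"
        then obtain n where n: "n \<in> carrier N" "q n = x" using q_surj by blast
        then obtain u v where uv: "u \<in> U" "v \<in> V" "n = u \<oplus>\<^bsub>N\<^esub> v" using UV(4) N.set_add_iff by blast
        then have "x = q u \<oplus>\<^bsub>M\<^esub> q v" using n sub q_add[of u v] by auto
        then show "x \<in> q ` U <+>\<^bsub>M\<^esub> q ` V" unfolding M.set_add_iff using uv by blast
      qed
    qed
    ultimately have "q ` U = {\<zero>\<^bsub>M\<^esub>} \<or> q ` V = {\<zero>\<^bsub>M\<^esub>}" using ind im UV by blast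
    then show ?thesis using zero[OF UV] zero[OF UV(2,1) VU] by blast
  qed
  then show ?thesis using N0 unfolding indecomposable_def by blast
qed

end

section \<open>Uniqueness of rigid lifts\<close>

text \<open>Lifting against \<open>m\<^sup>i E \<rightarrow> m\<^sup>i E / m\<^sup>i\<^sup>+\<^sup>1 E\<close> reduces to the rigidity of the common reduction \<open>M\<close>;
  the obstruction to lifting the identity of \<open>M\<close> to a map \<open>N \<rightarrow> E\<close> lies in \<open>m E\<close>.\<close>

lemma lift_over_reduction:
  assumes rN: "reduction L A N M \<pi> \<iota> c s nil q" and rE: "reduction L A E M \<pi> \<iota> c s nil q'"
    and rig: "rigid L N"
  shows "\<exists>\<beta>\<in>mod_hom L N E. \<forall>n\<in>carrier N. q' (\<beta> n) = q n"
proof -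
  interpret N: reduction L A N M \<pi> \<iota> c s nil q by fact
  interpret E: reduction L A E M \<pi> \<iota> c s nil q' by fact
  obtain a b e d F y where p: "pres L N a b e d F y" and facN: "factors N a b e F"
    using rig unfolding rigid_def by blast
  note pM = presD(1-4)[OF p]
  note fac = N.pres_factors_reduction(2)[OF p facN]
  \<comment> \<open>One step of solving e z = F w inside m^i E: the equation is solved modulo
    m^(i+1) E. For i = 0 this is the factorization property of the common reduction M.\<close>
  have step: "\<exists>w. (\<forall>k. w k \<in> E.mpow i) \<and> (\<forall>k. mvec E a e z k \<ominus>\<^bsub>E\<^esub> mvec E b F w k \<in> E.mpow (Suc i))"
    if "\<forall>k. z k \<in> E.mpow i" for i z
    using that
  proof (induction i arbitrary: z)
    case 0
    then have z: "z \<in> Vec E" by (simp add: Vec_def)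
    have ee: "(\<lambda>i j. \<pi> (e i j)) \<in> Mat A" by (rule N.h_Mat[OF pM(1)])
    have qz: "(\<lambda>i. q' (z i)) \<in> Vec M" by (rule E.q_Vec[OF z])
    have "mmul A a (\<lambda>i j. \<pi> (e i j)) (\<lambda>i j. \<pi> (e i j)) = (\<lambda>i j. \<pi> (e i j))"
      using N.h_mmul[OF pM(1,1), of a] presD(5)[OF p] by simp
    then have "mvec M a (\<lambda>i j. \<pi> (e i j)) (mvec M a (\<lambda>i j. \<pi> (e i j)) (\<lambda>i. q' (z i))) = mvec M a (\<lambda>i j. \<pi> (e i j)) (\<lambda>i. q' (z i))"
      using N.M.mvec_mmul[OF ee ee qz, of a a] by simp
    then obtain w0 where w0: "w0 \<in> Vec M" "mvec M b (\<lambda>i j. \<pi> (F i j)) w0 = mvec M a (\<lambda>i j. \<pi> (e i j)) (\<lambda>i. q' (z i))"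
      using fac N.M.mvec_Vec[OF ee qz] unfolding factors_def by blast
    obtain w where w: "w \<in> Vec E" "\<And>i. q' (w i) = w0 i" by (rule E.q_Vec_surj[OF w0(1)]) blast
    have "q' (mvec E a e z k \<ominus>\<^bsub>E\<^esub> mvec E b F w k) = \<zero>\<^bsub>M\<^esub>" for k
    proof -
      have cl: "mvec E a e z k \<in> carrier E" "mvec E b F w k \<in> carrier E"
        using VecD[OF E.N.mvec_Vec] z w pM by auto
      have "q' (mvec E a e z k) = q' (mvec E b F w k)"
        using fun_cong[OF E.q_mvec[OF pM(1) z, of a], of k] fun_cong[OF E.q_mvec[OF pM(3) w(1), of b], of k] w0(2) w(2)
        by simp
      then show ?thesis using cl by (simp add: E.q_diff N.M.M.minus_zero_iff E.q_closed)
    qed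
    then show ?case
      using w(1) VecD[OF E.N.mvec_Vec[OF pM(1) z]] VecD[OF E.N.mvec_Vec[OF pM(3) w(1)]]
      by (intro exI[of _ w]) (simp add: E.mpow_1_iff VecD del: E.mpow.simps(2))
  next
    \<comment> \<open>An element of m^(i+1) E is a combination of the \<open>c j\<close> with
      coefficients in m^i E. The coefficients are treated separately and recombined; the matrices
      pass through because the \<open>c j\<close> are central.\<close>
    case (Suc i)
    have "\<forall>k. \<exists>v. (\<forall>j. v j \<in> E.mpow i) \<and> z k = lcomb E s c v"
      using Suc.prems unfolding E.mpow.simps(2) by blast
    from choice[OF this] obtain v where v0: "\<forall>k. (\<forall>j. v k j \<in> E.mpow i) \<and> z k = lcomb E s c (v k)" ..
    then have v: "\<And>k j. v k j \<in> E.mpow i" "\<And>k. z k = lcomb E s c (v k)" by blast+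
    have "\<forall>j. \<exists>w. (\<forall>k. w k \<in> E.mpow i) \<and> (\<forall>k. mvec E a e (\<lambda>k. v k j) k \<ominus>\<^bsub>E\<^esub> mvec E b F w k \<in> E.mpow (Suc i))"
      by (intro allI Suc.IH) (rule v(1))
    from choice[OF this] obtain w where w0: "\<forall>j. (\<forall>k. w j k \<in> E.mpow i) \<and>
      (\<forall>k. mvec E a e (\<lambda>k. v k j) k \<ominus>\<^bsub>E\<^esub> mvec E b F (w j) k \<in> E.mpow (Suc i))" ..
    then have w: "\<And>j k. w j k \<in> E.mpow i"
      "\<And>j k. mvec E a e (\<lambda>k. v k j) k \<ominus>\<^bsub>E\<^esub> mvec E b F (w j) k \<in> E.mpow (Suc i)" by blast+
    have vV: "(\<lambda>k. v k j) \<in> Vec E" "w j \<in> Vec E" for j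
      by (rule E.mpow_Vec, rule v(1)) (rule E.mpow_Vec, rule w(1))
    have zeq: "z = (\<lambda>k. lcomb E s c (\<lambda>j. v k j))" by (rule ext) (rule v(2))
    have swap: "mvec E m B (\<lambda>k. lcomb E s c (\<lambda>j. x j k)) k = lcomb E s c (\<lambda>j. mvec E m B (x j) k)"
      if "B \<in> Mat L" "\<And>j. x j \<in> Vec E" for m B x k
      unfolding mvec_def by (rule E.N.lcomb_swap[OF MatD[OF that(1)] N.c that(2)]) (rule N.central[OF MatDD[OF that(1)]])
    let ?w = "\<lambda>k. lcomb E s c (\<lambda>j. w j k)"
    have "mvec E a e z k \<ominus>\<^bsub>E\<^esub> mvec E b F ?w k \<in> E.mpow (Suc (Suc i))" for k
    proof -
      have V: "(\<lambda>j. mvec E a e (\<lambda>k. v k j) k) \<in> Vec E" "(\<lambda>j. mvec E b F (w j) k) \<in> Vec E"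
        using VecD[OF E.N.mvec_Vec[OF pM(1) vV(1)]] VecD[OF E.N.mvec_Vec[OF pM(3) vV(2)]] by (auto intro: VecI)
      have "mvec E a e z k \<ominus>\<^bsub>E\<^esub> mvec E b F ?w k =
          lcomb E s c (\<lambda>j. mvec E a e (\<lambda>k. v k j) k \<ominus>\<^bsub>E\<^esub> mvec E b F (w j) k)"
        unfolding zeq swap[of e "\<lambda>j k. v k j", OF pM(1) vV(1)] swap[of F w, OF pM(3) vV(2)]
          E.N.lcomb_diff_r[OF N.c V] ..
      then show ?thesis using E.mpow_Suc_mem[OF w(2)] by simp
    qed
    moreover have "?w k \<in> E.mpow (Suc i)" for k by (rule E.mpow_Suc_mem) (rule w(1))
    ultimately show ?case by (intro exI[of _ ?w] conjI allI)
  qed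
  \<comment> \<open>The errors are removed step by step; the induction runs on the distance
    \<open>j\<close> to the end of the filtration. The remaining error is again fixed by
    \<open>e\<close>, so \<open>e\<close> may be applied to it.\<close>
  have lift: "\<exists>w. (\<forall>k. w k \<in> E.mpow i) \<and> mvec E a e z = mvec E b F w"
    if "i + j = nil" "\<forall>k. z k \<in> E.mpow i" for i j z
    using that
  proof (induction j arbitrary: i z)
    case 0
    then have "z = (\<lambda>_. \<zero>\<^bsub>E\<^esub>)" using E.mpow_nil by (auto simp: fun_eq_iff)
    then show ?case
      using pM submodule_zero[OF E.mpow_submodule] by (intro exI[of _ "\<lambda>_. \<zero>\<^bsub>E\<^esub>"]) simp
  next
    case (Suc j)
    have z: "z \<in> Vec E" using Suc.prems by (auto intro: E.mpow_Vec)
    obtain w where w: "\<forall>k. w k \<in> E.mpow i"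
      "\<forall>k. mvec E a e z k \<ominus>\<^bsub>E\<^esub> mvec E b F w k \<in> E.mpow (Suc i)" using step[OF Suc.prems(2)] by blast
    have wV: "w \<in> Vec E" using w by (auto intro: E.mpow_Vec)
    let ?z' = "vsub E (mvec E a e z) (mvec E b F w)"
    have "Suc i + j = nil" using Suc.prems(1) by simp
    moreover have "\<forall>k. ?z' k \<in> E.mpow (Suc i)" using w(2) by (simp add: vsub_def)
    ultimately obtain w' where w': "\<forall>k. w' k \<in> E.mpow (Suc i)" "mvec E a e ?z' = mvec E b F w'"
      using Suc.IH by blast
    have w'i: "w' k \<in> E.mpow i" for k using w'(1) E.mpow_decreasing by blast
    then have wV': "w' \<in> Vec E" by (rule E.mpow_Vec)
    have "mvec E a e ?z' = ?z'"
      using pM z wV presD(5,6)[OF p] by (simp add: E.N.mvec_vsub flip: E.N.mvec_mmul)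
    then have "mvec E b F w' = ?z'" using w'(2) by simp
    then have "vadd E (mvec E b F w) (mvec E b F w') = vadd E (mvec E b F w) ?z'" by simp
    also have "\<dots> = mvec E a e z"
      using VecD[OF E.N.mvec_Vec[OF pM(1) z]] VecD[OF E.N.mvec_Vec[OF pM(3) wV]]
      by (simp add: vadd_def vsub_def E.N.M.add_minus_cancel)
    finally have "mvec E a e z = mvec E b F (vadd E w w')" using pM wV wV' by (simp add: E.N.mvec_vadd)
    then show ?case
      using w(1) w'i submodule_add[OF E.mpow_submodule] by (intro exI[of _ "vadd E w w'"]) (simp add: vadd_def)
  qed
  have lift1: "\<exists>w\<in>Vec E. (\<forall>k. q' (w k) = \<zero>\<^bsub>M\<^esub>) \<and> mvec E a e z = mvec E b F w"
    if z: "z \<in> Vec E" "\<And>k. q' (z k) = \<zero>\<^bsub>M\<^esub>" for z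
  \<comment> \<open>The start at step one needs \<open>nil\<close> to be positive; otherwise E is
    zero.\<close>
  proof (cases "nil = 0")
    case True
    then have "carrier E = {\<zero>\<^bsub>E\<^esub>}" using E.mpow_nil by simp
    then have "z = (\<lambda>_. \<zero>\<^bsub>E\<^esub>)" using z(1) by (auto simp: Vec_def fun_eq_iff)
    then show ?thesis using pM by (intro bexI[of _ "\<lambda>_. \<zero>\<^bsub>E\<^esub>"]) (simp_all add: Vec_def E.q_zero)
  next
    case False
    have "\<forall>k. z k \<in> E.mpow (Suc 0)" using z E.mpow_1_iff VecD[OF z(1)] by blast
    then obtain w where w: "\<forall>k. w k \<in> E.mpow (Suc 0)" "mvec E a e z = mvec E b F w"
      using lift[of "Suc 0" "nil - 1" z] False by auto
    have "w \<in> Vec E" using w(1) by (auto intro: E.mpow_Vec simp del: E.mpow.simps)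
    then show ?thesis using w E.mpow_1_iff VecD by blast
  qed
  \<comment> \<open>Arbitrary lifts to E of the reduced generators of N. The defining relations F x
    = 0 hold only modulo mE; \<open>lift1\<close> removes this obstruction without altering the
    reduction.\<close>
  obtain x where x: "x \<in> Vec E" "\<And>i. q' (x i) = q (y i)" by (rule E.q_Vec_surj[OF N.q_Vec[OF pM(4)]]) blast
  have xy: "(\<lambda>i. q' (x i)) = (\<lambda>i. q (y i))" using x(2) by simp
  have "q' (mvec E b F x k) = \<zero>\<^bsub>M\<^esub>" for k
    using fun_cong[OF E.q_mvec[OF pM(3) x(1), of b], of k] fun_cong[OF N.q_mvec[OF pM(3,4), of b], of k]
      presD(9)[OF p] by (simp add: xy N.q_zero)
  then obtain w where w: "w \<in> Vec E" "\<And>k. q' (w k) = \<zero>\<^bsub>M\<^esub>" "mvec E a e (mvec E b F x) = mvec E b F w"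
    using lift1[OF E.N.mvec_Vec[OF pM(3) x(1)], of b] by blast
  define x2 where "x2 = vsub E x w"
  have x2: "x2 \<in> Vec E" using x w by (simp add: x2_def)
  have Fx2: "mvec E b F x2 = (\<lambda>_. \<zero>\<^bsub>E\<^esub>)"
    using w(3) presD(6)[OF p] pM x(1) w(1)
    by (simp add: x2_def E.N.mvec_vsub E.N.M.vsub_zero_iff flip: E.N.mvec_mmul)
  have qx2: "(\<lambda>i. q' (x2 i)) = (\<lambda>i. q (y i))"
  proof
    fix i
    have "q (y i) \<ominus>\<^bsub>M\<^esub> \<zero>\<^bsub>M\<^esub> = q (y i)"
      using N.q_closed[OF VecD[OF pM(4)]] by (simp add: a_minus_def N.M.M.minus_equality[of "\<zero>\<^bsub>M\<^esub>" "\<zero>\<^bsub>M\<^esub>"])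
    then show "q' (x2 i) = q (y i)"
      using E.q_diff[OF VecD[OF x(1)] VecD[OF w(1)], of i i] by (simp add: x2_def vsub_def w(2) x(2))
  qed
  \<comment> \<open>With the factor \<open>d\<close>, every relation v y = 0 carries over: v d is a
    combination of the rows of F, which kill \<open>x2\<close>.\<close>
  define x3 where "x3 = mvec E b d x2"
  have x3: "x3 \<in> Vec E" using pM x2 by (simp add: x3_def)
  have qx3: "(\<lambda>i. q' (x3 i)) = (\<lambda>i. q (y i))"
    using E.q_mvec[OF pM(2) x2, of b] N.q_mvec[OF pM(2,4), of b] presD(8)[OF p] by (simp add: x3_def qx2)
  have rel: "lcomb E b v x3 = \<zero>\<^bsub>E\<^esub>" if v: "v \<in> Vec L" "lcomb N b v y = \<zero>\<^bsub>N\<^esub>" for v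
  proof -
    have "mvec N b (\<lambda>_. v) y = (\<lambda>_. \<zero>\<^bsub>N\<^esub>)" using v by (simp add: mvec_def)
    then obtain U where U: "U \<in> Mat L" "mmul L b (\<lambda>_. v) d = mmul L a U F"
      using presD(11)[OF p Mat_const[OF v(1)]] by blast
    have "mvec E b (\<lambda>_. v) x3 = mvec E b (mmul L b (\<lambda>_. v) d) x2"
      unfolding x3_def by (rule E.N.mvec_mmul[OF Mat_const[OF v(1)] pM(2) x2, symmetric])
    also have "\<dots> = mvec E a U (mvec E b F x2)" unfolding U(2) by (rule E.N.mvec_mmul[OF U(1) pM(3) x2])
    also have "\<dots> = (\<lambda>_. \<zero>\<^bsub>E\<^esub>)" using U(1) by (simp add: Fx2)
    finally show ?thesis by (simp add: mvec_def fun_eq_iff)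
  qed
  have ex: "\<exists>v\<in>Vec L. n = lcomb N b v y" if n: "n \<in> carrier N" for n
  proof -
    obtain V where "V \<in> Mat L" "(\<lambda>_. n) = mvec N b V y" using presD(10)[OF p, of "\<lambda>_. n"] n by (auto simp: Vec_def)
    then show ?thesis by (intro bexI[of _ "V 0"]) (auto simp: mvec_def fun_eq_iff MatD)
  qed
  \<comment> \<open>The map sends \<open>y\<close> to \<open>x3\<close>; \<open>rel\<close> makes it
    independent of the chosen coefficients.\<close>
  define \<beta> where "\<beta> = (\<lambda>n\<in>carrier N. lcomb E b (SOME v. v \<in> Vec L \<and> n = lcomb N b v y) x3)"
  have \<beta>: "\<beta> (lcomb N b v y) = lcomb E b v x3" if v: "v \<in> Vec L" for v
  proof -
    let ?n = "lcomb N b v y"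
    have nN: "?n \<in> carrier N" using v pM by simp
    let ?u = "SOME u. u \<in> Vec L \<and> ?n = lcomb N b u y"
    have u: "?u \<in> Vec L \<and> ?n = lcomb N b ?u y"
      by (rule someI[of "\<lambda>u. u \<in> Vec L \<and> ?n = lcomb N b u y" v]) (simp add: v)
    have "(\<lambda>i. ?u i \<ominus>\<^bsub>L\<^esub> v i) \<in> Vec L" using u v by (simp add: Vec_def)
    moreover have "lcomb N b (\<lambda>i. ?u i \<ominus>\<^bsub>L\<^esub> v i) y = \<zero>\<^bsub>N\<^esub>"
      using N.N.lcomb_diff_l[of ?u v y b] u v pM(4) nN by (simp add: N.N.M.minus_zero_iff)
    ultimately have "lcomb E b (\<lambda>i. ?u i \<ominus>\<^bsub>L\<^esub> v i) x3 = \<zero>\<^bsub>E\<^esub>" by (rule rel)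
    then have "lcomb E b ?u x3 = lcomb E b v x3"
      using E.N.lcomb_diff_l[of ?u v x3 b] u v x3 E.N.M.minus_zero_iff[of "lcomb E b ?u x3" "lcomb E b v x3"] by simp
    then show ?thesis using nN by (simp add: \<beta>_def)
  qed
  have "\<beta> \<in> mod_hom L N E"
  proof (rule mod_homI)
    fix n assume "n \<in> carrier N"
    then obtain v where "v \<in> Vec L" "n = lcomb N b v y" using ex by blast
    then show "\<beta> n \<in> carrier E" using x3 by (simp add: \<beta>)
  next
    fix n n' assume n: "n \<in> carrier N" "n' \<in> carrier N"
    obtain v where v: "v \<in> Vec L" "n = lcomb N b v y" using ex[OF n(1)] by blast
    obtain v' where v': "v' \<in> Vec L" "n' = lcomb N b v' y" using ex[OF n(2)] by blast
    have vv: "(\<lambda>i. v i \<oplus>\<^bsub>L\<^esub> v' i) \<in> Vec L" using v v' by (simp add: Vec_def)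
    show "\<beta> (n \<oplus>\<^bsub>N\<^esub> n') = \<beta> n \<oplus>\<^bsub>E\<^esub> \<beta> n'"
      unfolding v(2) v'(2) N.N.lcomb_add_l[OF v(1) v'(1) pM(4), symmetric] \<beta>[OF v(1)] \<beta>[OF v'(1)] \<beta>[OF vv]
      by (rule E.N.lcomb_add_l[OF v(1) v'(1) x3])
  next
    fix l n assume n: "l \<in> carrier L" "n \<in> carrier N"
    obtain v where v: "v \<in> Vec L" "n = lcomb N b v y" using ex[OF n(2)] by blast
    have vv: "(\<lambda>i. l \<otimes>\<^bsub>L\<^esub> v i) \<in> Vec L" using v n by (simp add: Vec_def)
    show "\<beta> (l \<odot>\<^bsub>N\<^esub> n) = l \<odot>\<^bsub>E\<^esub> \<beta> n"
      unfolding v(2) N.N.lcomb_smult_l[OF n(1) v(1) pM(4), symmetric] \<beta>[OF v(1)] \<beta>[OF vv]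
      by (rule E.N.lcomb_smult_l[OF n(1) v(1) x3])
  qed (simp add: \<beta>_def)
  moreover have "q' (\<beta> n) = q n" if n: "n \<in> carrier N" for n
  proof -
    obtain v where v: "v \<in> Vec L" "n = lcomb N b v y" using ex[OF n] by blast
    show ?thesis using E.q_lcomb[OF v(1) x3, of b] N.q_lcomb[OF v(1) pM(4), of b] by (simp add: v(2) \<beta>[OF v(1)] qx3)
  qed
  ultimately show ?thesis by blast
qed

text \<open>The identity of M lifts to maps N -> E and E -> N. Both composites lie over the identity
  of M, hence are bijective, and so the lifts themselves are bijective.\<close>

lemma rigid_lift_unique:
  assumes rN: "reduction L A N M \<pi> \<iota> c s nil q" and rE: "reduction L A E M \<pi> \<iota> c s nil q'"
    and rig: "rigid L N" "rigid L E"
  shows "mod_iso L N E"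
proof -
  interpret N: reduction L A N M \<pi> \<iota> c s nil q by fact
  interpret E: reduction L A E M \<pi> \<iota> c s nil q' by fact
  obtain \<beta> where \<beta>: "\<beta> \<in> mod_hom L N E" "\<And>n. n \<in> carrier N \<Longrightarrow> q' (\<beta> n) = q n"
    using lift_over_reduction[OF rN rE rig(1)] by blast
  obtain \<alpha> where \<alpha>: "\<alpha> \<in> mod_hom L E N" "\<And>n. n \<in> carrier E \<Longrightarrow> q (\<alpha> n) = q' n"
    using lift_over_reduction[OF rE rN rig(2)] by blast
  have lm: "left_module L N" "left_module L E" by (rule N.N.left_module, rule E.N.left_module)
  have \<beta>c: "\<beta> n \<in> carrier E" if "n \<in> carrier N" for n by (rule mod_hom_closed[OF \<beta>(1) that])
  have \<alpha>c: "\<alpha> n \<in> carrier N" if "n \<in> carrier E" for n by (rule mod_hom_closed[OF \<alpha>(1) that])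
  have bij1: "bij_betw (compose (carrier N) \<alpha> \<beta>) (carrier N) (carrier N)"
    by (rule N.endomorphism_over_reduction_bij[OF mod_hom_compose[OF lm(1) \<beta>(1) \<alpha>(1)]])
      (simp add: compose_def \<alpha> \<beta> \<beta>c)
  have bij2: "bij_betw (compose (carrier E) \<beta> \<alpha>) (carrier E) (carrier E)"
    by (rule E.endomorphism_over_reduction_bij[OF mod_hom_compose[OF lm(2) \<alpha>(1) \<beta>(1)]])
      (simp add: compose_def \<alpha> \<beta> \<alpha>c)
  have "inj_on \<beta> (carrier N)"
  proof (rule inj_onI)
    fix x x' assume "x \<in> carrier N" "x' \<in> carrier N" "\<beta> x = \<beta> x'"
    then show "x = x'"
      using bij_betw_imp_inj_on[OF bij1] by (auto simp: compose_def inj_on_def)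
  qed
  moreover have "carrier E \<subseteq> \<beta> ` carrier N"
  proof
    fix x assume "x \<in> carrier E"
    then obtain z where "z \<in> carrier E" "x = compose (carrier E) \<beta> \<alpha> z"
      using bij_betw_imp_surj_on[OF bij2] by blast
    then show "x \<in> \<beta> ` carrier N" using \<alpha>c by (simp add: compose_def)
  qed
  ultimately have "bij_betw \<beta> (carrier N) (carrier E)" using \<beta>c by (auto simp: bij_betw_def)
  then show ?thesis using \<beta>(1) unfolding mod_iso_def by blast
qed

section \<open>Invariance under isomorphism\<close>

locale mod_isomorphism = mod_hom_loc A M N f for A (structure) and M N f +
  assumes bij: "bij_betw f (carrier M) (carrier N)"
begin

lemma injD: "x \<in> carrier M \<Longrightarrow> x' \<in> carrier M \<Longrightarrow> f x = f x' \<Longrightarrow> x = x'"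
  using bij_betw_imp_inj_on[OF bij] by (auto simp: inj_on_def)

lemma surj: "x \<in> carrier N \<Longrightarrow> \<exists>z\<in>carrier M. f z = x"
  unfolding bij_betw_imp_surj_on[OF bij, symmetric] by blast

lemma surj_Vec: assumes "x \<in> Vec N" shows "\<exists>z\<in>Vec M. (\<lambda>i. f (z i)) = x"
proof -
  have "\<forall>i. \<exists>z\<in>carrier M. f z = x i" using surj[OF VecD[OF assms]] by blast
  then obtain z where "\<And>i. z i \<in> carrier M" "\<And>i. f (z i) = x i" by metis
  then show ?thesis by (intro bexI[of _ z]) (auto simp: Vec_def)
qed

lemma inj_Vec: "z \<in> Vec M \<Longrightarrow> z' \<in> Vec M \<Longrightarrow> (\<lambda>i. f (z i)) = (\<lambda>i. f (z' i)) \<Longrightarrow> z = z'"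
  by (rule ext) (metis injD VecD)

lemma mvec: "B \<in> Mat A \<Longrightarrow> x \<in> Vec M \<Longrightarrow> mvec N n B (\<lambda>i. f (x i)) = (\<lambda>i. f (mvec M n B x i))"
  by (simp add: mvec_def lcomb MatD)

lemma rigid_iso:
  assumes "rigid A M" shows "rigid A N"
proof -
  obtain a b e d F y where p: "pres A M a b e d F y" and fac: "factors M a b e F"
    using assms unfolding rigid_def by blast
  note pM = presD(1-4)[OF p]
  have "pres A N a b e d F (\<lambda>i. f (y i))"
    unfolding pres_def
  proof (intro conjI ballI impI presD(1-3,5-7)[OF p])
    show "(\<lambda>i. f (y i)) \<in> Vec N" by (rule Vec[OF pM(4)])
    show "mvec N b d (\<lambda>i. f (y i)) = (\<lambda>i. f (y i))" using presD(8)[OF p] by (simp add: mvec pM)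
    show "mvec N b F (\<lambda>i. f (y i)) = (\<lambda>_. \<zero>\<^bsub>N\<^esub>)" using presD(9)[OF p] by (simp add: mvec pM zero)
    fix x assume "x \<in> Vec N"
    then obtain z where z: "z \<in> Vec M" "(\<lambda>i. f (z i)) = x" using surj_Vec by blast
    then obtain V where "V \<in> Mat A" "z = mvec M b V y" using presD(10)[OF p] by blast
    then show "\<exists>V\<in>Mat A. x = mvec N b V (\<lambda>i. f (y i))"
      using z by (intro bexI[of _ V]) (simp_all add: mvec pM)
  next
    fix V assume V: "V \<in> Mat A" "mvec N b V (\<lambda>i. f (y i)) = (\<lambda>_. \<zero>\<^bsub>N\<^esub>)"
    then have "(\<lambda>i. f (mvec M b V y i)) = (\<lambda>i. f \<zero>\<^bsub>M\<^esub>)" by (simp add: mvec pM zero)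
    then have "mvec M b V y = (\<lambda>i. \<zero>\<^bsub>M\<^esub>)"
      using M.mvec_Vec[OF V(1) pM(4)] by (intro inj_Vec) (simp_all add: Vec_def)
    then show "\<exists>U\<in>Mat A. mmul A b V d = mmul A a U F" using presD(11)[OF p V(1)] by blast
  qed
  moreover have "factors N a b e F"
    unfolding factors_def
  proof (intro ballI impI)
    fix x assume x: "x \<in> Vec N" "mvec N a e x = x"
    then obtain z where z: "z \<in> Vec M" "(\<lambda>i. f (z i)) = x" using surj_Vec by blast
    then have "mvec M a e z = z"
      using x(2) pM by (intro inj_Vec) (simp_all add: mvec flip: z(2))
    then obtain w where "w \<in> Vec M" "mvec M b F w = z" using fac z(1) unfolding factors_def by blast
    then show "\<exists>w\<in>Vec N. mvec N b F w = x"
      using z(2) Vec pM by (intro bexI[of _ "\<lambda>i. f (w i)"]) (simp_all add: mvec)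
  qed
  ultimately show ?thesis unfolding rigid_def by blast
qed

lemma submodule_vimage:
  assumes "submodule U A N" shows "submodule {x \<in> carrier M. f x \<in> U} A M"
  by (rule M.submoduleI)
    (auto simp: zero add smult submodule_zero[OF assms] submodule_add[OF assms] submodule_smult[OF assms])

lemma indecomposable_iso:
  assumes "indecomposable A M" shows "indecomposable A N"
  unfolding indecomposable_def
proof (intro conjI allI impI)
  show "carrier N \<noteq> {\<zero>\<^bsub>N\<^esub>}"
  proof
    assume N: "carrier N = {\<zero>\<^bsub>N\<^esub>}"
    have "x = \<zero>\<^bsub>M\<^esub>" if "x \<in> carrier M" for x
      using closed[OF that] N zero by (intro injD that) auto
    then show False using assms M.M.zero_closed unfolding indecomposable_def by blast
  qed
  fix U V assume UV: "submodule U A N" "submodule V A N" "U \<inter> V = {\<zero>\<^bsub>N\<^esub>}" "U <+>\<^bsub>N\<^esub> V = carrier N"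
  note sub = submodule_subset[OF UV(1)] submodule_subset[OF UV(2)]
  let ?p = "\<lambda>U. {x \<in> carrier M. f x \<in> U}"
  have triv: "U = {\<zero>\<^bsub>N\<^esub>}" if U: "submodule U A N" "?p U = {\<zero>\<^bsub>M\<^esub>}" for U
  proof -
    have "x = \<zero>\<^bsub>N\<^esub>" if "x \<in> U" for x
    proof -
      obtain z where "z \<in> carrier M" "f z = x" using surj submodule_subset[OF U(1)] \<open>x \<in> U\<close> by blast
      then have "z \<in> ?p U" using \<open>x \<in> U\<close> by simp
      then have "z = \<zero>\<^bsub>M\<^esub>" unfolding U(2) by simp
      then show ?thesis using \<open>f z = x\<close> zero by simp
    qed
    then show ?thesis using submodule_zero[OF U(1)] by blast
  qed
  have "?p U \<inter> ?p V = {\<zero>\<^bsub>M\<^esub>}"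
  proof -
    have "x = \<zero>\<^bsub>M\<^esub>" if "x \<in> ?p U \<inter> ?p V" for x
      using that UV(3) zero by (intro injD) auto
    then show ?thesis
      using submodule_zero[OF submodule_vimage[OF UV(1)]] submodule_zero[OF submodule_vimage[OF UV(2)]] by blast
  qed
  moreover have "?p U <+>\<^bsub>M\<^esub> ?p V = carrier M"
  proof
    show "?p U <+>\<^bsub>M\<^esub> ?p V \<subseteq> carrier M" by (auto simp: M.set_add_iff)
    show "carrier M \<subseteq> ?p U <+>\<^bsub>M\<^esub> ?p V"
    proof
      fix x assume x: "x \<in> carrier M"
      then obtain u v where uv: "u \<in> U" "v \<in> V" "f x = u \<oplus>\<^bsub>N\<^esub> v" using UV(4) N.set_add_iff closed by blast
      obtain u' where u': "u' \<in> carrier M" "f u' = u" using surj uv(1) sub by blast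
      obtain v' where v': "v' \<in> carrier M" "f v' = v" using surj uv(2) sub by blast
      have "x = u' \<oplus>\<^bsub>M\<^esub> v'" using x u' v' uv(3) by (intro injD) (simp_all add: add)
      then show "x \<in> ?p U <+>\<^bsub>M\<^esub> ?p V" unfolding M.set_add_iff using u' v' uv by blast
    qed
  qed
  ultimately have "?p U = {\<zero>\<^bsub>M\<^esub>} \<or> ?p V = {\<zero>\<^bsub>M\<^esub>}"
    using assms submodule_vimage UV unfolding indecomposable_def by blast
  then show "U = {\<zero>\<^bsub>N\<^esub>} \<or> V = {\<zero>\<^bsub>N\<^esub>}" using triv UV by blast
qed

end

lemma mod_isomorphismI:
  assumes "left_module A M" "left_module A N" "mod_iso A M N"
  obtains f where "mod_isomorphism A M N f"
proof -
  obtain f where "f \<in> mod_hom A M N" "bij_betw f (carrier M) (carrier N)"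
    using assms(3) by (auto simp: mod_iso_def)
  then show thesis
    by (intro that[of f] mod_isomorphism.intro mod_isomorphism_axioms.intro mod_hom_locI assms)
qed

text \<open>Composition with an isomorphism lets modules whose reductions are merely isomorphic be
  compared over a single M.\<close>

lemma reduction_iso:
  assumes "reduction L A N M \<pi> \<iota> c s nil q" "mod_isomorphism A M M' f"
  shows "reduction L A N M' \<pi> \<iota> c s nil (\<lambda>n. f (q n))"
proof -
  interpret N: reduction L A N M \<pi> \<iota> c s nil q by fact
  interpret f: mod_isomorphism A M M' f by fact
  show ?thesis
  proof (intro reduction.intro semilinear.intro semilinear_axioms.intro reduction_axioms.intro)
    show "nil_extension L A \<pi> \<iota> c s nil" by (rule N.nil_extension_axioms)
    show "left_module L N" by (rule N.N.left_module)
    show "left_module A M'" by (rule f.N.left_module)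
    show "\<pi> \<in> ring_hom L A" by (rule N.\<pi>)
  next
    fix n assume n: "n \<in> carrier N" "f (q n) = \<zero>\<^bsub>M'\<^esub>"
    then have "q n = \<zero>\<^bsub>M\<^esub>" using f.zero by (intro f.injD) (simp_all add: N.q_closed)
    then show "\<exists>v\<in>Vec N. n = lcomb N s c v" using N.q_ker n by blast
  next
    fix x assume "x \<in> carrier M'"
    then show "\<exists>n\<in>carrier N. f (q n) = x" using f.surj[of x] N.q_surj by blast
  qed (simp_all add: N.q_closed f.closed N.q_add f.add N.q_smult f.smult N.h_closed)
qed

text \<open>The kernel of a reduction is the set of combinations of the \<open>c j\<close>, so an
  isomorphism over L respects it and descends to the quotients.\<close>

lemma iso_reductions:
  assumes rN: "reduction L A N M \<pi> \<iota> c s nil q" and rN': "reduction L A N' M' \<pi> \<iota> c s nil q'"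
    and "mod_iso L N N'"
  shows "mod_iso A M M'"
proof -
  interpret N: reduction L A N M \<pi> \<iota> c s nil q by fact
  interpret N': reduction L A N' M' \<pi> \<iota> c s nil q' by fact
  obtain \<phi> where "mod_isomorphism L N N' \<phi>"
    using assms(3) by (rule mod_isomorphismI[OF N.N.left_module N'.N.left_module])
  then interpret \<phi>: mod_isomorphism L N N' \<phi> .
  have ker: "q n = \<zero>\<^bsub>M\<^esub> \<longleftrightarrow> q' (\<phi> n) = \<zero>\<^bsub>M'\<^esub>" if n: "n \<in> carrier N" for n
  proof
    assume "q n = \<zero>\<^bsub>M\<^esub>"
    then obtain v where v: "v \<in> Vec N" "n = lcomb N s c v" using N.q_ker n by blast
    then show "q' (\<phi> n) = \<zero>\<^bsub>M'\<^esub>" using N'.q_lcomb_c[OF \<phi>.Vec[OF v(1)]] by (simp add: \<phi>.lcomb[OF N.c])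
  next
    assume "q' (\<phi> n) = \<zero>\<^bsub>M'\<^esub>"
    then obtain v where v: "v \<in> Vec N'" "\<phi> n = lcomb N' s c v" using N'.q_ker \<phi>.closed[OF n] by blast
    obtain w where w: "w \<in> Vec N" "(\<lambda>i. \<phi> (w i)) = v" using \<phi>.surj_Vec[OF v(1)] by blast
    have "\<phi> n = \<phi> (lcomb N s c w)" using v(2) w by (simp add: \<phi>.lcomb[OF N.c])
    then have "n = lcomb N s c w" using n w(1) N.c by (intro \<phi>.injD) simp_all
    then show "q n = \<zero>\<^bsub>M\<^esub>" using N.q_lcomb_c[OF w(1)] by simp
  qed
  have eq: "q n = q n' \<longleftrightarrow> q' (\<phi> n) = q' (\<phi> n')" if n: "n \<in> carrier N" "n' \<in> carrier N" for n n'
  proof -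
    have "q n = q n' \<longleftrightarrow> q (n \<ominus>\<^bsub>N\<^esub> n') = \<zero>\<^bsub>M\<^esub>"
      using n by (simp add: N.q_diff N.M.M.minus_zero_iff N.q_closed)
    also have "\<dots> \<longleftrightarrow> q' (\<phi> (n \<ominus>\<^bsub>N\<^esub> n')) = \<zero>\<^bsub>M'\<^esub>" using n by (intro ker) simp
    also have "\<dots> \<longleftrightarrow> q' (\<phi> n) = q' (\<phi> n')"
      using n by (simp add: \<phi>.diff N'.q_diff \<phi>.closed N'.M.M.minus_zero_iff N'.q_closed)
    finally show ?thesis .
  qed
  define r where "r x = (SOME n. n \<in> carrier N \<and> q n = x)" for x
  have r: "r x \<in> carrier N" "q (r x) = x" if "x \<in> carrier M" for x
    using someI_ex[OF N.q_surj[OF that, unfolded Bex_def]] by (simp_all add: r_def)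
  define g where "g = (\<lambda>x\<in>carrier M. q' (\<phi> (r x)))"
  have g: "g (q n) = q' (\<phi> n)" if n: "n \<in> carrier N" for n
    using eq[of "r (q n)" n] r[OF N.q_closed[OF n]] n by (simp add: g_def N.q_closed)
  have "g \<in> mod_hom A M M'"
  proof (rule mod_homI)
    fix x assume x: "x \<in> carrier M"
    then show "g x \<in> carrier M'" using r[OF x] by (simp add: g_def N'.q_closed \<phi>.closed)
    fix x' assume x': "x' \<in> carrier M"
    have "g (x \<oplus>\<^bsub>M\<^esub> x') = g (q (r x \<oplus>\<^bsub>N\<^esub> r x'))" using r[OF x] r[OF x'] by (simp add: N.q_add)
    also have "\<dots> = q' (\<phi> (r x)) \<oplus>\<^bsub>M'\<^esub> q' (\<phi> (r x'))"
      using r[OF x] r[OF x'] by (simp add: g \<phi>.add N'.q_add \<phi>.closed)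
    finally show "g (x \<oplus>\<^bsub>M\<^esub> x') = g x \<oplus>\<^bsub>M'\<^esub> g x'" using x x' by (simp add: g_def)
  next
    fix a x assume ax: "a \<in> carrier A" "x \<in> carrier M"
    have "g (a \<odot>\<^bsub>M\<^esub> x) = g (q (\<iota> a \<odot>\<^bsub>N\<^esub> r x))" using r[OF ax(2)] ax by (simp add: N.q_smult N.\<iota>_closed N.\<pi>_\<iota>)
    also have "\<dots> = a \<odot>\<^bsub>M'\<^esub> q' (\<phi> (r x))"
      using r[OF ax(2)] ax by (simp add: g N.\<iota>_closed \<phi>.smult N'.q_smult \<phi>.closed N.\<pi>_\<iota>)
    finally show "g (a \<odot>\<^bsub>M\<^esub> x) = a \<odot>\<^bsub>M'\<^esub> g x" using ax by (simp add: g_def)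
  qed (simp add: g_def)
  moreover have "bij_betw g (carrier M) (carrier M')"
  proof (rule bij_betw_imageI)
    show "inj_on g (carrier M)"
    proof (rule inj_onI)
      fix x x' assume x: "x \<in> carrier M" "x' \<in> carrier M" "g x = g x'"
      then have "q (r x) = q (r x')" using eq[of "r x" "r x'"] r by (simp add: g_def)
      then show "x = x'" using r x by simp
    qed
    show "g ` carrier M = carrier M'"
    proof
      show "g ` carrier M \<subseteq> carrier M'" using r by (auto simp: g_def N'.q_closed \<phi>.closed)
      show "carrier M' \<subseteq> g ` carrier M"
      proof
        fix x assume "x \<in> carrier M'"
        then obtain n' where n': "n' \<in> carrier N'" "q' n' = x" using N'.q_surj by blast
        then obtain n where n: "n \<in> carrier N" "\<phi> n = n'" using \<phi>.surj by blast
        then show "x \<in> g ` carrier M" using n' g[OF n(1)] N.q_closed[OF n(1)] by force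
      qed
    qed
  qed
  ultimately show ?thesis unfolding mod_iso_def by blast
qed

section \<open>The path algebra of a finite acyclic quiver\<close>

lemma (in abelian_monoid) finsum_Sigma:
  assumes "finite A" "\<And>a. a \<in> A \<Longrightarrow> finite (B a)" "\<And>a b. a \<in> A \<Longrightarrow> b \<in> B a \<Longrightarrow> f a b \<in> carrier G"
  shows "(\<Oplus>a\<in>A. \<Oplus>b\<in>B a. f a b) = (\<Oplus>z\<in>Sigma A B. f (fst z) (snd z))"
  using assms
proof (induction A)
  case empty then show ?case by simp
next
  case (insert a A)
  have S: "Sigma (insert a A) B = Pair a ` B a \<union> Sigma A B" by auto
  have "(\<Oplus>z\<in>Sigma (insert a A) B. f (fst z) (snd z)) =
      (\<Oplus>z\<in>Pair a ` B a. f (fst z) (snd z)) \<oplus> (\<Oplus>z\<in>Sigma A B. f (fst z) (snd z))"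
    unfolding S using insert by (intro finsum_Un_disjoint) auto
  also have "(\<Oplus>z\<in>Pair a ` B a. f (fst z) (snd z)) = (\<Oplus>b\<in>B a. f a b)"
    using insert.prems by (subst finsum_reindex) (auto simp: inj_on_def)
  finally show ?case
    using insert by (subst finsum_insert) (auto intro!: finsum_closed)
qed

text \<open>A repeated vertex on a walk would cut out an oriented cycle, so every walk is free of
  repetitions, and a finite digraph has only finitely many of those.\<close>

lemma finite_paths:
  assumes "fin_digraph Q" "no_oriented_cycles Q"
  shows "finite (paths Q)"
proof -
  interpret fin_digraph Q by fact
  have "apath u p v" if w: "awalk u p v" for u p v
  proof (rule ccontr)
    assume "\<not> apath u p v"
    then have "\<not> distinct (awalk_verts u p)" using w by (simp add: apath_def)
    then obtain r w where "0 < length r" "awalk w r w" using awalk_not_distinct_decomp[OF w] by blast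
    then show False using assms(2) unfolding no_oriented_cycles_def by auto
  qed
  then have "paths Q \<subseteq> (\<lambda>(u, p, v). (u, p)) ` {(u, p, v). apath u p v}"
    unfolding paths_def by (force simp: image_iff)
  then show ?thesis by (rule finite_subset) (intro finite_imageI apaths_finite_triple)
qed

section \<open>The path algebra as a finite dimensional algebra\<close>

locale finite_paths = wf_digraph Q + field K for K :: "('k, 'c) ring_scheme" and Q :: "('v, 'e) pre_digraph" +
  assumes fin_paths: "finite (paths Q)"
begin

definition "pcomp q p = (fst p, snd p @ snd q)" for q p :: "'v \<times> 'e list"

declare split_paired_All [simp del]

abbreviation "FZ \<equiv> path_factorizations Q"

lemma path_endI: "awalk u p v \<Longrightarrow> path_end Q (u, p) = v"
  unfolding path_end_def by auto

lemma pcomp_path: "q \<in> paths Q \<Longrightarrow> p \<in> paths Q \<Longrightarrow> fst q = path_end Q p \<Longrightarrow> pcomp q p \<in> paths Q \<and> path_end Q (pcomp q p) = path_end Q q"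
proof -
  assume a: "q \<in> paths Q" "p \<in> paths Q" "fst q = path_end Q p"
  obtain u ps v where p: "p = (u, ps)" "awalk u ps v" using a(2) by (auto simp: paths_def)
  obtain w qs x where q: "q = (w, qs)" "awalk w qs x" using a(1) by (auto simp: paths_def)
  have "w = v" using a(3) path_endI[OF p(2)] p(1) q(1) by simp
  then have "awalk u (ps @ qs) x" using awalk_appendI p(2) q(2) by simp
  then show ?thesis using path_endI[OF q(2)] path_endI[OF \<open>awalk u (ps @ qs) x\<close>] p q by (auto simp: pcomp_def paths_def)
qed

lemma FZ_iff: "(q, p) \<in> FZ r \<longleftrightarrow> q \<in> paths Q \<and> p \<in> paths Q \<and> fst q = path_end Q p \<and> r = pcomp q p"
  by (auto simp: path_factorizations_def pcomp_def)

lemma finite_FZ: "finite (FZ r)"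
  by (rule finite_subset[of _ "paths Q \<times> paths Q"]) (auto simp: path_factorizations_def fin_paths)

lemma FZ_empty: "r \<notin> paths Q \<Longrightarrow> FZ r = {}"
  using pcomp_path by (auto simp: FZ_iff)

abbreviation "PA \<equiv> path_algebra K Q"

lemma PA_carrier: "f \<in> carrier PA \<longleftrightarrow> (\<forall>r. f r \<in> carrier K) \<and> (\<forall>r. r \<notin> paths Q \<longrightarrow> f r = \<zero>\<^bsub>K\<^esub>)"
proof -
  have "finite {r. f r \<noteq> \<zero>\<^bsub>K\<^esub>}" if "\<forall>r. r \<notin> paths Q \<longrightarrow> f r = \<zero>\<^bsub>K\<^esub>"
    by (rule finite_subset[OF _ fin_paths]) (use that in auto)
  then show ?thesis
    by (auto simp: path_algebra_def image_subset_iff)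
qed

lemma PA_fun_closed: "f \<in> carrier PA \<Longrightarrow> f r \<in> carrier K"
  unfolding PA_carrier by blast

lemma PA_fun_zero: "f \<in> carrier PA \<Longrightarrow> r \<notin> paths Q \<Longrightarrow> f r = \<zero>\<^bsub>K\<^esub>"
  unfolding PA_carrier by blast

lemma PA_simps:
  "f \<otimes>\<^bsub>PA\<^esub> g = (\<lambda>r. \<Oplus>\<^bsub>K\<^esub>z\<in>FZ r. f (fst z) \<otimes>\<^bsub>K\<^esub> g (snd z))"
  "\<one>\<^bsub>PA\<^esub> = (\<lambda>(u, p). if u \<in> verts Q \<and> p = [] then \<one>\<^bsub>K\<^esub> else \<zero>\<^bsub>K\<^esub>)"
  "\<zero>\<^bsub>PA\<^esub> = (\<lambda>_. \<zero>\<^bsub>K\<^esub>)" "f \<oplus>\<^bsub>PA\<^esub> g = (\<lambda>r. f r \<oplus>\<^bsub>K\<^esub> g r)" "c \<odot>\<^bsub>PA\<^esub> f = (\<lambda>r. c \<otimes>\<^bsub>K\<^esub> f r)"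
  by (simp_all add: path_algebra_def)

lemma PA_mult_closed: "f \<in> carrier PA \<Longrightarrow> g \<in> carrier PA \<Longrightarrow> f \<otimes>\<^bsub>PA\<^esub> g \<in> carrier PA"
  by (auto simp: PA_carrier PA_simps FZ_empty intro!: finsum_closed)

lemma PA_abelian_group: "abelian_group PA"
proof (rule abelian_groupI)
  fix f assume "f \<in> carrier PA"
  then show "\<exists>g\<in>carrier PA. g \<oplus>\<^bsub>PA\<^esub> f = \<zero>\<^bsub>PA\<^esub>"
    by (intro bexI[of _ "\<lambda>r. \<ominus>\<^bsub>K\<^esub> f r"])
      (auto simp: PA_carrier PA_simps l_neg minus_equality[of "\<zero>\<^bsub>K\<^esub>" "\<zero>\<^bsub>K\<^esub>"])
qed (auto simp: PA_carrier PA_simps a_ac)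

text \<open>Both sides are sums over the ways to cut \<open>r\<close> into three consecutive paths,
  indexed by two nested factorizations; \<open>?m\<close> is the change of bracketing.\<close>

lemma PA_assoc:
  assumes "f \<in> carrier PA" "g \<in> carrier PA" "h \<in> carrier PA"
  shows "(f \<otimes>\<^bsub>PA\<^esub> g) \<otimes>\<^bsub>PA\<^esub> h = f \<otimes>\<^bsub>PA\<^esub> (g \<otimes>\<^bsub>PA\<^esub> h)"
proof
  fix r
  have cl: "f x \<in> carrier K" "g x \<in> carrier K" "h x \<in> carrier K" for x
    using assms[THEN PA_fun_closed] by blast+
  let ?S1 = "Sigma (FZ r) (\<lambda>z. FZ (fst z))" and ?S2 = "Sigma (FZ r) (\<lambda>z. FZ (snd z))"
  let ?t1 = "\<lambda>w. (f (fst (snd w)) \<otimes>\<^bsub>K\<^esub> g (snd (snd w))) \<otimes>\<^bsub>K\<^esub> h (snd (fst w))"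
  let ?t2 = "\<lambda>w. f (fst (fst w)) \<otimes>\<^bsub>K\<^esub> (g (fst (snd w)) \<otimes>\<^bsub>K\<^esub> h (snd (snd w)))"
  let ?m = "\<lambda>w. ((fst (snd w), pcomp (snd (snd w)) (snd (fst w))), (snd (snd w), snd (fst w)))"
  have "((f \<otimes>\<^bsub>PA\<^esub> g) \<otimes>\<^bsub>PA\<^esub> h) r = (\<Oplus>\<^bsub>K\<^esub>z\<in>FZ r. \<Oplus>\<^bsub>K\<^esub>w\<in>FZ (fst z). (f (fst w) \<otimes>\<^bsub>K\<^esub> g (snd w)) \<otimes>\<^bsub>K\<^esub> h (snd z))"
    unfolding PA_simps using cl by (intro finsum_cong') (auto intro!: finsum_closed finsum_ldistr finite_FZ)
  also have "\<dots> = finsum K ?t1 ?S1"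
    using cl finite_FZ by (subst finsum_Sigma) auto
  also have "\<dots> = finsum K (\<lambda>w. ?t2 (?m w)) ?S1"
    using cl by (intro finsum_cong') (auto simp: m_assoc)
  also have "\<dots> = finsum K ?t2 (?m ` ?S1)"
  proof (rule finsum_reindex[symmetric])
    show "inj_on ?m ?S1"
      by (rule inj_on_inverseI[where g = "\<lambda>w. ((pcomp (fst (fst w)) (fst (snd w)), snd (snd w)), (fst (fst w), fst (snd w)))"])
        (auto simp: FZ_iff)
  qed (use cl in auto)
  also have "?m ` ?S1 = ?S2"
  proof
    show "?m ` ?S1 \<subseteq> ?S2"
      using pcomp_path by (auto simp: FZ_iff) (simp_all add: pcomp_def)
    show "?S2 \<subseteq> ?m ` ?S1"
    proof
      fix w assume "w \<in> ?S2"
      then obtain q p q1 p1 where w: "w = ((q, p), (q1, p1))" "(q, p) \<in> FZ r" "(q1, p1) \<in> FZ p" by auto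
      have S: "((pcomp q q1, p1), (q, q1)) \<in> ?S1"
        using w pcomp_path by (auto simp: FZ_iff) (simp_all add: pcomp_def)
      have "w = ?m ((pcomp q q1, p1), (q, q1))" using w by (simp add: FZ_iff)
      then show "w \<in> ?m ` ?S1" using S by (rule image_eqI)
    qed
  qed
  also have "finsum K ?t2 ?S2 = (\<Oplus>\<^bsub>K\<^esub>z\<in>FZ r. \<Oplus>\<^bsub>K\<^esub>w\<in>FZ (snd z). f (fst z) \<otimes>\<^bsub>K\<^esub> (g (fst w) \<otimes>\<^bsub>K\<^esub> h (snd w)))"
    using cl finite_FZ by (subst finsum_Sigma) auto
  also have "\<dots> = (f \<otimes>\<^bsub>PA\<^esub> (g \<otimes>\<^bsub>PA\<^esub> h)) r"
    unfolding PA_simps using cl by (intro finsum_cong') (auto intro!: finsum_closed finsum_rdistr[symmetric] finite_FZ)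
  finally show "((f \<otimes>\<^bsub>PA\<^esub> g) \<otimes>\<^bsub>PA\<^esub> h) r = (f \<otimes>\<^bsub>PA\<^esub> (g \<otimes>\<^bsub>PA\<^esub> h)) r" .
qed

lemma trivial_path: "u \<in> verts Q \<Longrightarrow> (u, []) \<in> paths Q \<and> path_end Q (u, []) = u"
  using path_endI[of u "[]" u] by (auto simp: paths_def awalk_Nil_iff)

lemma path_ends: "p \<in> paths Q \<Longrightarrow> fst p \<in> verts Q \<and> path_end Q p \<in> verts Q"
  using path_endI by (auto simp: paths_def dest: awalk_hd_in_verts awalk_last_in_verts)

lemma PA_one_closed: "\<one>\<^bsub>PA\<^esub> \<in> carrier PA"
  using trivial_path by (auto simp: PA_carrier PA_simps)

lemma PA_l_one: assumes "f \<in> carrier PA" shows "\<one>\<^bsub>PA\<^esub> \<otimes>\<^bsub>PA\<^esub> f = f"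
proof
  fix r
  have cl: "f x \<in> carrier K" for x by (rule PA_fun_closed[OF assms])
  show "(\<one>\<^bsub>PA\<^esub> \<otimes>\<^bsub>PA\<^esub> f) r = f r"
  proof (cases "r \<in> paths Q")
    case True
    \<comment> \<open>The only factorization that contributes: a trivial left factor has to sit at
      the end vertex of \<open>r\<close>.\<close>
    let ?z = "((path_end Q r, []), r)"
    have z: "?z \<in> FZ r" using True path_ends trivial_path by (auto simp: FZ_iff pcomp_def)
    have "(\<one>\<^bsub>PA\<^esub> \<otimes>\<^bsub>PA\<^esub> f) r = (\<Oplus>\<^bsub>K\<^esub>z\<in>FZ r. if ?z = z then f (snd z) else \<zero>\<^bsub>K\<^esub>)"
      unfolding PA_simps
    proof (intro finsum_cong')
      fix z assume "z \<in> FZ r"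
      then obtain u q p where z: "z = ((u, q), p)" "p \<in> paths Q" "u = path_end Q p" "r = pcomp (u, q) p"
        "(u, q) \<in> paths Q" by (cases z) (auto simp: FZ_iff)
      have u: "u \<in> verts Q" using path_ends[OF z(2)] z(3) by simp
      show "(case fst z of (u, p) \<Rightarrow> if u \<in> verts Q \<and> p = [] then \<one>\<^bsub>K\<^esub> else \<zero>\<^bsub>K\<^esub>) \<otimes>\<^bsub>K\<^esub> f (snd z) =
          (if ?z = z then f (snd z) else \<zero>\<^bsub>K\<^esub>)"
      proof (cases "q = []")
        case True
        then have "r = p" using z(4) by (simp add: pcomp_def)
        then show ?thesis using True u cl z(3) by (simp add: z(1))
      qed (use cl in \<open>simp add: z(1)\<close>)
    qed (use cl in auto)
    also have "\<dots> = f r" using finsum_singleton[OF z finite_FZ, of "\<lambda>z. f (snd z)"] cl by simp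
    finally show ?thesis .
  qed (use PA_fun_zero[OF assms] in \<open>simp add: PA_simps FZ_empty\<close>)
qed

lemma PA_r_one: assumes "f \<in> carrier PA" shows "f \<otimes>\<^bsub>PA\<^esub> \<one>\<^bsub>PA\<^esub> = f"
proof
  fix r
  have cl: "f x \<in> carrier K" for x by (rule PA_fun_closed[OF assms])
  show "(f \<otimes>\<^bsub>PA\<^esub> \<one>\<^bsub>PA\<^esub>) r = f r"
  proof (cases "r \<in> paths Q")
    case True
    let ?z = "(r, (fst r, []))"
    have z: "?z \<in> FZ r" using True path_ends trivial_path by (auto simp: FZ_iff pcomp_def)
    have "(f \<otimes>\<^bsub>PA\<^esub> \<one>\<^bsub>PA\<^esub>) r = (\<Oplus>\<^bsub>K\<^esub>z\<in>FZ r. if ?z = z then f (fst z) else \<zero>\<^bsub>K\<^esub>)"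
      unfolding PA_simps
    proof (intro finsum_cong')
      fix z assume "z \<in> FZ r"
      then obtain q u p where z: "z = (q, (u, p))" "q \<in> paths Q" "(u, p) \<in> paths Q" "fst q = path_end Q (u, p)" "r = pcomp q (u, p)"
        by (cases z) (auto simp: FZ_iff)
      have u: "u \<in> verts Q" using path_ends[OF z(3)] by simp
      show "f (fst z) \<otimes>\<^bsub>K\<^esub> (case snd z of (u, p) \<Rightarrow> if u \<in> verts Q \<and> p = [] then \<one>\<^bsub>K\<^esub> else \<zero>\<^bsub>K\<^esub>) =
          (if ?z = z then f (fst z) else \<zero>\<^bsub>K\<^esub>)"
      proof (cases "p = []")
        case True
        have "fst q = u" using z(4) trivial_path[OF u] True by simp
        then have "r = q" using z(5) True by (auto simp: pcomp_def prod_eq_iff)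
        then show ?thesis using True u cl \<open>fst q = u\<close> by (simp add: z(1))
      qed (use cl in \<open>simp add: z(1)\<close>)
    qed (use cl in auto)
    also have "\<dots> = f r" using finsum_singleton[OF z finite_FZ, of "\<lambda>z. f (fst z)"] cl by simp
    finally show ?thesis .
  qed (use PA_fun_zero[OF assms] in \<open>simp add: PA_simps FZ_empty\<close>)
qed

lemma PA_ring: "ring PA"
proof (rule ringI[OF PA_abelian_group])
  show "monoid PA"
    by (rule monoidI) (simp_all add: PA_mult_closed PA_one_closed PA_assoc PA_l_one PA_r_one)
  fix f g h assume f: "f \<in> carrier PA" "g \<in> carrier PA" "h \<in> carrier PA"
  note cl = f[THEN PA_fun_closed]
  show "(f \<oplus>\<^bsub>PA\<^esub> g) \<otimes>\<^bsub>PA\<^esub> h = f \<otimes>\<^bsub>PA\<^esub> h \<oplus>\<^bsub>PA\<^esub> g \<otimes>\<^bsub>PA\<^esub> h"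
    unfolding PA_simps
  proof (rule ext)
    fix r
    have "(\<Oplus>\<^bsub>K\<^esub>z\<in>FZ r. (f (fst z) \<oplus>\<^bsub>K\<^esub> g (fst z)) \<otimes>\<^bsub>K\<^esub> h (snd z)) =
        (\<Oplus>\<^bsub>K\<^esub>z\<in>FZ r. f (fst z) \<otimes>\<^bsub>K\<^esub> h (snd z) \<oplus>\<^bsub>K\<^esub> g (fst z) \<otimes>\<^bsub>K\<^esub> h (snd z))"
      using cl by (intro finsum_cong') (simp_all add: l_distr)
    also have "\<dots> = (\<Oplus>\<^bsub>K\<^esub>z\<in>FZ r. f (fst z) \<otimes>\<^bsub>K\<^esub> h (snd z)) \<oplus>\<^bsub>K\<^esub> (\<Oplus>\<^bsub>K\<^esub>z\<in>FZ r. g (fst z) \<otimes>\<^bsub>K\<^esub> h (snd z))"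
      using cl by (intro finsum_addf) simp_all
    finally show "(\<Oplus>\<^bsub>K\<^esub>z\<in>FZ r. (f (fst z) \<oplus>\<^bsub>K\<^esub> g (fst z)) \<otimes>\<^bsub>K\<^esub> h (snd z)) = \<dots>" .
  qed
  show "h \<otimes>\<^bsub>PA\<^esub> (f \<oplus>\<^bsub>PA\<^esub> g) = h \<otimes>\<^bsub>PA\<^esub> f \<oplus>\<^bsub>PA\<^esub> h \<otimes>\<^bsub>PA\<^esub> g"
    unfolding PA_simps
  proof (rule ext)
    fix r
    have "(\<Oplus>\<^bsub>K\<^esub>z\<in>FZ r. h (fst z) \<otimes>\<^bsub>K\<^esub> (f (snd z) \<oplus>\<^bsub>K\<^esub> g (snd z))) =
        (\<Oplus>\<^bsub>K\<^esub>z\<in>FZ r. h (fst z) \<otimes>\<^bsub>K\<^esub> f (snd z) \<oplus>\<^bsub>K\<^esub> h (fst z) \<otimes>\<^bsub>K\<^esub> g (snd z))"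
      using cl by (intro finsum_cong') (simp_all add: r_distr)
    also have "\<dots> = (\<Oplus>\<^bsub>K\<^esub>z\<in>FZ r. h (fst z) \<otimes>\<^bsub>K\<^esub> f (snd z)) \<oplus>\<^bsub>K\<^esub> (\<Oplus>\<^bsub>K\<^esub>z\<in>FZ r. h (fst z) \<otimes>\<^bsub>K\<^esub> g (snd z))"
      using cl by (intro finsum_addf) simp_all
    finally show "(\<Oplus>\<^bsub>K\<^esub>z\<in>FZ r. h (fst z) \<otimes>\<^bsub>K\<^esub> (f (snd z) \<oplus>\<^bsub>K\<^esub> g (snd z))) = \<dots>" .
  qed
qed

lemma PA_assoc_algebra: "assoc_algebra K PA"
proof (intro assoc_algebra.intro assoc_algebra_axioms.intro PA_ring)
  show "module K PA"
    by (rule moduleI[OF cring_axioms PA_abelian_group])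
      (auto simp: PA_carrier PA_simps l_distr r_distr m_assoc fun_eq_iff)
  fix c f g assume f: "c \<in> carrier K" "f \<in> carrier PA" "g \<in> carrier PA"
  note cl = f(2,3)[THEN PA_fun_closed]
  have "(\<Oplus>\<^bsub>K\<^esub>z\<in>FZ r. (c \<otimes>\<^bsub>K\<^esub> f (fst z)) \<otimes>\<^bsub>K\<^esub> g (snd z)) = c \<otimes>\<^bsub>K\<^esub> (\<Oplus>\<^bsub>K\<^esub>z\<in>FZ r. f (fst z) \<otimes>\<^bsub>K\<^esub> g (snd z))" for r
    using cl f(1) by (subst finsum_rdistr) (auto simp: m_assoc finite_FZ intro!: finsum_cong')
  then show "c \<odot>\<^bsub>PA\<^esub> f \<otimes>\<^bsub>PA\<^esub> g = c \<odot>\<^bsub>PA\<^esub> (f \<otimes>\<^bsub>PA\<^esub> g)"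
    unfolding PA_simps by (rule ext)
  have "(\<Oplus>\<^bsub>K\<^esub>z\<in>FZ r. f (fst z) \<otimes>\<^bsub>K\<^esub> (c \<otimes>\<^bsub>K\<^esub> g (snd z))) = c \<otimes>\<^bsub>K\<^esub> (\<Oplus>\<^bsub>K\<^esub>z\<in>FZ r. f (fst z) \<otimes>\<^bsub>K\<^esub> g (snd z))" for r
    using cl f(1) by (subst finsum_rdistr) (auto simp: m_lcomm finite_FZ intro!: finsum_cong')
  then show "f \<otimes>\<^bsub>PA\<^esub> (c \<odot>\<^bsub>PA\<^esub> g) = c \<odot>\<^bsub>PA\<^esub> (f \<otimes>\<^bsub>PA\<^esub> g)"
    unfolding PA_simps by (rule ext)
qed

lemma PA_finitely_generated: "finitely_generated K PA"
proof -
  interpret PA: assoc_algebra K PA by (rule PA_assoc_algebra)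
  have lm: "left_module K PA"
    by (intro left_module.intro left_module_axioms.intro ring_axioms PA_abelian_group)
      (auto simp: PA.smult_l_distr PA.smult_r_distr PA.smult_assoc1)
  define \<delta> where "\<delta> p = (\<lambda>r. if r = p then \<one>\<^bsub>K\<^esub> else \<zero>\<^bsub>K\<^esub>)" for p :: "'v \<times> 'e list"
  have \<delta>: "\<delta> p \<in> carrier PA" if "p \<in> paths Q" for p using that by (auto simp: PA_carrier \<delta>_def)
  have "W = carrier PA" if W: "submodule W K PA" "\<delta> ` paths Q \<subseteq> W" for W
  proof
    show "W \<subseteq> carrier PA" by (rule submodule_subset[OF W(1)])
    \<comment> \<open>Induction over a finite set that contains the support, splitting off the value
      at one path.\<close>
    have sub: "f \<in> W" if "finite S" "S \<subseteq> paths Q" "f \<in> carrier PA" "\<And>r. r \<notin> S \<Longrightarrow> f r = \<zero>\<^bsub>K\<^esub>" for S f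
      using that
    proof (induction S arbitrary: f)
      case empty
      then have "f = \<zero>\<^bsub>PA\<^esub>" by (auto simp: PA_simps)
      then show ?case using submodule_zero[OF W(1)] by simp
    next
      case (insert p S)
      note cl = insert.prems(2)[THEN PA_fun_closed]
      let ?g = "\<lambda>r. if r = p then \<zero>\<^bsub>K\<^esub> else f r"
      have "?g \<in> carrier PA" using insert.prems(2) by (auto simp: PA_carrier)
      then have "?g \<in> W" using insert by (intro insert.IH) auto
      moreover have "f p \<odot>\<^bsub>PA\<^esub> \<delta> p \<in> W" using W(2) insert.prems cl by (intro submodule_smult[OF W(1)]) auto
      moreover have "f = f p \<odot>\<^bsub>PA\<^esub> \<delta> p \<oplus>\<^bsub>PA\<^esub> ?g"
        by (rule ext) (simp add: PA_simps \<delta>_def cl)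
      ultimately show ?case using submodule_add[OF W(1)] by metis
    qed
    show "carrier PA \<subseteq> W" using sub[OF fin_paths] by (auto simp: PA_carrier)
  qed
  then have "gens K PA (\<delta> ` paths Q)" using \<delta> by (auto simp: gens_def)
  then show ?thesis using finitely_generated_iff[OF lm] fin_paths by blast
qed

lemma PA_fd_algebra: "fd_algebra K PA"
  by (intro fd_algebra.intro fd_algebra_axioms.intro PA_assoc_algebra field_axioms PA_finitely_generated)

end

section \<open>Local commutative algebras over an algebraically closed field\<close>

text \<open>A generating set of least cardinality is independent: a nontrivial relation would allow
  one generator to be expressed by the others and dropped.\<close>

lemma vector_space_basis:
  assumes "field K" "left_module K V" "finitely_generated K V"
  shows "\<exists>n y. y \<in> Vec V \<and> (\<forall>x\<in>carrier V. \<exists>v\<in>Vec K. x = lcomb V n v y) \<and>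
    (\<forall>v\<in>Vec K. lcomb V n v y = \<zero>\<^bsub>V\<^esub> \<longrightarrow> (\<forall>k<n. v k = \<zero>\<^bsub>K\<^esub>))"
proof -
  interpret K: field K by fact
  interpret left_module K V by fact
  obtain S0 where "finite S0 \<and> gens K V S0" using assms finitely_generated_iff by blast
  then obtain S where S: "finite S" "gens K V S" and min: "\<And>S'. finite S' \<Longrightarrow> gens K V S' \<Longrightarrow> card S \<le> card S'"
    using ex_has_least_nat[of "\<lambda>S. finite S \<and> gens K V S" S0 card] by blast
  obtain n y where y: "y \<in> Vec V" "bij_betw y {..<n} S"
    and span: "\<forall>x\<in>carrier V. \<exists>v\<in>Vec K. x = lcomb V n v y" using gens_lcomb[OF assms(2) S] by blast
  have indep: "v k = \<zero>\<^bsub>K\<^esub>" if v: "v \<in> Vec K" "lcomb V n v y = \<zero>\<^bsub>V\<^esub>" "k < n" for v k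
  proof (rule ccontr)
    assume "v k \<noteq> \<zero>\<^bsub>K\<^esub>"
    then have u: "v k \<in> Units K" using VecD[OF v(1)] by (simp add: K.field_Units)
    have vk: "v k \<in> carrier K" using v(1) by (rule VecD)
    have yk: "y k \<in> S" using y(2) v(3) by (auto simp: bij_betw_def)
    have "gens K V (S - {y k})"
      unfolding gens_def
    proof (intro conjI allI impI)
      show "S - {y k} \<subseteq> carrier V" using S by (auto simp: gens_def)
      fix W assume W: "submodule W K V" "S - {y k} \<subseteq> W"
      let ?e = "\<lambda>i. if i = k then \<one>\<^bsub>K\<^esub> else \<zero>\<^bsub>K\<^esub>" and ?w = "\<lambda>i. if i = k then \<zero>\<^bsub>K\<^esub> else v i"
      have e: "?e \<in> Vec K" and w: "?w \<in> Vec K" using v(1) by (auto simp: Vec_def)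
      have vke: "(\<lambda>i. v k \<otimes>\<^bsub>K\<^esub> ?e i) \<in> Vec K" using e vk by (simp add: Vec_def)
      have "v = (\<lambda>i. v k \<otimes>\<^bsub>K\<^esub> ?e i \<oplus>\<^bsub>K\<^esub> ?w i)" using VecD[OF v(1)] by (auto simp: fun_eq_iff)
      then have "lcomb V n v y = v k \<odot>\<^bsub>V\<^esub> y k \<oplus>\<^bsub>V\<^esub> lcomb V n ?w y"
        using lcomb_add_l[OF vke w y(1), of n] lcomb_smult_l[OF vk e y(1), of n] lcomb_unit[OF v(3) y(1)] by simp
      then have "v k \<odot>\<^bsub>V\<^esub> y k = \<ominus>\<^bsub>V\<^esub> lcomb V n ?w y"
        using v(2) VecD[OF y(1)] vk w y(1) by (intro M.minus_equality[symmetric]) simp_all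
      moreover have "lcomb V n ?w y \<in> W"
        unfolding lcomb_def
      proof (rule submodule_ssum[OF W(1)])
        fix i assume i: "i < n"
        show "?w i \<odot>\<^bsub>V\<^esub> y i \<in> W"
        proof (cases "i = k")
          case True then show ?thesis using submodule_zero[OF W(1)] VecD[OF y(1)] by simp
        next
          case False
          then have "y i \<in> S - {y k}" using y(2) i v(3) by (auto simp: bij_betw_def inj_on_def)
          then show ?thesis using False W VecD[OF v(1)] by (auto intro: submodule_smult[OF W(1)])
        qed
      qed
      ultimately have vy: "v k \<odot>\<^bsub>V\<^esub> y k \<in> W" using submodule_minus[OF W(1)] by simp
      have "inv\<^bsub>K\<^esub> (v k) \<odot>\<^bsub>V\<^esub> (v k \<odot>\<^bsub>V\<^esub> y k) \<in> W"
        by (rule submodule_smult[OF W(1) K.Units_inv_closed[OF u] vy])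
      moreover have "inv\<^bsub>K\<^esub> (v k) \<odot>\<^bsub>V\<^esub> (v k \<odot>\<^bsub>V\<^esub> y k) = y k"
        using smult_assoc1[OF K.Units_inv_closed[OF u] vk VecD[OF y(1), of k]] u VecD[OF y(1), of k] by simp
      ultimately have "S \<subseteq> W" using W(2) by auto
      then show "W = carrier V" using S(2) W(1) by (auto simp: gens_def)
    qed
    then have "card S \<le> card (S - {y k})" using min S(1) by blast
    then show False using S(1) yk by (metis card_Diff1_less not_less)
  qed
  then show ?thesis using y(1) span by (intro exI[of _ n] exI[of _ y]) blast
qed

locale local_algebra = K: algebraically_closed K + RA: algebra K R
  for K :: "('k, 'c) ring_scheme" and R :: "('k, 'r) module" +
  assumes fin: "finitely_generated K R" and loc: "local_ring R"
begin

lemma left_module_R: "left_module K R"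
  by (intro left_module.intro left_module_axioms.intro K.ring_axioms RA.M.abelian_group_axioms)
    (auto simp: RA.smult_l_distr RA.smult_r_distr RA.smult_assoc1)

sublocale V: left_module K R by (rule left_module_R)

lemma bounded: "bounded_length K R"
  by (rule bounded_length_vector_space[OF K.field_axioms left_module_R fin])

definition "sc c = c \<odot>\<^bsub>R\<^esub> \<one>\<^bsub>R\<^esub>"

lemma sc_closed [simp]: "c \<in> carrier K \<Longrightarrow> sc c \<in> carrier R"
  by (simp add: sc_def)

lemma sc_mult: "c \<in> carrier K \<Longrightarrow> x \<in> carrier R \<Longrightarrow> sc c \<otimes>\<^bsub>R\<^esub> x = c \<odot>\<^bsub>R\<^esub> x"
  by (simp add: sc_def RA.smult_assoc2)

lemma mult_sc: "c \<in> carrier K \<Longrightarrow> x \<in> carrier R \<Longrightarrow> x \<otimes>\<^bsub>R\<^esub> sc c = c \<odot>\<^bsub>R\<^esub> x"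
  using RA.m_comm[of x "sc c"] by (simp add: sc_mult)

lemma sc_add: "c \<in> carrier K \<Longrightarrow> c' \<in> carrier K \<Longrightarrow> sc (c \<oplus>\<^bsub>K\<^esub> c') = sc c \<oplus>\<^bsub>R\<^esub> sc c'"
  by (simp add: sc_def RA.smult_l_distr)

lemma sc_mult_sc: "c \<in> carrier K \<Longrightarrow> c' \<in> carrier K \<Longrightarrow> sc (c \<otimes>\<^bsub>K\<^esub> c') = sc c \<otimes>\<^bsub>R\<^esub> sc c'"
  by (simp add: sc_mult) (simp add: sc_def RA.smult_assoc1)

lemma sc_one: "sc \<one>\<^bsub>K\<^esub> = \<one>\<^bsub>R\<^esub>"
  by (simp add: sc_def)

lemma sc_zero: "sc \<zero>\<^bsub>K\<^esub> = \<zero>\<^bsub>R\<^esub>"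
  by (simp add: sc_def)

lemma ideal_submodule: assumes "ideal J R" shows "submodule J K R"
proof -
  interpret J: ideal J R by fact
  show ?thesis
  proof (rule V.submoduleI)
    show "c \<odot>\<^bsub>R\<^esub> x \<in> J" if "c \<in> carrier K" "x \<in> J" for c x
      using J.I_l_closed[OF that(2) sc_closed[OF that(1)]] that J.a_subset by (simp add: sc_mult subset_iff)
  qed (use J.a_subset in auto)
qed

section \<open>The maximal ideal and the residue field\<close>

definition "mx = (THE J. maximalideal J R)"

lemma mx: "maximalideal mx R"
  unfolding mx_def using loc theI'[of "\<lambda>J. maximalideal J R"] by (simp add: local_ring_def)

lemma mx_unique: "maximalideal J R \<Longrightarrow> J = mx"
  using loc mx by (auto simp: local_ring_def)

lemma mx_ideal: "ideal mx R"
  using mx by (rule maximalideal.axioms(1))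

lemma mx_prime: "x \<in> carrier R \<Longrightarrow> y \<in> carrier R \<Longrightarrow> x \<otimes>\<^bsub>R\<^esub> y \<in> mx \<Longrightarrow> x \<in> mx \<or> y \<in> mx"
  using RA.maximalideal_prime[OF mx] by (rule primeideal.I_prime)

lemma mx_closed: "x \<in> mx \<Longrightarrow> x \<in> carrier R"
  using additive_subgroup.a_subset[OF ideal.axioms(1)[OF mx_ideal]] by auto

lemma one_notin_mx: "\<one>\<^bsub>R\<^esub> \<notin> mx"
  using ideal.one_imp_carrier[OF mx_ideal] maximalideal.I_notcarr[OF mx] by metis

text \<open>If \<open>x\<close> were no unit, its principal ideal would be proper and contained in a
  maximal ideal, which exists by the chain condition and can only be \<open>mx\<close>.\<close>

lemma unit_outside: assumes x: "x \<in> carrier R" "x \<notin> mx" shows "x \<in> Units R"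
proof -
  let ?P = "\<lambda>J. ideal J R \<and> J \<noteq> carrier R \<and> x \<in> J"
  have xJ: "ideal (PIdl\<^bsub>R\<^esub> x) R" "x \<in> PIdl\<^bsub>R\<^esub> x" using RA.cgenideal_ideal x(1) RA.cgenideal_self by auto
  have "PIdl\<^bsub>R\<^esub> x = carrier R"
  proof (rule ccontr)
    assume "PIdl\<^bsub>R\<^esub> x \<noteq> carrier R"
    then obtain J where J: "submodule J K R" "?P J"
      and max: "\<forall>W. submodule W K R \<longrightarrow> ?P W \<longrightarrow> J \<subseteq> W \<longrightarrow> W = J"
      using max_submodule[of K R "PIdl\<^bsub>R\<^esub> x" ?P, OF bounded ideal_submodule[OF xJ(1)]] xJ by blast
    have "maximalideal J R"
    proof (rule maximalidealI)
      fix J' assume "ideal J' R" "J \<subseteq> J'" "J' \<subseteq> carrier R"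
      then show "J' = J \<or> J' = carrier R" using max ideal_submodule J(2) by blast
    qed (use J in auto)
    then show False using mx_unique J(2) x(2) by blast
  qed
  then have "\<one>\<^bsub>R\<^esub> \<in> PIdl\<^bsub>R\<^esub> x" by simp
  then obtain z where "z \<in> carrier R" "\<one>\<^bsub>R\<^esub> = z \<otimes>\<^bsub>R\<^esub> x" by (auto simp: cgenideal_def)
  then show ?thesis using x(1) RA.m_comm[of z x] unfolding Units_def by auto
qed

lemma sc_mx: assumes "c \<in> carrier K" "sc c \<in> mx" shows "c = \<zero>\<^bsub>K\<^esub>"
proof (rule ccontr)
  assume "c \<noteq> \<zero>\<^bsub>K\<^esub>"
  then have u: "c \<in> Units K" using assms by (simp add: K.field_Units)
  have "sc (inv\<^bsub>K\<^esub> c) \<otimes>\<^bsub>R\<^esub> sc c \<in> mx"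
    using ideal.I_l_closed[OF mx_ideal assms(2)] u by simp
  then show False using u assms(1) one_notin_mx by (simp add: sc_one flip: sc_mult_sc)
qed

text \<open>Every element of \<open>R\<close> satisfies a polynomial equation over \<open>K\<close>, and \<open>K\<close> is algebraically closed;
  so the residue field is \<open>K\<close>.\<close>

definition "evR r p = foldl (\<lambda>x a. x \<otimes>\<^bsub>R\<^esub> r \<oplus>\<^bsub>R\<^esub> sc a) \<zero>\<^bsub>R\<^esub> p"

lemma evR_Nil [simp]: "evR r [] = \<zero>\<^bsub>R\<^esub>"
  and evR_snoc [simp]: "evR r (p @ [a]) = evR r p \<otimes>\<^bsub>R\<^esub> r \<oplus>\<^bsub>R\<^esub> sc a"
  by (simp_all add: evR_def)

lemma evR_closed: "r \<in> carrier R \<Longrightarrow> set p \<subseteq> carrier K \<Longrightarrow> evR r p \<in> carrier R"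
  by (induction p rule: rev_induct) auto

text \<open>Division of a polynomial by X - c with remainder its value at c, evaluated at
  \<open>r\<close>; the quotient is built by Horner's scheme.\<close>

lemma evR_divide:
  assumes r: "r \<in> carrier R" and c: "c \<in> carrier K" and "set p \<subseteq> carrier K" "p \<noteq> []"
  shows "\<exists>q. set q \<subseteq> carrier K \<and> length p = Suc (length q) \<and> (q \<noteq> [] \<longrightarrow> hd q = hd p) \<and>
    evR r p = (r \<ominus>\<^bsub>R\<^esub> sc c) \<otimes>\<^bsub>R\<^esub> evR r q \<oplus>\<^bsub>R\<^esub> sc (K.eval p c)"
  using assms(3,4)
proof (induction p rule: rev_induct)
  case (snoc a p)
  have a: "a \<in> carrier K" and p: "set p \<subseteq> carrier K" using snoc.prems by auto
  have ec: "K.eval p c \<in> carrier K" using K.eval_in_carrier[OF p c] .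
  have ev: "K.eval (p @ [a]) c = K.eval p c \<otimes>\<^bsub>K\<^esub> c \<oplus>\<^bsub>K\<^esub> a" by (rule K.eval_append_aux[OF p a c])
  show ?case
  proof (cases "p = []")
    case True
    then show ?thesis using a c r ev by (intro exI[of _ "[]"]) (simp add: evR_def)
  next
    case False
    then obtain q where q: "set q \<subseteq> carrier K" "length p = Suc (length q)" "q \<noteq> [] \<longrightarrow> hd q = hd p"
      "evR r p = (r \<ominus>\<^bsub>R\<^esub> sc c) \<otimes>\<^bsub>R\<^esub> evR r q \<oplus>\<^bsub>R\<^esub> sc (K.eval p c)" using snoc.IH[OF p] by blast
    let ?q = "q @ [K.eval p c]"
    \<comment> \<open>Keeping the leading coefficient ensures that a monic polynomial has a monic
      quotient. If \<open>q\<close> is empty, \<open>p\<close> has a single entry, which is also its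
      value at c.\<close>
    have hd: "hd ?q = hd (p @ [a])"
    proof (cases q)
      case Nil
      then obtain b where "p = [b]" using q(2) by (cases p) auto
      then show ?thesis using Nil p c by simp
    qed (use q(3) False in simp)
    define E where "E = evR r q"
    define e where "e = sc (K.eval p c)"
    define d where "d = r \<ominus>\<^bsub>R\<^esub> sc c"
    have cl: "E \<in> carrier R" "e \<in> carrier R" "d \<in> carrier R" "sc a \<in> carrier R" "sc c \<in> carrier R"
      using evR_closed[OF r q(1)] ec r c a by (simp_all add: E_def e_def d_def)
    have rd: "r = d \<oplus>\<^bsub>R\<^esub> sc c"
      using r c cl unfolding d_def by (simp add: a_minus_def RA.M.a_assoc RA.M.l_neg)
    have "evR r (p @ [a]) = (d \<otimes>\<^bsub>R\<^esub> E \<oplus>\<^bsub>R\<^esub> e) \<otimes>\<^bsub>R\<^esub> r \<oplus>\<^bsub>R\<^esub> sc a"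
      by (simp add: q(4) E_def e_def d_def)
    also have "\<dots> = d \<otimes>\<^bsub>R\<^esub> (E \<otimes>\<^bsub>R\<^esub> r) \<oplus>\<^bsub>R\<^esub> (e \<otimes>\<^bsub>R\<^esub> r \<oplus>\<^bsub>R\<^esub> sc a)"
      using cl r by (simp add: RA.l_distr RA.m_assoc RA.M.a_assoc)
    also have "e \<otimes>\<^bsub>R\<^esub> r = d \<otimes>\<^bsub>R\<^esub> e \<oplus>\<^bsub>R\<^esub> e \<otimes>\<^bsub>R\<^esub> sc c"
      using cl RA.m_comm[of e d] RA.r_distr[of d "sc c" e] rd by metis
    also have "d \<otimes>\<^bsub>R\<^esub> (E \<otimes>\<^bsub>R\<^esub> r) \<oplus>\<^bsub>R\<^esub> (d \<otimes>\<^bsub>R\<^esub> e \<oplus>\<^bsub>R\<^esub> e \<otimes>\<^bsub>R\<^esub> sc c \<oplus>\<^bsub>R\<^esub> sc a) =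
        d \<otimes>\<^bsub>R\<^esub> (E \<otimes>\<^bsub>R\<^esub> r \<oplus>\<^bsub>R\<^esub> e) \<oplus>\<^bsub>R\<^esub> (e \<otimes>\<^bsub>R\<^esub> sc c \<oplus>\<^bsub>R\<^esub> sc a)"
      using cl r by (simp add: RA.r_distr RA.M.a_assoc)
    also have "E \<otimes>\<^bsub>R\<^esub> r \<oplus>\<^bsub>R\<^esub> e = evR r ?q" by (simp add: E_def e_def)
    also have "e \<otimes>\<^bsub>R\<^esub> sc c \<oplus>\<^bsub>R\<^esub> sc a = sc (K.eval (p @ [a]) c)"
      unfolding ev e_def using ec c a by (simp add: sc_add sc_mult_sc)
    finally show ?thesis
      using q ec hd by (intro exI[of _ ?q]) (simp add: d_def)
  qed
qed simp

text \<open>The span of 1, r, ..., r^(j-1), generated in the order of Horner's scheme.\<close>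

primrec krylov :: "'r \<Rightarrow> nat \<Rightarrow> 'r set" where
  "krylov r 0 = {\<zero>\<^bsub>R\<^esub>}"
| "krylov r (Suc j) = {x \<otimes>\<^bsub>R\<^esub> r \<oplus>\<^bsub>R\<^esub> sc a | x a. x \<in> krylov r j \<and> a \<in> carrier K}"

lemma krylov_iff: "x \<in> krylov r j \<longleftrightarrow> (\<exists>p. length p = j \<and> set p \<subseteq> carrier K \<and> x = evR r p)"
proof (induction j arbitrary: x)
  case (Suc j)
  show ?case
  proof
    assume "x \<in> krylov r (Suc j)"
    then obtain p a where "length p = j" "set p \<subseteq> carrier K" "a \<in> carrier K" "x = evR r p \<otimes>\<^bsub>R\<^esub> r \<oplus>\<^bsub>R\<^esub> sc a"
      using Suc by auto
    then show "\<exists>p. length p = Suc j \<and> set p \<subseteq> carrier K \<and> x = evR r p"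
      by (intro exI[of _ "p @ [a]"]) simp
  next
    assume "\<exists>p. length p = Suc j \<and> set p \<subseteq> carrier K \<and> x = evR r p"
    then obtain p where p: "length p = Suc j" "set p \<subseteq> carrier K" "x = evR r p" by blast
    then obtain q a where "p = q @ [a]" by (cases p rule: rev_cases) auto
    then show "x \<in> krylov r (Suc j)" using p Suc by auto
  qed
qed simp

lemma krylov_submodule: assumes r: "r \<in> carrier R" shows "submodule (krylov r j) K R"
proof (induction j)
  case 0 then show ?case using V.submodule_zero_set by simp
next
  case (Suc j)
  have cl: "x \<in> carrier R" if "x \<in> krylov r j" for x using submodule_subset[OF Suc] that by auto
  show ?case
  proof (rule V.submoduleI)
    show "krylov r (Suc j) \<subseteq> carrier R" using cl r by auto
    show "\<zero>\<^bsub>R\<^esub> \<in> krylov r (Suc j)"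
      using submodule_zero[OF Suc] r by (auto intro!: exI[of _ "\<zero>\<^bsub>R\<^esub>"] exI[of _ "\<zero>\<^bsub>K\<^esub>"] simp: sc_def)
  next
    fix x y assume "x \<in> krylov r (Suc j)" "y \<in> krylov r (Suc j)"
    then obtain x' a y' b where *: "x' \<in> krylov r j" "a \<in> carrier K" "x = x' \<otimes>\<^bsub>R\<^esub> r \<oplus>\<^bsub>R\<^esub> sc a"
      "y' \<in> krylov r j" "b \<in> carrier K" "y = y' \<otimes>\<^bsub>R\<^esub> r \<oplus>\<^bsub>R\<^esub> sc b" by auto
    have "x \<oplus>\<^bsub>R\<^esub> y = (x' \<oplus>\<^bsub>R\<^esub> y') \<otimes>\<^bsub>R\<^esub> r \<oplus>\<^bsub>R\<^esub> sc (a \<oplus>\<^bsub>K\<^esub> b)"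
      using * cl r by (simp add: RA.l_distr sc_add RA.M.a_ac)
    then show "x \<oplus>\<^bsub>R\<^esub> y \<in> krylov r (Suc j)" using * submodule_add[OF Suc *(1,4)] by auto
  next
    fix c x assume "c \<in> carrier K" "x \<in> krylov r (Suc j)"
    then obtain x' a where *: "c \<in> carrier K" "x' \<in> krylov r j" "a \<in> carrier K" "x = x' \<otimes>\<^bsub>R\<^esub> r \<oplus>\<^bsub>R\<^esub> sc a" by auto
    have "c \<odot>\<^bsub>R\<^esub> x = (c \<odot>\<^bsub>R\<^esub> x') \<otimes>\<^bsub>R\<^esub> r \<oplus>\<^bsub>R\<^esub> sc (c \<otimes>\<^bsub>K\<^esub> a)"
      using * cl r by (simp add: RA.smult_r_distr RA.smult_assoc2 sc_mult_sc sc_mult)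
    then show "c \<odot>\<^bsub>R\<^esub> x \<in> krylov r (Suc j)" using * submodule_smult[OF Suc *(1,2)] by auto
  qed
qed

lemma krylov_mono: assumes "r \<in> carrier R" shows "krylov r j \<subseteq> krylov r (Suc j)"
proof (induction j)
  case 0 then show ?case using submodule_zero[OF krylov_submodule[OF assms, of 1]] by simp
next
  case (Suc j) then show ?case by (auto simp del: krylov.simps(2)) (auto simp: subset_iff)
qed

text \<open>The lower coefficients cancel and a pure power of \<open>r\<close> remains. This turns
  an expression of that power by lower ones into a monic equation.\<close>

lemma monic_difference:
  assumes "r \<in> carrier R" "set p \<subseteq> carrier K"
  shows "evR r (\<one>\<^bsub>K\<^esub> # map (a_inv K) p) \<oplus>\<^bsub>R\<^esub> evR r p = evR r (\<one>\<^bsub>K\<^esub> # replicate (length p) \<zero>\<^bsub>K\<^esub>)"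
  using assms(2)
proof (induction p rule: rev_induct)
  case Nil
  then show ?case using assms(1) by (simp add: evR_def sc_one)
next
  case (snoc a p)
  let ?u = "\<one>\<^bsub>K\<^esub> # map (a_inv K) p" and ?z = "\<one>\<^bsub>K\<^esub> # replicate (length p) \<zero>\<^bsub>K\<^esub>"
  have a: "a \<in> carrier K" and p: "set p \<subseteq> carrier K" using snoc.prems by auto
  have su: "set ?u \<subseteq> carrier K" using p by auto
  have cl: "evR r ?u \<in> carrier R" "evR r p \<in> carrier R"
    by (rule evR_closed[OF assms(1) su], rule evR_closed[OF assms(1) p])
  have "sc (\<ominus>\<^bsub>K\<^esub> a) \<oplus>\<^bsub>R\<^esub> sc a = \<zero>\<^bsub>R\<^esub>" using a by (simp flip: sc_add add: K.l_neg) (simp add: sc_def)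
  moreover have reassoc: "(E \<oplus>\<^bsub>R\<^esub> n) \<oplus>\<^bsub>R\<^esub> (E' \<oplus>\<^bsub>R\<^esub> n') = (E \<oplus>\<^bsub>R\<^esub> E') \<oplus>\<^bsub>R\<^esub> (n \<oplus>\<^bsub>R\<^esub> n')"
    if "E \<in> carrier R" "E' \<in> carrier R" "n \<in> carrier R" "n' \<in> carrier R" for E E' n n'
    using that by (simp add: RA.M.a_ac)
  ultimately have "evR r (?u @ [\<ominus>\<^bsub>K\<^esub> a]) \<oplus>\<^bsub>R\<^esub> evR r (p @ [a]) = (evR r ?u \<oplus>\<^bsub>R\<^esub> evR r p) \<otimes>\<^bsub>R\<^esub> r"
    unfolding evR_snoc
    using reassoc[of "evR r ?u \<otimes>\<^bsub>R\<^esub> r" "evR r p \<otimes>\<^bsub>R\<^esub> r" "sc (\<ominus>\<^bsub>K\<^esub> a)" "sc a"] cl a assms(1)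
    by (simp only: RA.l_distr RA.m_closed RA.M.r_zero RA.M.a_closed sc_closed K.a_inv_closed)
  also have "\<dots> = evR r (?z @ [\<zero>\<^bsub>K\<^esub>])"
    unfolding evR_snoc using snoc.IH[OF p] cl assms(1) by (simp add: sc_def) (metis RA.M.a_closed RA.m_closed RA.M.r_zero)
  finally show ?case by (simp add: replicate_append_same)
qed

text \<open>Take a monic polynomial of least degree whose value at \<open>r\<close> lies in
  \<open>mx\<close>, and split off a root c. As \<open>mx\<close> is prime, either r - c lies in it
  or the quotient contradicts minimality.\<close>

lemma residue: assumes r: "r \<in> carrier R" shows "\<exists>c\<in>carrier K. r \<ominus>\<^bsub>R\<^esub> sc c \<in> mx"
proof -
  \<comment> \<open>Membership in \<open>mx\<close> is asked instead of vanishing, so that the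
    condition can be inherited by a factor.\<close>
  define P where "P p \<longleftrightarrow> set p \<subseteq> carrier K \<and> p \<noteq> [] \<and> hd p = \<one>\<^bsub>K\<^esub> \<and> evR r p \<in> mx" for p
  have "\<exists>p. P p"
  proof -
    obtain W where "submodule W K R" "W \<in> range (krylov r)"
      and max: "\<forall>U. submodule U K R \<longrightarrow> U \<in> range (krylov r) \<longrightarrow> W \<subseteq> U \<longrightarrow> U = W"
      using max_submodule[of K R "krylov r 0" "\<lambda>W. W \<in> range (krylov r)", OF bounded krylov_submodule[OF r]] by blast
    then obtain j where j: "W = krylov r j" by blast
    \<comment> \<open>The increasing chain of subspaces stops, so r^j is a combination of lower
      powers.\<close>
    have eq: "krylov r (Suc j) = krylov r j"
      using max krylov_submodule[OF r, of "Suc j"] krylov_mono[OF r, of j] j by blast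
    have "evR r (\<one>\<^bsub>K\<^esub> # replicate j \<zero>\<^bsub>K\<^esub>) \<in> krylov r (Suc j)"
      unfolding krylov_iff by (intro exI[of _ "\<one>\<^bsub>K\<^esub> # replicate j \<zero>\<^bsub>K\<^esub>"]) (auto simp: set_replicate_conv_if)
    then obtain p where p: "length p = j" "set p \<subseteq> carrier K" "evR r (\<one>\<^bsub>K\<^esub> # replicate j \<zero>\<^bsub>K\<^esub>) = evR r p"
      unfolding eq krylov_iff by blast
    let ?u = "\<one>\<^bsub>K\<^esub> # map (a_inv K) p"
    have su: "set ?u \<subseteq> carrier K" using p(2) by auto
    have "evR r ?u \<oplus>\<^bsub>R\<^esub> evR r p = evR r p" using monic_difference[OF r p(2)] p by simp
    then have "evR r p \<ominus>\<^bsub>R\<^esub> evR r p = evR r ?u"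
      using RA.M.add_minus_right_cancel[OF evR_closed[OF r su] evR_closed[OF r p(2)]] by (simp only:)
    then have "evR r ?u = \<zero>\<^bsub>R\<^esub>"
      using RA.M.minus_zero_iff[OF evR_closed[OF r p(2)] evR_closed[OF r p(2)]] by (simp only:)
    then show ?thesis
      using su additive_subgroup.zero_closed[OF ideal.axioms(1)[OF mx_ideal]] by (intro exI[of _ ?u]) (simp add: P_def)
  qed
  then obtain p0 where "P p0" ..
  from ex_has_least_nat[of P, OF this, of length]
  obtain p where p: "P p" and min: "\<And>q. P q \<Longrightarrow> length p \<le> length q" by blast
  note p = p[unfolded P_def]
  have len: "length p > 1"
  proof (rule ccontr)
    assume "\<not> length p > 1"
    then have "p = [\<one>\<^bsub>K\<^esub>]" using p by (cases p) auto
    then have "evR r p = \<one>\<^bsub>R\<^esub>" using r by (simp add: evR_def sc_one)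
    then show False using p one_notin_mx by simp
  qed
  have poly: "p \<in> carrier (poly_ring K)"
    using p K.one_not_zero by (simp add: univ_poly_carrier[symmetric] polynomial_def)
  \<comment> \<open>Over an algebraically closed field the number of roots is the degree, here one
    less than the number of coefficients.\<close>
  have "size (K.roots p) = length p - 1" using K.roots_over_carrier[OF poly] by (simp add: K.splitted_def)
  then have "K.roots p \<noteq> {#}" using len by auto
  then obtain c where "c \<in># K.roots p" by (meson multiset_nonemptyE)
  then have c: "c \<in> carrier K" "K.eval p c = \<zero>\<^bsub>K\<^esub>"
    using K.roots_mem_iff_is_root[OF poly] by (auto simp: K.is_root_def)
  obtain q where q: "set q \<subseteq> carrier K" "length p = Suc (length q)" "q \<noteq> [] \<longrightarrow> hd q = hd p"
    "evR r p = (r \<ominus>\<^bsub>R\<^esub> sc c) \<otimes>\<^bsub>R\<^esub> evR r q \<oplus>\<^bsub>R\<^esub> sc (K.eval p c)" using evR_divide[OF r c(1)] p by blast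
  have qR: "evR r q \<in> carrier R" by (rule evR_closed[OF r q(1)])
  have "evR r p = (r \<ominus>\<^bsub>R\<^esub> sc c) \<otimes>\<^bsub>R\<^esub> evR r q" using q(4) c r qR by (simp add: sc_def)
  then have "(r \<ominus>\<^bsub>R\<^esub> sc c) \<otimes>\<^bsub>R\<^esub> evR r q \<in> mx" using p by simp
  then consider "r \<ominus>\<^bsub>R\<^esub> sc c \<in> mx" | "evR r q \<in> mx" using mx_prime qR r c by (metis RA.M.minus_closed sc_closed)
  then show ?thesis
  proof cases
    case 2
    have "q \<noteq> []" using len q(2) by auto
    then have "P q" using q p 2 by (simp add: P_def)
    then show ?thesis using min q(2) by fastforce
  qed (use c in blast)
qed

section \<open>The residue map and nilpotency of the maximal ideal\<close>

definition "\<rho> r = (SOME c. c \<in> carrier K \<and> r \<ominus>\<^bsub>R\<^esub> sc c \<in> mx)"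

lemma \<rho>: assumes "r \<in> carrier R" shows "\<rho> r \<in> carrier K" "r \<ominus>\<^bsub>R\<^esub> sc (\<rho> r) \<in> mx"
  using someI_ex[OF residue[OF assms, unfolded Bex_def]] by (simp_all add: \<rho>_def)

lemma mx_submodule: "submodule mx K R"
  by (rule ideal_submodule[OF mx_ideal])

lemma \<rho>I: assumes r: "r \<in> carrier R" "c \<in> carrier K" "r \<ominus>\<^bsub>R\<^esub> sc c \<in> mx" shows "\<rho> r = c"
proof -
  have "(r \<ominus>\<^bsub>R\<^esub> sc c) \<ominus>\<^bsub>R\<^esub> (r \<ominus>\<^bsub>R\<^esub> sc (\<rho> r)) \<in> mx"
    by (rule submodule_diff[OF mx_submodule r(3) \<rho>(2)[OF r(1)]])
  also have "(r \<ominus>\<^bsub>R\<^esub> sc c) \<ominus>\<^bsub>R\<^esub> (r \<ominus>\<^bsub>R\<^esub> sc (\<rho> r)) = sc (\<rho> r) \<ominus>\<^bsub>R\<^esub> sc c"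
    using r \<rho>[OF r(1)] by (simp add: a_minus_def RA.M.minus_add RA.M.a_ac RA.M.r_neg1 RA.M.r_neg2)
  also have "\<dots> = sc (\<rho> r \<ominus>\<^bsub>K\<^esub> c)" using r \<rho>(1)[OF r(1)] by (simp add: sc_def V.smult_l_diff)
  finally have "\<rho> r \<ominus>\<^bsub>K\<^esub> c = \<zero>\<^bsub>K\<^esub>" using r \<rho>(1)[OF r(1)] by (intro sc_mx) simp_all
  then show ?thesis using r \<rho>(1)[OF r(1)] by (simp add: K.minus_zero_iff)
qed

lemma \<rho>_sc: "c \<in> carrier K \<Longrightarrow> \<rho> (sc c) = c"
  using submodule_zero[OF mx_submodule] by (intro \<rho>I) (simp_all add: RA.M.minus_zero_iff RA.M.r_neg a_minus_def)

lemma \<rho>_add: assumes "r \<in> carrier R" "r' \<in> carrier R" shows "\<rho> (r \<oplus>\<^bsub>R\<^esub> r') = \<rho> r \<oplus>\<^bsub>K\<^esub> \<rho> r'"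
proof (rule \<rho>I)
  have "(r \<ominus>\<^bsub>R\<^esub> sc (\<rho> r)) \<oplus>\<^bsub>R\<^esub> (r' \<ominus>\<^bsub>R\<^esub> sc (\<rho> r')) \<in> mx"
    using assms \<rho> by (intro submodule_add[OF mx_submodule]) auto
  also have "(r \<ominus>\<^bsub>R\<^esub> sc (\<rho> r)) \<oplus>\<^bsub>R\<^esub> (r' \<ominus>\<^bsub>R\<^esub> sc (\<rho> r')) = (r \<oplus>\<^bsub>R\<^esub> r') \<ominus>\<^bsub>R\<^esub> sc (\<rho> r \<oplus>\<^bsub>K\<^esub> \<rho> r')"
    using assms \<rho> by (simp add: sc_add a_minus_def RA.M.minus_add RA.M.a_ac)
  finally show "(r \<oplus>\<^bsub>R\<^esub> r') \<ominus>\<^bsub>R\<^esub> sc (\<rho> r \<oplus>\<^bsub>K\<^esub> \<rho> r') \<in> mx" .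
qed (use assms \<rho> in auto)

lemma \<rho>_mult: assumes "r \<in> carrier R" "r' \<in> carrier R" shows "\<rho> (r \<otimes>\<^bsub>R\<^esub> r') = \<rho> r \<otimes>\<^bsub>K\<^esub> \<rho> r'"
proof (rule \<rho>I)
  let ?a = "sc (\<rho> r)" and ?b = "sc (\<rho> r')"
  have cl: "?a \<in> carrier R" "?b \<in> carrier R" using \<rho> assms by auto
  have "(r \<ominus>\<^bsub>R\<^esub> ?a) \<otimes>\<^bsub>R\<^esub> r' \<oplus>\<^bsub>R\<^esub> ?a \<otimes>\<^bsub>R\<^esub> (r' \<ominus>\<^bsub>R\<^esub> ?b) \<in> mx"
    using assms cl \<rho> by (intro submodule_add[OF mx_submodule] ideal.I_r_closed[OF mx_ideal] ideal.I_l_closed[OF mx_ideal]) auto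
  also have "(r \<ominus>\<^bsub>R\<^esub> ?a) \<otimes>\<^bsub>R\<^esub> r' \<oplus>\<^bsub>R\<^esub> ?a \<otimes>\<^bsub>R\<^esub> (r' \<ominus>\<^bsub>R\<^esub> ?b) = r \<otimes>\<^bsub>R\<^esub> r' \<ominus>\<^bsub>R\<^esub> ?a \<otimes>\<^bsub>R\<^esub> ?b"
    using assms cl by (simp add: RA.l_distr RA.r_distr RA.l_minus RA.r_minus a_minus_def RA.M.a_assoc RA.M.r_neg1)
  also have "\<dots> = r \<otimes>\<^bsub>R\<^esub> r' \<ominus>\<^bsub>R\<^esub> sc (\<rho> r \<otimes>\<^bsub>K\<^esub> \<rho> r')" using assms \<rho> by (simp add: sc_mult_sc)
  finally show "r \<otimes>\<^bsub>R\<^esub> r' \<ominus>\<^bsub>R\<^esub> sc (\<rho> r \<otimes>\<^bsub>K\<^esub> \<rho> r') \<in> mx" .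
qed (use assms \<rho> in auto)

lemma \<rho>_smult: assumes "c \<in> carrier K" "r \<in> carrier R" shows "\<rho> (c \<odot>\<^bsub>R\<^esub> r) = c \<otimes>\<^bsub>K\<^esub> \<rho> r"
  using \<rho>_mult[of "sc c" r] assms by (simp add: sc_mult \<rho>_sc)

lemma \<rho>_one: "\<rho> \<one>\<^bsub>R\<^esub> = \<one>\<^bsub>K\<^esub>"
  using \<rho>_sc[of "\<one>\<^bsub>K\<^esub>"] by (simp add: sc_one)

lemma \<rho>_zero_iff: assumes "r \<in> carrier R" shows "\<rho> r = \<zero>\<^bsub>K\<^esub> \<longleftrightarrow> r \<in> mx"
proof -
  have "r \<ominus>\<^bsub>R\<^esub> sc \<zero>\<^bsub>K\<^esub> = r" using assms by (simp add: sc_def a_minus_def RA.M.minus_equality[of "\<zero>\<^bsub>R\<^esub>" "\<zero>\<^bsub>R\<^esub>"])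
  then show ?thesis using \<rho>(2)[OF assms] \<rho>I[OF assms, of "\<zero>\<^bsub>K\<^esub>"] by auto
qed

text \<open>The descending chain of the ideals x^j R stops, so x^j = x^(j+1) a and x^j (1 - x a) =
  0. Since x a lies in \<open>mx\<close>, the second factor is a unit.\<close>

lemma mx_nilpotent: assumes x: "x \<in> mx" shows "\<exists>j. x [^]\<^bsub>R\<^esub> (j::nat) = \<zero>\<^bsub>R\<^esub>"
proof -
  have xR: "x \<in> carrier R" by (rule mx_closed[OF x])
  define W where "W j = (\<lambda>a. x [^]\<^bsub>R\<^esub> j \<otimes>\<^bsub>R\<^esub> a) ` carrier R" for j :: nat
  have W: "submodule (W j) K R" for j
  proof (rule V.submoduleI)
    show "\<zero>\<^bsub>R\<^esub> \<in> W j" unfolding W_def using xR by (intro image_eqI[of _ _ "\<zero>\<^bsub>R\<^esub>"]) auto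
    fix u v assume "u \<in> W j" "v \<in> W j"
    then show "u \<oplus>\<^bsub>R\<^esub> v \<in> W j" using xR by (auto simp: W_def RA.r_distr[symmetric])
  next
    fix c u assume "c \<in> carrier K" "u \<in> W j"
    then obtain a where "c \<in> carrier K" "a \<in> carrier R" "u = x [^]\<^bsub>R\<^esub> j \<otimes>\<^bsub>R\<^esub> a" by (auto simp: W_def)
    moreover have "c \<odot>\<^bsub>R\<^esub> (x [^]\<^bsub>R\<^esub> j \<otimes>\<^bsub>R\<^esub> a) = x [^]\<^bsub>R\<^esub> j \<otimes>\<^bsub>R\<^esub> (a \<otimes>\<^bsub>R\<^esub> sc c)"
      if "c \<in> carrier K" "a \<in> carrier R" for c a
      using that xR mult_sc[of c "x [^]\<^bsub>R\<^esub> j \<otimes>\<^bsub>R\<^esub> a"] by (simp add: RA.m_assoc)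
    ultimately show "c \<odot>\<^bsub>R\<^esub> u \<in> W j" by (simp add: W_def)
  qed (use xR in \<open>auto simp: W_def\<close>)
  obtain U where "submodule U K R" "U \<in> range W"
    and min: "\<forall>V. submodule V K R \<longrightarrow> V \<in> range W \<longrightarrow> V \<subseteq> U \<longrightarrow> V = U"
    using min_submodule[of K R "W 0" "\<lambda>U. U \<in> range W", OF bounded W] by blast
  then obtain j where j: "U = W j" by blast
  have "W (Suc j) \<subseteq> W j"
    unfolding W_def using xR by (auto simp: RA.m_assoc)
  then have "W (Suc j) = W j" using min W j by blast
  moreover have "x [^]\<^bsub>R\<^esub> j \<in> W j" unfolding W_def using xR by (intro image_eqI[of _ _ "\<one>\<^bsub>R\<^esub>"]) auto
  ultimately obtain a where a: "a \<in> carrier R" "x [^]\<^bsub>R\<^esub> j = x [^]\<^bsub>R\<^esub> Suc j \<otimes>\<^bsub>R\<^esub> a" by (auto simp: W_def)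
  have xa: "x \<otimes>\<^bsub>R\<^esub> a \<in> mx" using ideal.I_r_closed[OF mx_ideal x a(1)] .
  have u: "\<one>\<^bsub>R\<^esub> \<ominus>\<^bsub>R\<^esub> x \<otimes>\<^bsub>R\<^esub> a \<in> Units R"
  proof (rule unit_outside)
    show "\<one>\<^bsub>R\<^esub> \<ominus>\<^bsub>R\<^esub> x \<otimes>\<^bsub>R\<^esub> a \<notin> mx"
    proof
      assume "\<one>\<^bsub>R\<^esub> \<ominus>\<^bsub>R\<^esub> x \<otimes>\<^bsub>R\<^esub> a \<in> mx"
      then have "x \<otimes>\<^bsub>R\<^esub> a \<oplus>\<^bsub>R\<^esub> (\<one>\<^bsub>R\<^esub> \<ominus>\<^bsub>R\<^esub> x \<otimes>\<^bsub>R\<^esub> a) \<in> mx" by (rule submodule_add[OF mx_submodule xa])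
      then show False using xR a one_notin_mx by (simp add: RA.M.add_minus_cancel)
    qed
  qed (use xR a in simp)
  let ?u = "\<one>\<^bsub>R\<^esub> \<ominus>\<^bsub>R\<^esub> x \<otimes>\<^bsub>R\<^esub> a" and ?p = "x [^]\<^bsub>R\<^esub> j"
  have pR: "?p \<in> carrier R" using xR by simp
  have "?p \<otimes>\<^bsub>R\<^esub> ?u = ?p \<ominus>\<^bsub>R\<^esub> ?p \<otimes>\<^bsub>R\<^esub> (x \<otimes>\<^bsub>R\<^esub> a)"
    using pR xR a(1) by (simp add: a_minus_def RA.r_distr RA.r_minus)
  also have "?p \<otimes>\<^bsub>R\<^esub> (x \<otimes>\<^bsub>R\<^esub> a) = ?p" using a xR by (simp add: RA.m_assoc)
  finally have "?p \<otimes>\<^bsub>R\<^esub> ?u = \<zero>\<^bsub>R\<^esub>" using pR by (simp add: RA.M.minus_zero_iff)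
  then have "(?p \<otimes>\<^bsub>R\<^esub> ?u) \<otimes>\<^bsub>R\<^esub> inv\<^bsub>R\<^esub> ?u = \<zero>\<^bsub>R\<^esub>" using u by simp
  moreover have "(?p \<otimes>\<^bsub>R\<^esub> ?u) \<otimes>\<^bsub>R\<^esub> inv\<^bsub>R\<^esub> ?u = ?p \<otimes>\<^bsub>R\<^esub> (?u \<otimes>\<^bsub>R\<^esub> inv\<^bsub>R\<^esub> ?u)"
    by (rule RA.m_assoc[OF pR RA.Units_closed[OF u] RA.Units_inv_closed[OF u]])
  moreover have "?p \<otimes>\<^bsub>R\<^esub> (?u \<otimes>\<^bsub>R\<^esub> inv\<^bsub>R\<^esub> ?u) = ?p" unfolding RA.Units_r_inv[OF u] by (rule RA.r_one[OF pR])
  ultimately have "?p = \<zero>\<^bsub>R\<^esub>" by simp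
  then show ?thesis by blast
qed

text \<open>Induction on the number of letters: by commutativity all occurrences of the last letter
  are collected in one power, leaving a word in the others.\<close>

lemma nilpotent_words:
  fixes s :: nat
  assumes c: "\<And>j. c j \<in> mx"
  shows "\<exists>N. \<forall>w. set w \<subseteq> {..<s} \<longrightarrow> N \<le> length w \<longrightarrow> foldl (\<lambda>p j. p \<otimes>\<^bsub>R\<^esub> c j) \<one>\<^bsub>R\<^esub> w = \<zero>\<^bsub>R\<^esub>"
proof (induction s)
  case 0
  then show ?case by (intro exI[of _ 1]) auto
next
  case (Suc s)
  let ?wd = "foldl (\<lambda>p j. p \<otimes>\<^bsub>R\<^esub> c j) \<one>\<^bsub>R\<^esub>"
  have cR: "c j \<in> carrier R" for j by (rule mx_closed[OF c])
  have wdR: "?wd w \<in> carrier R" for w by (induction w rule: rev_induct) (auto simp: cR)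
  obtain N where N: "\<And>w. set w \<subseteq> {..<s} \<Longrightarrow> N \<le> length w \<Longrightarrow> ?wd w = \<zero>\<^bsub>R\<^esub>" using Suc by blast
  obtain k where k: "c s [^]\<^bsub>R\<^esub> (k::nat) = \<zero>\<^bsub>R\<^esub>" using mx_nilpotent[OF c] by blast
  have split: "?wd w = c s [^]\<^bsub>R\<^esub> (length (filter (\<lambda>j. j = s) w)) \<otimes>\<^bsub>R\<^esub> ?wd (filter (\<lambda>j. j \<noteq> s) w)" for w
  proof (induction w rule: rev_induct)
    case (snoc a w)
    let ?p = "c s [^]\<^bsub>R\<^esub> (length (filter (\<lambda>j. j = s) w))" and ?q = "?wd (filter (\<lambda>j. j \<noteq> s) w)"
    have cl: "?p \<in> carrier R" "?q \<in> carrier R" using cR wdR by auto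
    show ?case
    proof (cases "a = s")
      case True
      then show ?thesis using snoc.IH cl cR RA.m_comm[of ?q "c s"] by (simp add: RA.m_assoc)
    next
      case False
      then show ?thesis using snoc.IH cl cR by (simp add: RA.m_assoc)
    qed
  qed simp
  show ?case
  \<comment> \<open>Among N + k letters either at least k equal \<open>s\<close>, or at least N do
    not.\<close>
  proof (intro exI[of _ "N + k"] allI impI)
    fix w assume w: "set w \<subseteq> {..<Suc s}" "N + k \<le> length w"
    let ?i = "length (filter (\<lambda>j. j = s) w)" and ?r = "filter (\<lambda>j. j \<noteq> s) w"
    show "?wd w = \<zero>\<^bsub>R\<^esub>"
    proof (cases "k \<le> ?i")
      case True
      then have "c s [^]\<^bsub>R\<^esub> ?i = c s [^]\<^bsub>R\<^esub> k \<otimes>\<^bsub>R\<^esub> c s [^]\<^bsub>R\<^esub> (?i - k)"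
        using cR by (simp add: RA.nat_pow_mult)
      then show ?thesis unfolding split[of w] using cR wdR by (simp add: k)
    next
      case False
      have "length w = ?i + length ?r" by (induction w) auto
      then have "N \<le> length ?r" using False w(2) by simp
      moreover have "set ?r \<subseteq> {..<s}" using w(1) by (auto simp: less_Suc_eq)
      ultimately show ?thesis unfolding split[of w] using N cR by simp
    qed
  qed
qed

section \<open>A basis of R and generators of the maximal ideal\<close>

lemma ex_basis: "\<exists>n y. y \<in> Vec R \<and> (\<forall>x\<in>carrier R. \<exists>v\<in>Vec K. x = lcomb R n v y) \<and>
    (\<forall>v\<in>Vec K. lcomb R n v y = \<zero>\<^bsub>R\<^esub> \<longrightarrow> (\<forall>k<n. v k = \<zero>\<^bsub>K\<^esub>))"
  by (rule vector_space_basis[OF K.field_axioms left_module_R fin])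

definition "rk = (SOME n. \<exists>y. y \<in> Vec R \<and> (\<forall>x\<in>carrier R. \<exists>v\<in>Vec K. x = lcomb R n v y) \<and>
    (\<forall>v\<in>Vec K. lcomb R n v y = \<zero>\<^bsub>R\<^esub> \<longrightarrow> (\<forall>k<n. v k = \<zero>\<^bsub>K\<^esub>)))"

definition "bs = (SOME y. y \<in> Vec R \<and> (\<forall>x\<in>carrier R. \<exists>v\<in>Vec K. x = lcomb R rk v y) \<and>
    (\<forall>v\<in>Vec K. lcomb R rk v y = \<zero>\<^bsub>R\<^esub> \<longrightarrow> (\<forall>k<rk. v k = \<zero>\<^bsub>K\<^esub>)))"

text \<open>Only the entries below \<open>rk\<close> are determined by \<open>x\<close>; later users
  restrict to these.\<close>

definition "coord x = (SOME v. v \<in> Vec K \<and> x = lcomb R rk v bs)"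

lemma bs: "bs \<in> Vec R" "x \<in> carrier R \<Longrightarrow> \<exists>v\<in>Vec K. x = lcomb R rk v bs"
  "v \<in> Vec K \<Longrightarrow> lcomb R rk v bs = \<zero>\<^bsub>R\<^esub> \<Longrightarrow> k < rk \<Longrightarrow> v k = \<zero>\<^bsub>K\<^esub>"
  using someI_ex[OF someI_ex[OF ex_basis, folded rk_def], folded bs_def] by blast+

lemma coord: assumes "x \<in> carrier R" shows "coord x \<in> Vec K" "x = lcomb R rk (coord x) bs"
  using someI_ex[OF bs(2)[OF assms, unfolded Bex_def], folded coord_def] by blast+

lemma coordI: assumes v: "v \<in> Vec K" "x = lcomb R rk v bs" "k < rk" shows "coord x k = v k"
proof -
  have x: "x \<in> carrier R" unfolding v(2) by (rule V.lcomb_closed[OF v(1) bs(1)])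
  have "lcomb R rk (\<lambda>i. coord x i \<ominus>\<^bsub>K\<^esub> v i) bs = \<zero>\<^bsub>R\<^esub>"
    using V.lcomb_diff_l[OF coord(1)[OF x] v(1) bs(1), of rk] coord(2)[OF x] v(2) x RA.M.minus_zero_iff[of x x] by simp
  moreover have "(\<lambda>i. coord x i \<ominus>\<^bsub>K\<^esub> v i) \<in> Vec K" using coord(1)[OF x] v(1) by (simp add: Vec_def)
  ultimately have "coord x k \<ominus>\<^bsub>K\<^esub> v k = \<zero>\<^bsub>K\<^esub>" using bs(3) v(3) by blast
  then show ?thesis using VecD[OF coord(1)[OF x], of k] VecD[OF v(1), of k] by (simp add: K.minus_zero_iff)
qed

lemma coord_add:
  assumes "x \<in> carrier R" "x' \<in> carrier R" "k < rk"
  shows "coord (x \<oplus>\<^bsub>R\<^esub> x') k = coord x k \<oplus>\<^bsub>K\<^esub> coord x' k"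
  using V.lcomb_add_l[OF coord(1)[OF assms(1)] coord(1)[OF assms(2)] bs(1), of rk]
    coord(2)[OF assms(1)] coord(2)[OF assms(2)] coord(1)[OF assms(1)] coord(1)[OF assms(2)] assms(3)
  by (intro coordI) (simp_all add: Vec_def)

lemma coord_smult:
  assumes "c \<in> carrier K" "x \<in> carrier R" "k < rk"
  shows "coord (c \<odot>\<^bsub>R\<^esub> x) k = c \<otimes>\<^bsub>K\<^esub> coord x k"
  using V.lcomb_smult_l[OF assms(1) coord(1)[OF assms(2)] bs(1), of rk]
    coord(2)[OF assms(2)] coord(1)[OF assms(2)] assms
  by (intro coordI) (simp_all add: Vec_def)

text \<open>The basis elements shifted by their residues into the maximal ideal.\<close>

definition "gm j = bs j \<ominus>\<^bsub>R\<^esub> sc (\<rho> (bs j))"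

lemma gm: "gm j \<in> mx"
  unfolding gm_def by (rule \<rho>(2)[OF VecD[OF bs(1)]])

lemma gm_Vec: "gm \<in> Vec R"
  by (rule VecI) (rule mx_closed[OF gm])

text \<open>The shift changes the combination by the residue of \<open>x\<close>, which is zero. So
  the coordinates of \<open>x\<close> in the basis serve for the generators too.\<close>

lemma mx_span: assumes "x \<in> mx" shows "x = lcomb R rk (coord x) gm"
proof -
  have x: "x \<in> carrier R" by (rule mx_closed[OF assms])
  note v = coord[OF x]
  have s: "(\<lambda>j. sc (\<rho> (bs j))) \<in> Vec R" using \<rho>(1)[OF VecD[OF bs(1)]] by (simp add: Vec_def)
  have "lcomb R rk (coord x) gm = x \<ominus>\<^bsub>R\<^esub> lcomb R rk (coord x) (\<lambda>j. sc (\<rho> (bs j)))"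
    unfolding gm_def[abs_def] using V.lcomb_diff_r[OF v(1) bs(1) s, of rk] v(2) by simp
  also have "lcomb R rk (coord x) (\<lambda>j. sc (\<rho> (bs j))) = sc (\<rho> x)"
  proof -
    have "\<rho> x = ssum K rk (\<lambda>j. \<rho> (coord x j \<odot>\<^bsub>R\<^esub> bs j))"
      unfolding ssum_hom[OF RA.M.abelian_group_axioms K.is_abelian_group \<rho>_add, of rk "\<lambda>j. coord x j \<odot>\<^bsub>R\<^esub> bs j", symmetric]
      using v(2) VecD[OF v(1)] VecD[OF bs(1)] \<rho>_zero_iff[of "\<zero>\<^bsub>R\<^esub>"] submodule_zero[OF mx_submodule]
      by (subst ssum_hom[OF RA.M.abelian_group_axioms K.is_abelian_group \<rho>_add, symmetric]) (simp_all add: lcomb_def)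
    also have "\<dots> = ssum K rk (\<lambda>j. coord x j \<otimes>\<^bsub>K\<^esub> \<rho> (bs j))"
      using VecD[OF v(1)] VecD[OF bs(1)] by (simp add: \<rho>_smult)
    finally have "sc (\<rho> x) = sc (ssum K rk (\<lambda>j. coord x j \<otimes>\<^bsub>K\<^esub> \<rho> (bs j)))" by simp
    also have "\<dots> = ssum R rk (\<lambda>j. sc (coord x j \<otimes>\<^bsub>K\<^esub> \<rho> (bs j)))"
      using VecD[OF v(1)] \<rho>(1)[OF VecD[OF bs(1)]]
      by (intro ssum_hom[OF K.is_abelian_group RA.M.abelian_group_axioms sc_add sc_zero]) simp_all
    finally show ?thesis
      using VecD[OF v(1)] \<rho>(1)[OF VecD[OF bs(1)]] by (simp add: lcomb_def sc_mult_sc sc_mult)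
  qed
  also have "x \<ominus>\<^bsub>R\<^esub> sc (\<rho> x) = x"
    using \<rho>_zero_iff[OF x] assms x by (simp add: sc_def a_minus_def RA.M.minus_equality[of "\<zero>\<^bsub>R\<^esub>" "\<zero>\<^bsub>R\<^esub>"])
  finally show ?thesis ..
qed

end

section \<open>Tensor products\<close>

definition additive :: "('a, 'c) ring_scheme \<Rightarrow> ('b, 'd) ring_scheme \<Rightarrow> ('a \<Rightarrow> 'b) \<Rightarrow> bool" where
  "additive G H f \<longleftrightarrow> (\<forall>x\<in>carrier G. f x \<in> carrier H) \<and>
     (\<forall>x\<in>carrier G. \<forall>y\<in>carrier G. f (x \<oplus>\<^bsub>G\<^esub> y) = f x \<oplus>\<^bsub>H\<^esub> f y)"

lemma additiveI:
  "(\<And>x. x \<in> carrier G \<Longrightarrow> f x \<in> carrier H) \<Longrightarrow>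
   (\<And>x y. x \<in> carrier G \<Longrightarrow> y \<in> carrier G \<Longrightarrow> f (x \<oplus>\<^bsub>G\<^esub> y) = f x \<oplus>\<^bsub>H\<^esub> f y) \<Longrightarrow> additive G H f"
  by (simp add: additive_def)

lemma additiveD:
  assumes "additive G H f"
  shows "x \<in> carrier G \<Longrightarrow> f x \<in> carrier H"
    and "x \<in> carrier G \<Longrightarrow> y \<in> carrier G \<Longrightarrow> f (x \<oplus>\<^bsub>G\<^esub> y) = f x \<oplus>\<^bsub>H\<^esub> f y"
  using assms by (auto simp: additive_def)

lemma additive_map_zero:
  "abelian_group G \<Longrightarrow> abelian_group H \<Longrightarrow> additive G H f \<Longrightarrow> f \<zero>\<^bsub>G\<^esub> = \<zero>\<^bsub>H\<^esub>"
  using additive_zero[of G H f] by (auto simp: additive_def)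

lemma additive_map_ssum:
  "abelian_group G \<Longrightarrow> abelian_group H \<Longrightarrow> additive G H f \<Longrightarrow> (\<And>i. i < n \<Longrightarrow> x i \<in> carrier G) \<Longrightarrow>
    f (ssum G n x) = ssum H n (\<lambda>i. f (x i))"
  by (rule ssum_hom) (auto simp: additiveD additive_map_zero)

lemma additive_compose:
  "additive G H f \<Longrightarrow> additive H J g \<Longrightarrow> additive G J (\<lambda>x. g (f x))"
  by (simp add: additive_def)

text \<open>Only the additive part of \<open>T\<close> is tied to the tensor group; its products and
  scalars stay open. In this way both the algebra R \<otimes> A and the induced module are
  instances.\<close>

locale tensor_product = U: abelian_group U + V: abelian_group V
  for A :: "('a, 'c) ring_scheme" and U :: "('a, 'm) module" and V :: "('a, 'n) module"
    and T :: "(('m \<times> 'n \<Rightarrow>\<^sub>0 int) set, 'd) ring_scheme" +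
  assumes U_smult: "a \<in> carrier A \<Longrightarrow> x \<in> carrier U \<Longrightarrow> a \<odot>\<^bsub>U\<^esub> x \<in> carrier U"
    and V_smult: "a \<in> carrier A \<Longrightarrow> y \<in> carrier V \<Longrightarrow> a \<odot>\<^bsub>V\<^esub> y \<in> carrier V"
    and T_carrier: "carrier T = carrier (tensor_group A U V)"
    and T_add: "add T = monoid.mult (tensor_group A U V)"
    and T_zero: "\<zero>\<^bsub>T\<^esub> = \<one>\<^bsub>tensor_group A U V\<^esub>"
begin

abbreviation "S \<equiv> carrier U \<times> carrier V"
abbreviation "FG \<equiv> tensor_free U V"
abbreviation "null \<equiv> tensor_null A U V"
abbreviation "cl \<equiv> tensor_class A U V"
abbreviation "pt \<equiv> pure_tensor A U V"

sublocale FG: comm_group FG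
  unfolding tensor_free_def by (rule abelian_free_Abelian_group)

lemma FG_carrier: "c \<in> carrier FG \<longleftrightarrow> Poly_Mapping.keys c \<subseteq> S"
  by (simp add: tensor_free_def)

lemma FG_simps [simp]: "c \<otimes>\<^bsub>FG\<^esub> d = c + d" "\<one>\<^bsub>FG\<^esub> = 0"
  by (simp_all add: tensor_free_def)

lemma FG_of [simp]: "frag_of (x, y) \<in> carrier FG \<longleftrightarrow> x \<in> carrier U \<and> y \<in> carrier V"
  by (simp add: FG_carrier keys_frag_of)

lemma FG_diff [simp]: "c \<in> carrier FG \<Longrightarrow> d \<in> carrier FG \<Longrightarrow> c - d \<in> carrier FG"
  using keys_diff[of c d] by (auto simp: FG_carrier)

lemma FG_add [simp]: "c \<in> carrier FG \<Longrightarrow> d \<in> carrier FG \<Longrightarrow> c + d \<in> carrier FG"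
  using FG.m_closed[of c d] by simp

lemma FG_0 [simp]: "0 \<in> carrier FG"
  using FG.one_closed by simp

lemma FG_minus [simp]: "c \<in> carrier FG \<Longrightarrow> - c \<in> carrier FG"
  using FG_diff[of 0 c] by simp

lemma rels_closed: "tensor_rels A U V \<subseteq> carrier FG"
  by (auto simp: tensor_rels_def U_smult V_smult)

lemma null_subgroup: "subgroup null FG"
  unfolding tensor_null_def by (rule FG.generate_is_subgroup[OF rels_closed])

lemma null_normal: "null \<lhd> FG"
  by (rule FG.subgroup_imp_normal[OF null_subgroup])

lemma cl_eq_iff:
  assumes "c \<in> carrier FG" "d \<in> carrier FG" shows "cl c = cl d \<longleftrightarrow> c - d \<in> null"
proof -
  have "c - d \<in> null \<longleftrightarrow> c \<in> null #>\<^bsub>FG\<^esub> d"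
    by (force simp: r_coset_def)
  then show ?thesis
    using FG.repr_independence[OF _ assms(2) null_subgroup, of c] FG.rcos_self[OF assms(1) null_subgroup]
    by (auto simp: tensor_class_def)
qed

lemma cl_mem: "c \<in> carrier FG \<Longrightarrow> d \<in> cl c \<Longrightarrow> d \<in> carrier FG \<and> cl d = cl c"
  using FG.repr_independence[OF _ _ null_subgroup, of d c] FG.r_coset_subset_G[OF subgroup.subset[OF null_subgroup], of c]
  by (auto simp: tensor_class_def)

lemma cl_self: "c \<in> carrier FG \<Longrightarrow> c \<in> cl c"
  using FG.rcos_self[OF _ null_subgroup, of c] by (simp add: tensor_class_def)

lemma cl_closed [simp]: "c \<in> carrier FG \<Longrightarrow> cl c \<in> carrier T"
  by (auto simp: T_carrier tensor_group_def FactGroup_def RCOSETS_def tensor_class_def)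

lemma clE: assumes "C \<in> carrier T" obtains c where "c \<in> carrier FG" "C = cl c"
  using assms by (auto simp: T_carrier tensor_group_def FactGroup_def RCOSETS_def tensor_class_def)

lemma cl_add: "c \<in> carrier FG \<Longrightarrow> d \<in> carrier FG \<Longrightarrow> cl c \<oplus>\<^bsub>T\<^esub> cl d = cl (c + d)"
  using normal.rcos_sum[OF null_normal, of c d] by (simp add: T_add tensor_group_def FactGroup_def tensor_class_def)

lemma cl_zero: "cl 0 = \<zero>\<^bsub>T\<^esub>"
  using FG.coset_mult_one[OF subgroup.subset[OF null_subgroup]]
  by (simp add: T_zero tensor_group_def FactGroup_def tensor_class_def)

sublocale T: abelian_group T
proof (rule abelian_groupI)
  fix x assume "x \<in> carrier T"
  then obtain c where "c \<in> carrier FG" "x = cl c" by (rule clE)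
  then show "\<exists>y\<in>carrier T. y \<oplus>\<^bsub>T\<^esub> x = \<zero>\<^bsub>T\<^esub>"
    by (intro bexI[of _ "cl (- c)"]) (simp_all add: cl_add cl_zero)
qed (auto elim!: clE simp: cl_add cl_zero add_ac simp flip: cl_zero)

lemma pt_closed [simp]: "x \<in> carrier U \<Longrightarrow> y \<in> carrier V \<Longrightarrow> pt x y \<in> carrier T"
  by (simp add: pure_tensor_def)

lemma rels_null: "r \<in> tensor_rels A U V \<Longrightarrow> r \<in> null"
  unfolding tensor_null_def by (rule generate.incl)

lemma pt_add_left:
  assumes "x \<in> carrier U" "x' \<in> carrier U" "y \<in> carrier V"
  shows "pt (x \<oplus>\<^bsub>U\<^esub> x') y = pt x y \<oplus>\<^bsub>T\<^esub> pt x' y"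
proof -
  have "frag_of (x \<oplus>\<^bsub>U\<^esub> x', y) - (frag_of (x, y) + frag_of (x', y)) \<in> null"
    by (rule rels_null) (use assms in \<open>auto simp: tensor_rels_def algebra_simps\<close>)
  then show ?thesis using assms by (simp add: pure_tensor_def cl_add cl_eq_iff)
qed

lemma pt_add_right:
  assumes "x \<in> carrier U" "y \<in> carrier V" "y' \<in> carrier V"
  shows "pt x (y \<oplus>\<^bsub>V\<^esub> y') = pt x y \<oplus>\<^bsub>T\<^esub> pt x y'"
proof -
  have "frag_of (x, y \<oplus>\<^bsub>V\<^esub> y') - (frag_of (x, y) + frag_of (x, y')) \<in> null"
    by (rule rels_null) (use assms in \<open>auto simp: tensor_rels_def algebra_simps\<close>)
  then show ?thesis using assms by (simp add: pure_tensor_def cl_add cl_eq_iff)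
qed

lemma pt_balanced:
  assumes "a \<in> carrier A" "x \<in> carrier U" "y \<in> carrier V"
  shows "pt (a \<odot>\<^bsub>U\<^esub> x) y = pt x (a \<odot>\<^bsub>V\<^esub> y)"
proof -
  have "frag_of (a \<odot>\<^bsub>U\<^esub> x, y) - frag_of (x, a \<odot>\<^bsub>V\<^esub> y) \<in> null"
    by (rule rels_null) (use assms in \<open>auto simp: tensor_rels_def\<close>)
  then show ?thesis using assms by (simp add: pure_tensor_def cl_eq_iff U_smult V_smult)
qed

lemma pt_zero_left: "y \<in> carrier V \<Longrightarrow> pt \<zero>\<^bsub>U\<^esub> y = \<zero>\<^bsub>T\<^esub>"
  by (rule additive_zero[OF U.abelian_group_axioms T.abelian_group_axioms, of "\<lambda>x. pt x y"]) (auto simp: pt_add_left)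

lemma cl_minus_of:
  assumes "x \<in> carrier U" "y \<in> carrier V" shows "cl (- frag_of (x, y)) = pt (\<ominus>\<^bsub>U\<^esub> x) y"
proof -
  have "pt x y \<oplus>\<^bsub>T\<^esub> pt (\<ominus>\<^bsub>U\<^esub> x) y = pt x y \<oplus>\<^bsub>T\<^esub> cl (- frag_of (x, y))"
    using assms pt_add_left[of x "\<ominus>\<^bsub>U\<^esub> x" y]
    by (simp add: U.r_neg pt_zero_left) (simp add: pure_tensor_def cl_add cl_zero)
  then show ?thesis using assms by simp
qed

text \<open>Negatives of pure tensors are pure, so sums suffice. In the proof the claim for c and -c
  is shown together, because the induction on formal combinations proceeds by differences.\<close>

lemma tensor_induct [consumes 1, case_names zero pure add]:
  assumes x: "x \<in> carrier T" and zero: "P \<zero>\<^bsub>T\<^esub>"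
    and pure: "\<And>u v. u \<in> carrier U \<Longrightarrow> v \<in> carrier V \<Longrightarrow> P (pt u v)"
    and add: "\<And>x y. x \<in> carrier T \<Longrightarrow> y \<in> carrier T \<Longrightarrow> P x \<Longrightarrow> P y \<Longrightarrow> P (x \<oplus>\<^bsub>T\<^esub> y)"
  shows "P x"
proof -
  obtain c where c: "c \<in> carrier FG" "x = cl c" using x by (rule clE)
  have "c \<in> carrier FG \<and> P (cl c) \<and> P (cl (- c))"
    using c(1)[unfolded FG_carrier]
  proof (induction c rule: frag_induction)
    case zero
    then show ?case using assms(2) by (simp add: cl_zero)
  next
    case (one z)
    obtain u v where z: "z = (u, v)" by (cases z)
    then show ?case using one pure[of u v] pure[of "\<ominus>\<^bsub>U\<^esub> u" v]
      by (simp add: cl_minus_of) (simp add: pure_tensor_def)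
  next
    case (diff a b)
    have "cl (a - b) = cl a \<oplus>\<^bsub>T\<^esub> cl (- b)" "cl (- (a - b)) = cl b \<oplus>\<^bsub>T\<^esub> cl (- a)"
      using diff by (simp_all add: cl_add)
    then show ?case using diff add[of "cl a" "cl (- b)"] add[of "cl b" "cl (- a)"] by simp
  qed
  then show ?thesis using c(2) by simp
qed

lemma additive_ext:
  assumes G: "abelian_group G" and "additive T G f" "additive T G g"
    and "\<And>u v. u \<in> carrier U \<Longrightarrow> v \<in> carrier V \<Longrightarrow> f (pt u v) = g (pt u v)" and "x \<in> carrier T"
  shows "f x = g x"
  using assms(5)
  by (induction rule: tensor_induct)
    (simp_all add: assms(4) additiveD[OF assms(2)] additiveD[OF assms(3)]
      additive_map_zero[OF T.abelian_group_axioms G assms(2)] additive_map_zero[OF T.abelian_group_axioms G assms(3)])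

definition "balanced G b \<longleftrightarrow>
  (\<forall>u\<in>carrier U. \<forall>v\<in>carrier V. b u v \<in> carrier G) \<and>
  (\<forall>u\<in>carrier U. \<forall>u'\<in>carrier U. \<forall>v\<in>carrier V. b (u \<oplus>\<^bsub>U\<^esub> u') v = b u v \<oplus>\<^bsub>G\<^esub> b u' v) \<and>
  (\<forall>u\<in>carrier U. \<forall>v\<in>carrier V. \<forall>v'\<in>carrier V. b u (v \<oplus>\<^bsub>V\<^esub> v') = b u v \<oplus>\<^bsub>G\<^esub> b u v') \<and>
  (\<forall>a\<in>carrier A. \<forall>u\<in>carrier U. \<forall>v\<in>carrier V. b (a \<odot>\<^bsub>U\<^esub> u) v = b u (a \<odot>\<^bsub>V\<^esub> v))"

lemma balancedI:
  assumes "\<And>u v. u \<in> carrier U \<Longrightarrow> v \<in> carrier V \<Longrightarrow> b u v \<in> carrier G"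
    and "\<And>u u' v. u \<in> carrier U \<Longrightarrow> u' \<in> carrier U \<Longrightarrow> v \<in> carrier V \<Longrightarrow> b (u \<oplus>\<^bsub>U\<^esub> u') v = b u v \<oplus>\<^bsub>G\<^esub> b u' v"
    and "\<And>u v v'. u \<in> carrier U \<Longrightarrow> v \<in> carrier V \<Longrightarrow> v' \<in> carrier V \<Longrightarrow> b u (v \<oplus>\<^bsub>V\<^esub> v') = b u v \<oplus>\<^bsub>G\<^esub> b u v'"
    and "\<And>a u v. a \<in> carrier A \<Longrightarrow> u \<in> carrier U \<Longrightarrow> v \<in> carrier V \<Longrightarrow> b (a \<odot>\<^bsub>U\<^esub> u) v = b u (a \<odot>\<^bsub>V\<^esub> v)"
  shows "balanced G b"
  using assms by (simp add: balanced_def)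

text \<open>The map on the free group kills the relations by balancedness, hence the subgroup they
  generate, and so it descends to classes.\<close>

lemma universal:
  assumes G: "abelian_group G" and b: "balanced G b"
  obtains \<Phi> where "additive T G \<Phi>" "\<And>u v. u \<in> carrier U \<Longrightarrow> v \<in> carrier V \<Longrightarrow> \<Phi> (pt u v) = b u v"
proof -
  interpret G: abelian_group G by fact
  note b = b[unfolded balanced_def]
  have "comm_group (add_monoid G)" by (rule G.a_comm_group)
  then obtain h where h: "h \<in> hom (free_Abelian_group S) (add_monoid G)"
    "\<And>z. z \<in> S \<Longrightarrow> h (frag_of z) = (case z of (u, v) \<Rightarrow> b u v)"
  proof (rule comm_group.free_Abelian_group_universal[of _ "\<lambda>z. case z of (u, v) \<Rightarrow> b u v" S])
    show "(\<lambda>z. case z of (u, v) \<Rightarrow> b u v) ` S \<subseteq> carrier (add_monoid G)" using b by auto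
  qed auto
  have hc: "h c \<in> carrier G" if "c \<in> carrier FG" for c
    using h(1) that by (auto simp: hom_def tensor_free_def)
  have ha: "h (c + d) = h c \<oplus>\<^bsub>G\<^esub> h d" if "c \<in> carrier FG" "d \<in> carrier FG" for c d
    using h(1) that by (auto simp: hom_def tensor_free_def)
  have ho: "h (frag_of (u, v)) = b u v" if "u \<in> carrier U" "v \<in> carrier V" for u v
    using h(2)[of "(u, v)"] that by simp
  interpret h: group_hom FG "add_monoid G" h
    using h(1) by (intro group_hom.intro group_hom_axioms.intro FG.group_axioms G.a_group) (simp add: tensor_free_def)
  have "tensor_rels A U V \<subseteq> kernel FG (add_monoid G) h"
  proof
    fix r assume r: "r \<in> tensor_rels A U V"
    then have rc: "r \<in> carrier FG" using rels_closed by blast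
    have sub: "h (c - d) = \<zero>\<^bsub>G\<^esub>" if "h c = h d" "c \<in> carrier FG" "d \<in> carrier FG" for c d
    proof -
      have "h (c - d) \<oplus>\<^bsub>G\<^esub> h d = \<zero>\<^bsub>G\<^esub> \<oplus>\<^bsub>G\<^esub> h d" using ha[of "c - d" d] that hc[of d] by simp
      then show ?thesis using hc[of d] hc[of "c - d"] that by (simp only: G.add.right_cancel FG_diff G.zero_closed)
    qed
    from r consider x x' y where "x \<in> carrier U" "x' \<in> carrier U" "y \<in> carrier V"
        "r = frag_of (x \<oplus>\<^bsub>U\<^esub> x', y) - (frag_of (x, y) + frag_of (x', y))"
      | x y y' where "x \<in> carrier U" "y \<in> carrier V" "y' \<in> carrier V"
        "r = frag_of (x, y \<oplus>\<^bsub>V\<^esub> y') - (frag_of (x, y) + frag_of (x, y'))"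
      | a x y where "a \<in> carrier A" "x \<in> carrier U" "y \<in> carrier V"
        "r = frag_of (a \<odot>\<^bsub>U\<^esub> x, y) - frag_of (x, a \<odot>\<^bsub>V\<^esub> y)"
      unfolding tensor_rels_def by (auto simp: algebra_simps)
    then have "h r = \<zero>\<^bsub>G\<^esub>"
      by cases (auto intro!: sub simp: ho ha b U_smult V_smult)
    then show "r \<in> kernel FG (add_monoid G) h" using rc by (simp add: kernel_def)
  qed
  then have "null \<subseteq> kernel FG (add_monoid G) h"
    unfolding tensor_null_def by (rule FG.generate_subgroup_incl[OF _ h.subgroup_kernel])
  then have hn: "h r = \<zero>\<^bsub>G\<^esub>" if "r \<in> null" for r using that by (auto simp: kernel_def)
  define \<Phi> where "\<Phi> C = h (SOME c. c \<in> carrier FG \<and> C = cl c)" for C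
  have \<Phi>: "\<Phi> (cl c) = h c" if c: "c \<in> carrier FG" for c
  proof -
    define d where "d = (SOME d. d \<in> carrier FG \<and> cl c = cl d)"
    have d: "d \<in> carrier FG" "cl c = cl d"
      unfolding d_def using someI[of "\<lambda>d. d \<in> carrier FG \<and> cl c = cl d" c] c by auto
    have "h c = h ((c - d) + d)" by simp
    also have "\<dots> = h d" using c d hn[of "c - d"] by (subst ha) (auto simp: cl_eq_iff hc)
    finally show ?thesis by (simp add: \<Phi>_def d_def)
  qed
  show thesis
  proof
    show "additive T G \<Phi>"
      by (rule additiveI) (auto elim!: clE simp: \<Phi> hc cl_add ha)
    show "\<Phi> (pt u v) = b u v" if "u \<in> carrier U" "v \<in> carrier V" for u v
      using that by (simp add: pure_tensor_def \<Phi> ho)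
  qed
qed

lemma additive_frag_extend:
  assumes \<Psi>: "additive T T \<Psi>"
    and g: "\<And>u v. u \<in> carrier U \<Longrightarrow> v \<in> carrier V \<Longrightarrow> g (u, v) \<in> carrier FG \<and> \<Psi> (pt u v) = cl (g (u, v))"
    and c: "c \<in> carrier FG"
  shows "frag_extend g c \<in> carrier FG \<and> \<Psi> (cl c) = cl (frag_extend g c)"
  using c[unfolded FG_carrier]
proof -
  have "c \<in> carrier FG \<and> frag_extend g c \<in> carrier FG \<and> \<Psi> (cl c) = cl (frag_extend g c)"
    using c[unfolded FG_carrier]
  proof (induction c rule: frag_induction)
    case zero
    then show ?case
      using additive_map_zero[OF T.abelian_group_axioms T.abelian_group_axioms \<Psi>] by (simp add: cl_zero)
  next
    case (one z)
    obtain u v where "z = (u, v)" by (cases z)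
    then show ?case using one g[of u v] by (simp add: pure_tensor_def)
  next
    case (diff a b)
    have "\<Psi> (cl (a - b)) \<oplus>\<^bsub>T\<^esub> \<Psi> (cl b) = cl (frag_extend g (a - b)) \<oplus>\<^bsub>T\<^esub> \<Psi> (cl b)"
      using diff additiveD(2)[OF \<Psi>, of "cl (a - b)" "cl b"] by (simp add: cl_add frag_extend_diff)
    then show ?case using diff by (simp add: frag_extend_diff additiveD(1)[OF \<Psi>])
  qed
  then show ?thesis by blast
qed

text \<open>The operations on tensors are defined as unions over all representatives. If an additive
  map describes the effect on pure tensors, all classes in the union coincide with its
  value.\<close>

lemma map_class:
  assumes \<Psi>: "additive T T \<Psi>"
    and g: "\<And>u v. u \<in> carrier U \<Longrightarrow> v \<in> carrier V \<Longrightarrow> g (u, v) \<in> carrier FG \<and> \<Psi> (pt u v) = cl (g (u, v))"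
    and C: "C \<in> carrier T"
  shows "(\<Union>c\<in>C. cl (frag_extend g c)) = \<Psi> C"
proof -
  obtain c where c: "c \<in> carrier FG" "C = cl c" using C by (rule clE)
  have "cl (frag_extend g d) = \<Psi> C" if "d \<in> C" for d
    using cl_mem[OF c(1), of d] that additive_frag_extend[OF \<Psi> g, of d] c(2) by simp
  then show ?thesis using cl_self[OF c(1)] c(2) by blast
qed

text \<open>The additive map is built from the universal property and then identified with the union
  formula. This gives both the scalar action on R \<otimes> A and the action on the induced
  module.\<close>

lemma act_left:
  assumes f: "additive U U f" "\<And>a u. a \<in> carrier A \<Longrightarrow> u \<in> carrier U \<Longrightarrow> f (a \<odot>\<^bsub>U\<^esub> u) = a \<odot>\<^bsub>U\<^esub> f u"
  defines "\<Psi> \<equiv> \<lambda>C. \<Union>c\<in>C. cl (frag_extend (\<lambda>(x, y). frag_of (f x, y)) c)"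
  shows "additive T T \<Psi>" "\<And>u v. u \<in> carrier U \<Longrightarrow> v \<in> carrier V \<Longrightarrow> \<Psi> (pt u v) = pt (f u) v"
proof -
  have "balanced T (\<lambda>u v. pt (f u) v)"
    by (rule balancedI) (simp_all add: additiveD[OF f(1)] f(2) pt_add_left pt_add_right pt_balanced)
  then obtain \<Phi> where \<Phi>: "additive T T \<Phi>" "\<And>u v. u \<in> carrier U \<Longrightarrow> v \<in> carrier V \<Longrightarrow> \<Phi> (pt u v) = pt (f u) v"
    by (rule universal[OF T.abelian_group_axioms]) blast
  have eq: "\<Psi> C = \<Phi> C" if "C \<in> carrier T" for C
    unfolding \<Psi>_def by (rule map_class[OF \<Phi>(1) _ that]) (simp add: \<Phi>(2) additiveD(1)[OF f(1)], simp add: pure_tensor_def)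
  show "additive T T \<Psi>" by (rule additiveI) (simp_all add: eq additiveD[OF \<Phi>(1)])
  show "\<And>u v. u \<in> carrier U \<Longrightarrow> v \<in> carrier V \<Longrightarrow> \<Psi> (pt u v) = pt (f u) v" by (simp add: eq \<Phi>(2))
qed

end

lemma gensD: "gens A M S \<Longrightarrow> submodule W A M \<Longrightarrow> S \<subseteq> W \<Longrightarrow> x \<in> carrier M \<Longrightarrow> x \<in> W"
  unfolding gens_def by blast

section \<open>The tensor product of two algebras\<close>

locale algebra_tensor = RA: algebra K R + SA: assoc_algebra K S
  for K :: "('k, 'c) ring_scheme" and R :: "('k, 'r) module" and S :: "('k, 's) module"
begin

abbreviation "L \<equiv> tensor_algebra K R S"

sublocale tensor_product K R S L
  by (intro tensor_product.intro tensor_product_axioms.intro RA.M.abelian_group_axioms SA.M.abelian_group_axioms)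
    (simp_all add: tensor_algebra_def)

lemma R_assoc3:
  "k \<in> carrier K \<Longrightarrow> x \<in> carrier R \<Longrightarrow> y \<in> carrier R \<Longrightarrow> x \<otimes>\<^bsub>R\<^esub> (k \<odot>\<^bsub>R\<^esub> y) = k \<odot>\<^bsub>R\<^esub> (x \<otimes>\<^bsub>R\<^esub> y)"
  using RA.smult_assoc2[of k y x] by (simp add: RA.m_comm)

text \<open>The universal property is used twice: \<open>P r s\<close> is left multiplication by a
  pure tensor, and for fixed D these maps are balanced in r and s, which yields \<Theta> D. The
  product given by representatives agrees with \<Theta>.\<close>

lemma
  shows mult_left: "D \<in> carrier L \<Longrightarrow> additive L L (\<lambda>C. C \<otimes>\<^bsub>L\<^esub> D)"
    and mult_right: "C \<in> carrier L \<Longrightarrow> additive L L (\<lambda>D. C \<otimes>\<^bsub>L\<^esub> D)"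
    and mult_pt: "\<lbrakk>r \<in> carrier R; s \<in> carrier S; r' \<in> carrier R; s' \<in> carrier S\<rbrakk> \<Longrightarrow>
      pt r s \<otimes>\<^bsub>L\<^esub> pt r' s' = pt (r \<otimes>\<^bsub>R\<^esub> r') (s \<otimes>\<^bsub>S\<^esub> s')"
proof -
  \<comment> \<open>The membership conditions are placed inside the existential, so that a choice
    function on all r and s can be extracted.\<close>
  have "\<exists>\<Phi>. r \<in> carrier R \<longrightarrow> s \<in> carrier S \<longrightarrow> additive L L \<Phi> \<and>
     (\<forall>r'\<in>carrier R. \<forall>s'\<in>carrier S. \<Phi> (pt r' s') = pt (r \<otimes>\<^bsub>R\<^esub> r') (s \<otimes>\<^bsub>S\<^esub> s'))" for r s
  proof (cases "r \<in> carrier R \<and> s \<in> carrier S")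
    case True
    then have "balanced L (\<lambda>r' s'. pt (r \<otimes>\<^bsub>R\<^esub> r') (s \<otimes>\<^bsub>S\<^esub> s'))"
      by (intro balancedI)
        (simp_all add: RA.r_distr SA.r_distr pt_add_left pt_add_right R_assoc3 SA.smult_assoc3 pt_balanced)
    then show ?thesis by (rule universal[OF T.abelian_group_axioms]) blast
  qed blast
  then obtain P where P: "\<And>r s. r \<in> carrier R \<Longrightarrow> s \<in> carrier S \<Longrightarrow> additive L L (P r s)"
    "\<And>r s r' s'. \<lbrakk>r \<in> carrier R; s \<in> carrier S; r' \<in> carrier R; s' \<in> carrier S\<rbrakk> \<Longrightarrow>
       P r s (pt r' s') = pt (r \<otimes>\<^bsub>R\<^esub> r') (s \<otimes>\<^bsub>S\<^esub> s')"
    by metis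
  have Pc: "P r s D \<in> carrier L" if "r \<in> carrier R" "s \<in> carrier S" "D \<in> carrier L" for r s D
    using additiveD(1)[OF P(1)] that by simp
  have sum: "additive L L (\<lambda>D. f D \<oplus>\<^bsub>L\<^esub> g D)" if "additive L L f" "additive L L g" for f g
    by (rule additiveI) (simp_all add: additiveD[OF that(1)] additiveD[OF that(2)] T.a_ac)
  have bal: "balanced L (\<lambda>r s. P r s D)" if D: "D \<in> carrier L" for D
  proof (rule balancedI)
    fix u u' v assume "u \<in> carrier R" "u' \<in> carrier R" "v \<in> carrier S"
    then show "P (u \<oplus>\<^bsub>R\<^esub> u') v D = P u v D \<oplus>\<^bsub>L\<^esub> P u' v D"
      by (intro additive_ext[OF T.abelian_group_axioms _ _ _ D, of "P (u \<oplus>\<^bsub>R\<^esub> u') v"] sum P(1))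
        (simp_all add: P(2) RA.l_distr pt_add_left)
  next
    fix u v v' assume "u \<in> carrier R" "v \<in> carrier S" "v' \<in> carrier S"
    then show "P u (v \<oplus>\<^bsub>S\<^esub> v') D = P u v D \<oplus>\<^bsub>L\<^esub> P u v' D"
      by (intro additive_ext[OF T.abelian_group_axioms _ _ _ D, of "P u (v \<oplus>\<^bsub>S\<^esub> v')"] sum P(1))
        (simp_all add: P(2) SA.l_distr pt_add_right)
  next
    fix a u v assume "a \<in> carrier K" "u \<in> carrier R" "v \<in> carrier S"
    then show "P (a \<odot>\<^bsub>R\<^esub> u) v D = P u (a \<odot>\<^bsub>S\<^esub> v) D"
      by (intro additive_ext[OF T.abelian_group_axioms _ _ _ D, of "P (a \<odot>\<^bsub>R\<^esub> u) v"] P(1))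
        (simp_all add: P(2) RA.smult_assoc2 SA.smult_assoc2 pt_balanced)
  qed (use D in \<open>simp add: Pc\<close>)
  have "\<exists>\<Theta>. D \<in> carrier L \<longrightarrow> additive L L \<Theta> \<and> (\<forall>r\<in>carrier R. \<forall>s\<in>carrier S. \<Theta> (pt r s) = P r s D)" for D
  proof (cases "D \<in> carrier L")
    case True
    then show ?thesis using universal[OF T.abelian_group_axioms bal[OF True]] by metis
  qed blast
  then obtain \<Theta> where \<Theta>: "\<And>D. D \<in> carrier L \<Longrightarrow> additive L L (\<Theta> D)"
    "\<And>D r s. D \<in> carrier L \<Longrightarrow> r \<in> carrier R \<Longrightarrow> s \<in> carrier S \<Longrightarrow> \<Theta> D (pt r s) = P r s D"
    by metis
  have eq: "C \<otimes>\<^bsub>L\<^esub> D = \<Theta> D C" if C: "C \<in> carrier L" and D: "D \<in> carrier L" for C D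
  proof -
    obtain c d where c: "c \<in> carrier FG" "C = cl c" and d: "d \<in> carrier FG" "D = cl d"
      using C D by (meson clE)
    let ?h = "\<lambda>r s (r', s'). frag_of (r \<otimes>\<^bsub>R\<^esub> r', s \<otimes>\<^bsub>S\<^esub> s')"
    let ?g = "\<lambda>d (r, s). frag_extend (?h r s) d"
    have g: "?g d' (r, s) \<in> carrier FG \<and> \<Theta> D (pt r s) = cl (?g d' (r, s))"
      if d': "d' \<in> D" and rs: "r \<in> carrier R" "s \<in> carrier S" for d' r s
    proof -
      have "d' \<in> carrier FG" "cl d' = D" using cl_mem[OF d(1)] d' d(2) by auto
      moreover have "?h r s (r', s') \<in> carrier FG \<and> P r s (pt r' s') = cl (?h r s (r', s'))"
        if "r' \<in> carrier R" "s' \<in> carrier S" for r' s'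
        using rs that by (simp add: P(2)) (simp add: pure_tensor_def)
      ultimately show ?thesis
        using additive_frag_extend[OF P(1)[OF rs], of "?h r s" d'] rs D by (simp add: \<Theta>(2))
    qed
    have const: "cl (frag_extend (?g d') c') = \<Theta> D C" if "d' \<in> D" "c' \<in> C" for d' c'
      using cl_mem[OF c(1), of c'] that additive_frag_extend[OF \<Theta>(1)[OF D] g[OF that(1)], of c'] c(2) by simp
    have ne: "c \<in> C" "d \<in> D" using cl_self c d by auto
    have "C \<otimes>\<^bsub>L\<^esub> D = (\<Union>c\<in>C. \<Union>d\<in>D. cl (frag_extend (?g d) c))"
      by (simp add: tensor_algebra_def)
    also have "\<dots> = \<Theta> D C" using const ne by blast
    finally show ?thesis .
  qed
  show left: "additive L L (\<lambda>C. C \<otimes>\<^bsub>L\<^esub> D)" if "D \<in> carrier L" for D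
    by (rule additiveI) (simp_all add: eq that additiveD[OF \<Theta>(1)[OF that]])
  show "pt r s \<otimes>\<^bsub>L\<^esub> pt r' s' = pt (r \<otimes>\<^bsub>R\<^esub> r') (s \<otimes>\<^bsub>S\<^esub> s')"
    if "r \<in> carrier R" "s \<in> carrier S" "r' \<in> carrier R" "s' \<in> carrier S" for r s r' s'
    using that by (simp add: eq \<Theta>(2) P(2))
  have cl': "C \<otimes>\<^bsub>L\<^esub> D \<in> carrier L" if "C \<in> carrier L" "D \<in> carrier L" for C D
    by (rule additiveD(1)[OF left[OF that(2)] that(1)])
  show "additive L L (\<lambda>D. C \<otimes>\<^bsub>L\<^esub> D)" if C: "C \<in> carrier L" for C
  proof (rule additiveI)
    fix D D' assume D: "D \<in> carrier L" "D' \<in> carrier L"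
    show "C \<otimes>\<^bsub>L\<^esub> (D \<oplus>\<^bsub>L\<^esub> D') = C \<otimes>\<^bsub>L\<^esub> D \<oplus>\<^bsub>L\<^esub> C \<otimes>\<^bsub>L\<^esub> D'"
      by (rule additive_ext[OF T.abelian_group_axioms _ _ _ C])
        (use D in \<open>auto intro!: sum left simp: eq \<Theta>(2) additiveD(2)[OF P(1)]\<close>)
  qed (use C cl' in simp)
qed

lemma mult_closed: "C \<in> carrier L \<Longrightarrow> D \<in> carrier L \<Longrightarrow> C \<otimes>\<^bsub>L\<^esub> D \<in> carrier L"
  by (rule additiveD(1)[OF mult_right])

lemma one: "\<one>\<^bsub>L\<^esub> = pt \<one>\<^bsub>R\<^esub> \<one>\<^bsub>S\<^esub>"
  by (simp add: tensor_algebra_def)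

lemma additive_id: "additive G G (\<lambda>x. x)"
  by (simp add: additive_def)

lemma
  assumes k: "k \<in> carrier K"
  shows smult_additive: "additive L L (\<lambda>C. k \<odot>\<^bsub>L\<^esub> C)"
    and smult_pt: "\<And>r s. r \<in> carrier R \<Longrightarrow> s \<in> carrier S \<Longrightarrow> k \<odot>\<^bsub>L\<^esub> pt r s = pt (k \<odot>\<^bsub>R\<^esub> r) s"
proof -
  have f: "additive R R (\<lambda>r. k \<odot>\<^bsub>R\<^esub> r)"
    using k by (intro additiveI) (simp_all add: RA.smult_r_distr)
  have c: "k \<odot>\<^bsub>R\<^esub> (a \<odot>\<^bsub>R\<^esub> u) = a \<odot>\<^bsub>R\<^esub> (k \<odot>\<^bsub>R\<^esub> u)" if "a \<in> carrier K" "u \<in> carrier R" for a u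
    using that k by (simp add: RA.R.m_comm flip: RA.smult_assoc1)
  have e: "(\<lambda>C. k \<odot>\<^bsub>L\<^esub> C) = (\<lambda>C. \<Union>c\<in>C. cl (frag_extend (\<lambda>(x, y). frag_of (k \<odot>\<^bsub>R\<^esub> x, y)) c))"
    by (simp add: tensor_algebra_def)
  show "additive L L (\<lambda>C. k \<odot>\<^bsub>L\<^esub> C)"
    unfolding e by (rule act_left(1)[OF f c])
  show "k \<odot>\<^bsub>L\<^esub> pt r s = pt (k \<odot>\<^bsub>R\<^esub> r) s" if "r \<in> carrier R" "s \<in> carrier S" for r s
    using act_left(2)[OF f c that] fun_cong[OF e, of "pt r s"] by simp
qed

lemma smult_closed: "k \<in> carrier K \<Longrightarrow> C \<in> carrier L \<Longrightarrow> k \<odot>\<^bsub>L\<^esub> C \<in> carrier L"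
  by (rule additiveD(1)[OF smult_additive])

lemma additive_sum: "additive L L f \<Longrightarrow> additive L L g \<Longrightarrow> additive L L (\<lambda>x. f x \<oplus>\<^bsub>L\<^esub> g x)"
  by (rule additiveI) (simp_all add: additiveD[of L L f] additiveD[of L L g] T.a_ac)

lemmas lext = additive_ext[OF T.abelian_group_axioms]

text \<open>Each law is additive in every variable, so it is enough to check it on pure tensors, one
  variable after the other.\<close>

lemma ring_L: "ring L"
proof (rule ringI)
  show "abelian_group L" by (rule T.abelian_group_axioms)
  show "Group.monoid L"
  proof (rule monoidI)
    show "\<one>\<^bsub>L\<^esub> \<in> carrier L" by (simp add: one)
  next
    fix x y z assume x: "x \<in> carrier L" and y: "y \<in> carrier L" and z: "z \<in> carrier L"
    show "(x \<otimes>\<^bsub>L\<^esub> y) \<otimes>\<^bsub>L\<^esub> z = x \<otimes>\<^bsub>L\<^esub> (y \<otimes>\<^bsub>L\<^esub> z)"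
    proof (rule lext[OF _ _ _ x])
      show "additive L L (\<lambda>x. (x \<otimes>\<^bsub>L\<^esub> y) \<otimes>\<^bsub>L\<^esub> z)"
        by (rule additive_compose[OF mult_left[OF y] mult_left[OF z]])
      show "additive L L (\<lambda>x. x \<otimes>\<^bsub>L\<^esub> (y \<otimes>\<^bsub>L\<^esub> z))"
        by (rule mult_left[OF mult_closed[OF y z]])
      fix r s assume rs: "r \<in> carrier R" "s \<in> carrier S"
      then have p: "pt r s \<in> carrier L" by simp
      show "(pt r s \<otimes>\<^bsub>L\<^esub> y) \<otimes>\<^bsub>L\<^esub> z = pt r s \<otimes>\<^bsub>L\<^esub> (y \<otimes>\<^bsub>L\<^esub> z)"
      proof (rule lext[OF _ _ _ y])
        show "additive L L (\<lambda>y. (pt r s \<otimes>\<^bsub>L\<^esub> y) \<otimes>\<^bsub>L\<^esub> z)"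
          by (rule additive_compose[OF mult_right[OF p] mult_left[OF z]])
        show "additive L L (\<lambda>y. pt r s \<otimes>\<^bsub>L\<^esub> (y \<otimes>\<^bsub>L\<^esub> z))"
          by (rule additive_compose[OF mult_left[OF z] mult_right[OF p]])
        fix r' s' assume rs': "r' \<in> carrier R" "s' \<in> carrier S"
        then have p': "pt r' s' \<in> carrier L" by simp
        show "(pt r s \<otimes>\<^bsub>L\<^esub> pt r' s') \<otimes>\<^bsub>L\<^esub> z = pt r s \<otimes>\<^bsub>L\<^esub> (pt r' s' \<otimes>\<^bsub>L\<^esub> z)"
          by (rule lext[OF mult_right[OF mult_closed[OF p p']] additive_compose[OF mult_right[OF p'] mult_right[OF p]] _ z])
            (use rs rs' in \<open>simp add: mult_pt RA.m_assoc SA.m_assoc\<close>)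
      qed
    qed
  next
    fix x assume x: "x \<in> carrier L"
    have o: "\<one>\<^bsub>L\<^esub> \<in> carrier L" by (simp add: one)
    show "\<one>\<^bsub>L\<^esub> \<otimes>\<^bsub>L\<^esub> x = x"
      by (rule lext[OF mult_right[OF o] additive_id _ x]) (simp add: mult_pt one)
    show "x \<otimes>\<^bsub>L\<^esub> \<one>\<^bsub>L\<^esub> = x"
      by (rule lext[OF mult_left[OF o] additive_id _ x]) (simp add: mult_pt one)
  qed (rule mult_closed)
qed (simp_all add: additiveD(2)[OF mult_left] additiveD(2)[OF mult_right])

lemma assoc_algebra_L: "assoc_algebra K L"
proof (intro assoc_algebra.intro assoc_algebra_axioms.intro module.intro module_axioms.intro ring_L
    RA.R.cring_axioms T.abelian_group_axioms)
  fix k x y assume k: "k \<in> carrier K" and x: "x \<in> carrier L" and y: "y \<in> carrier L"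
  show "k \<odot>\<^bsub>L\<^esub> (x \<oplus>\<^bsub>L\<^esub> y) = k \<odot>\<^bsub>L\<^esub> x \<oplus>\<^bsub>L\<^esub> k \<odot>\<^bsub>L\<^esub> y"
    by (rule additiveD(2)[OF smult_additive[OF k] x y])
  show "(k \<odot>\<^bsub>L\<^esub> x) \<otimes>\<^bsub>L\<^esub> y = k \<odot>\<^bsub>L\<^esub> (x \<otimes>\<^bsub>L\<^esub> y)"
  proof (rule lext[OF _ _ _ x])
    show "additive L L (\<lambda>x. (k \<odot>\<^bsub>L\<^esub> x) \<otimes>\<^bsub>L\<^esub> y)"
      by (rule additive_compose[OF smult_additive[OF k] mult_left[OF y]])
    show "additive L L (\<lambda>x. k \<odot>\<^bsub>L\<^esub> (x \<otimes>\<^bsub>L\<^esub> y))"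
      by (rule additive_compose[OF mult_left[OF y] smult_additive[OF k]])
    fix r s assume rs: "r \<in> carrier R" "s \<in> carrier S"
    then have p: "pt r s \<in> carrier L" "k \<odot>\<^bsub>L\<^esub> pt r s \<in> carrier L" using smult_closed[OF k] by auto
    show "(k \<odot>\<^bsub>L\<^esub> pt r s) \<otimes>\<^bsub>L\<^esub> y = k \<odot>\<^bsub>L\<^esub> (pt r s \<otimes>\<^bsub>L\<^esub> y)"
      by (rule lext[OF mult_right[OF p(2)] additive_compose[OF mult_right[OF p(1)] smult_additive[OF k]] _ y])
        (use rs k in \<open>simp add: mult_pt smult_pt RA.smult_assoc2\<close>)
  qed
  show "x \<otimes>\<^bsub>L\<^esub> (k \<odot>\<^bsub>L\<^esub> y) = k \<odot>\<^bsub>L\<^esub> (x \<otimes>\<^bsub>L\<^esub> y)"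
  proof (rule lext[OF _ _ _ x])
    show "additive L L (\<lambda>x. x \<otimes>\<^bsub>L\<^esub> (k \<odot>\<^bsub>L\<^esub> y))"
      by (rule mult_left[OF smult_closed[OF k y]])
    show "additive L L (\<lambda>x. k \<odot>\<^bsub>L\<^esub> (x \<otimes>\<^bsub>L\<^esub> y))"
      by (rule additive_compose[OF mult_left[OF y] smult_additive[OF k]])
    fix r s assume rs: "r \<in> carrier R" "s \<in> carrier S"
    then have p: "pt r s \<in> carrier L" by simp
    show "pt r s \<otimes>\<^bsub>L\<^esub> (k \<odot>\<^bsub>L\<^esub> y) = k \<odot>\<^bsub>L\<^esub> (pt r s \<otimes>\<^bsub>L\<^esub> y)"
      by (rule lext[OF additive_compose[OF smult_additive[OF k] mult_right[OF p]]
            additive_compose[OF mult_right[OF p] smult_additive[OF k]] _ y])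
        (use rs k in \<open>simp add: mult_pt smult_pt R_assoc3\<close>)
  qed
next
  fix k l x assume k: "k \<in> carrier K" and l: "l \<in> carrier K" and x: "x \<in> carrier L"
  show "(k \<oplus>\<^bsub>K\<^esub> l) \<odot>\<^bsub>L\<^esub> x = k \<odot>\<^bsub>L\<^esub> x \<oplus>\<^bsub>L\<^esub> l \<odot>\<^bsub>L\<^esub> x"
    by (rule lext[OF smult_additive additive_sum[OF smult_additive[OF k] smult_additive[OF l]] _ x])
      (use k l in \<open>simp_all add: smult_pt RA.smult_l_distr pt_add_left\<close>)
  show "(k \<otimes>\<^bsub>K\<^esub> l) \<odot>\<^bsub>L\<^esub> x = k \<odot>\<^bsub>L\<^esub> (l \<odot>\<^bsub>L\<^esub> x)"
    by (rule lext[OF smult_additive additive_compose[OF smult_additive[OF l] smult_additive[OF k]] _ x])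
      (use k l in \<open>simp_all add: smult_pt RA.smult_assoc1\<close>)
next
  fix x assume x: "x \<in> carrier L"
  show "\<one>\<^bsub>K\<^esub> \<odot>\<^bsub>L\<^esub> x = x"
    by (rule lext[OF smult_additive additive_id _ x]) (simp_all add: smult_pt)
qed (rule smult_closed)

lemma left_module_L: "left_module K L"
proof -
  interpret L: assoc_algebra K L by (rule assoc_algebra_L)
  show ?thesis
    by (intro left_module.intro left_module_axioms.intro RA.R.ring_axioms T.abelian_group_axioms)
      (simp_all add: L.smult_l_distr L.smult_r_distr L.smult_assoc1)
qed

text \<open>Pure tensors of generators suffice, first extended in the second factor and then in the
  first.\<close>

lemma finitely_generated_L:
  assumes "left_module K R" "left_module K S" "finitely_generated K R" "finitely_generated K S"
  shows "finitely_generated K L"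
proof -
  interpret R': left_module K R by fact
  interpret S': left_module K S by fact
  obtain Gr where Grf: "finite Gr" "gens K R Gr" using assms by (auto simp: finitely_generated_iff)
  obtain Gs where Gsf: "finite Gs" "gens K S Gs" using assms by (auto simp: finitely_generated_iff)
  have Gc: "Gr \<subseteq> carrier R" "Gs \<subseteq> carrier S" using Grf Gsf by (auto simp: gens_def)
  have "W = carrier L" if W: "submodule W K L" "(\<lambda>(x, y). pt x y) ` (Gr \<times> Gs) \<subseteq> W" for W
  proof -
    have 1: "pt x s \<in> W" if x: "x \<in> Gr" and s: "s \<in> carrier S" for x s
    proof -
      have xR: "x \<in> carrier R" using x Gc by auto
      have sm: "k \<odot>\<^bsub>L\<^esub> pt x u = pt x (k \<odot>\<^bsub>S\<^esub> u)" if "k \<in> carrier K" "u \<in> carrier S" for k u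
        using that xR by (simp add: smult_pt pt_balanced)
      have z: "pt x \<zero>\<^bsub>S\<^esub> = \<zero>\<^bsub>L\<^esub>"
        by (rule additive_zero[OF SA.M.abelian_group_axioms T.abelian_group_axioms]) (use xR in \<open>auto simp: pt_add_right\<close>)
      have "submodule {s \<in> carrier S. pt x s \<in> W} K S"
      proof (rule S'.submoduleI)
        show "\<zero>\<^bsub>S\<^esub> \<in> {s \<in> carrier S. pt x s \<in> W}" using submodule_zero[OF W(1)] by (simp add: z)
        show "u \<oplus>\<^bsub>S\<^esub> v \<in> {s \<in> carrier S. pt x s \<in> W}"
          if "u \<in> {s \<in> carrier S. pt x s \<in> W}" "v \<in> {s \<in> carrier S. pt x s \<in> W}" for u v
          using that submodule_add[OF W(1), of "pt x u" "pt x v"] xR by (simp add: pt_add_right)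
        show "k \<odot>\<^bsub>S\<^esub> u \<in> {s \<in> carrier S. pt x s \<in> W}"
          if "k \<in> carrier K" "u \<in> {s \<in> carrier S. pt x s \<in> W}" for k u
          using that submodule_smult[OF W(1), of k "pt x u"] sm[of k u] by simp
      qed blast
      moreover have "Gs \<subseteq> {s \<in> carrier S. pt x s \<in> W}"
      proof
        fix y assume y: "y \<in> Gs"
        have "pt x y \<in> (\<lambda>(x, y). pt x y) ` (Gr \<times> Gs)" by (rule image_eqI[of _ _ "(x, y)"]) (use x y in simp_all)
        then show "y \<in> {s \<in> carrier S. pt x s \<in> W}" using subsetD[OF W(2)] subsetD[OF Gc(2) y] by simp
      qed
      ultimately have "s \<in> {s \<in> carrier S. pt x s \<in> W}" by (rule gensD[OF Gsf(2) _ _ s])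
      then show ?thesis by simp
    qed
    have 2: "pt r s \<in> W" if r: "r \<in> carrier R" and s: "s \<in> carrier S" for r s
    proof -
      have "submodule {r \<in> carrier R. pt r s \<in> W} K R"
      proof (rule R'.submoduleI)
        show "\<zero>\<^bsub>R\<^esub> \<in> {r \<in> carrier R. pt r s \<in> W}" using submodule_zero[OF W(1)] s by (simp add: pt_zero_left)
        show "u \<oplus>\<^bsub>R\<^esub> v \<in> {r \<in> carrier R. pt r s \<in> W}"
          if "u \<in> {r \<in> carrier R. pt r s \<in> W}" "v \<in> {r \<in> carrier R. pt r s \<in> W}" for u v
          using that submodule_add[OF W(1), of "pt u s" "pt v s"] s by (simp add: pt_add_left)
        show "k \<odot>\<^bsub>R\<^esub> u \<in> {r \<in> carrier R. pt r s \<in> W}"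
          if "k \<in> carrier K" "u \<in> {r \<in> carrier R. pt r s \<in> W}" for k u
          using that submodule_smult[OF W(1), of k "pt u s"] smult_pt[of k u s] s by simp
      qed blast
      moreover have "Gr \<subseteq> {r \<in> carrier R. pt r s \<in> W}" using 1 s Gc(1) by blast
      ultimately have "r \<in> {r \<in> carrier R. pt r s \<in> W}" by (rule gensD[OF Grf(2) _ _ r])
      then show ?thesis by simp
    qed
    have "x \<in> W" if "x \<in> carrier L" for x
      using that
      by (induction rule: tensor_induct) (auto simp: 2 submodule_zero[OF W(1)] submodule_add[OF W(1)])
    then show ?thesis using submodule_subset[OF W(1)] by blast
  qed
  moreover have "(\<lambda>(x, y). pt x y) ` (Gr \<times> Gs) \<subseteq> carrier L"
    unfolding image_subset_iff using subsetD[OF Gc(1)] subsetD[OF Gc(2)] by auto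
  ultimately have "gens K L ((\<lambda>(x, y). pt x y) ` (Gr \<times> Gs))"
    unfolding gens_def by blast
  then show ?thesis
    unfolding finitely_generated_iff[OF left_module_L] using finite_imageI[OF finite_cartesian_product[OF Grf(1) Gsf(1)]] by blast
qed

end

lemma additive_ssum:
  assumes "abelian_group G" "\<And>i. i < n \<Longrightarrow> additive T G (f i)"
  shows "additive T G (\<lambda>x. ssum G n (\<lambda>i. f i x))"
proof -
  interpret G: abelian_group G by fact
  show ?thesis
  proof (rule additiveI)
    fix x y assume "x \<in> carrier T" "y \<in> carrier T"
    then show "ssum G n (\<lambda>i. f i (x \<oplus>\<^bsub>T\<^esub> y)) = ssum G n (\<lambda>i. f i x) \<oplus>\<^bsub>G\<^esub> ssum G n (\<lambda>i. f i y)"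
      by (subst G.ssum_add[symmetric]) (auto simp: additiveD[OF assms(2)] intro: ssum_cong)
  qed (simp add: G.ssum_closed additiveD[OF assms(2)])
qed

lemma additive_diff_map:
  assumes "abelian_group G" "additive T G f" "additive T G g"
  shows "additive T G (\<lambda>x. f x \<ominus>\<^bsub>G\<^esub> g x)"
proof -
  interpret G: abelian_group G by fact
  show ?thesis
    by (rule additiveI)
      (simp_all add: additiveD[OF assms(2)] additiveD[OF assms(3)] G.minus_add a_minus_def G.a_ac)
qed

section \<open>Extension of coefficients along a local algebra\<close>

locale coefficients = local_algebra K R + SA: fd_algebra K A
  for K :: "('k, 'c) ring_scheme" and R :: "('k, 'r) module" and A :: "('k, 'a) module"
begin

sublocale TP: algebra_tensor K R A
  by (intro algebra_tensor.intro RA.algebra_axioms SA.assoc_algebra_axioms)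

abbreviation "L \<equiv> tensor_algebra K R A"
abbreviation "pt \<equiv> pure_tensor K R A"
abbreviation "\<iota> \<equiv> pt \<one>\<^bsub>R\<^esub>"

sublocale L: assoc_algebra K L by (rule TP.assoc_algebra_L)

lemma L_ring: "ring L" ..

lemma AL: "abelian_group L" ..

lemma AA: "abelian_group A" ..

lemma fd_algebra_L: "fd_algebra K L"
  by (intro fd_algebra.intro fd_algebra_axioms.intro L.assoc_algebra_axioms K.field_axioms
      TP.finitely_generated_L left_module_R SA.left_module_A fin SA.fin)

definition "linear_form f \<longleftrightarrow> additive R K f \<and> (\<forall>c\<in>carrier K. \<forall>r\<in>carrier R. f (c \<odot>\<^bsub>R\<^esub> r) = c \<otimes>\<^bsub>K\<^esub> f r)"

text \<open>Contraction of the first tensor factor by a linear form. Both \<pi> and the coordinates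
  \<open>co\<close> are contractions.\<close>

definition "contr f = (SOME \<Phi>. additive L A \<Phi> \<and>
  (\<forall>r\<in>carrier R. \<forall>a\<in>carrier A. \<Phi> (pt r a) = f r \<odot>\<^bsub>A\<^esub> a))"

lemma contr:
  assumes f: "linear_form f"
  shows "additive L A (contr f)"
    and "\<And>r a. r \<in> carrier R \<Longrightarrow> a \<in> carrier A \<Longrightarrow> contr f (pt r a) = f r \<odot>\<^bsub>A\<^esub> a"
proof -
  have fa: "additive R K f" using f by (simp add: linear_form_def)
  have "TP.balanced A (\<lambda>r a. f r \<odot>\<^bsub>A\<^esub> a)"
    using f[unfolded linear_form_def]
    by (intro TP.balancedI)
      (simp_all add: additiveD[OF fa] SA.smult_l_distr SA.smult_r_distr K.m_comm flip: SA.smult_assoc1)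
  then have "\<exists>\<Phi>. additive L A \<Phi> \<and> (\<forall>r\<in>carrier R. \<forall>a\<in>carrier A. \<Phi> (pt r a) = f r \<odot>\<^bsub>A\<^esub> a)"
    by (rule TP.universal[OF AA]) blast
  from someI_ex[OF this] show "additive L A (contr f)"
    "\<And>r a. r \<in> carrier R \<Longrightarrow> a \<in> carrier A \<Longrightarrow> contr f (pt r a) = f r \<odot>\<^bsub>A\<^esub> a"
    by (auto simp: contr_def)
qed

lemma \<iota>_hom: "\<iota> \<in> ring_hom A L"
  by (rule ring_hom_memI) (simp_all add: TP.mult_pt TP.pt_add_right TP.one)

lemma \<iota>_closed: "a \<in> carrier A \<Longrightarrow> \<iota> a \<in> carrier L"
  by simp

text \<open>Linearity over A on the right, which allows contractions to be applied to the first
  factor of \<Lambda> \<otimes> M over A.\<close>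

lemma contr_mult_\<iota>:
  assumes f: "linear_form f" and l: "l \<in> carrier L" and a: "a \<in> carrier A"
  shows "contr f (l \<otimes>\<^bsub>L\<^esub> \<iota> a) = contr f l \<otimes>\<^bsub>A\<^esub> a"
proof (rule TP.additive_ext[OF AA _ _ _ l])
  show "additive L A (\<lambda>l. contr f (l \<otimes>\<^bsub>L\<^esub> \<iota> a))"
    by (rule additive_compose[OF TP.mult_left contr(1)[OF f]]) (simp add: a)
  show "additive L A (\<lambda>l. contr f l \<otimes>\<^bsub>A\<^esub> a)"
    by (rule additive_compose[OF contr(1)[OF f]]) (rule additiveI, simp_all add: a SA.l_distr)
next
  fix r b assume "r \<in> carrier R" "b \<in> carrier A"
  then show "contr f (pt r b \<otimes>\<^bsub>L\<^esub> \<iota> a) = contr f (pt r b) \<otimes>\<^bsub>A\<^esub> a"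
    using a f by (simp add: TP.mult_pt contr(2)[OF f] linear_form_def additive_def SA.smult_assoc2)
qed

definition "\<pi> = contr \<rho>"

lemma linear_\<rho>: "linear_form \<rho>"
  by (simp add: linear_form_def additive_def \<rho>(1) \<rho>_add \<rho>_smult)

lemma \<pi>_pt: "r \<in> carrier R \<Longrightarrow> a \<in> carrier A \<Longrightarrow> \<pi> (pt r a) = \<rho> r \<odot>\<^bsub>A\<^esub> a"
  unfolding \<pi>_def by (rule contr(2)[OF linear_\<rho>])

lemma \<pi>_additive: "additive L A \<pi>"
  unfolding \<pi>_def by (rule contr(1)[OF linear_\<rho>])

lemma \<pi>_\<iota>: "a \<in> carrier A \<Longrightarrow> \<pi> (\<iota> a) = a"
  by (simp add: \<pi>_pt \<rho>_one)

lemma \<pi>_hom: "\<pi> \<in> ring_hom L A"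
proof (rule ring_hom_memI)
  fix x y assume x: "x \<in> carrier L" and y: "y \<in> carrier L"
  show "\<pi> (x \<oplus>\<^bsub>L\<^esub> y) = \<pi> x \<oplus>\<^bsub>A\<^esub> \<pi> y" by (rule additiveD(2)[OF \<pi>_additive x y])
  have mA: "additive A A (\<lambda>b. b \<otimes>\<^bsub>A\<^esub> a)" "additive A A (\<lambda>b. a \<otimes>\<^bsub>A\<^esub> b)" if "a \<in> carrier A" for a
    using that by (simp_all add: additive_def SA.l_distr SA.r_distr)
  have p: "\<pi> y \<in> carrier A" by (rule additiveD(1)[OF \<pi>_additive y])
  show "\<pi> (x \<otimes>\<^bsub>L\<^esub> y) = \<pi> x \<otimes>\<^bsub>A\<^esub> \<pi> y"
  proof (rule TP.additive_ext[OF AA additive_compose[OF TP.mult_left[OF y] \<pi>_additive]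
        additive_compose[OF \<pi>_additive mA(1)[OF p]] _ x])
    fix r a assume ra: "r \<in> carrier R" "a \<in> carrier A"
    then have "pt r a \<in> carrier L" "\<pi> (pt r a) \<in> carrier A"
      by (simp_all add: additiveD(1)[OF \<pi>_additive])
    then show "\<pi> (pt r a \<otimes>\<^bsub>L\<^esub> y) = \<pi> (pt r a) \<otimes>\<^bsub>A\<^esub> \<pi> y"
      by (intro TP.additive_ext[OF AA additive_compose[OF TP.mult_right \<pi>_additive]
            additive_compose[OF \<pi>_additive mA(2)] _ y])
        (use ra in \<open>simp_all add: TP.mult_pt \<pi>_pt \<rho>_mult \<rho>(1) SA.smult_assoc2 SA.smult_assoc3 K.m_comm flip: SA.smult_assoc1\<close>)
  qed
qed (simp_all add: additiveD(1)[OF \<pi>_additive] TP.one \<pi>_\<iota>)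

text \<open>The k-th coordinate of an element of \<Lambda> over A. The cut at \<open>rk\<close> is
  needed for linearity, as \<open>coord\<close> is unspecified beyond.\<close>

definition "co k = contr (\<lambda>r. if k < rk then coord r k else \<zero>\<^bsub>K\<^esub>)"

lemma linear_coord: "linear_form (\<lambda>r. if k < rk then coord r k else \<zero>\<^bsub>K\<^esub>)"
  using coord(1) by (auto simp: linear_form_def additive_def coord_add coord_smult VecD)

lemma co_pt: "r \<in> carrier R \<Longrightarrow> a \<in> carrier A \<Longrightarrow> k < rk \<Longrightarrow> co k (pt r a) = coord r k \<odot>\<^bsub>A\<^esub> a"
  using contr(2)[OF linear_coord, of r a k] by (simp add: co_def)

lemmas co_additive = contr(1)[OF linear_coord, folded co_def]
lemmas co_mult_\<iota> = contr_mult_\<iota>[OF linear_coord, folded co_def]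

lemma co_closed: "l \<in> carrier L \<Longrightarrow> co k l \<in> carrier A"
  by (rule additiveD(1)[OF co_additive])

text \<open>\<open>t\<close> is a basis of \<Lambda> as a right A-module, and the \<open>c k\<close>
  generate the kernel of \<pi>.\<close>

definition "t k = pt (bs k) \<one>\<^bsub>A\<^esub>"
definition "c k = pt (gm k) \<one>\<^bsub>A\<^esub>"

lemma bs_closed [simp]: "bs k \<in> carrier R" by (rule VecD[OF bs(1)])

lemma gm_closed [simp]: "gm k \<in> carrier R" by (rule VecD[OF gm_Vec])

lemma t_Vec: "t \<in> Vec L" and c_Vec: "c \<in> Vec L"
  by (rule VecI; simp add: t_def c_def)+

lemma t_closed [simp]: "t k \<in> carrier L" and c_closed [simp]: "c k \<in> carrier L"
  by (simp_all add: t_def c_def)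

lemma pt_lcomb:
  assumes v: "v \<in> Vec K" and y: "y \<in> Vec R" and a: "a \<in> carrier A"
  shows "pt (lcomb R n v y) a = ssum L n (\<lambda>k. pt (y k) \<one>\<^bsub>A\<^esub> \<otimes>\<^bsub>L\<^esub> \<iota> (v k \<odot>\<^bsub>A\<^esub> a))"
proof -
  note vy = VecD[OF v] VecD[OF y]
  have "pt (lcomb R n v y) a = ssum L n (\<lambda>k. pt (v k \<odot>\<^bsub>R\<^esub> y k) a)"
    unfolding lcomb_def
    by (rule additive_map_ssum[OF RA.M.abelian_group_axioms AL, of "\<lambda>r. pt r a"])
      (use a vy in \<open>simp_all add: additive_def TP.pt_add_left\<close>)
  also have "\<dots> = ssum L n (\<lambda>k. pt (y k) \<one>\<^bsub>A\<^esub> \<otimes>\<^bsub>L\<^esub> \<iota> (v k \<odot>\<^bsub>A\<^esub> a))"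
    by (rule ssum_cong) (use a vy in \<open>simp add: TP.mult_pt TP.pt_balanced\<close>)
  finally show ?thesis .
qed

lemma additive_right_\<iota>: "additive T A f \<Longrightarrow> x \<in> carrier L \<Longrightarrow> additive T L (\<lambda>l. x \<otimes>\<^bsub>L\<^esub> \<iota> (f l))"
  by (rule additiveI)
    (simp_all add: additiveD[of T A f] TP.mult_closed TP.pt_add_right additiveD(2)[OF TP.mult_right])

lemma additive_\<iota>: "additive T A f \<Longrightarrow> additive T L (\<lambda>l. \<iota> (f l))"
  by (rule additiveI) (simp_all add: additiveD[of T A f] TP.pt_add_right)

lemma expand: assumes l: "l \<in> carrier L" shows "l = ssum L rk (\<lambda>k. t k \<otimes>\<^bsub>L\<^esub> \<iota> (co k l))"
proof (rule TP.additive_ext[OF AL TP.additive_id _ _ l])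
  show "additive L L (\<lambda>l. ssum L rk (\<lambda>k. t k \<otimes>\<^bsub>L\<^esub> \<iota> (co k l)))"
    by (intro additive_ssum AL additive_right_\<iota> co_additive t_closed)
  fix r a assume ra: "r \<in> carrier R" "a \<in> carrier A"
  have "pt r a = pt (lcomb R rk (coord r) bs) a" by (simp flip: coord(2)[OF ra(1)])
  also have "\<dots> = ssum L rk (\<lambda>k. t k \<otimes>\<^bsub>L\<^esub> \<iota> (co k (pt r a)))"
    unfolding pt_lcomb[OF coord(1)[OF ra(1)] bs(1) ra(2)]
    by (rule ssum_cong) (simp add: t_def co_pt ra)
  finally show "pt r a = ssum L rk (\<lambda>k. t k \<otimes>\<^bsub>L\<^esub> \<iota> (co k (pt r a)))" .
qed

definition "nilpart l = l \<ominus>\<^bsub>L\<^esub> \<iota> (\<pi> l)"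

lemma nilpart_additive: "additive L L nilpart"
  unfolding nilpart_def by (intro additive_diff_map AL TP.additive_id additive_\<iota> \<pi>_additive)

lemma nilpart_closed [simp]: "l \<in> carrier L \<Longrightarrow> nilpart l \<in> carrier L"
  by (rule additiveD(1)[OF nilpart_additive])

text \<open>For a pure tensor the component in the kernel of \<pi> is (r - \<rho> r) \<otimes> a,
  whose first factor is spanned by the generators of the maximal ideal.\<close>

lemma nilpart_expand:
  assumes l: "l \<in> carrier L" shows "nilpart l = ssum L rk (\<lambda>k. c k \<otimes>\<^bsub>L\<^esub> \<iota> (co k (nilpart l)))"
proof (rule TP.additive_ext[OF AL nilpart_additive _ _ l])
  show "additive L L (\<lambda>l. ssum L rk (\<lambda>k. c k \<otimes>\<^bsub>L\<^esub> \<iota> (co k (nilpart l))))"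
    by (intro additive_ssum AL additive_right_\<iota>
        additive_compose[OF nilpart_additive co_additive] c_closed)
  fix r a assume ra: "r \<in> carrier R" "a \<in> carrier A"
  define m where "m = r \<ominus>\<^bsub>R\<^esub> sc (\<rho> r)"
  have m: "m \<in> mx" unfolding m_def by (rule \<rho>(2)[OF ra(1)])
  note mR = mx_closed[OF m]
  have "nilpart (pt r a) = pt r a \<ominus>\<^bsub>L\<^esub> pt (sc (\<rho> r)) a"
    using ra \<rho>(1)[OF ra(1)] by (simp add: nilpart_def \<pi>_pt sc_def TP.pt_balanced)
  also have "\<dots> = pt m a"
    unfolding m_def
    by (rule additive_diff[OF RA.M.abelian_group_axioms AL, of "\<lambda>r. pt r a", symmetric])
      (use ra \<rho>(1)[OF ra(1)] in \<open>simp_all add: TP.pt_add_left\<close>)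
  finally have n: "nilpart (pt r a) = pt m a" .
  have "pt m a = pt (lcomb R rk (coord m) gm) a" by (simp flip: mx_span[OF m])
  also have "\<dots> = ssum L rk (\<lambda>k. c k \<otimes>\<^bsub>L\<^esub> \<iota> (co k (pt m a)))"
    unfolding pt_lcomb[OF coord(1)[OF mR] gm_Vec ra(2)]
    by (rule ssum_cong) (simp add: c_def co_pt ra mR)
  finally show "nilpart (pt r a) = ssum L rk (\<lambda>k. c k \<otimes>\<^bsub>L\<^esub> \<iota> (co k (nilpart (pt r a))))"
    unfolding n .
qed

lemma central: assumes r: "r \<in> carrier R" and l: "l \<in> carrier L"
  shows "l \<otimes>\<^bsub>L\<^esub> pt r \<one>\<^bsub>A\<^esub> = pt r \<one>\<^bsub>A\<^esub> \<otimes>\<^bsub>L\<^esub> l"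
  by (rule TP.additive_ext[OF AL TP.mult_left TP.mult_right _ l]) (use r in \<open>simp_all add: TP.mult_pt RA.m_comm\<close>)

lemma foldl_pt:
  assumes "r \<in> carrier R"
  shows "foldl (\<lambda>p j. p \<otimes>\<^bsub>L\<^esub> c j) (pt r \<one>\<^bsub>A\<^esub>) w = pt (foldl (\<lambda>p j. p \<otimes>\<^bsub>R\<^esub> gm j) r w) \<one>\<^bsub>A\<^esub>"
  using assms by (induction w arbitrary: r) (simp_all add: c_def TP.mult_pt)

definition "nl = (SOME N. \<forall>w. set w \<subseteq> {..<rk} \<longrightarrow> N \<le> length w \<longrightarrow>
  foldl (\<lambda>p j. p \<otimes>\<^bsub>R\<^esub> gm j) \<one>\<^bsub>R\<^esub> w = \<zero>\<^bsub>R\<^esub>)"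

lemma nl: "set w \<subseteq> {..<rk} \<Longrightarrow> length w = nl \<Longrightarrow> foldl (\<lambda>p j. p \<otimes>\<^bsub>R\<^esub> gm j) \<one>\<^bsub>R\<^esub> w = \<zero>\<^bsub>R\<^esub>"
  using someI_ex[OF nilpotent_words[of gm rk, OF gm], folded nl_def] by simp

sublocale nil_extension L A \<pi> \<iota> c rk nl
proof (intro nil_extension.intro nil_extension_axioms.intro L_ring SA.ring_A \<pi>_hom \<iota>_hom c_Vec)
  fix j show "\<pi> (c j) = \<zero>\<^bsub>A\<^esub>"
    using gm[of j] by (simp add: c_def \<pi>_pt \<rho>_zero_iff[THEN iffD2] SA.left_module_A left_module.smult_l_null)
next
  fix l j assume "l \<in> carrier L"
  then show "l \<otimes>\<^bsub>L\<^esub> c j = c j \<otimes>\<^bsub>L\<^esub> l" unfolding c_def by (rule central[OF gm_closed])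
next
  fix w assume "length w = nl" "set w \<subseteq> {..<rk}"
  then show "foldl (\<lambda>p j. p \<otimes>\<^bsub>L\<^esub> c j) \<one>\<^bsub>L\<^esub> w = \<zero>\<^bsub>L\<^esub>"
    by (simp add: TP.one foldl_pt nl TP.pt_zero_left)
qed (simp add: \<pi>_\<iota>)

end

section \<open>The induced module as free extension and as lift of M\<close>

locale induced_module = coefficients K R A + M: left_module A M
  for K :: "('k, 'c) ring_scheme" and R :: "('k, 'r) module" and A :: "('k, 'a) module"
    and M :: "('a, 'm) module"
begin

abbreviation "U \<equiv> right_module_along L \<iota>"
abbreviation "E \<equiv> extend_scalars A L \<iota> M"

lemma U_simps [simp]:
  "carrier U = carrier L" "add U = add L" "\<zero>\<^bsub>U\<^esub> = \<zero>\<^bsub>L\<^esub>" "a \<odot>\<^bsub>U\<^esub> x = x \<otimes>\<^bsub>L\<^esub> \<iota> a"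
  by (simp_all add: right_module_along_def)

lemma U_abelian_group: "abelian_group U"
  by (rule abelian_group_cong[OF AL]) simp_all

sublocale TE: tensor_product A U M E
  by (intro tensor_product.intro tensor_product_axioms.intro U_abelian_group M.M.abelian_group_axioms)
    (simp_all add: extend_scalars_def Let_def TP.mult_closed)

abbreviation "pe \<equiv> pure_tensor A U M"

lemma pe_add_left: "l \<in> carrier L \<Longrightarrow> l' \<in> carrier L \<Longrightarrow> m \<in> carrier M \<Longrightarrow> pe (l \<oplus>\<^bsub>L\<^esub> l') m = pe l m \<oplus>\<^bsub>E\<^esub> pe l' m"
  using TE.pt_add_left[of l l' m] by simp

lemma pe_add_right: "l \<in> carrier L \<Longrightarrow> m \<in> carrier M \<Longrightarrow> m' \<in> carrier M \<Longrightarrow> pe l (m \<oplus>\<^bsub>M\<^esub> m') = pe l m \<oplus>\<^bsub>E\<^esub> pe l m'"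
  using TE.pt_add_right[of l m m'] by simp

lemma pe_balanced: "l \<in> carrier L \<Longrightarrow> a \<in> carrier A \<Longrightarrow> m \<in> carrier M \<Longrightarrow> pe (l \<otimes>\<^bsub>L\<^esub> \<iota> a) m = pe l (a \<odot>\<^bsub>M\<^esub> m)"
  using TE.pt_balanced[of a l m] by simp

lemma AE: "abelian_group E" ..

lemma AM: "abelian_group M" ..

lemma E_ext:
  assumes "abelian_group G" "additive E G f" "additive E G g"
    and "\<And>l m. l \<in> carrier L \<Longrightarrow> m \<in> carrier M \<Longrightarrow> f (pe l m) = g (pe l m)" and "x \<in> carrier E"
  shows "f x = g x"
  by (rule TE.additive_ext[OF assms(1-3) _ assms(5)]) (simp add: assms(4))

lemma
  assumes l: "l \<in> carrier L"
  shows smult_additive: "additive E E (\<lambda>x. l \<odot>\<^bsub>E\<^esub> x)"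
    and smult_pe: "\<And>l' m. l' \<in> carrier L \<Longrightarrow> m \<in> carrier M \<Longrightarrow> l \<odot>\<^bsub>E\<^esub> pe l' m = pe (l \<otimes>\<^bsub>L\<^esub> l') m"
proof -
  have f: "additive U U (\<lambda>x. l \<otimes>\<^bsub>L\<^esub> x)"
    using l by (simp add: additive_def TP.mult_closed additiveD(2)[OF TP.mult_right])
  have c: "l \<otimes>\<^bsub>L\<^esub> (a \<odot>\<^bsub>U\<^esub> u) = a \<odot>\<^bsub>U\<^esub> (l \<otimes>\<^bsub>L\<^esub> u)" if "a \<in> carrier A" "u \<in> carrier U" for a u
    using that l by (simp add: monoid.m_assoc[OF ring.is_monoid[OF L_ring]])
  have e: "(\<lambda>x. l \<odot>\<^bsub>E\<^esub> x) = (\<lambda>C. \<Union>c\<in>C. TE.cl (frag_extend (\<lambda>(x, y). frag_of (l \<otimes>\<^bsub>L\<^esub> x, y)) c))"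
    by (simp add: extend_scalars_def Let_def)
  show "additive E E (\<lambda>x. l \<odot>\<^bsub>E\<^esub> x)"
    unfolding e by (rule TE.act_left(1)[OF f c])
  show "l \<odot>\<^bsub>E\<^esub> pe l' m = pe (l \<otimes>\<^bsub>L\<^esub> l') m" if "l' \<in> carrier L" "m \<in> carrier M" for l' m
    using TE.act_left(2)[OF f c, of l' m] that fun_cong[OF e, of "pe l' m"] by simp
qed

lemma L_assoc: "x \<in> carrier L \<Longrightarrow> y \<in> carrier L \<Longrightarrow> z \<in> carrier L \<Longrightarrow> x \<otimes>\<^bsub>L\<^esub> y \<otimes>\<^bsub>L\<^esub> z = x \<otimes>\<^bsub>L\<^esub> (y \<otimes>\<^bsub>L\<^esub> z)"
  by (rule monoid.m_assoc[OF ring.is_monoid[OF L_ring]])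

lemma L_one: "\<one>\<^bsub>L\<^esub> \<in> carrier L" "x \<in> carrier L \<Longrightarrow> \<one>\<^bsub>L\<^esub> \<otimes>\<^bsub>L\<^esub> x = x" "x \<in> carrier L \<Longrightarrow> x \<otimes>\<^bsub>L\<^esub> \<one>\<^bsub>L\<^esub> = x"
  using monoid.one_closed[OF ring.is_monoid[OF L_ring]] monoid.l_one[OF ring.is_monoid[OF L_ring]]
    monoid.r_one[OF ring.is_monoid[OF L_ring]] by auto

lemma E_left_module: "left_module L E"
proof (intro left_module.intro left_module_axioms.intro L_ring AE)
  fix l x assume l: "l \<in> carrier L" and x: "x \<in> carrier E"
  show "l \<odot>\<^bsub>E\<^esub> x \<in> carrier E" by (rule additiveD(1)[OF smult_additive[OF l] x])
  fix y assume y: "y \<in> carrier E"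
  show "l \<odot>\<^bsub>E\<^esub> (x \<oplus>\<^bsub>E\<^esub> y) = l \<odot>\<^bsub>E\<^esub> x \<oplus>\<^bsub>E\<^esub> l \<odot>\<^bsub>E\<^esub> y"
    by (rule additiveD(2)[OF smult_additive[OF l] x y])
next
  fix l l' x assume l: "l \<in> carrier L" and l': "l' \<in> carrier L" and x: "x \<in> carrier E"
  have sum: "additive E E (\<lambda>x. l \<odot>\<^bsub>E\<^esub> x \<oplus>\<^bsub>E\<^esub> l' \<odot>\<^bsub>E\<^esub> x)"
    by (rule additiveI)
      (simp_all add: additiveD[OF smult_additive[OF l]] additiveD[OF smult_additive[OF l']] TE.T.a_ac)
  show "(l \<oplus>\<^bsub>L\<^esub> l') \<odot>\<^bsub>E\<^esub> x = l \<odot>\<^bsub>E\<^esub> x \<oplus>\<^bsub>E\<^esub> l' \<odot>\<^bsub>E\<^esub> x"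
    by (rule E_ext[OF AE smult_additive sum _ x])
      (use l l' in \<open>simp_all add: smult_pe additiveD(2)[OF TP.mult_left] TP.mult_closed pe_add_left\<close>)
  show "(l \<otimes>\<^bsub>L\<^esub> l') \<odot>\<^bsub>E\<^esub> x = l \<odot>\<^bsub>E\<^esub> (l' \<odot>\<^bsub>E\<^esub> x)"
    by (rule E_ext[OF AE smult_additive additive_compose[OF smult_additive[OF l'] smult_additive[OF l]] _ x])
      (use l l' in \<open>simp_all add: smult_pe TP.mult_closed L_assoc\<close>)
next
  fix x assume x: "x \<in> carrier E"
  show "\<one>\<^bsub>L\<^esub> \<odot>\<^bsub>E\<^esub> x = x"
    by (rule E_ext[OF AE smult_additive[OF L_one(1)] TP.additive_id _ x]) (simp add: smult_pe L_one)
qed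

sublocale E: left_module L E by (rule E_left_module)

text \<open>A right \<open>A\<close>-linear map \<open>f : \<Lambda> \<rightarrow> A\<close> induces \<open>\<Lambda> \<otimes>\<^sub>A M \<rightarrow> M\<close>, \<open>l \<otimes> m \<mapsto> f(l) m\<close>.\<close>

lemma contract:
  assumes f: "additive L A f" "\<And>l a. l \<in> carrier L \<Longrightarrow> a \<in> carrier A \<Longrightarrow> f (l \<otimes>\<^bsub>L\<^esub> \<iota> a) = f l \<otimes>\<^bsub>A\<^esub> a"
  shows "\<exists>\<Phi>. additive E M \<Phi> \<and> (\<forall>l\<in>carrier L. \<forall>m\<in>carrier M. \<Phi> (pe l m) = f l \<odot>\<^bsub>M\<^esub> m)"
proof -
  have "TE.balanced M (\<lambda>l m. f l \<odot>\<^bsub>M\<^esub> m)"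
    by (rule TE.balancedI)
      (simp_all add: additiveD[OF f(1)] f(2) M.smult_l_distr M.smult_r_distr M.smult_assoc1)
  then show ?thesis by (rule TE.universal[OF AM]) auto
qed

definition "q = (SOME \<Phi>. additive E M \<Phi> \<and> (\<forall>l\<in>carrier L. \<forall>m\<in>carrier M. \<Phi> (pe l m) = \<pi> l \<odot>\<^bsub>M\<^esub> m))"

lemma shows q_additive: "additive E M q" and q_pe: "l \<in> carrier L \<Longrightarrow> m \<in> carrier M \<Longrightarrow> q (pe l m) = \<pi> l \<odot>\<^bsub>M\<^esub> m"
  using someI_ex[OF contract[OF \<pi>_additive contr_mult_\<iota>[OF linear_\<rho>, folded \<pi>_def]], folded q_def] by auto

text \<open>The coordinates on the induced module, obtained by contracting with those of \<Lambda>;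
  they prove that E has unique coordinates with respect to \<open>t\<close>.\<close>

definition "th k = (SOME \<Phi>. additive E M \<Phi> \<and> (\<forall>l\<in>carrier L. \<forall>m\<in>carrier M. \<Phi> (pe l m) = co k l \<odot>\<^bsub>M\<^esub> m))"

lemma shows th_additive: "additive E M (th k)"
    and th_pe: "l \<in> carrier L \<Longrightarrow> m \<in> carrier M \<Longrightarrow> th k (pe l m) = co k l \<odot>\<^bsub>M\<^esub> m"
  using someI_ex[OF contract[OF co_additive co_mult_\<iota>, of k], folded th_def] by auto

lemma \<pi>_closed: "l \<in> carrier L \<Longrightarrow> \<pi> l \<in> carrier A"
  by (rule additiveD(1)[OF \<pi>_additive])

abbreviation "s \<equiv> pe \<one>\<^bsub>L\<^esub>"

lemma s_closed: "m \<in> carrier M \<Longrightarrow> s m \<in> carrier E"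
  by (simp add: L_one)

lemma pe_mult_\<iota>: "l \<in> carrier L \<Longrightarrow> a \<in> carrier A \<Longrightarrow> m \<in> carrier M \<Longrightarrow> pe (l \<otimes>\<^bsub>L\<^esub> \<iota> a) m = l \<odot>\<^bsub>E\<^esub> s (a \<odot>\<^bsub>M\<^esub> m)"
  by (simp add: smult_pe L_one pe_balanced)

lemma pe_ssum:
  assumes v: "v \<in> Vec L" and a: "a \<in> Vec A" and m: "m \<in> carrier M"
  shows "pe (ssum L n (\<lambda>k. v k \<otimes>\<^bsub>L\<^esub> \<iota> (a k))) m = lcomb E n v (\<lambda>k. s (a k \<odot>\<^bsub>M\<^esub> m))"
proof -
  have "pe (ssum L n (\<lambda>k. v k \<otimes>\<^bsub>L\<^esub> \<iota> (a k))) m = ssum E n (\<lambda>k. pe (v k \<otimes>\<^bsub>L\<^esub> \<iota> (a k)) m)"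
    by (rule additive_map_ssum[OF AL AE, of "\<lambda>l. pe l m"])
      (use m VecD[OF v] VecD[OF a] in \<open>simp_all add: additive_def pe_add_left TP.mult_closed\<close>)
  then show ?thesis
    unfolding lcomb_def using VecD[OF v] VecD[OF a] m by (simp add: pe_mult_\<iota>)
qed

lemma additive_lcomb:
  assumes "v \<in> Vec L" "\<And>k. additive E E (f k)"
  shows "additive E E (\<lambda>x. lcomb E n v (\<lambda>k. f k x))"
  unfolding lcomb_def
  by (intro additive_ssum AE additive_compose[OF assms(2)] smult_additive VecD[OF assms(1)])

lemma additive_s: "additive M E s"
  by (rule additiveI) (simp_all add: L_one pe_add_right)

lemma expand_E: assumes x: "x \<in> carrier E" shows "x = lcomb E rk t (\<lambda>k. s (th k x))"
proof (rule E_ext[OF AE TP.additive_id additive_lcomb[OF t_Vec additive_compose[OF th_additive additive_s]] _ x])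
  fix l m assume lm: "l \<in> carrier L" "m \<in> carrier M"
  have "pe l m = pe (ssum L rk (\<lambda>k. t k \<otimes>\<^bsub>L\<^esub> \<iota> (co k l))) m" by (simp flip: expand[OF lm(1)])
  also have "\<dots> = lcomb E rk t (\<lambda>k. s (co k l \<odot>\<^bsub>M\<^esub> m))"
    by (rule pe_ssum[OF t_Vec _ lm(2)]) (rule VecI, rule co_closed[OF lm(1)])
  finally show "pe l m = lcomb E rk t (\<lambda>k. s (th k (pe l m)))" unfolding th_pe[OF lm] .
qed

lemma co_t: assumes "j < rk" "k < rk" shows "co k (t j) = (if j = k then \<one>\<^bsub>A\<^esub> else \<zero>\<^bsub>A\<^esub>)"
proof -
  have "coord (bs j) k = (if k = j then \<one>\<^bsub>K\<^esub> else \<zero>\<^bsub>K\<^esub>)"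
    by (rule coordI[OF _ _ assms(2)]) (use assms(1) V.lcomb_unit[of j rk bs] bs(1) in \<open>auto intro: VecI\<close>)
  then show ?thesis
    using assms left_module.smult_l_null[OF SA.left_module_A, of "\<one>\<^bsub>A\<^esub>"] by (auto simp: t_def co_pt)
qed

lemma free: "free_extension A L M E \<iota> s rk t"
proof (intro free_extension.intro semilinear.intro semilinear_axioms.intro free_extension_axioms.intro
    M.left_module_axioms E_left_module \<iota>_hom t_Vec)
  show "s x \<in> carrier E" if "x \<in> carrier M" for x by (rule s_closed[OF that])
  show "s (x \<oplus>\<^bsub>M\<^esub> y) = s x \<oplus>\<^bsub>E\<^esub> s y" if "x \<in> carrier M" "y \<in> carrier M" for x y
    by (rule additiveD(2)[OF additive_s that])
  show "s (a \<odot>\<^bsub>M\<^esub> m) = \<iota> a \<odot>\<^bsub>E\<^esub> s m" if "a \<in> carrier A" "m \<in> carrier M" for a m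
    using that by (simp add: smult_pe L_one flip: pe_balanced)
  show "\<iota> a \<otimes>\<^bsub>L\<^esub> t k = t k \<otimes>\<^bsub>L\<^esub> \<iota> a" if "a \<in> carrier A" for a k
    unfolding t_def by (rule central) (use that in simp_all)
  show "\<exists>u\<in>Vec A. l = ssum L rk (\<lambda>k. t k \<otimes>\<^bsub>L\<^esub> \<iota> (u k))" if "l \<in> carrier L" for l
    by (intro bexI[of _ "\<lambda>k. co k l"] expand that VecI co_closed)
  show "\<exists>m\<in>Vec M. x = lcomb E rk t (\<lambda>k. s (m k))" if "x \<in> carrier E" for x
    by (intro bexI[of _ "\<lambda>k. th k x"] expand_E that VecI additiveD(1)[OF th_additive])
next
  fix m k assume m: "m \<in> Vec M" and z: "lcomb E rk t (\<lambda>k. s (m k)) = \<zero>\<^bsub>E\<^esub>" and k: "k < rk"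
  note mc = VecD[OF m]
  \<comment> \<open>Applying the k-th coordinate map to the vanishing combination isolates
    \<open>m k\<close>, by \<open>co_t\<close>.\<close>
  have "\<zero>\<^bsub>M\<^esub> = th k (lcomb E rk t (\<lambda>k. s (m k)))"
    unfolding z by (rule additive_map_zero[OF AE AM th_additive, symmetric])
  also have "\<dots> = ssum M rk (\<lambda>j. th k (t j \<odot>\<^bsub>E\<^esub> s (m j)))"
    unfolding lcomb_def by (rule additive_map_ssum[OF AE AM th_additive]) (simp add: mc L_one)
  also have "\<dots> = ssum M rk (\<lambda>j. if j = k then m k else \<zero>\<^bsub>M\<^esub>)"
    by (rule ssum_cong) (simp add: mc smult_pe L_one th_pe co_t k M.smult_l_null)
  also have "\<dots> = m k" by (rule M.M.ssum_single[OF k mc])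
  finally show "m k = \<zero>\<^bsub>M\<^esub>" by simp
qed

text \<open>For a pure tensor l \<otimes> m the difference is the kernel component of l tensored
  with m. Hence the kernel of \<open>q\<close> consists of combinations of the
  \<open>c k\<close>.\<close>

lemma nilpart_E: assumes x: "x \<in> carrier E" shows "\<exists>v\<in>Vec E. x \<ominus>\<^bsub>E\<^esub> s (q x) = lcomb E rk c v"
  using x
proof (induction rule: TE.tensor_induct)
  case zero
  have "s (q \<zero>\<^bsub>E\<^esub>) = \<zero>\<^bsub>E\<^esub>"
    using additive_map_zero[OF AE AM q_additive] additive_map_zero[OF AM AE additive_s] by simp
  moreover have "lcomb E rk c (\<lambda>_. \<zero>\<^bsub>E\<^esub>) = \<zero>\<^bsub>E\<^esub>" by (rule E.lcomb_zero_r[OF c_Vec])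
  moreover have "(\<lambda>_. \<zero>\<^bsub>E\<^esub>) \<in> Vec E" by (rule VecI, rule TE.T.zero_closed)
  moreover have "\<zero>\<^bsub>E\<^esub> \<ominus>\<^bsub>E\<^esub> \<zero>\<^bsub>E\<^esub> = \<zero>\<^bsub>E\<^esub>"
    using TE.T.minus_zero_iff[OF TE.T.zero_closed TE.T.zero_closed] by simp
  ultimately show ?case by (intro bexI[of _ "\<lambda>_. \<zero>\<^bsub>E\<^esub>"]) simp_all
next
  case (pure l m)
  then have lm: "l \<in> carrier L" "m \<in> carrier M" by simp_all
  have "s (q (pe l m)) = pe (\<iota> (\<pi> l)) m"
    using lm \<pi>_closed[OF lm(1)] by (simp add: q_pe L_one flip: pe_balanced)
  then have "pe l m \<ominus>\<^bsub>E\<^esub> s (q (pe l m)) = pe (nilpart l) m"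
    unfolding nilpart_def using additive_diff[OF AL AE, of "\<lambda>l. pe l m" l "\<iota> (\<pi> l)"] lm \<pi>_closed[OF lm(1)]
    by (simp add: pe_add_left)
  also have "\<dots> = pe (ssum L rk (\<lambda>k. c k \<otimes>\<^bsub>L\<^esub> \<iota> (co k (nilpart l)))) m"
    by (simp flip: nilpart_expand[OF lm(1)])
  also have "\<dots> = lcomb E rk c (\<lambda>k. s (co k (nilpart l) \<odot>\<^bsub>M\<^esub> m))"
    by (rule pe_ssum[OF c_Vec _ lm(2)]) (rule VecI, rule co_closed[OF nilpart_closed[OF lm(1)]])
  finally have "pe l m \<ominus>\<^bsub>E\<^esub> s (q (pe l m)) = lcomb E rk c (\<lambda>k. s (co k (nilpart l) \<odot>\<^bsub>M\<^esub> m))" .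
  moreover have "(\<lambda>k. s (co k (nilpart l) \<odot>\<^bsub>M\<^esub> m)) \<in> Vec E"
    by (intro VecI s_closed M.smult_closed co_closed nilpart_closed lm)
  ultimately show ?case by blast
next
  case (add x y)
  then obtain v w where vw: "v \<in> Vec E" "x \<ominus>\<^bsub>E\<^esub> s (q x) = lcomb E rk c v"
    "w \<in> Vec E" "y \<ominus>\<^bsub>E\<^esub> s (q y) = lcomb E rk c w" by blast
  have "additive E E (\<lambda>x. x \<ominus>\<^bsub>E\<^esub> s (q x))"
    by (intro additive_diff_map AE TP.additive_id additive_compose[OF q_additive additive_s])
  from additiveD(2)[OF this add(1,2)] have "x \<oplus>\<^bsub>E\<^esub> y \<ominus>\<^bsub>E\<^esub> s (q (x \<oplus>\<^bsub>E\<^esub> y)) = lcomb E rk c (\<lambda>k. v k \<oplus>\<^bsub>E\<^esub> w k)"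
    by (simp add: vw E.lcomb_add_r c_Vec)
  moreover have "(\<lambda>k. v k \<oplus>\<^bsub>E\<^esub> w k) \<in> Vec E"
    by (intro VecI TE.T.a_closed VecD[OF vw(1)] VecD[OF vw(3)])
  ultimately show ?case by blast
qed

lemma q_semilinear:
  assumes l: "l \<in> carrier L" and x: "x \<in> carrier E" shows "q (l \<odot>\<^bsub>E\<^esub> x) = \<pi> l \<odot>\<^bsub>M\<^esub> q x"
proof (rule E_ext[OF AM additive_compose[OF smult_additive[OF l] q_additive] additive_compose[OF q_additive] _ x])
  show "additive M M (\<lambda>m. \<pi> l \<odot>\<^bsub>M\<^esub> m)"
    using \<pi>_closed[OF l] by (simp add: additive_def M.smult_r_distr)
  show "q (l \<odot>\<^bsub>E\<^esub> pe l' m) = \<pi> l \<odot>\<^bsub>M\<^esub> q (pe l' m)" if "l' \<in> carrier L" "m \<in> carrier M" for l' m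
    using that l by (simp add: smult_pe q_pe TP.mult_closed ring_hom_mult[OF \<pi>_hom] \<pi>_closed M.smult_assoc1)
qed

lemma reduction: "reduction L A E M \<pi> \<iota> c rk nl q"
proof (intro reduction.intro semilinear.intro semilinear_axioms.intro reduction_axioms.intro
    M.left_module_axioms E_left_module \<pi>_hom nil_extension_axioms)
  show "q x \<in> carrier M" if "x \<in> carrier E" for x by (rule additiveD(1)[OF q_additive that])
  show "q (x \<oplus>\<^bsub>E\<^esub> y) = q x \<oplus>\<^bsub>M\<^esub> q y" if "x \<in> carrier E" "y \<in> carrier E" for x y
    by (rule additiveD(2)[OF q_additive that])
  show "q (l \<odot>\<^bsub>E\<^esub> x) = \<pi> l \<odot>\<^bsub>M\<^esub> q x" if "l \<in> carrier L" "x \<in> carrier E" for l x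
    by (rule q_semilinear[OF that])
  show "\<exists>n\<in>carrier E. q n = m" if "m \<in> carrier M" for m
    using that by (intro bexI[of _ "s m"]) (simp_all add: L_one q_pe ring_hom_one[OF \<pi>_hom])
  show "\<exists>v\<in>Vec E. x = lcomb E rk c v" if x: "x \<in> carrier E" "q x = \<zero>\<^bsub>M\<^esub>" for x
  proof -
    have "x \<ominus>\<^bsub>E\<^esub> s (q x) = x"
      using x additive_map_zero[OF AM AE additive_s] TE.T.minus_equality[of "\<zero>\<^bsub>E\<^esub>" "\<zero>\<^bsub>E\<^esub>"] by (simp add: a_minus_def)
    then show ?thesis using nilpart_E[OF x(1)] by simp
  qed
qed

end

section \<open>Induction and reduction on isomorphism classes\<close>

section \<open>The bijection\<close>

lemma (in fd_algebra) indec_tau_rigid_iff: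
  "indec_tau_rigid K A M \<longleftrightarrow> left_module A M \<and> indecomposable A M \<and> rigid A M"
  unfolding indec_tau_rigid_def using rigid_imp_finitely_generated tau_rigid_iff by blast

lemma (in fd_algebra) indec_tau_rigid_iso:
  assumes "left_module A M" "left_module A N" "mod_iso A M N" "indec_tau_rigid K A M"
  shows "indec_tau_rigid K A N"
proof -
  obtain f where "mod_isomorphism A M N f" by (rule mod_isomorphismI[OF assms(1-3)])
  then interpret mod_isomorphism A M N f .
  show ?thesis using assms(2,4) rigid_iso indecomposable_iso unfolding indec_tau_rigid_iff by blast
qed

text \<open>Induced modules live on a larger type than the one used for isomorphism classes, so a
  copy on that type is needed.\<close>

lemma (in fd_algebra) ex_iso_indec_tau_rigid:
  assumes "indec_tau_rigid K A M"
  obtains N :: "('a, nat \<Rightarrow> 'k) module" where "indec_tau_rigid K A N" "mod_iso A M N"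
proof -
  have M: "left_module A M" "finitely_generated A M" using assms by (simp_all add: indec_tau_rigid_def)
  then obtain N :: "('a, nat \<Rightarrow> 'k) module" where "left_module A N" "mod_iso A M N"
    using ex_iso_module[OF assoc_algebra_axioms fin] by blast
  then show thesis using that indec_tau_rigid_iso[OF M(1) _ _ assms] by blast
qed

lemma iso_class_eqI:
  assumes "left_module A M" "left_module A N" "mod_iso A M N"
  shows "iso_class A M = iso_class A N"
  unfolding iso_class_def
  using mod_iso_trans[OF assms(2) mod_iso_sym[OF assms]] mod_iso_trans[OF assms(1,3)] by blast

text \<open>Without the witness \<open>P\<close> both classes could be empty, as M and N may live on
  types other than that of the members.\<close>

lemma iso_class_eqD:
  fixes P :: "('a, 'u) module"
  assumes M: "left_module A M" and N: "left_module A N" and P: "left_module A P"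
    and "mod_iso A M P" "iso_class A M = (iso_class A N :: ('a, 'u) module set)"
  shows "mod_iso A M N"
proof -
  have "P \<in> iso_class A M" using assms(4) P by (simp add: iso_class_def)
  then have "mod_iso A N P" unfolding assms(5) by (simp add: iso_class_def)
  then show ?thesis by (rule mod_iso_trans[OF M assms(4) mod_iso_sym[OF N P]])
qed

context coefficients
begin

text \<open>The quotient N/mN with A acting through \<iota>. That \<Lambda> acts on it through \<pi>
  is the content of \<open>coset_nilpart\<close>.\<close>

lemma ex_reduction:
  fixes N :: "(_, 'n) module"
  assumes "left_module L N"
  shows "\<exists>(M :: ('a, 'n set) module) q. reduction L A N M \<pi> \<iota> c rk nl q"
proof -
  interpret N: left_module L N by fact
  define W where "W = {lcomb N rk c v | v. v \<in> Vec N}"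
  have W: "submodule W L N"
  proof (rule N.submoduleI)
    show "W \<subseteq> carrier N" by (auto simp: W_def c_Vec)
    show "\<zero>\<^bsub>N\<^esub> \<in> W"
      unfolding W_def by (intro CollectI exI[of _ "\<lambda>_. \<zero>\<^bsub>N\<^esub>"] conjI) (auto simp: N.lcomb_zero_r[OF c_Vec] intro: VecI)
  next
    fix x y assume "x \<in> W" "y \<in> W"
    then obtain v w where vw: "v \<in> Vec N" "x = lcomb N rk c v" "w \<in> Vec N" "y = lcomb N rk c w" by (auto simp: W_def)
    have "x \<oplus>\<^bsub>N\<^esub> y = lcomb N rk c (\<lambda>k. v k \<oplus>\<^bsub>N\<^esub> w k)" using vw by (simp add: N.lcomb_add_r c_Vec)
    moreover have "(\<lambda>k. v k \<oplus>\<^bsub>N\<^esub> w k) \<in> Vec N" by (intro VecI N.M.a_closed VecD[OF vw(1)] VecD[OF vw(3)])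
    ultimately show "x \<oplus>\<^bsub>N\<^esub> y \<in> W" unfolding W_def by blast
  next
    fix l x assume l: "l \<in> carrier L" and "x \<in> W"
    then obtain v where v: "v \<in> Vec N" "x = lcomb N rk c v" by (auto simp: W_def)
    have "l \<odot>\<^bsub>N\<^esub> x = lcomb N rk c (\<lambda>k. l \<odot>\<^bsub>N\<^esub> v k)"
      unfolding v(2) by (rule N.lcomb_smult_r[symmetric]) (use v l c_Vec in \<open>simp_all add: c_def central\<close>)
    moreover have "(\<lambda>k. l \<odot>\<^bsub>N\<^esub> v k) \<in> Vec N" by (intro VecI N.smult_closed l VecD[OF v(1)])
    ultimately show "l \<odot>\<^bsub>N\<^esub> x \<in> W" unfolding W_def by blast
  qed
  interpret Q: quotient_mod L N W
    by (intro quotient_mod.intro quotient_mod_axioms.intro pure_left_module.intro assms W)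
  interpret QM: left_module L Q.Q by (rule Q.Q_left_module)
  define M :: "('a, 'n set) module" where "M = \<lparr>carrier = carrier Q.Q, monoid.mult = undefined, one = undefined,
      ring.zero = \<zero>\<^bsub>Q.Q\<^esub>, ring.add = add Q.Q, smult = (\<lambda>a x. \<iota> a \<odot>\<^bsub>Q.Q\<^esub> x)\<rparr>"
  have M: "carrier M = carrier Q.Q" "\<zero>\<^bsub>M\<^esub> = \<zero>\<^bsub>Q.Q\<^esub>" "add M = add Q.Q" "\<And>a x. a \<odot>\<^bsub>M\<^esub> x = \<iota> a \<odot>\<^bsub>Q.Q\<^esub> x"
    by (simp_all add: M_def)
  have aM: "abelian_group M" by (rule abelian_group_cong[OF QM.M.abelian_group_axioms]) (simp_all add: M)
  have lM: "left_module A M"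
    by (intro left_module.intro left_module_axioms.intro SA.ring_A aM)
      (simp_all add: M \<iota>_closed ring_hom_add[OF \<iota>_hom] ring_hom_mult[OF \<iota>_hom] ring_hom_one[OF \<iota>_hom]
        QM.smult_l_distr QM.smult_r_distr QM.smult_assoc1)
  \<comment> \<open>The scalars l and \<iota> (\<pi> l) differ by \<open>nilpart l\<close>, a
    combination of the \<open>c k\<close>, which maps N into \<open>W\<close>.\<close>
  have coset_nilpart: "Q.coset (l \<odot>\<^bsub>N\<^esub> x) = Q.coset (\<iota> (\<pi> l) \<odot>\<^bsub>N\<^esub> x)"
    if l: "l \<in> carrier L" and x: "x \<in> carrier N" for l x
  proof -
    have pl: "\<iota> (\<pi> l) \<in> carrier L" using additiveD(1)[OF \<pi>_additive l] by simp
    note nc = co_closed[OF nilpart_closed[OF l]]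
    have "(l \<odot>\<^bsub>N\<^esub> x) \<ominus>\<^bsub>N\<^esub> (\<iota> (\<pi> l) \<odot>\<^bsub>N\<^esub> x) = nilpart l \<odot>\<^bsub>N\<^esub> x"
      using l pl x by (simp add: nilpart_def N.smult_l_diff)
    also have "\<dots> = ssum L rk (\<lambda>k. c k \<otimes>\<^bsub>L\<^esub> \<iota> (co k (nilpart l))) \<odot>\<^bsub>N\<^esub> x"
      by (simp flip: nilpart_expand[OF l])
    also have "\<dots> = ssum N rk (\<lambda>k. (c k \<otimes>\<^bsub>L\<^esub> \<iota> (co k (nilpart l))) \<odot>\<^bsub>N\<^esub> x)"
      by (rule additive_map_ssum[OF AL N.M.abelian_group_axioms, of "\<lambda>l. l \<odot>\<^bsub>N\<^esub> x"])
        (use x nc in \<open>simp_all add: additive_def N.smult_l_distr TP.mult_closed\<close>)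
    also have "\<dots> = lcomb N rk c (\<lambda>k. \<iota> (co k (nilpart l)) \<odot>\<^bsub>N\<^esub> x)"
      unfolding lcomb_def by (rule ssum_cong) (use x nc in \<open>simp add: N.smult_assoc1\<close>)
    finally have "(l \<odot>\<^bsub>N\<^esub> x) \<ominus>\<^bsub>N\<^esub> (\<iota> (\<pi> l) \<odot>\<^bsub>N\<^esub> x) = lcomb N rk c (\<lambda>k. \<iota> (co k (nilpart l)) \<odot>\<^bsub>N\<^esub> x)" .
    moreover have "(\<lambda>k. \<iota> (co k (nilpart l)) \<odot>\<^bsub>N\<^esub> x) \<in> Vec N"
      by (intro VecI N.smult_closed \<iota>_closed nc x)
    ultimately show ?thesis
      using l pl x by (subst Q.coset_eq_iff) (auto simp: W_def)
  qed
  have "reduction L A N M \<pi> \<iota> c rk nl Q.coset"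
  proof (intro reduction.intro semilinear.intro semilinear_axioms.intro reduction_axioms.intro
      assms lM \<pi>_hom nil_extension_axioms)
    show "Q.coset x \<in> carrier M" if "x \<in> carrier N" for x using that by (simp add: M Q.coset_closed)
    show "Q.coset (x \<oplus>\<^bsub>N\<^esub> y) = Q.coset x \<oplus>\<^bsub>M\<^esub> Q.coset y" if "x \<in> carrier N" "y \<in> carrier N" for x y
      using that by (simp add: M Q.Q_add)
    show "Q.coset (l \<odot>\<^bsub>N\<^esub> x) = \<pi> l \<odot>\<^bsub>M\<^esub> Q.coset x" if "l \<in> carrier L" "x \<in> carrier N" for l x
      using that additiveD(1)[OF \<pi>_additive that(1)] by (simp add: M coset_nilpart Q.Q_smult)
    show "\<exists>n\<in>carrier N. Q.coset n = x" if "x \<in> carrier M" for x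
      using that by (auto simp: M Q.Q_carrier)
    show "\<exists>v\<in>Vec N. x = lcomb N rk c v" if "x \<in> carrier N" "Q.coset x = \<zero>\<^bsub>M\<^esub>" for x
    proof -
      have "x \<in> W" using that Q.coset_zero_iff[OF that(1)] unfolding M Q.Q_zero by blast
      then show ?thesis unfolding W_def by blast
    qed
  qed
  then show ?thesis by blast
qed

abbreviation "ind \<equiv> extend_scalars A L \<iota>"

interpretation FL: fd_algebra K L by (rule fd_algebra_L)

lemma induced: "left_module A M \<Longrightarrow> induced_module K R A M"
  by (intro induced_module.intro coefficients_axioms)

lemma ind_reduction: "left_module A M \<Longrightarrow> \<exists>q. reduction L A (ind M) M \<pi> \<iota> c rk nl q"
  using induced_module.reduction[OF induced] by blast

lemma ind_indec_tau_rigid: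
  assumes "indec_tau_rigid K A M" shows "indec_tau_rigid K L (ind M)"
proof -
  have M: "left_module A M" "indecomposable A M" "rigid A M" using assms by (simp_all add: SA.indec_tau_rigid_iff)
  interpret induced_module K R A M by (rule induced[OF M(1)])
  show ?thesis
    unfolding FL.indec_tau_rigid_iff
    using E_left_module reduction.indecomposable_extension[OF reduction M(2)]
      free_extension.rigid_extension[OF free M(3)] by blast
qed

text \<open>From left to right isomorphisms descend to reductions. Conversely, both induced modules
  are rigid lifts of the same module up to isomorphism, so uniqueness of lifts applies.\<close>

lemma ind_iso_iff:
  assumes "indec_tau_rigid K A M" "indec_tau_rigid K A M'"
  shows "mod_iso L (ind M) (ind M') \<longleftrightarrow> mod_iso A M M'"
proof -
  have M: "left_module A M" "left_module A M'" using assms by (simp_all add: SA.indec_tau_rigid_iff)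
  have r: "rigid L (ind M)" "rigid L (ind M')"
    using ind_indec_tau_rigid[OF assms(1)] ind_indec_tau_rigid[OF assms(2)] by (simp_all add: FL.indec_tau_rigid_iff)
  obtain q q' where q: "reduction L A (ind M) M \<pi> \<iota> c rk nl q" "reduction L A (ind M') M' \<pi> \<iota> c rk nl q'"
    using ind_reduction[OF M(1)] ind_reduction[OF M(2)] by blast
  show ?thesis
  proof
    show "mod_iso L (ind M) (ind M') \<Longrightarrow> mod_iso A M M'" by (rule iso_reductions[OF q])
    assume "mod_iso A M M'"
    then obtain f where f: "mod_isomorphism A M M' f" by (rule mod_isomorphismI[OF M])
    show "mod_iso L (ind M) (ind M')" by (rule rigid_lift_unique[OF reduction_iso[OF q(1) f] q(2) r])
  qed
qed

text \<open>N and the induced module of its reduction are rigid lifts of the same module, hence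
  isomorphic.\<close>

lemma ind_surj:
  fixes N :: "(_, 'n) module"
  assumes N: "indec_tau_rigid K L N"
  obtains M :: "('a, nat \<Rightarrow> 'k) module" where "indec_tau_rigid K A M" "mod_iso L (ind M) N"
proof -
  have N': "left_module L N" "indecomposable L N" "rigid L N" using N by (simp_all add: FL.indec_tau_rigid_iff)
  obtain M\<^sub>0 :: "('a, 'n set) module" and q\<^sub>0 where q0: "reduction L A N M\<^sub>0 \<pi> \<iota> c rk nl q\<^sub>0"
    using ex_reduction[OF N'(1)] by blast
  then interpret q0: reduction L A N M\<^sub>0 \<pi> \<iota> c rk nl q\<^sub>0 .
  have M0: "left_module A M\<^sub>0" "rigid A M\<^sub>0" by (rule q0.M.left_module, rule q0.rigid_reduction[OF N'(3)])
  \<comment> \<open>The reduction consists of cosets; it is replaced by a copy on the type used for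
    isomorphism classes.\<close>
  obtain M :: "('a, nat \<Rightarrow> 'k) module" where M: "left_module A M" "mod_iso A M\<^sub>0 M"
    using ex_iso_module[OF SA.assoc_algebra_axioms SA.fin M0(1) rigid_imp_finitely_generated[OF M0]] by blast
  obtain f where f: "mod_isomorphism A M\<^sub>0 M f" by (rule mod_isomorphismI[OF M0(1) M])
  have rM: "rigid A M" by (rule mod_isomorphism.rigid_iso[OF f M0(2)])
  interpret ind: induced_module K R A M by (rule induced[OF M(1)])
  have iso: "mod_iso L N (ind M)"
    by (rule rigid_lift_unique[OF reduction_iso[OF q0 f] ind.reduction N'(3) free_extension.rigid_extension[OF ind.free rM]])
  obtain g where g: "mod_isomorphism L N (ind M) g" by (rule mod_isomorphismI[OF N'(1) ind.E_left_module iso])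
  \<comment> \<open>Indecomposability is read off last, because a decomposition of M is only known
    to extend to the induced module and not to N directly.\<close>
  have "indecomposable A M"
    by (rule free_extension.indecomposable_restriction[OF ind.free mod_isomorphism.indecomposable_iso[OF g N'(2)]])
  then show thesis
    using that M(1) rM mod_iso_sym[OF N'(1) ind.E_left_module iso] by (simp add: SA.indec_tau_rigid_iff)
qed

theorem ind_bijection:
  "\<exists>F. bij_betw F (indec_tau_rigid_classes K A) (indec_tau_rigid_classes K L) \<and>
     (\<forall>M :: ('a, nat \<Rightarrow> 'k) module. indec_tau_rigid K A M \<longrightarrow> F (iso_class A M) = iso_class L (ind M))"
proof -
  \<comment> \<open>The bijection has to be a function on classes, so a representative is chosen;
    \<open>ind_iso_iff\<close> removes the dependence on it.\<close>
  define rep :: "('a, nat \<Rightarrow> 'k) module set \<Rightarrow> ('a, nat \<Rightarrow> 'k) module"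
    where "rep C = (SOME M. indec_tau_rigid K A M \<and> iso_class A M = C)" for C
  define F :: "('a, nat \<Rightarrow> 'k) module set \<Rightarrow> (_, nat \<Rightarrow> 'k) module set"
    where "F C = iso_class L (ind (rep C))" for C
  have lm: "left_module A M" "left_module L (ind M)" if "indec_tau_rigid K A M" for M :: "('a, nat \<Rightarrow> 'k) module"
    using that ind_indec_tau_rigid[OF that] by (simp_all add: indec_tau_rigid_def)
  have eqA: "iso_class A M = (iso_class A M' :: ('a, nat \<Rightarrow> 'k) module set) \<longleftrightarrow> mod_iso A M M'"
    if "indec_tau_rigid K A M" "indec_tau_rigid K A M'" for M M' :: "('a, nat \<Rightarrow> 'k) module"
    using iso_class_eqI[OF lm(1)[OF that(1)] lm(1)[OF that(2)]]
      iso_class_eqD[OF lm(1)[OF that(1)] lm(1)[OF that(2)] lm(1)[OF that(1)] mod_iso_refl[OF lm(1)[OF that(1)]]]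
    by blast
  have eqL: "iso_class L (ind M) = (iso_class L (ind M') :: (_, nat \<Rightarrow> 'k) module set) \<longleftrightarrow> mod_iso L (ind M) (ind M')"
    if M: "indec_tau_rigid K A M" "indec_tau_rigid K A M'" for M M' :: "('a, nat \<Rightarrow> 'k) module"
  proof -
    \<comment> \<open>The copy \<open>P\<close> shows that the class of the induced module is
      inhabited on this type, so that equality of classes carries information.\<close>
    obtain P :: "(_, nat \<Rightarrow> 'k) module" where "indec_tau_rigid K L P" "mod_iso L (ind M) P"
      by (rule FL.ex_iso_indec_tau_rigid[OF ind_indec_tau_rigid[OF M(1)]])
    then show ?thesis
      using iso_class_eqI[OF lm(2)[OF M(1)] lm(2)[OF M(2)]]
        iso_class_eqD[OF lm(2)[OF M(1)] lm(2)[OF M(2)], of P] by (auto simp: indec_tau_rigid_def)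
  qed
  have F: "F (iso_class A M) = iso_class L (ind M)" if M: "indec_tau_rigid K A M" for M :: "('a, nat \<Rightarrow> 'k) module"
  proof -
    have r: "indec_tau_rigid K A (rep (iso_class A M)) \<and> iso_class A (rep (iso_class A M)) = (iso_class A M :: (_, nat \<Rightarrow> 'k) module set)"
      unfolding rep_def by (rule someI[of _ M]) (simp add: M)
    then show ?thesis unfolding F_def using eqA eqL ind_iso_iff M by blast
  qed
  have "bij_betw F (indec_tau_rigid_classes K A) (indec_tau_rigid_classes K L)"
    unfolding bij_betw_def
  proof
    show "inj_on F (indec_tau_rigid_classes K A)"
    proof (rule inj_onI)
      fix C D assume "C \<in> indec_tau_rigid_classes K A" "D \<in> indec_tau_rigid_classes K A" and FCD: "F C = F D"
      then obtain M M' :: "('a, nat \<Rightarrow> 'k) module" where M: "indec_tau_rigid K A M" "C = iso_class A M"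
        "indec_tau_rigid K A M'" "D = iso_class A M'" by (auto simp: indec_tau_rigid_classes_def)
      have "iso_class L (ind M) = (iso_class L (ind M') :: (_, nat \<Rightarrow> 'k) module set)"
        using FCD unfolding M(2,4) by (simp only: F[OF M(1)] F[OF M(3)])
      then show "C = D"
        unfolding M(2,4) using eqA[OF M(1,3)] eqL[OF M(1,3)] ind_iso_iff[OF M(1,3)] by blast
    qed
    show "F ` indec_tau_rigid_classes K A = indec_tau_rigid_classes K L"
    proof (intro equalityI subsetI)
      fix D assume "D \<in> F ` indec_tau_rigid_classes K A"
      then obtain M :: "('a, nat \<Rightarrow> 'k) module" where M: "indec_tau_rigid K A M" "D = iso_class L (ind M)"
        using F by (auto simp: indec_tau_rigid_classes_def)
      obtain P :: "(_, nat \<Rightarrow> 'k) module" where P: "indec_tau_rigid K L P" "mod_iso L (ind M) P"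
        by (rule FL.ex_iso_indec_tau_rigid[OF ind_indec_tau_rigid[OF M(1)]])
      have "D = iso_class L P"
        unfolding M(2) by (rule iso_class_eqI[OF lm(2)[OF M(1)] _ P(2)]) (use P(1) in \<open>simp add: indec_tau_rigid_def\<close>)
      then show "D \<in> indec_tau_rigid_classes K L" unfolding indec_tau_rigid_classes_def using P(1) by blast
    next
      fix D assume "D \<in> indec_tau_rigid_classes K L"
      then obtain N :: "(_, nat \<Rightarrow> 'k) module" where N: "indec_tau_rigid K L N" "D = iso_class L N"
        by (auto simp: indec_tau_rigid_classes_def)
      obtain M :: "('a, nat \<Rightarrow> 'k) module" where M: "indec_tau_rigid K A M" "mod_iso L (ind M) N"
        by (rule ind_surj[OF N(1)])
      have "F (iso_class A M) = D"
        unfolding F[OF M(1)] N(2)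
        by (rule iso_class_eqI[OF lm(2)[OF M(1)] _ M(2)]) (use N(1) in \<open>simp add: indec_tau_rigid_def\<close>)
      then show "D \<in> F ` indec_tau_rigid_classes K A" unfolding indec_tau_rigid_classes_def using M(1) by blast
    qed
  qed
  then show ?thesis using F by blast
qed

end

theorem proposition1p13:
  fixes K :: "('k, 'c) ring_scheme"
    and R :: "('k, 'r) module"
    and Q :: "('v, 'e) pre_digraph"
  assumes "algebraically_closed K"
    and "algebra K R" and "finitely_generated K R" and "local_ring R"
    and "fin_digraph Q" and "no_oriented_cycles Q"
  shows "\<exists>F. bij_betw F (indec_tau_rigid_classes K (path_algebra K Q))
                        (indec_tau_rigid_classes K (Lambda_algebra K R Q)) \<and>
             (\<forall>M :: ('v \<times> 'e list \<Rightarrow> 'k, nat \<Rightarrow> 'k) module.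
                indec_tau_rigid K (path_algebra K Q) M \<longrightarrow>
                F (iso_class (path_algebra K Q) M) =
                  iso_class (Lambda_algebra K R Q) (induction K R Q M))"
proof -
  interpret R: local_algebra K R
    by (intro local_algebra.intro local_algebra_axioms.intro assms)
  have "finite_paths K Q"
    by (intro finite_paths.intro finite_paths_axioms.intro R.K.field_axioms finite_paths assms
        fin_digraph.axioms)
  then interpret coefficients K R "path_algebra K Q"
    by (intro coefficients.intro R.local_algebra_axioms finite_paths.PA_fd_algebra)
  show ?thesis using ind_bijection unfolding Lambda_algebra_def induction_def .
qed

end
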